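(* Let $d=1$, $\alpha\in(0,2]$ and let $u_0$ be a bounded continuous function on $\mathbb R$. Then $$u(t,x)=\mathbb E_X\Big[u_0(X^x_t)\exp\Big(\int_0^t\int_{\mathbb R}\delta(X^x_{t-r}-y)\,W(dr,dy)\Big)\Big]$$ is a mild Stratonovich solution of $\partial_t u=-(-\Delta)^{\alpha/2}u+u\dot W$, $u(0,\cdot)=u_0$. Furthermore, for every positive integer $p$, $$\mathbb E[u(t,x)^p]=\mathbb E\Big[\prod_{j=1}^p u_0(X^{(j)}_t+x)\exp\Big(\frac12\sum_{j,k=1}^p\int_{[0,t]^2}p_{|s-r|}(X^{(j)}_s-X^{(k)}_r)\,ds\,dr\Big)\Big],$$ where $X^{(1)},\dots,X^{(p)}$ are independent copies of $X$.
   Context: $p_t(x)=(2\pi t)^{-d/2}\exp(-|x|^2/(2t))$ is the heat kernel. $X$ is a $d$-dimensional $\alpha$-stable process started at $0$ with density $g_\alpha(t,\cdot)$ whose Fourier transform is $\exp(-c_\alpha t|\xi|^\alpha)$, $c_\alpha>0$; $X^x_s=X_s+x$; $\mathbb E_X$ denotes expectation with respect to $X$ only. $\mathcal H$ is the completion of $C_c^\infty([0,\infty)\times\mathbb R^d)$ under $\langle f,g\rangle_{\mathcal H}=\int f(s,x)g(t,y)p_{|t-s|}(x-y)\,dx\,dy\,ds\,dt$, and $W$ is an isonormal Gaussian process on $\mathcal H$ independent of $X$. With $\psi_\delta(t)=\delta^{-1}\mathbf 1_{[0,\delta]}(t)$ and $A^{\varepsilon,\delta}_{t,x}(r,y)=\int_0^t\psi_\delta(t-s-r)p_\varepsilon(X^x_s-y)ds$,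 the integral $\int_0^t\int\delta(X^x_{t-r}-y)W(dr,dy)$ is the $L^2$-limit of $W(A^{\varepsilon,\delta}_{t,x})$ as $(\varepsilon,\delta)\to0$ (which exists for $d=1$). Stratonovich integral: let $\dot W^{\varepsilon,\delta}(t,x)=\int_{[0,t]\times\mathbb R^d}\psi_\delta(t-s)p_\varepsilon(x-y)W(ds,dy)$; for a random field $v$ with $\int_0^T\int|v(t,x)|dx\,dt<\infty$ a.s. for all $T$, $\int_0^T\int v(t,x)W(dt,dx)$ is the limit in probability of $\int_0^T\int v(t,x)\dot W^{\varepsilon,\delta}(t,x)\,dx\,dt$ as $\varepsilon,\delta\to0$. A mild Stratonovich solution is a random field $u$ with $u(t,x)$ measurable w.r.t. $\mathcal F^W_t=\sigma\{W(s,x):s\le t\}$ and $u(t,x)=\int g_\alpha(t,x-y)u_0(y)dy+\int_0^t\int g_\alpha(t-s,x-y)u(s,y)W(ds,dy)$ with the integral in the Stratonovich sense above. *)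

theory Defs
  imports "HOL-Probability.Probability"
begin

definition heat :: "real \<Rightarrow> real \<Rightarrow> real" where
  "heat t x = exp (- (x^2) / (2 * t)) / sqrt (2 * pi * t)"

text \<open>Density g_alpha(t,.) of the alpha-stable process: inverse Fourier transform of
  exp(-c t |xi|^alpha), with the convention hat g(xi) = int exp(i xi x) g(x) dx.\<close>
definition g_alpha :: "real \<Rightarrow> real \<Rightarrow> real \<Rightarrow> real \<Rightarrow> real" where
  "g_alpha c \<alpha> t x =
     (1 / (2 * pi)) * (\<integral>\<xi>. cos (\<xi> * x) * exp (- (c * t * \<bar>\<xi>\<bar> powr \<alpha>)) \<partial>lborel)"

definition stable_process :: "'a measure \<Rightarrow> (real \<Rightarrow> 'a \<Rightarrow> real) \<Rightarrow> real \<Rightarrow> real \<Rightarrow> bool" where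
  "stable_process Px X c \<alpha> \<longleftrightarrow>
     (\<forall>t. X t \<in> borel_measurable Px) \<and>
     (\<forall>\<omega>\<in>space Px. X 0 \<omega> = 0) \<and>
     (\<forall>\<omega>\<in>space Px. (\<forall>t\<ge>0. continuous (at_right t) (\<lambda>s. X s \<omega>)) \<and>
                       (\<forall>t>0. \<exists>l. ((\<lambda>s. X s \<omega>) \<longlongrightarrow> l) (at_left t))) \<and>
     (\<forall>(n::nat) (ts::nat \<Rightarrow> real). 0 \<le> ts 0 \<and> (\<forall>i<n. ts i \<le> ts (Suc i)) \<longrightarrow>
         prob_space.indep_vars Px (\<lambda>_. borel) (\<lambda>i \<omega>. X (ts (Suc i)) \<omega> - X (ts i) \<omega>) {..<n}) \<and>
     (\<forall>s t \<xi>. 0 \<le> s \<and> s \<le> t \<longrightarrow>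
         char (distr Px borel (\<lambda>\<omega>. X t \<omega> - X s \<omega>)) \<xi>
           = complex_of_real (exp (- (c * (t - s) * \<bar>\<xi>\<bar> powr \<alpha>))))"

text \<open>The Hilbert space H: functions on [0,oo) x R with the inner product
  <f,g> = int f(s,x) g(t,y) p_|t-s|(x-y). We work on the (dense) class of measurable
  functions for which the absolute integral is finite.\<close>
definition Hset :: "((real \<times> real) \<times> (real \<times> real)) set" where
  "Hset = ({0..} \<times> UNIV) \<times> ({0..} \<times> UNIV)"

definition Hdom :: "(real \<times> real \<Rightarrow> real) \<Rightarrow> bool" where
  "Hdom f \<longleftrightarrow> f \<in> borel_measurable lborel \<and>
     set_integrable (lborel \<Otimes>\<^sub>M lborel) Hset
       (\<lambda>((s,x),(t,y)). \<bar>f (s,x)\<bar> * \<bar>f (t,y)\<bar> * heat \<bar>t - s\<bar> (x - y))"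

definition Hinner :: "(real \<times> real \<Rightarrow> real) \<Rightarrow> (real \<times> real \<Rightarrow> real) \<Rightarrow> real" where
  "Hinner f g = (\<integral>z\<in>Hset. (case z of ((s,x),(t,y)) \<Rightarrow> f (s,x) * g (t,y) * heat \<bar>t - s\<bar> (x - y))
                   \<partial>(lborel \<Otimes>\<^sub>M lborel))"

text \<open>Isonormal Gaussian process: a centered Gaussian family indexed by H with covariance <.,.>_H
  (joint Gaussianity expressed through joint characteristic functions).\<close>
definition isonormal :: "'b measure \<Rightarrow> ((real \<times> real \<Rightarrow> real) \<Rightarrow> 'b \<Rightarrow> real) \<Rightarrow> bool" where
  "isonormal Pw W \<longleftrightarrow>
     (\<forall>f. Hdom f \<longrightarrow> W f \<in> borel_measurable Pw) \<and>
     (\<forall>(n::nat) (f::nat \<Rightarrow> real \<times> real \<Rightarrow> real) (a::nat \<Rightarrow> real). (\<forall>i<n. Hdom (f i)) \<longrightarrow>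
        (CLINT \<omega>|Pw. iexp (\<Sum>i<n. a i * W (f i) \<omega>))
          = complex_of_real (exp (- (\<Sum>i<n. \<Sum>j<n. a i * a j * Hinner (f i) (f j)) / 2)))"

definition psi :: "real \<Rightarrow> real \<Rightarrow> real" where
  "psi \<delta> r = indicator {0..\<delta>} r / \<delta>"

definition Aed :: "(real \<Rightarrow> 'a \<Rightarrow> real) \<Rightarrow> real \<Rightarrow> real \<Rightarrow> real \<Rightarrow> real \<Rightarrow> 'a \<Rightarrow> real \<times> real \<Rightarrow> real" where
  "Aed X \<epsilon> \<delta> t x \<omega>x = (\<lambda>(r,y). \<integral>s\<in>{0..t}. psi \<delta> (t - s - r) * heat \<epsilon> (X s \<omega>x + x - y) \<partial>lborel)"

text \<open>Kernel of dot W^{eps,delta}(t,x) = int_{[0,t] x R} psi_delta(t-s) p_eps(x-y) W(ds,dy).\<close>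
definition phi_ed :: "real \<Rightarrow> real \<Rightarrow> real \<Rightarrow> real \<Rightarrow> real \<times> real \<Rightarrow> real" where
  "phi_ed \<epsilon> \<delta> t x = (\<lambda>(s,y). indicator {0..t} s * psi \<delta> (t - s) * heat \<epsilon> (x - y))"

abbreviation ed0 :: "(real \<times> real) filter" where
  "ed0 \<equiv> at_right 0 \<times>\<^sub>F at_right 0"

definition L2_conv :: "'b measure \<Rightarrow> 'e filter \<Rightarrow> ('e \<Rightarrow> 'b \<Rightarrow> real) \<Rightarrow> ('b \<Rightarrow> real) \<Rightarrow> bool" where
  "L2_conv M F Y Z \<longleftrightarrow> Z \<in> borel_measurable M \<and>
     (\<forall>\<^sub>F e in F. Y e \<in> borel_measurable M \<and> integrable M (\<lambda>\<omega>. (Y e \<omega> - Z \<omega>)^2)) \<and>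
     ((\<lambda>e. \<integral>\<omega>. (Y e \<omega> - Z \<omega>)^2 \<partial>M) \<longlongrightarrow> 0) F"

text \<open>Stratonovich integral int_0^T int v(t,x) W(dt,dx) = Z, defined via the measurable
  version Wd of the regularised noise dot W^{eps,delta}.\<close>
definition strat_int :: "'b measure \<Rightarrow> (real \<Rightarrow> real \<Rightarrow> real \<Rightarrow> real \<Rightarrow> 'b \<Rightarrow> real)
    \<Rightarrow> (real \<Rightarrow> real \<Rightarrow> 'b \<Rightarrow> real) \<Rightarrow> real \<Rightarrow> ('b \<Rightarrow> real) \<Rightarrow> bool" where
  "strat_int Pw Wd v T Z \<longleftrightarrow>
     (AE \<omega> in Pw. set_integrable lborel ({0..T} \<times> UNIV) (\<lambda>(t,x). v t x \<omega>)) \<and>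
     Z \<in> borel_measurable Pw \<and>
     (\<forall>\<^sub>F (\<epsilon>,\<delta>) in ed0.
        (\<lambda>\<omega>. \<integral>z\<in>{0..T} \<times> UNIV. (case z of (t,x) \<Rightarrow> v t x \<omega> * Wd \<epsilon> \<delta> t x \<omega>) \<partial>lborel)
          \<in> borel_measurable Pw) \<and>
     (\<forall>\<eta>>0. ((\<lambda>(\<epsilon>,\<delta>). measure Pw {\<omega>\<in>space Pw.
          \<bar>(\<integral>z\<in>{0..T} \<times> UNIV. (case z of (t,x) \<Rightarrow> v t x \<omega> * Wd \<epsilon> \<delta> t x \<omega>) \<partial>lborel) - Z \<omega>\<bar> > \<eta>})
        \<longlongrightarrow> 0) ed0)"

definition Wfilt :: "'b measure \<Rightarrow> ((real \<times> real \<Rightarrow> real) \<Rightarrow> 'b \<Rightarrow> real) \<Rightarrow> real \<Rightarrow> 'b measure" where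
  "Wfilt Pw W t = sigma (space Pw)
     ({(W (indicator ({0..s} \<times> {min 0 y..max 0 y}))) -` B \<inter> space Pw | s y B.
          0 \<le> s \<and> s \<le> t \<and> B \<in> sets borel}
      \<union> {N \<in> sets Pw. emeasure Pw N = 0})"

definition mild_strat_sol :: "'b measure \<Rightarrow> ((real \<times> real \<Rightarrow> real) \<Rightarrow> 'b \<Rightarrow> real)
    \<Rightarrow> (real \<Rightarrow> real \<Rightarrow> real \<Rightarrow> real \<Rightarrow> 'b \<Rightarrow> real) \<Rightarrow> real \<Rightarrow> real
    \<Rightarrow> (real \<Rightarrow> real) \<Rightarrow> (real \<Rightarrow> real \<Rightarrow> 'b \<Rightarrow> real) \<Rightarrow> bool" where
  "mild_strat_sol Pw W Wd c \<alpha> u0 u \<longleftrightarrow>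
     (\<forall>t\<ge>0. \<forall>x. u t x \<in> borel_measurable (Wfilt Pw W t)) \<and>
     (\<forall>t>0. \<forall>x. \<exists>Z. strat_int Pw Wd (\<lambda>s y \<omega>. g_alpha c \<alpha> (t - s) (x - y) * u s y \<omega>) t Z \<and>
        (AE \<omega> in Pw. u t x \<omega> = (\<integral>y. g_alpha c \<alpha> t (x - y) * u0 y \<partial>lborel) + Z \<omega>))"

text \<open>u(t,x) = E_X[u0(X^x_t) exp(I(t,x))], with I(t,x) = int int delta(X^x_{t-r}-y) W(dr,dy).\<close>
definition fk_sol :: "'a measure \<Rightarrow> (real \<Rightarrow> 'a \<Rightarrow> real) \<Rightarrow> (real \<Rightarrow> real \<Rightarrow> 'a \<Rightarrow> 'b \<Rightarrow> real)
    \<Rightarrow> (real \<Rightarrow> real) \<Rightarrow> real \<Rightarrow> real \<Rightarrow> 'b \<Rightarrow> real" where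
  "fk_sol Px X I u0 t x \<omega> = (\<integral>\<omega>x. u0 (X t \<omega>x + x) * exp (I t x \<omega>x \<omega>) \<partial>Px)"

text \<open>Right-hand side of the moment formula, evaluated on p independent copies X^(j)(\<omega>) = X(\<omega> j).\<close>
definition moment_rhs :: "(real \<Rightarrow> 'a \<Rightarrow> real) \<Rightarrow> (real \<Rightarrow> real) \<Rightarrow> nat \<Rightarrow> real \<Rightarrow> real
    \<Rightarrow> (nat \<Rightarrow> 'a) \<Rightarrow> real" where
  "moment_rhs X u0 p t x \<omega> =
     (\<Prod>j\<in>{1..p}. u0 (X t (\<omega> j) + x)) *
     exp ((1/2) * (\<Sum>j\<in>{1..p}. \<Sum>k\<in>{1..p}.
        (\<integral>z\<in>{0..t} \<times> {0..t}. (case z of (s,r) \<Rightarrow> heat \<bar>s - r\<bar> (X s (\<omega> j) - X r (\<omega> k))) \<partial>lborel)))"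

end

(* Averaging the regularised noise along the path gives In := W(A^{eps,delta}_{t,x}), which converges to I in L^2.
   All these variables lie in one Gaussian Hilbert space, so every expectation below is a Gaussian exponential moment,
   and every covariance is an integral of the heat kernel, dominated by a multiple of |u - v|^(-1/2). The moment formula
   is then Fubini over p independent paths.

   For the equation, write the regularised Stratonovich integral of g u as an integral of
   p_n = u0 * exp(I) * Wn over time s, the stable process run for time t - s from x, and an independent path started at
   the point reached. Replace I by In. For q_n = u0 * exp(In) * Wn the Markov property glues both paths into one, along
   which the integrand is f * exp(int f) with f the regularised noise on the path; integrating over s gives
   exp(int f) - 1, so the integral of q_n is exactly u_n - E u0(X_t + x), where u_n is the solution for the regularised
   noise. The replacement is harmless because the second moment of the integral of p_n - q_n is a double integral of
   four Gaussian expectations E[exp(A + B) Wn Wn'], with A, B each the limit I or its approximation In, which have the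
   same limit and cancel. *)

theory Submission
  imports Defs "HOL-Real_Asymp.Real_Asymp"
begin

subsection \<open>Square-integrable random variables\<close>

text \<open>\<open>isonormal\<close> prescribes only joint characteristic functions, and
  \<open>Wd\<close> agrees with the noise only almost surely at each separate point. Additivity of
  \<open>W\<close>, its continuity and its commutation with integrals along a path are therefore
  proved by computing a mean square distance from covariances and finding that it is, or tends to,
  0. All kernels involved are nonnegative, so \<open>HN\<close> takes values in
  \<open>ennreal\<close> and Tonelli is available throughout. The decisive estimate is that the
  covariance of the regularised noise at times u and v is at most 8 |u - v|^(-1/2), uniformly in the
  regularisation. At equal times the available bound is of order \<epsilon>^(-1/2) and diverges.
  This is why p_n - q_n is estimated only after integration over time: its second moment is a double
  time integral in which the diagonal is a null set. The closed formula for E[exp(Y) Z Z'] does the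
  work of a Gaussian integration by parts. Exceptional sets of paths depend on (t, x); they are
  collected through a countable, jointly measurable description of the good paths
  (\<open>goodI\<close>).\<close>

definition sqi :: "'b measure \<Rightarrow> ('b \<Rightarrow> real) \<Rightarrow> bool" where
  "sqi M Y \<longleftrightarrow> Y \<in> borel_measurable M \<and> integrable M (\<lambda>\<omega>. (Y \<omega>)\<^sup>2)"

lemma sqi_measurable [measurable_dest]: "sqi M Y \<Longrightarrow> Y \<in> borel_measurable M"
  by (simp add: sqi_def)

lemma sqi_mult:
  assumes "sqi M Y" "sqi M Z"
  shows "integrable M (\<lambda>\<omega>. Y \<omega> * Z \<omega>)"
proof (rule Bochner_Integration.integrable_bound)
  show "integrable M (\<lambda>\<omega>. (Y \<omega>)\<^sup>2 + (Z \<omega>)\<^sup>2)"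
    using assms by (auto simp: sqi_def)
  show "(\<lambda>\<omega>. Y \<omega> * Z \<omega>) \<in> borel_measurable M"
    using assms by (auto simp: sqi_def)
  have "\<bar>a * b\<bar> \<le> a\<^sup>2 + b\<^sup>2" for a b :: real
  proof -
    have "0 \<le> (\<bar>a\<bar> - \<bar>b\<bar>)\<^sup>2" by simp
    then have "2 * \<bar>a * b\<bar> \<le> a\<^sup>2 + b\<^sup>2"
      by (simp add: power2_diff abs_mult)
    then show ?thesis by linarith
  qed
  then show "AE \<omega> in M. norm (Y \<omega> * Z \<omega>) \<le> norm ((Y \<omega>)\<^sup>2 + (Z \<omega>)\<^sup>2)"
    by auto
qed

lemma sqi_cmult: "sqi M Y \<Longrightarrow> sqi M (\<lambda>\<omega>. a * Y \<omega>)"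
  by (auto simp: sqi_def power_mult_distrib)

lemma sqi_add:
  assumes "sqi M Y" "sqi M Z"
  shows "sqi M (\<lambda>\<omega>. Y \<omega> + Z \<omega>)"
  unfolding sqi_def power2_sum
  using assms sqi_mult[OF assms] by (auto simp: sqi_def mult.assoc)

lemma sqi_diff:
  assumes "sqi M Y" "sqi M Z"
  shows "sqi M (\<lambda>\<omega>. Y \<omega> - Z \<omega>)"
  using sqi_add[OF assms(1) sqi_cmult[OF assms(2), of "-1"]] by simp

lemma sqi_zero [simp]: "sqi M (\<lambda>\<omega>. 0)"
  by (simp add: sqi_def)

lemma sqi_cong_AE:
  assumes "sqi M Y" "Z \<in> borel_measurable M" "AE \<omega> in M. Y \<omega> = Z \<omega>"
  shows "sqi M Z"
proof -
  have "AE \<omega> in M. (Y \<omega>)\<^sup>2 = (Z \<omega>)\<^sup>2" using assms(3) by eventually_elim simp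
  then show ?thesis
    using assms integrable_cong_AE[of "\<lambda>\<omega>. (Y \<omega>)\<^sup>2" M "\<lambda>\<omega>. (Z \<omega>)\<^sup>2"] by (auto simp: sqi_def)
qed

lemma (in finite_measure) sqi_integrable: "sqi M Y \<Longrightarrow> integrable M Y"
  using sqi_mult[of M Y "\<lambda>_. 1"] by (simp add: sqi_def)

text \<open>The second moment of \<open>l * Y + Z\<close> is a nonnegative quadratic polynomial in
  \<open>l\<close>, so its discriminant cannot be positive.\<close>

lemma sqi_Cauchy_Schwarz:
  assumes Y: "sqi M Y" and Z: "sqi M Z"
  shows "\<bar>\<integral>\<omega>. Y \<omega> * Z \<omega> \<partial>M\<bar> \<le> sqrt (\<integral>\<omega>. (Y \<omega>)\<^sup>2 \<partial>M) * sqrt (\<integral>\<omega>. (Z \<omega>)\<^sup>2 \<partial>M)"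
proof -
  let ?a = "\<integral>\<omega>. (Y \<omega>)\<^sup>2 \<partial>M" and ?b = "\<integral>\<omega>. Y \<omega> * Z \<omega> \<partial>M" and ?c = "\<integral>\<omega>. (Z \<omega>)\<^sup>2 \<partial>M"
  have iY: "integrable M (\<lambda>\<omega>. (Y \<omega>)\<^sup>2)" and iZ: "integrable M (\<lambda>\<omega>. (Z \<omega>)\<^sup>2)"
    using Y Z by (auto simp: sqi_def)
  note iYZ = sqi_mult[OF Y Z]
  have a0: "?a \<ge> 0" and c0: "?c \<ge> 0" by auto
  have quad: "0 \<le> l\<^sup>2 * ?a + 2 * l * ?b + ?c" for l
  proof -
    have "0 \<le> (\<integral>\<omega>. (l * Y \<omega> + Z \<omega>)\<^sup>2 \<partial>M)" by simp
    also have "\<dots> = (\<integral>\<omega>. l\<^sup>2 * (Y \<omega>)\<^sup>2 + (2 * l) * (Y \<omega> * Z \<omega>) + (Z \<omega>)\<^sup>2 \<partial>M)"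
      by (intro Bochner_Integration.integral_cong) (auto simp: power2_sum power_mult_distrib algebra_simps)
    also have "\<dots> = l\<^sup>2 * ?a + 2 * l * ?b + ?c"
      using iY iZ iYZ by simp
    finally show ?thesis .
  qed
  have "?b\<^sup>2 \<le> ?a * ?c"
  proof (cases "?a = 0")
    case True
    \<comment> \<open>With leading coefficient 0 the polynomial is affine; if its slope were
      nonzero, the value of \<open>l\<close> below would make it equal to -1.\<close>
    have "?b = 0"
    proof (rule ccontr)
      assume b: "?b \<noteq> 0"
      have "0 \<le> 2 * (- (?c + 1) / (2 * ?b)) * ?b + ?c"
        using quad[of "- (?c + 1) / (2 * ?b)"] True by simp
      then show False using b by (simp add: field_simps)
    qed
    then show ?thesis using True by simp
  next
    case False
    then have ap: "?a > 0" using a0 by linarith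
    \<comment> \<open>\<open>- ?b / ?a\<close> minimises the quadratic polynomial.\<close>
    have "0 \<le> (- ?b / ?a)\<^sup>2 * ?a + 2 * (- ?b / ?a) * ?b + ?c" by (rule quad)
    also have "\<dots> = ?c - ?b\<^sup>2 / ?a"
      using ap by (simp add: field_simps power2_eq_square)
    finally show ?thesis using ap by (simp add: field_simps)
  qed
  then have "sqrt (?b\<^sup>2) \<le> sqrt (?a * ?c)" by (rule real_sqrt_le_mono)
  then show ?thesis by (simp add: real_sqrt_mult)
qed

section \<open>Convergence in mean square\<close>

definition l2lim :: "'b measure \<Rightarrow> (nat \<Rightarrow> 'b \<Rightarrow> real) \<Rightarrow> ('b \<Rightarrow> real) \<Rightarrow> bool" where
  "l2lim M Yn Y \<longleftrightarrow> (\<forall>n. sqi M (Yn n)) \<and> sqi M Y \<and> (\<lambda>n. \<integral>\<omega>. (Yn n \<omega> - Y \<omega>)\<^sup>2 \<partial>M) \<longlonglongrightarrow> 0"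

lemma l2lim_const: "sqi M Y \<Longrightarrow> l2lim M (\<lambda>n. Y) Y"
  by (simp add: l2lim_def)

text \<open>The difference of the products is dY dZ + dY Z + Y dZ; by Cauchy-Schwarz each term is at
  most a product of two L2 norms, at least one of which tends to 0.\<close>

lemma l2lim_inner:
  assumes "l2lim M Yn Y" "l2lim M Zn Z"
  shows "(\<lambda>n. \<integral>\<omega>. Yn n \<omega> * Zn n \<omega> \<partial>M) \<longlonglongrightarrow> (\<integral>\<omega>. Y \<omega> * Z \<omega> \<partial>M)"
proof -
  have Y: "\<And>n. sqi M (Yn n)" "sqi M Y" and Z: "\<And>n. sqi M (Zn n)" "sqi M Z"
    and limY: "(\<lambda>n. \<integral>\<omega>. (Yn n \<omega> - Y \<omega>)\<^sup>2 \<partial>M) \<longlonglongrightarrow> 0"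
    and limZ: "(\<lambda>n. \<integral>\<omega>. (Zn n \<omega> - Z \<omega>)\<^sup>2 \<partial>M) \<longlonglongrightarrow> 0"
    using assms by (auto simp: l2lim_def)
  let ?dY = "\<lambda>n \<omega>. Yn n \<omega> - Y \<omega>" and ?dZ = "\<lambda>n \<omega>. Zn n \<omega> - Z \<omega>"
  have dY: "sqi M (?dY n)" and dZ: "sqi M (?dZ n)" for n
    using sqi_diff[OF Y(1) Y(2)] sqi_diff[OF Z(1) Z(2)] by auto
  let ?q = "\<lambda>U. sqrt (\<integral>\<omega>. (U \<omega>)\<^sup>2 \<partial>M)"
  have "(\<lambda>n. (\<integral>\<omega>. Yn n \<omega> * Zn n \<omega> \<partial>M) - (\<integral>\<omega>. Y \<omega> * Z \<omega> \<partial>M)) \<longlonglongrightarrow> 0"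
  proof (rule Lim_null_comparison)
    show "\<forall>\<^sub>F n in sequentially. norm ((\<integral>\<omega>. Yn n \<omega> * Zn n \<omega> \<partial>M) - (\<integral>\<omega>. Y \<omega> * Z \<omega> \<partial>M))
      \<le> ?q (?dY n) * ?q (?dZ n) + ?q (?dY n) * ?q Z + ?q Y * ?q (?dZ n)"
    proof (intro always_eventually allI)
      fix n
      have "(\<integral>\<omega>. Yn n \<omega> * Zn n \<omega> \<partial>M) - (\<integral>\<omega>. Y \<omega> * Z \<omega> \<partial>M)
        = (\<integral>\<omega>. Yn n \<omega> * Zn n \<omega> - Y \<omega> * Z \<omega> \<partial>M)"
        using sqi_mult[OF Y(1) Z(1), of n n] sqi_mult[OF Y(2) Z(2)] by simp
      also have "\<dots> = (\<integral>\<omega>. ?dY n \<omega> * ?dZ n \<omega> + ?dY n \<omega> * Z \<omega> + Y \<omega> * ?dZ n \<omega> \<partial>M)"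
        by (intro Bochner_Integration.integral_cong) (auto simp: algebra_simps)
      also have "\<dots> = (\<integral>\<omega>. ?dY n \<omega> * ?dZ n \<omega> \<partial>M) + (\<integral>\<omega>. ?dY n \<omega> * Z \<omega> \<partial>M) + (\<integral>\<omega>. Y \<omega> * ?dZ n \<omega> \<partial>M)"
        using sqi_mult[OF dY dZ] sqi_mult[OF dY Z(2)] sqi_mult[OF Y(2) dZ] by simp
      finally show "norm ((\<integral>\<omega>. Yn n \<omega> * Zn n \<omega> \<partial>M) - (\<integral>\<omega>. Y \<omega> * Z \<omega> \<partial>M))
      \<le> ?q (?dY n) * ?q (?dZ n) + ?q (?dY n) * ?q Z + ?q Y * ?q (?dZ n)"
        using sqi_Cauchy_Schwarz[OF dY dZ, of n n] sqi_Cauchy_Schwarz[OF dY Z(2), of n]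
          sqi_Cauchy_Schwarz[OF Y(2) dZ, of n] by (auto simp del: real_sqrt_mult)
    qed
    show "(\<lambda>n. ?q (?dY n) * ?q (?dZ n) + ?q (?dY n) * ?q Z + ?q Y * ?q (?dZ n)) \<longlonglongrightarrow> 0"
      by (rule tendsto_eq_intros limY limZ refl)+ simp
  qed
  then show ?thesis by (simp add: LIM_zero_iff)
qed

lemma l2lim_cmult: "l2lim M Yn Y \<Longrightarrow> l2lim M (\<lambda>n \<omega>. a * Yn n \<omega>) (\<lambda>\<omega>. a * Y \<omega>)"
  unfolding l2lim_def right_diff_distrib[symmetric] power_mult_distrib
  by (auto intro: sqi_cmult tendsto_mult_right_zero)

lemma l2lim_add:
  assumes "l2lim M Yn Y" "l2lim M Zn Z"
  shows "l2lim M (\<lambda>n \<omega>. Yn n \<omega> + Zn n \<omega>) (\<lambda>\<omega>. Y \<omega> + Z \<omega>)"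
proof -
  have Y: "\<And>n. sqi M (Yn n)" "sqi M Y" and Z: "\<And>n. sqi M (Zn n)" "sqi M Z"
    and limY: "(\<lambda>n. \<integral>\<omega>. (Yn n \<omega> - Y \<omega>)\<^sup>2 \<partial>M) \<longlonglongrightarrow> 0"
    and limZ: "(\<lambda>n. \<integral>\<omega>. (Zn n \<omega> - Z \<omega>)\<^sup>2 \<partial>M) \<longlonglongrightarrow> 0"
    using assms by (auto simp: l2lim_def)
  note dY = sqi_diff[OF Y(1) Y(2)] and dZ = sqi_diff[OF Z(1) Z(2)]
  have le: "(\<integral>\<omega>. (Yn n \<omega> + Zn n \<omega> - (Y \<omega> + Z \<omega>))\<^sup>2 \<partial>M)
      \<le> 2 * (\<integral>\<omega>. (Yn n \<omega> - Y \<omega>)\<^sup>2 \<partial>M) + 2 * (\<integral>\<omega>. (Zn n \<omega> - Z \<omega>)\<^sup>2 \<partial>M)" for n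
  proof -
    have "(\<integral>\<omega>. (Yn n \<omega> + Zn n \<omega> - (Y \<omega> + Z \<omega>))\<^sup>2 \<partial>M)
      \<le> (\<integral>\<omega>. 2 * (Yn n \<omega> - Y \<omega>)\<^sup>2 + 2 * (Zn n \<omega> - Z \<omega>)\<^sup>2 \<partial>M)"
    proof (rule integral_mono)
      show "integrable M (\<lambda>\<omega>. (Yn n \<omega> + Zn n \<omega> - (Y \<omega> + Z \<omega>))\<^sup>2)"
        using sqi_diff[OF sqi_add[OF Y(1) Z(1)] sqi_add[OF Y(2) Z(2)]] by (simp add: sqi_def)
      show "integrable M (\<lambda>\<omega>. 2 * (Yn n \<omega> - Y \<omega>)\<^sup>2 + 2 * (Zn n \<omega> - Z \<omega>)\<^sup>2)"
        using dY[of n] dZ[of n] by (simp add: sqi_def)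
      have "(a + b - (a' + b'))\<^sup>2 \<le> 2 * (a - a')\<^sup>2 + 2 * (b - b')\<^sup>2" for a b a' b' :: real
        using zero_le_power2[of "(a - a') - (b - b')"] by (simp add: power2_eq_square algebra_simps)
      then show "\<And>\<omega>. (Yn n \<omega> + Zn n \<omega> - (Y \<omega> + Z \<omega>))\<^sup>2 \<le> 2 * (Yn n \<omega> - Y \<omega>)\<^sup>2 + 2 * (Zn n \<omega> - Z \<omega>)\<^sup>2" .
    qed
    then show ?thesis using dY[of n] dZ[of n] by (simp add: sqi_def)
  qed
  have "(\<lambda>n. 2 * (\<integral>\<omega>. (Yn n \<omega> - Y \<omega>)\<^sup>2 \<partial>M) + 2 * (\<integral>\<omega>. (Zn n \<omega> - Z \<omega>)\<^sup>2 \<partial>M)) \<longlonglongrightarrow> 0"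
    using limY limZ by (auto intro!: tendsto_eq_intros)
  then have "(\<lambda>n. \<integral>\<omega>. (Yn n \<omega> + Zn n \<omega> - (Y \<omega> + Z \<omega>))\<^sup>2 \<partial>M) \<longlonglongrightarrow> 0"
    by (rule Lim_null_comparison[rotated]) (use le in auto)
  then show ?thesis
    using sqi_add[OF Y(1) Z(1)] sqi_add[OF Y(2) Z(2)] by (simp add: l2lim_def)
qed

subsection \<open>Centred Gaussian variables\<close>

text \<open>A centred normal law, with the second moment itself as the variance. Giving it by the
  characteristic function admits variance 0 and passes easily to L2 limits.\<close>

definition gaussian :: "'b measure \<Rightarrow> ('b \<Rightarrow> real) \<Rightarrow> bool" where
  "gaussian M Y \<longleftrightarrow> sqi M Y \<and>
     (\<forall>\<theta>. (CLINT \<omega>|M. iexp (\<theta> * Y \<omega>)) = complex_of_real (exp (- (\<theta>\<^sup>2 * (\<integral>\<omega>. (Y \<omega>)\<^sup>2 \<partial>M)) / 2)))"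

text \<open>Completing the square: tilting the standard normal density by
  \<open>exp (\<sigma> * x)\<close> gives a constant times the normal density with mean
  \<sigma>.\<close>

lemma std_normal_exp:
  "integrable std_normal_distribution (\<lambda>x. exp (\<sigma> * x))"
  "(\<integral>x. exp (\<sigma> * x) \<partial>std_normal_distribution) = exp (\<sigma>\<^sup>2 / 2)"
proof -
  have eq: "std_normal_density x * exp (\<sigma> * x) = exp (\<sigma>\<^sup>2 / 2) * normal_density \<sigma> 1 x" for x
    by (simp add: normal_density_def exp_add[symmetric] field_simps power2_eq_square)
  show "integrable std_normal_distribution (\<lambda>x. exp (\<sigma> * x))"
    by (subst integrable_density) (auto simp: eq normal_density_nonneg)
  show "(\<integral>x. exp (\<sigma> * x) \<partial>std_normal_distribution) = exp (\<sigma>\<^sup>2 / 2)"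
    by (subst integral_density) (auto simp: eq normal_density_nonneg integral_normal_density)
qed

context prob_space
begin

text \<open>That \<open>v\<close> is nonnegative follows because a characteristic function is
  bounded by 1 and its value at 1 is \<open>exp (- v / 2)\<close>. The law is written as the image
  of the standard normal law under a scaling, not with a density, so that \<open>v = 0\<close> is
  included.\<close>

lemma gaussian_char_distr:
  assumes [measurable]: "Y \<in> borel_measurable M"
    and ch: "\<And>\<theta>. (CLINT \<omega>|M. iexp (\<theta> * Y \<omega>)) = complex_of_real (exp (- (\<theta>\<^sup>2 * v) / 2))"
  shows "v \<ge> 0" and "distr M borel Y = distr std_normal_distribution borel (\<lambda>x. sqrt v * x)"
proof -
  interpret D: real_distribution "distr M borel Y" by simp
  have c: "char (distr M borel Y) \<theta> = complex_of_real (exp (- (\<theta>\<^sup>2 * v) / 2))" for \<theta>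
    unfolding char_def by (subst integral_distr) (use ch[of \<theta>] in auto)
  have "norm (char (distr M borel Y) 1) \<le> 1" by (rule D.cmod_char_le_1)
  then show v: "v \<ge> 0" by (simp add: c)
  interpret N: real_distribution std_normal_distribution by (rule real_dist_normal_dist)
  show "distr M borel Y = distr std_normal_distribution borel (\<lambda>x. sqrt v * x)"
  proof (rule Levy_uniqueness)
    show "char (distr M borel Y) = char (distr std_normal_distribution borel (\<lambda>x. sqrt v * x))"
    proof
      fix \<theta>
      have "char (distr std_normal_distribution borel (\<lambda>x. sqrt v * x)) \<theta> = char std_normal_distribution (\<theta> * sqrt v)"
        unfolding char_def by (subst integral_distr) (auto simp: mult.assoc)
      also have "\<dots> = complex_of_real (exp (- (\<theta>\<^sup>2 * v) / 2))"
        using v by (simp add: char_std_normal_distribution power_mult_distrib)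
      finally show "char (distr M borel Y) \<theta> = char (distr std_normal_distribution borel (\<lambda>x. sqrt v * x)) \<theta>"
        by (simp add: c)
    qed
    show "real_distribution (distr std_normal_distribution borel (\<lambda>x. sqrt v * x))"
      using N.real_distribution_distr[of "\<lambda>x. sqrt v * x"] by simp
  qed (rule D.real_distribution_axioms)
qed

text \<open>Once the law is identified, all moments are those of a scaled standard normal variable.
  In this way the variance of a combination of the \<open>W f\<close> is read off from its
  characteristic function.\<close>

lemma gaussian_charI:
  assumes [measurable]: "Y \<in> borel_measurable M"
    and ch: "\<And>\<theta>. (CLINT \<omega>|M. iexp (\<theta> * Y \<omega>)) = complex_of_real (exp (- (\<theta>\<^sup>2 * v) / 2))"
  shows "gaussian M Y" "(\<integral>\<omega>. (Y \<omega>)\<^sup>2 \<partial>M) = v" "integrable M (\<lambda>\<omega>. exp (Y \<omega>))"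
    "(\<integral>\<omega>. exp (Y \<omega>) \<partial>M) = exp (v / 2)"
proof -
  note v = gaussian_char_distr(1)[OF assms] and d = gaussian_char_distr(2)[OF assms]
  have "integrable (distr M borel Y) (\<lambda>x. x\<^sup>2)"
    unfolding d by (subst integrable_distr_eq) 
      (auto simp: power_mult_distrib integrable_std_normal_distribution_moment)
  then have "integrable M (\<lambda>\<omega>. (Y \<omega>)\<^sup>2)" by (subst (asm) integrable_distr_eq) auto
  then have s: "sqi M Y" by (simp add: sqi_def)
  have "(\<integral>\<omega>. (Y \<omega>)\<^sup>2 \<partial>M) = (\<integral>x. x\<^sup>2 \<partial>distr M borel Y)" by (subst integral_distr) auto
  also have "\<dots> = v * (\<integral>x. x\<^sup>2 \<partial>std_normal_distribution)"
    unfolding d using v by (subst integral_distr) (auto simp: power_mult_distrib)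
  also have "\<dots> = v"
    using std_normal_distribution_even_moments(1)[of 1] by (simp add: fact_2 numeral_2_eq_2)
  finally show E: "(\<integral>\<omega>. (Y \<omega>)\<^sup>2 \<partial>M) = v" .
  show "gaussian M Y" using s ch by (simp add: gaussian_def E)
  have "integrable (distr M borel Y) exp"
    unfolding d by (subst integrable_distr_eq) (auto simp: std_normal_exp)
  then show "integrable M (\<lambda>\<omega>. exp (Y \<omega>))" by (subst (asm) integrable_distr_eq) auto
  have "(\<integral>\<omega>. exp (Y \<omega>) \<partial>M) = (\<integral>x. exp x \<partial>distr M borel Y)" by (subst integral_distr) auto
  also have "\<dots> = exp (v / 2)"
    unfolding d using v by (subst integral_distr) (auto simp: std_normal_exp)
  finally show "(\<integral>\<omega>. exp (Y \<omega>) \<partial>M) = exp (v / 2)" .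
qed

lemma gaussian_exp:
  assumes "gaussian M Y"
  shows "integrable M (\<lambda>\<omega>. exp (Y \<omega>))"
    "(\<integral>\<omega>. exp (Y \<omega>) \<partial>M) = exp ((\<integral>\<omega>. (Y \<omega>)\<^sup>2 \<partial>M) / 2)"
  using gaussian_charI(3,4)[of Y "\<integral>\<omega>. (Y \<omega>)\<^sup>2 \<partial>M"] assms by (auto simp: gaussian_def sqi_def)

text \<open>Characteristic functions converge because \<open>|e^(ia) - e^(ib)| <= |a - b|\<close>,
  and variances converge by \<open>l2lim_inner\<close>; hence the Gaussian form survives in the
  limit.\<close>

lemma gaussian_l2lim:
  assumes lim: "l2lim M Yn Y" and g: "\<And>n. gaussian M (Yn n)"
  shows "gaussian M Y"
proof -
  have Y: "\<And>n. sqi M (Yn n)" "sqi M Y" and l: "(\<lambda>n. \<integral>\<omega>. (Yn n \<omega> - Y \<omega>)\<^sup>2 \<partial>M) \<longlonglongrightarrow> 0"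
    using lim by (auto simp: l2lim_def)
  note [measurable] = Y[THEN sqi_measurable]
  have v: "(\<lambda>n. \<integral>\<omega>. (Yn n \<omega>)\<^sup>2 \<partial>M) \<longlonglongrightarrow> (\<integral>\<omega>. (Y \<omega>)\<^sup>2 \<partial>M)"
    using l2lim_inner[OF lim lim] by (simp add: power2_eq_square)
  have "(CLINT \<omega>|M. iexp (\<theta> * Y \<omega>)) = complex_of_real (exp (- (\<theta>\<^sup>2 * (\<integral>\<omega>. (Y \<omega>)\<^sup>2 \<partial>M)) / 2))" for \<theta>
  proof (rule LIMSEQ_unique)
    show "(\<lambda>n. CLINT \<omega>|M. iexp (\<theta> * Yn n \<omega>)) \<longlonglongrightarrow> complex_of_real (exp (- (\<theta>\<^sup>2 * (\<integral>\<omega>. (Y \<omega>)\<^sup>2 \<partial>M)) / 2))"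
      using g unfolding gaussian_def by (auto intro!: tendsto_intros v)
    have "(\<lambda>n. (CLINT \<omega>|M. iexp (\<theta> * Yn n \<omega>)) - (CLINT \<omega>|M. iexp (\<theta> * Y \<omega>))) \<longlonglongrightarrow> 0"
    proof (rule Lim_null_comparison)
      show "\<forall>\<^sub>F n in sequentially. norm ((CLINT \<omega>|M. iexp (\<theta> * Yn n \<omega>)) - (CLINT \<omega>|M. iexp (\<theta> * Y \<omega>)))
        \<le> \<bar>\<theta>\<bar> * sqrt (\<integral>\<omega>. (Yn n \<omega> - Y \<omega>)\<^sup>2 \<partial>M)"
      proof (intro always_eventually allI)
        fix n
        have d: "sqi M (\<lambda>\<omega>. Yn n \<omega> - Y \<omega>)" using sqi_diff Y by auto
        have d': "sqi M (\<lambda>\<omega>. \<bar>Yn n \<omega> - Y \<omega>\<bar>)" using d by (simp add: sqi_def)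
        have "norm ((CLINT \<omega>|M. iexp (\<theta> * Yn n \<omega>)) - (CLINT \<omega>|M. iexp (\<theta> * Y \<omega>)))
          = norm (CLINT \<omega>|M. iexp (\<theta> * Yn n \<omega>) - iexp (\<theta> * Y \<omega>))"
          by (subst Bochner_Integration.integral_diff) (auto intro!: integrable_iexp)
        also have "\<dots> \<le> (\<integral>\<omega>. \<bar>\<theta>\<bar> * \<bar>Yn n \<omega> - Y \<omega>\<bar> \<partial>M)"
        proof (rule order_trans[OF integral_norm_bound], rule integral_mono)
          show "integrable M (\<lambda>\<omega>. norm (iexp (\<theta> * Yn n \<omega>) - iexp (\<theta> * Y \<omega>)))"
            by (intro integrable_norm Bochner_Integration.integrable_diff integrable_iexp) auto
          show "integrable M (\<lambda>\<omega>. \<bar>\<theta>\<bar> * \<bar>Yn n \<omega> - Y \<omega>\<bar>)"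
            using sqi_integrable[OF d'] by simp
          fix \<omega>
          have "norm (iexp a - iexp b) = norm (iexp (a - b) - 1)" for a b
          proof -
            have "iexp a - iexp b = iexp b * (iexp (a - b) - 1)"
              by (simp add: exp_add[symmetric] algebra_simps)
            then show ?thesis by (simp only: norm_mult norm_exp_i_times mult_1)
          qed
          then have "norm (iexp (\<theta> * Yn n \<omega>) - iexp (\<theta> * Y \<omega>)) = norm (iexp (\<theta> * Yn n \<omega> - \<theta> * Y \<omega>) - 1)"
            by blast
          also have "\<dots> \<le> \<bar>\<theta> * Yn n \<omega> - \<theta> * Y \<omega>\<bar>"
            using iexp_approx1[of "\<theta> * Yn n \<omega> - \<theta> * Y \<omega>" 0] by simp
          finally show "norm (iexp (\<theta> * Yn n \<omega>) - iexp (\<theta> * Y \<omega>)) \<le> \<bar>\<theta>\<bar> * \<bar>Yn n \<omega> - Y \<omega>\<bar>"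
            by (simp add: abs_mult[symmetric] right_diff_distrib)
        qed
        also have "\<dots> = \<bar>\<theta>\<bar> * (\<integral>\<omega>. \<bar>Yn n \<omega> - Y \<omega>\<bar> * 1 \<partial>M)" by simp
        also have "\<dots> \<le> \<bar>\<theta>\<bar> * sqrt (\<integral>\<omega>. (Yn n \<omega> - Y \<omega>)\<^sup>2 \<partial>M)"
          using sqi_Cauchy_Schwarz[OF d', of "\<lambda>_. 1"] 
          by (intro mult_left_mono) (auto simp: sqi_def prob_space)
        finally show "norm ((CLINT \<omega>|M. iexp (\<theta> * Yn n \<omega>)) - (CLINT \<omega>|M. iexp (\<theta> * Y \<omega>)))
          \<le> \<bar>\<theta>\<bar> * sqrt (\<integral>\<omega>. (Yn n \<omega> - Y \<omega>)\<^sup>2 \<partial>M)" .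
      qed
      show "(\<lambda>n. \<bar>\<theta>\<bar> * sqrt (\<integral>\<omega>. (Yn n \<omega> - Y \<omega>)\<^sup>2 \<partial>M)) \<longlonglongrightarrow> 0"
        by (rule tendsto_eq_intros l refl)+ simp
    qed
    then show "(\<lambda>n. CLINT \<omega>|M. iexp (\<theta> * Yn n \<omega>)) \<longlonglongrightarrow> (CLINT \<omega>|M. iexp (\<theta> * Y \<omega>))"
      by (simp add: LIM_zero_iff)
  qed
  then show ?thesis using Y by (simp add: gaussian_def)
qed

end

text \<open>The quantity is the square of \<open>exp (x / 2) - exp (- x / 2)\<close>, and
  \<open>exp y - exp (- y) <= 2 * y * exp y\<close> for nonnegative \<open>y\<close>, here
  \<open>y = |x| / 2\<close>.\<close>

lemma exp_second_difference_bound: "\<bar>exp x + exp (- x) - 2\<bar> \<le> x\<^sup>2 * exp \<bar>x::real\<bar>"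
proof -
  have a: "exp y - exp (- y) \<le> 2 * y * exp y" if "y \<ge> 0" for y :: real
  proof -
    have "1 + (- 2 * y) \<le> exp (- 2 * y)" by (rule exp_ge_add_one_self)
    then have "exp y * (1 - exp (- 2 * y)) \<le> exp y * (2 * y)" by (intro mult_left_mono) auto
    then show ?thesis by (simp add: algebra_simps exp_add[symmetric])
  qed
  define y where "y = \<bar>x\<bar> / 2"
  have y: "y \<ge> 0" by (simp add: y_def)
  have "exp x + exp (- x) - 2 = (exp y - exp (- y))\<^sup>2"
    by (cases "x \<ge> 0") (simp_all add: y_def power2_eq_square algebra_simps exp_add[symmetric])
  moreover have "(exp y - exp (- y))\<^sup>2 \<le> (2 * y * exp y)\<^sup>2"
    using a[OF y] y by (intro power_mono) auto
  moreover have "(2 * y * exp y)\<^sup>2 = x\<^sup>2 * exp \<bar>x\<bar>"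
    by (simp add: y_def power2_eq_square algebra_simps exp_add[symmetric] mult_exp_exp)
  ultimately show ?thesis by simp
qed

text \<open>This is the second derivative at \<open>a = 0\<close> of
  \<open>exp ((A + 2 * a * B + a^2 * C) / 2)\<close>, the exponential moment of
  \<open>Y + a * Z\<close> when \<open>A\<close>, \<open>B\<close>, \<open>C\<close> are the second
  moments of the Gaussian pair.\<close>

lemma exp_second_difference_limit:
  "(\<lambda>n. (exp ((A + 2 * (1 / real (Suc n)) * B + (1 / real (Suc n))\<^sup>2 * C) / 2)
       + exp ((A - 2 * (1 / real (Suc n)) * B + (1 / real (Suc n))\<^sup>2 * C) / 2) - 2 * exp (A / 2)) / (1 / real (Suc n))\<^sup>2)
    \<longlonglongrightarrow> exp (A / 2) * (C + B\<^sup>2)"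
proof -
  have "(\<lambda>n::nat. ((exp ((2 * (1 / real (Suc n)) * B + (1 / real (Suc n))\<^sup>2 * C) / 2)
       + exp ((- 2 * (1 / real (Suc n)) * B + (1 / real (Suc n))\<^sup>2 * C) / 2) - 2) / (1 / real (Suc n))\<^sup>2))
    \<longlonglongrightarrow> (C + B\<^sup>2)"
    by (real_asymp simp: power2_eq_square field_simps)
  from tendsto_mult_left[OF this, of "exp (A / 2)"] show ?thesis
    by (simp add: algebra_simps exp_add[symmetric] add_divide_distrib diff_divide_distrib)
qed

context prob_space
begin

text \<open>Second difference of \<open>a \<mapsto> E exp (Y + a Z)\<close> at 0, with the dominating
  function \<open>z\<^sup>2 e\<^sup>|\<^sup>z\<^sup>| \<le> 2 (e\<^sup>2\<^sup>z + e\<^sup>-\<^sup>2\<^sup>z)\<close>.\<close>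

lemma gaussian_exp_sq:
  assumes g: "\<And>a. gaussian M (\<lambda>\<omega>. Y \<omega> + a * Z \<omega>)" and Y: "sqi M Y" and Z: "sqi M Z"
  shows "integrable M (\<lambda>\<omega>. exp (Y \<omega>) * (Z \<omega>)\<^sup>2)"
    "(\<integral>\<omega>. exp (Y \<omega>) * (Z \<omega>)\<^sup>2 \<partial>M) = exp ((\<integral>\<omega>. (Y \<omega>)\<^sup>2 \<partial>M) / 2) *
      ((\<integral>\<omega>. (Z \<omega>)\<^sup>2 \<partial>M) + (\<integral>\<omega>. Y \<omega> * Z \<omega> \<partial>M)\<^sup>2)"
proof -
  note [measurable] = Y[THEN sqi_measurable] Z[THEN sqi_measurable]
  let ?A = "\<integral>\<omega>. (Y \<omega>)\<^sup>2 \<partial>M" and ?B = "\<integral>\<omega>. Y \<omega> * Z \<omega> \<partial>M" and ?C = "\<integral>\<omega>. (Z \<omega>)\<^sup>2 \<partial>M"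
  have v: "(\<integral>\<omega>. (Y \<omega> + a * Z \<omega>)\<^sup>2 \<partial>M) = ?A + 2 * a * ?B + a\<^sup>2 * ?C" for a
  proof -
    have "(\<integral>\<omega>. (Y \<omega> + a * Z \<omega>)\<^sup>2 \<partial>M) = (\<integral>\<omega>. (Y \<omega>)\<^sup>2 + 2 * a * (Y \<omega> * Z \<omega>) + a\<^sup>2 * (Z \<omega>)\<^sup>2 \<partial>M)"
      by (intro Bochner_Integration.integral_cong) (auto simp: power2_eq_square algebra_simps)
    then show ?thesis using Y Z sqi_mult[OF Y Z] by (simp add: sqi_def)
  qed
  have i: "integrable M (\<lambda>\<omega>. exp (Y \<omega> + a * Z \<omega>))"
    and e: "(\<integral>\<omega>. exp (Y \<omega> + a * Z \<omega>) \<partial>M) = exp ((?A + 2 * a * ?B + a\<^sup>2 * ?C) / 2)" for a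
    using gaussian_exp[OF g[of a]] by (auto simp: v)
  define D where "D = (\<lambda>\<omega>. 2 * (exp (Y \<omega> + 2 * Z \<omega>) + exp (Y \<omega> + (- 2) * Z \<omega>)))"
  have iD: "integrable M D" unfolding D_def using i[of 2] i[of "-2"] by simp
  have dom: "exp y * (z\<^sup>2 * exp \<bar>z\<bar>) \<le> 2 * (exp (y + 2 * z) + exp (y + (- 2) * z))" for y z :: real
  proof -
    have "z\<^sup>2 \<le> 2 * exp \<bar>z\<bar>"
      using exp_lower_Taylor_quadratic[of "\<bar>z\<bar>"] by simp
    then have "z\<^sup>2 * exp \<bar>z\<bar> \<le> 2 * exp \<bar>z\<bar> * exp \<bar>z\<bar>" by (intro mult_right_mono) auto
    also have "\<dots> = 2 * exp (2 * \<bar>z\<bar>)" by (simp add: exp_add[symmetric])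
    also have "\<dots> \<le> 2 * (exp (2 * z) + exp (- 2 * z))" by (cases "z \<ge> 0") auto
    finally have "exp y * (z\<^sup>2 * exp \<bar>z\<bar>) \<le> exp y * (2 * (exp (2 * z) + exp (- 2 * z)))"
      by (intro mult_left_mono) auto
    then show ?thesis by (simp only: exp_add distrib_left mult.assoc mult.left_commute)
  qed
  show "integrable M (\<lambda>\<omega>. exp (Y \<omega>) * (Z \<omega>)\<^sup>2)"
  proof (rule Bochner_Integration.integrable_bound[OF iD])
    have "exp y * z\<^sup>2 \<le> exp y * (z\<^sup>2 * exp \<bar>z\<bar>)" for y z :: real
      by (intro mult_left_mono mult_le_cancel_left1[THEN iffD2]) auto
    then show "AE \<omega> in M. norm (exp (Y \<omega>) * (Z \<omega>)\<^sup>2) \<le> norm (D \<omega>)"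
      unfolding D_def using order_trans[OF _ dom] by (auto simp: mult.assoc)
  qed measurable
  define a where "a = (\<lambda>n. 1 / real (Suc n))"
  have a: "0 < a n" "a n \<le> 1" for n by (auto simp: a_def)
  have a0: "a \<longlonglongrightarrow> 0" unfolding a_def by real_asymp
  define F where "F = (\<lambda>n \<omega>. (exp (Y \<omega> + a n * Z \<omega>) + exp (Y \<omega> + (- a n) * Z \<omega>) - 2 * exp (Y \<omega> + 0 * Z \<omega>)) / (a n)\<^sup>2)"
  have "(\<lambda>n. \<integral>\<omega>. F n \<omega> \<partial>M) \<longlonglongrightarrow> (\<integral>\<omega>. exp (Y \<omega>) * (Z \<omega>)\<^sup>2 \<partial>M)"
  proof (rule integral_dominated_convergence[OF _ _ iD])
    show "AE \<omega> in M. (\<lambda>n. F n \<omega>) \<longlonglongrightarrow> exp (Y \<omega>) * (Z \<omega>)\<^sup>2"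
    proof (rule AE_I2)
      fix \<omega>
      \<comment> \<open>The pointwise limit is an instance of the same real limit, with
        \<open>A = 2 * Y\<close>, \<open>B = Z\<close> and \<open>C = 0\<close>; these identities
        fit its exponents.\<close>
      have half: "(2 * y + 2 * r * z + r\<^sup>2 * 0) / 2 = y + r * z" "(2 * y - 2 * r * z + r\<^sup>2 * 0) / 2 = y + (- r) * z"
        "2 * y / 2 = y + 0 * z" for y z r :: real
        by auto
      show "(\<lambda>n. F n \<omega>) \<longlonglongrightarrow> exp (Y \<omega>) * (Z \<omega>)\<^sup>2"
        using exp_second_difference_limit[of "2 * Y \<omega>" "Z \<omega>" 0]
        unfolding half F_def a_def by simp
    qed
    show "AE \<omega> in M. norm (F n \<omega>) \<le> D \<omega>" for n
    proof (rule AE_I2)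
      fix \<omega>
      let ?z = "Z \<omega>"
      have "F n \<omega> = exp (Y \<omega>) * ((exp (a n * ?z) + exp (- (a n * ?z)) - 2) / (a n)\<^sup>2)"
        by (simp only: F_def exp_add mult_minus_left mult_zero_left exp_zero)
          (simp add: right_diff_distrib distrib_left diff_divide_distrib add_divide_distrib)
      then have "norm (F n \<omega>) = exp (Y \<omega>) * (\<bar>exp (a n * ?z) + exp (- (a n * ?z)) - 2\<bar> / (a n)\<^sup>2)"
        by (simp add: abs_mult)
      also have "\<dots> \<le> exp (Y \<omega>) * ((a n * ?z)\<^sup>2 * exp \<bar>a n * ?z\<bar> / (a n)\<^sup>2)"
        by (intro mult_left_mono divide_right_mono exp_second_difference_bound) auto
      also have "\<dots> = exp (Y \<omega>) * (?z\<^sup>2 * exp (a n * \<bar>?z\<bar>))"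
        using a(1)[of n] by (simp add: power_mult_distrib abs_mult)
      also have "\<dots> \<le> exp (Y \<omega>) * (?z\<^sup>2 * exp (\<bar>?z\<bar>))"
        using a[of n] by (intro mult_left_mono) (auto simp: mult_left_le_one_le)
      also have "\<dots> \<le> D \<omega>" unfolding D_def by (rule dom)
      finally show "norm (F n \<omega>) \<le> D \<omega>" .
    qed
  qed (auto simp: F_def)
  moreover have "(\<integral>\<omega>. F n \<omega> \<partial>M) = (exp ((?A + 2 * a n * ?B + (a n)\<^sup>2 * ?C) / 2)
       + exp ((?A - 2 * a n * ?B + (a n)\<^sup>2 * ?C) / 2) - 2 * exp (?A / 2)) / (a n)\<^sup>2" for n
    unfolding F_def using i[of "a n"] i[of "- a n"] i[of 0] e[of "a n"] e[of "- a n"] e[of 0] by simp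
  ultimately show "(\<integral>\<omega>. exp (Y \<omega>) * (Z \<omega>)\<^sup>2 \<partial>M) = exp (?A / 2) * (?C + ?B\<^sup>2)"
    using exp_second_difference_limit[of ?A ?B ?C] by (auto simp: a_def intro: LIMSEQ_unique)
qed

text \<open>Polarisation: \<open>Z1 * Z2\<close> is a quarter of the difference of the squares of
  \<open>Z1 + Z2\<close> and \<open>Z1 - Z2\<close>, to both of which \<open>gaussian_exp_sq\<close>
  applies.\<close>

lemma gaussian_exp_mult:
  assumes g: "\<And>a b. gaussian M (\<lambda>\<omega>. Y \<omega> + (a * Z1 \<omega> + b * Z2 \<omega>))"
    and Y: "sqi M Y" and Z: "sqi M Z1" "sqi M Z2"
  shows "integrable M (\<lambda>\<omega>. exp (Y \<omega>) * (Z1 \<omega> * Z2 \<omega>))"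
    "(\<integral>\<omega>. exp (Y \<omega>) * (Z1 \<omega> * Z2 \<omega>) \<partial>M) = exp ((\<integral>\<omega>. (Y \<omega>)\<^sup>2 \<partial>M) / 2) *
      ((\<integral>\<omega>. Z1 \<omega> * Z2 \<omega> \<partial>M) + (\<integral>\<omega>. Y \<omega> * Z1 \<omega> \<partial>M) * (\<integral>\<omega>. Y \<omega> * Z2 \<omega> \<partial>M))"
proof -
  let ?P = "\<lambda>\<omega>. Z1 \<omega> + Z2 \<omega>" and ?N = "\<lambda>\<omega>. Z1 \<omega> - Z2 \<omega>"
  have P: "sqi M ?P" and N: "sqi M ?N" using Z by (auto intro: sqi_add sqi_diff)
  have gP: "gaussian M (\<lambda>\<omega>. Y \<omega> + a * ?P \<omega>)" for a
    using g[of a a] by (simp add: algebra_simps)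
  have gN: "gaussian M (\<lambda>\<omega>. Y \<omega> + a * ?N \<omega>)" for a
    using g[of a "-a"] by (simp add: algebra_simps)
  note p = gaussian_exp_sq[OF gP Y P] and n = gaussian_exp_sq[OF gN Y N]
  have eq: "z1 * z2 = ((z1 + z2)\<^sup>2 - (z1 - z2)\<^sup>2) / 4" for z1 z2 :: real
    by (simp add: power2_eq_square algebra_simps)
  have eq': "exp y * (z1 * z2) = (exp y * (z1 + z2)\<^sup>2 - exp y * (z1 - z2)\<^sup>2) / 4" for y z1 z2 :: real
    unfolding eq[of z1 z2] by (simp add: right_diff_distrib)
  show "integrable M (\<lambda>\<omega>. exp (Y \<omega>) * (Z1 \<omega> * Z2 \<omega>))"
    unfolding eq' using p(1) n(1) by simp
  have "(\<integral>\<omega>. exp (Y \<omega>) * (Z1 \<omega> * Z2 \<omega>) \<partial>M) =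
     ((\<integral>\<omega>. exp (Y \<omega>) * (?P \<omega>)\<^sup>2 \<partial>M) - (\<integral>\<omega>. exp (Y \<omega>) * (?N \<omega>)\<^sup>2 \<partial>M)) / 4"
    unfolding eq' using p(1) n(1) by simp
  moreover have "(\<integral>\<omega>. Z1 \<omega> * Z2 \<omega> \<partial>M) = ((\<integral>\<omega>. (?P \<omega>)\<^sup>2 \<partial>M) - (\<integral>\<omega>. (?N \<omega>)\<^sup>2 \<partial>M)) / 4"
    unfolding eq using P N by (simp add: sqi_def)
  moreover have "(\<integral>\<omega>. Y \<omega> * ?P \<omega> \<partial>M) = (\<integral>\<omega>. Y \<omega> * Z1 \<omega> \<partial>M) + (\<integral>\<omega>. Y \<omega> * Z2 \<omega> \<partial>M)"
    "(\<integral>\<omega>. Y \<omega> * ?N \<omega> \<partial>M) = (\<integral>\<omega>. Y \<omega> * Z1 \<omega> \<partial>M) - (\<integral>\<omega>. Y \<omega> * Z2 \<omega> \<partial>M)"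
    using sqi_mult[OF Y Z(1)] sqi_mult[OF Y Z(2)] by (simp_all add: distrib_left right_diff_distrib)
  moreover have alg: "(E * (P + (b1 + b2)\<^sup>2) - E * (N + (b1 - b2)\<^sup>2)) / 4 = E * ((P - N) / 4 + b1 * b2)"
    for E P N b1 b2 :: real
    by (simp add: power2_eq_square field_simps)
  ultimately show "(\<integral>\<omega>. exp (Y \<omega>) * (Z1 \<omega> * Z2 \<omega>) \<partial>M) = exp ((\<integral>\<omega>. (Y \<omega>)\<^sup>2 \<partial>M) / 2) *
      ((\<integral>\<omega>. Z1 \<omega> * Z2 \<omega> \<partial>M) + (\<integral>\<omega>. Y \<omega> * Z1 \<omega> \<partial>M) * (\<integral>\<omega>. Y \<omega> * Z2 \<omega> \<partial>M))"
    using alg by (simp only: p(2) n(2))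
qed

end

subsection \<open>The Gaussian Hilbert space of the noise\<close>

text \<open>Combinations are formed of the variables \<open>W f\<close> and not of the functions
  \<open>f\<close>, since \<open>isonormal\<close> does not state that \<open>W\<close> is linear.
  With a list of terms, addition is concatenation.\<close>

definition lincomb :: "((real \<times> real \<Rightarrow> real) \<Rightarrow> 'b \<Rightarrow> real) \<Rightarrow> ('b \<Rightarrow> real) \<Rightarrow> bool" where
  "lincomb W Y \<longleftrightarrow> (\<exists>xs. (\<forall>p\<in>set xs. Hdom (snd p)) \<and> Y = (\<lambda>\<omega>. \<Sum>p\<leftarrow>xs. fst p * W (snd p) \<omega>))"

text \<open>The L2 closure of the span of the noise, that is, its first Wiener chaos. It contains
  the limits \<open>I\<close>, which need not be \<open>W f\<close> for a function
  \<open>f\<close>.\<close>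

definition gspace :: "'b measure \<Rightarrow> ((real \<times> real \<Rightarrow> real) \<Rightarrow> 'b \<Rightarrow> real) \<Rightarrow> ('b \<Rightarrow> real) set" where
  "gspace Pw W = {Y. \<exists>Yn. (\<forall>n. lincomb W (Yn n)) \<and> l2lim Pw Yn Y}"

lemma lincomb_add:
  assumes "lincomb W Y" "lincomb W Z"
  shows "lincomb W (\<lambda>\<omega>. Y \<omega> + Z \<omega>)"
proof -
  obtain xs ys where "\<forall>p\<in>set xs. Hdom (snd p)" "Y = (\<lambda>\<omega>. \<Sum>p\<leftarrow>xs. fst p * W (snd p) \<omega>)"
    "\<forall>p\<in>set ys. Hdom (snd p)" "Z = (\<lambda>\<omega>. \<Sum>p\<leftarrow>ys. fst p * W (snd p) \<omega>)"
    using assms unfolding lincomb_def by blast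
  then show ?thesis unfolding lincomb_def by (intro exI[of _ "xs @ ys"]) auto
qed

lemma lincomb_cmult:
  assumes "lincomb W Y"
  shows "lincomb W (\<lambda>\<omega>. a * Y \<omega>)"
proof -
  obtain xs where "\<forall>p\<in>set xs. Hdom (snd p)" "Y = (\<lambda>\<omega>. \<Sum>p\<leftarrow>xs. fst p * W (snd p) \<omega>)"
    using assms unfolding lincomb_def by blast
  then show ?thesis unfolding lincomb_def
    by (intro exI[of _ "map (\<lambda>p. (a * fst p, snd p)) xs"])
      (auto simp: sum_list_const_mult[symmetric] o_def mult.assoc)
qed

lemma lincomb_W: "Hdom f \<Longrightarrow> lincomb W (W f)"
  unfolding lincomb_def by (intro exI[of _ "[(1, f)]"]) auto

locale noise = prob_space Pw for Pw :: "'b measure" +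
  fixes W :: "(real \<times> real \<Rightarrow> real) \<Rightarrow> 'b \<Rightarrow> real"
  assumes iso: "isonormal Pw W"
begin

lemma W_measurable: "Hdom f \<Longrightarrow> W f \<in> borel_measurable Pw"
  using iso by (auto simp: isonormal_def)

lemma W_char:
  fixes n :: nat
  assumes "\<And>i. i < n \<Longrightarrow> Hdom (f i)"
  shows "(CLINT \<omega>|Pw. iexp (\<Sum>i<n. a i * W (f i) \<omega>))
          = complex_of_real (exp (- (\<Sum>i<n. \<Sum>j<n. a i * a j * Hinner (f i) (f j)) / 2))"
  using conjunct2[OF iso[unfolded isonormal_def], THEN spec, THEN spec, THEN spec, THEN mp, of n f a] assms
  by simp

lemma lincomb_gaussian:
  assumes "lincomb W Y"
  shows "gaussian Pw Y"
proof -
  obtain xs where xs: "\<forall>p\<in>set xs. Hdom (snd p)" and Y: "Y = (\<lambda>\<omega>. \<Sum>p\<leftarrow>xs. fst p * W (snd p) \<omega>)"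
    using assms unfolding lincomb_def by blast
  define n a f where "n = length xs" and "a = (\<lambda>i. fst (xs ! i))" and "f = (\<lambda>i. snd (xs ! i))"
  have f: "\<forall>i<n. Hdom (f i)" using xs by (auto simp: n_def f_def)
  have Y': "Y = (\<lambda>\<omega>. \<Sum>i<n. a i * W (f i) \<omega>)"
    unfolding Y n_def a_def f_def by (subst sum_list_sum_nth) (auto simp: atLeast0LessThan)
  let ?v = "\<Sum>i<n. \<Sum>j<n. a i * a j * Hinner (f i) (f j)"
  show ?thesis
  proof (rule gaussian_charI(1))
    show "Y \<in> borel_measurable Pw" unfolding Y' using f W_measurable by auto
    fix \<theta> :: real
    have "(CLINT \<omega>|Pw. iexp (\<Sum>i<n. (\<theta> * a i) * W (f i) \<omega>))
          = complex_of_real (exp (- (\<Sum>i<n. \<Sum>j<n. (\<theta> * a i) * (\<theta> * a j) * Hinner (f i) (f j)) / 2))"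
      by (rule W_char[where n = n and a = "\<lambda>i. \<theta> * a i" and f = f]) (use f in auto)
    also have "(\<Sum>i<n. \<Sum>j<n. (\<theta> * a i) * (\<theta> * a j) * Hinner (f i) (f j)) = \<theta>\<^sup>2 * ?v"
      by (simp add: sum_distrib_left power2_eq_square mult_ac)
    also have "(\<lambda>\<omega>. iexp (\<Sum>i<n. (\<theta> * a i) * W (f i) \<omega>)) = (\<lambda>\<omega>. iexp (\<theta> * Y \<omega>))"
      unfolding Y' by (simp add: sum_distrib_left mult.assoc)
    finally show "(CLINT \<omega>|Pw. iexp (\<theta> * Y \<omega>)) = complex_of_real (exp (- (\<theta>\<^sup>2 * ?v) / 2))" .
  qed
qed

lemma lincomb_sqi: "lincomb W Y \<Longrightarrow> sqi Pw Y"
  using lincomb_gaussian by (auto simp: gaussian_def)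

lemma W_variance:
  assumes "Hdom f"
  shows "(\<integral>\<omega>. (W f \<omega>)\<^sup>2 \<partial>Pw) = Hinner f f"
proof (rule gaussian_charI(2))
  show "W f \<in> borel_measurable Pw" using assms by (rule W_measurable)
  fix \<theta> :: real
  show "(CLINT \<omega>|Pw. iexp (\<theta> * W f \<omega>)) = complex_of_real (exp (- (\<theta>\<^sup>2 * Hinner f f) / 2))"
    using W_char[of "Suc 0" "\<lambda>_. f" "\<lambda>_. \<theta>"] assms
    by (simp add: power2_eq_square)
qed

text \<open>Comparing the variance of \<open>W f + W g\<close> with those of the summands yields
  only the symmetrised product. Symmetry enters later, through \<open>HN_commute\<close>.\<close>

lemma W_covariance:
  assumes f: "Hdom f" and g: "Hdom g"
  shows "(\<integral>\<omega>. W f \<omega> * W g \<omega> \<partial>Pw) = (Hinner f g + Hinner g f) / 2"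
proof -
  have s: "sqi Pw (W f)" "sqi Pw (W g)" using f g by (auto intro: lincomb_sqi lincomb_W)
  have "(\<integral>\<omega>. (W f \<omega> + W g \<omega>)\<^sup>2 \<partial>Pw) = Hinner f f + Hinner f g + Hinner g f + Hinner g g"
  proof (rule gaussian_charI(2))
    show "(\<lambda>\<omega>. W f \<omega> + W g \<omega>) \<in> borel_measurable Pw" using W_measurable f g by auto
    fix \<theta> :: real
    show "(CLINT \<omega>|Pw. iexp (\<theta> * (W f \<omega> + W g \<omega>)))
      = complex_of_real (exp (- (\<theta>\<^sup>2 * (Hinner f f + Hinner f g + Hinner g f + Hinner g g)) / 2))"
    proof -
      define F where "F = (\<lambda>i::nat. if i = 0 then f else g)"
      have F: "F 0 = f" "F (Suc 0) = g" by (auto simp: F_def)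
      have H: "Hdom (F i)" for i using f g by (simp add: F_def)
      have "(\<Sum>i<(2::nat). \<theta> * W (F i) \<omega>) = \<theta> * (W f \<omega> + W g \<omega>)" for \<omega>
        by (simp add: numeral_2_eq_2 distrib_left F)
      moreover have "(\<Sum>i<(2::nat). \<Sum>j<(2::nat). \<theta> * \<theta> * Hinner (F i) (F j))
          = \<theta>\<^sup>2 * (Hinner f f + Hinner f g + Hinner g f + Hinner g g)"
        by (simp add: numeral_2_eq_2 distrib_left F)
      moreover note W_char[where n = 2 and a = "\<lambda>_. \<theta>" and f = F, OF H]
      ultimately show ?thesis by (simp only:)
    qed
  qed
  moreover have "(\<integral>\<omega>. (W f \<omega> + W g \<omega>)\<^sup>2 \<partial>Pw) = (\<integral>\<omega>. (W f \<omega>)\<^sup>2 + 2 * (W f \<omega> * W g \<omega>) + (W g \<omega>)\<^sup>2 \<partial>Pw)"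
    by (intro Bochner_Integration.integral_cong) (auto simp: power2_eq_square algebra_simps)
  moreover have "\<dots> = Hinner f f + 2 * (\<integral>\<omega>. W f \<omega> * W g \<omega> \<partial>Pw) + Hinner g g"
    using s sqi_mult[OF s] by (simp add: sqi_def W_variance f g)
  ultimately show ?thesis by simp
qed

lemma gspace_lincomb: "lincomb W Y \<Longrightarrow> Y \<in> gspace Pw W"
  unfolding gspace_def by (intro CollectI exI[of _ "\<lambda>_. Y"] conjI allI l2lim_const lincomb_sqi)

lemma gspace_W: "Hdom f \<Longrightarrow> W f \<in> gspace Pw W"
  by (intro gspace_lincomb lincomb_W)

lemma gspace_sqi: "Y \<in> gspace Pw W \<Longrightarrow> sqi Pw Y"
  by (auto simp: gspace_def l2lim_def)

lemma gspace_zero: "(\<lambda>\<omega>. 0) \<in> gspace Pw W"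
  by (rule gspace_lincomb, unfold lincomb_def, rule exI[of _ "[]"]) simp

lemma gspace_add:
  assumes "Y \<in> gspace Pw W" "Z \<in> gspace Pw W"
  shows "(\<lambda>\<omega>. Y \<omega> + Z \<omega>) \<in> gspace Pw W"
proof -
  obtain Yn Zn where "\<forall>n. lincomb W (Yn n)" "l2lim Pw Yn Y" "\<forall>n. lincomb W (Zn n)" "l2lim Pw Zn Z"
    using assms unfolding gspace_def by blast
  then have "\<forall>n. lincomb W (\<lambda>\<omega>. Yn n \<omega> + Zn n \<omega>)" "l2lim Pw (\<lambda>n \<omega>. Yn n \<omega> + Zn n \<omega>) (\<lambda>\<omega>. Y \<omega> + Z \<omega>)"
    by (auto intro: lincomb_add l2lim_add)
  then show ?thesis unfolding gspace_def by (intro CollectI exI[of _ "\<lambda>n \<omega>. Yn n \<omega> + Zn n \<omega>"] conjI)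
qed

lemma gspace_cmult:
  assumes "Y \<in> gspace Pw W"
  shows "(\<lambda>\<omega>. a * Y \<omega>) \<in> gspace Pw W"
proof -
  obtain Yn where "\<forall>n. lincomb W (Yn n)" "l2lim Pw Yn Y"
    using assms unfolding gspace_def by blast
  then have "\<forall>n. lincomb W (\<lambda>\<omega>. a * Yn n \<omega>)" "l2lim Pw (\<lambda>n \<omega>. a * Yn n \<omega>) (\<lambda>\<omega>. a * Y \<omega>)"
    by (auto intro: lincomb_cmult l2lim_cmult)
  then show ?thesis unfolding gspace_def by (intro CollectI exI[of _ "\<lambda>n \<omega>. a * Yn n \<omega>"] conjI)
qed

lemma gspace_sum: "(\<And>i. i \<in> S \<Longrightarrow> Y i \<in> gspace Pw W) \<Longrightarrow> (\<lambda>\<omega>. \<Sum>i\<in>S. Y i \<omega>) \<in> gspace Pw W"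
  by (induction S rule: infinite_finite_induct) (auto intro!: gspace_add gspace_zero)

text \<open>A closure is closed: each \<open>Yn n\<close> is replaced by a finite combination at
  mean square distance below \<open>1 / (n + 1)\<close>.\<close>

lemma gspace_l2lim:
  assumes Y: "\<And>n. Yn n \<in> gspace Pw W" and lim: "l2lim Pw Yn Y"
  shows "Y \<in> gspace Pw W"
proof -
  have "\<exists>Z. lincomb W Z \<and> (\<integral>\<omega>. (Z \<omega> - Yn n \<omega>)\<^sup>2 \<partial>Pw) < 1 / real (Suc n)" for n
  proof -
    obtain Zm where Zm: "\<forall>m. lincomb W (Zm m)" "l2lim Pw Zm (Yn n)"
      using Y[of n] unfolding gspace_def by blast
    then have "(\<lambda>m. \<integral>\<omega>. (Zm m \<omega> - Yn n \<omega>)\<^sup>2 \<partial>Pw) \<longlonglongrightarrow> 0" by (simp add: l2lim_def)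
    then have "\<forall>\<^sub>F m in sequentially. (\<integral>\<omega>. (Zm m \<omega> - Yn n \<omega>)\<^sup>2 \<partial>Pw) < 1 / real (Suc n)"
      by (rule order_tendstoD) simp
    then obtain m where "(\<integral>\<omega>. (Zm m \<omega> - Yn n \<omega>)\<^sup>2 \<partial>Pw) < 1 / real (Suc n)"
      by (auto simp: eventually_sequentially)
    then show ?thesis using Zm by blast
  qed
  then obtain Z where Z: "\<And>n. lincomb W (Z n)" "\<And>n. (\<integral>\<omega>. (Z n \<omega> - Yn n \<omega>)\<^sup>2 \<partial>Pw) < 1 / real (Suc n)"
    by metis
  have dz: "l2lim Pw (\<lambda>n \<omega>. Z n \<omega> - Yn n \<omega>) (\<lambda>\<omega>. 0)"
  proof -
    have "(\<lambda>n. \<integral>\<omega>. (Z n \<omega> - Yn n \<omega>)\<^sup>2 \<partial>Pw) \<longlonglongrightarrow> 0"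
    proof (rule Lim_null_comparison)
      show "\<forall>\<^sub>F n in sequentially. norm (\<integral>\<omega>. (Z n \<omega> - Yn n \<omega>)\<^sup>2 \<partial>Pw) \<le> 1 / real (Suc n)"
        using Z(2) by (intro always_eventually allI) (simp add: less_imp_le)
    qed real_asymp
    then show ?thesis unfolding l2lim_def using Z(1) Y by (auto intro: sqi_diff lincomb_sqi gspace_sqi)
  qed
  from l2lim_add[OF dz lim] have "l2lim Pw Z Y" by simp
  then show ?thesis unfolding gspace_def using Z(1) by (intro CollectI exI[of _ Z] conjI allI)
qed

lemma gspace_cong_AE:
  assumes Y: "Y \<in> gspace Pw W" and Z: "Z \<in> borel_measurable Pw" and eq: "AE \<omega> in Pw. Y \<omega> = Z \<omega>"
  shows "Z \<in> gspace Pw W"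
proof (rule gspace_l2lim[of "\<lambda>_. Y"])
  have "(\<integral>\<omega>. (Y \<omega> - Z \<omega>)\<^sup>2 \<partial>Pw) = 0"
    by (rule integral_eq_zero_AE) (use eq in auto)
  then show "l2lim Pw (\<lambda>_. Y) Z"
    using gspace_sqi[OF Y] sqi_cong_AE[OF gspace_sqi[OF Y] Z eq] by (simp add: l2lim_def)
qed (rule Y)

lemma gspace_gaussian:
  assumes "Y \<in> gspace Pw W"
  shows "gaussian Pw Y"
proof -
  obtain Yn where "\<And>n. lincomb W (Yn n)" "l2lim Pw Yn Y"
    using assms unfolding gspace_def by blast
  then show ?thesis using gaussian_l2lim lincomb_gaussian by blast
qed

lemma gspace_exp:
  assumes "Y \<in> gspace Pw W"
  shows "integrable Pw (\<lambda>\<omega>. exp (Y \<omega>))"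
    "(\<integral>\<omega>. exp (Y \<omega>) \<partial>Pw) = exp ((\<integral>\<omega>. (Y \<omega>)\<^sup>2 \<partial>Pw) / 2)"
  using gaussian_exp[OF gspace_gaussian[OF assms]] by auto

lemma gspace_exp_mult:
  assumes "Y \<in> gspace Pw W" "Z1 \<in> gspace Pw W" "Z2 \<in> gspace Pw W"
  shows "integrable Pw (\<lambda>\<omega>. exp (Y \<omega>) * (Z1 \<omega> * Z2 \<omega>))"
    "(\<integral>\<omega>. exp (Y \<omega>) * (Z1 \<omega> * Z2 \<omega>) \<partial>Pw) = exp ((\<integral>\<omega>. (Y \<omega>)\<^sup>2 \<partial>Pw) / 2) *
      ((\<integral>\<omega>. Z1 \<omega> * Z2 \<omega> \<partial>Pw) + (\<integral>\<omega>. Y \<omega> * Z1 \<omega> \<partial>Pw) * (\<integral>\<omega>. Y \<omega> * Z2 \<omega> \<partial>Pw))"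
proof -
  have g: "gaussian Pw (\<lambda>\<omega>. Y \<omega> + (a * Z1 \<omega> + b * Z2 \<omega>))" for a b
    by (intro gspace_gaussian gspace_add gspace_cmult assms)
  note * = gaussian_exp_mult[OF g gspace_sqi[OF assms(1)] gspace_sqi[OF assms(2)] gspace_sqi[OF assms(3)]]
  show "integrable Pw (\<lambda>\<omega>. exp (Y \<omega>) * (Z1 \<omega> * Z2 \<omega>))"
    "(\<integral>\<omega>. exp (Y \<omega>) * (Z1 \<omega> * Z2 \<omega>) \<partial>Pw) = exp ((\<integral>\<omega>. (Y \<omega>)\<^sup>2 \<partial>Pw) / 2) *
      ((\<integral>\<omega>. Z1 \<omega> * Z2 \<omega> \<partial>Pw) + (\<integral>\<omega>. Y \<omega> * Z1 \<omega> \<partial>Pw) * (\<integral>\<omega>. Y \<omega> * Z2 \<omega> \<partial>Pw))"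
    by (rule *)+
qed

end

subsection \<open>The heat kernel and the covariance of the regularised noise\<close>

lemma heat_nonneg: "0 \<le> t \<Longrightarrow> 0 \<le> heat t x"
  by (simp add: heat_def)

lemma heat_measurable [measurable]:
  assumes [measurable]: "f \<in> borel_measurable M" "g \<in> borel_measurable M"
  shows "(\<lambda>x. heat (f x) (g x)) \<in> borel_measurable M"
  unfolding heat_def by measurable

lemma heat_minus [simp]: "heat t (- x) = heat t x"
  by (simp add: heat_def)

lemma heat_commute: "heat t (x - y) = heat t (y - x)"
  using heat_minus[of t "y - x"] by simp

text \<open>Division by zero makes the kernel at time 0 vanish instead of being a Dirac mass. In the
  double time integrals this concerns only the diagonal, a null set.\<close>

lemma heat_zero [simp]: "heat 0 x = 0"
  by (simp add: heat_def)

text \<open>The time singularity of the heat kernel, integrable at 0. As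
  \<open>0 powr r = 0\<close>, also \<open>isq 0 = 0\<close>, so comparisons have to exclude the
  origin.\<close>

definition isq :: "real \<Rightarrow> real" where "isq x = \<bar>x\<bar> powr (- 1 / 2)"

lemma isq_nonneg [simp]: "0 \<le> isq x" by (simp add: isq_def)

lemma isq_measurable [measurable]:
  assumes [measurable]: "f \<in> borel_measurable M"
  shows "(\<lambda>x. isq (f x)) \<in> borel_measurable M"
  unfolding isq_def by measurable

lemma isq_sqrt: "isq x = 1 / sqrt \<bar>x\<bar>"
  unfolding isq_def using powr_minus_divide[of "\<bar>x\<bar>" "1/2"] by (simp add: powr_half_sqrt)

lemma isq_minus: "isq (- x) = isq x" by (simp add: isq_def)

lemma isq_commute: "isq (x - y) = isq (y - x)" by (simp add: isq_def abs_minus_commute)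

lemma isq_mono: "0 < \<bar>x\<bar> \<Longrightarrow> \<bar>x\<bar> \<le> \<bar>y\<bar> \<Longrightarrow> isq y \<le> isq x"
  unfolding isq_def by (intro powr_mono2') auto

text \<open>The maximum over space is at 0 and equals \<open>1 / sqrt (2 * pi * t)\<close>. With a
  separate \<open>s\<close> one may discard from the time \<open>t\<close> either the mollification
  or the time difference, whichever is not wanted in the bound.\<close>

lemma heat_le_isq:
  assumes "0 < s" "s \<le> t"
  shows "heat t x \<le> isq s"
proof -
  have t: "t > 0" using assms by simp
  have "heat t x \<le> 1 / sqrt (2 * pi * t)"
    unfolding heat_def using t by (intro divide_right_mono) auto
  also have "\<dots> \<le> 1 / sqrt t"
  proof (intro divide_left_mono real_sqrt_le_mono)
    show "t \<le> 2 * pi * t" using t pi_ge_two by (simp add: mult_le_cancel_right1)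
  qed (use t in auto)
  also have "\<dots> = isq t"
    using t by (simp add: isq_sqrt)
  also have "\<dots> \<le> isq s" using assms by (intro isq_mono) auto
  finally show ?thesis .
qed

lemma heat_normal_density: "0 < t \<Longrightarrow> heat t x = normal_density 0 (sqrt t) x"
  by (simp add: heat_def normal_density_def)

lemma nn_integral_heat_conv:
  assumes s: "0 < s" and t: "0 < t"
  shows "(\<integral>\<^sup>+y. ennreal (heat s (x - y) * heat t (y - z)) \<partial>lborel) = ennreal (heat (s + t) (x - z))"
proof -
  have "(\<integral>\<^sup>+y. ennreal (heat s (x - y) * heat t (y - z)) \<partial>lborel)
    = (\<integral>\<^sup>+y. ennreal (heat s (x - (z + y)) * heat t ((z + y) - z)) \<partial>lborel)"
    using nn_integral_real_affine[of "\<lambda>y. ennreal (heat s (x - y) * heat t (y - z))" 1 z] by simp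
  also have "\<dots> = (\<integral>\<^sup>+y. ennreal (normal_density 0 (sqrt s) ((x - z) - y) * normal_density 0 (sqrt t) y) \<partial>lborel)"
    using s t by (simp add: heat_normal_density diff_diff_add)
  also have "\<dots> = ennreal (heat (s + t) (x - z))"
    using conv_normal_density_zero_mean[of "sqrt s" "sqrt t"] s t by (simp add: heat_normal_density fun_eq_iff)
  finally show ?thesis .
qed

lemma nn_integral_heat: "0 < t \<Longrightarrow> (\<integral>\<^sup>+y. ennreal (heat t (x - y)) \<partial>lborel) = 1"
proof -
  assume t: "0 < t"
  have "(\<integral>\<^sup>+y. ennreal (heat t (x - y)) \<partial>lborel) = (\<integral>\<^sup>+y. ennreal (normal_density x (sqrt t) y) \<partial>lborel)"
    using t by (simp add: heat_def normal_density_def power2_commute)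
  also have "\<dots> = 1"
    using prob_space.emeasure_space_1[OF prob_space_normal_density[of "sqrt t" x]] t
    by (simp add: emeasure_density)
  finally show ?thesis .
qed

text \<open>By the semigroup property, used twice, mollifying the heat kernel in both space
  variables only lengthens its time.\<close>

lemma nn_integral_heat_triple:
  assumes e: "0 < e" "0 < e'" and a: "0 < a"
  shows "(\<integral>\<^sup>+y. \<integral>\<^sup>+y'. ennreal (heat e (x - y) * heat e' (x' - y') * heat a (y - y')) \<partial>lborel \<partial>lborel)
    = ennreal (heat (a + e + e') (x - x'))"
proof -
  have "(\<integral>\<^sup>+y'. ennreal (heat e (x - y) * heat e' (x' - y') * heat a (y - y')) \<partial>lborel)
    = ennreal (heat e (x - y) * heat (a + e') (y - x'))" for y
  proof -
    have "(\<integral>\<^sup>+y'. ennreal (heat e (x - y) * heat e' (x' - y') * heat a (y - y')) \<partial>lborel)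
      = (\<integral>\<^sup>+y'. ennreal (heat e (x - y)) * ennreal (heat a (y - y') * heat e' (y' - x')) \<partial>lborel)"
      using e by (intro nn_integral_cong) (simp add: ennreal_mult'[symmetric] heat_nonneg heat_commute[of e' x'] mult_ac)
    also have "\<dots> = ennreal (heat e (x - y)) * ennreal (heat (a + e') (y - x'))"
      using nn_integral_heat_conv[OF a e(2), of y x'] by (simp add: nn_integral_cmult)
    finally show ?thesis using e by (simp add: ennreal_mult' heat_nonneg)
  qed
  then show ?thesis using nn_integral_heat_conv[of e "a + e'" x x'] e a by (simp add: add_ac)
qed

section \<open>The inverse square root averaged over short time intervals\<close>

lemma nn_integral_isq_local:
  assumes "0 < d"
  shows "(\<integral>\<^sup>+a. ennreal (indicator {c-d..c+d} a * isq (a - c)) \<partial>lborel) \<le> ennreal (4 * d powr (1/2))"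
proof -
  have half: "(\<integral>\<^sup>+z. ennreal (indicator {0..d} z * isq z) \<partial>lborel) = ennreal (2 * d powr (1/2))"
  proof -
    have "integral\<^sup>N lborel (\<lambda>z. indicator {0..d} z * (z powr (-1/2))) = ennreal (d powr (-1/2+1) / (-1/2+1))"
      by (rule nn_integral_has_integral_lebesgue[OF _ has_integral_powr_from_0]) (use assms in auto)
    moreover have "(\<lambda>z. ennreal (indicator {0..d} z * isq z)) = (\<lambda>z. ennreal (indicator {0..d} z * (z powr (-1/2))))"
      by (auto simp: fun_eq_iff indicator_def isq_def)
    ultimately show ?thesis by simp
  qed
  have "(\<integral>\<^sup>+a. ennreal (indicator {c-d..c+d} a * isq (a - c)) \<partial>lborel)
     = (\<integral>\<^sup>+z. ennreal (indicator {c-d..c+d} (c + z) * isq z) \<partial>lborel)"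
    using nn_integral_real_affine[of "\<lambda>a. ennreal (indicator {c-d..c+d} a * isq (a - c))" 1 c] by simp
  also have "\<dots> \<le> (\<integral>\<^sup>+z. ennreal (indicator {0..d} z * isq z) + ennreal (indicator {0..d} (-z) * isq (-z)) \<partial>lborel)"
    by (intro nn_integral_mono) (auto simp: indicator_def isq_minus)
  also have "\<dots> = (\<integral>\<^sup>+z. ennreal (indicator {0..d} z * isq z) \<partial>lborel) + (\<integral>\<^sup>+z. ennreal (indicator {0..d} (-z) * isq (-z)) \<partial>lborel)"
    by (intro nn_integral_add) auto
  also have "(\<integral>\<^sup>+z. ennreal (indicator {0..d} (-z) * isq (-z)) \<partial>lborel) = (\<integral>\<^sup>+z. ennreal (indicator {0..d} z * isq z) \<partial>lborel)"
    using nn_integral_real_affine[of "\<lambda>z. ennreal (indicator {0..d} z * isq z)" "-1" 0] by simp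
  finally show ?thesis by (simp add: half flip: ennreal_plus)
qed

text \<open>Points within \<open>d\<close> of the singularity contribute at most
  \<open>4 * sqrt d\<close>; elsewhere the integrand is at most \<open>1 / sqrt d\<close> on a set
  of length at most \<open>d\<close>. The position of \<open>c\<close> does not matter.\<close>

lemma nn_integral_isq_interval:
  assumes "0 < d"
  shows "(\<integral>\<^sup>+a. ennreal (indicator {u-d..u} a * isq (a - c)) \<partial>lborel) \<le> ennreal (5 * d powr (1/2))"
proof -
  have "(\<integral>\<^sup>+a. ennreal (indicator {u-d..u} a * isq (a - c)) \<partial>lborel)
    \<le> (\<integral>\<^sup>+a. ennreal (d powr (-1/2)) * indicator {u-d..u} a + ennreal (indicator {c-d..c+d} a * isq (a - c)) \<partial>lborel)"
  proof (intro nn_integral_mono)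
    fix a
    have "isq (a - c) \<le> d powr (-1/2) + indicator {c-d..c+d} a * isq (a - c)"
    proof (cases "a \<in> {c-d..c+d}")
      case False
      then have "\<bar>d\<bar> \<le> \<bar>a - c\<bar>" using assms by auto
      then show ?thesis using isq_mono[of d "a - c"] False assms by (simp add: isq_def)
    qed simp
    then have "indicator {u-d..u} a * isq (a - c) \<le> indicator {u-d..u} a * d powr (-1/2) + indicator {c-d..c+d} a * isq (a - c)"
      by (auto simp: indicator_def split: if_splits)
    then have "ennreal (indicator {u-d..u} a * isq (a - c)) \<le> ennreal (indicator {u-d..u} a * d powr (-1/2) + indicator {c-d..c+d} a * isq (a - c))"
      by (rule ennreal_leI)
    also have "\<dots> = ennreal (d powr (-1/2)) * indicator {u-d..u} a + ennreal (indicator {c-d..c+d} a * isq (a - c))"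
      by (subst ennreal_plus) (auto simp: indicator_def)
    finally show "ennreal (indicator {u-d..u} a * isq (a - c)) \<le> \<dots>" .
  qed
  also have "\<dots> = ennreal (d powr (-1/2)) * ennreal d + (\<integral>\<^sup>+a. ennreal (indicator {c-d..c+d} a * isq (a - c)) \<partial>lborel)"
    using assms by (subst nn_integral_add) (auto simp: nn_integral_cmult_indicator)
  also have "\<dots> \<le> ennreal (d powr (1/2)) + ennreal (4 * d powr (1/2))"
  proof (intro add_mono nn_integral_isq_local assms)
    have "d powr (-1/2) * d = d powr (1/2)"
      using assms powr_add[of d "-1/2" 1] by simp
    then show "ennreal (d powr (-1/2)) * ennreal d \<le> ennreal (d powr (1/2))"
      by (simp add: ennreal_mult'[symmetric])
  qed
  also have "\<dots> = ennreal (5 * d powr (1/2))"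
    by (simp flip: ennreal_plus)
  finally show ?thesis .
qed

text \<open>Time kernel of the regularised noise at time \<open>u\<close>. The cut at 0 removes mass
  when \<open>\<delta>\<close> exceeds \<open>u\<close>, so the total mass is 1 only for
  \<open>\<delta> \<le> u\<close>.\<close>

definition qker :: "real \<Rightarrow> real \<Rightarrow> real \<Rightarrow> real" where
  "qker \<delta> u a = indicator {0..u} a * psi \<delta> (u - a)"

lemma qker_nonneg: "0 < \<delta> \<Longrightarrow> 0 \<le> qker \<delta> u a"
  by (simp add: qker_def psi_def)

lemma qker_measurable [measurable]:
  assumes [measurable]: "f \<in> borel_measurable M" "g \<in> borel_measurable M"
  shows "(\<lambda>x. qker \<delta> (f x) (g x)) \<in> borel_measurable M"
proof -
  have eq: "qker \<delta> u a = (if 0 \<le> a \<and> a \<le> u \<and> u - a \<le> \<delta> then 1 / \<delta> else 0)" for u a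
    by (auto simp: qker_def psi_def indicator_def)
  show ?thesis unfolding eq by measurable
qed

lemma nn_integral_qker_le: "0 < \<delta> \<Longrightarrow> (\<integral>\<^sup>+a. ennreal (qker \<delta> u a) \<partial>lborel) \<le> 1"
proof -
  assume d: "0 < \<delta>"
  have "(\<integral>\<^sup>+a. ennreal (qker \<delta> u a) \<partial>lborel) \<le> (\<integral>\<^sup>+a. ennreal (1/\<delta>) * indicator {u-\<delta>..u} a \<partial>lborel)"
    using d by (intro nn_integral_mono) (auto simp: qker_def psi_def indicator_def)
  also have "\<dots> = 1" using d by (simp add: nn_integral_cmult_indicator ennreal_mult'[symmetric])
  finally show ?thesis .
qed

lemma nn_integral_qker: "0 < \<delta> \<Longrightarrow> \<delta> \<le> u \<Longrightarrow> (\<integral>\<^sup>+a. ennreal (qker \<delta> u a) \<partial>lborel) = 1"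
proof -
  assume d: "0 < \<delta>" "\<delta> \<le> u"
  have "(\<integral>\<^sup>+a. ennreal (qker \<delta> u a) \<partial>lborel) = (\<integral>\<^sup>+a. ennreal (1/\<delta>) * indicator {u-\<delta>..u} a \<partial>lborel)"
    using d by (intro nn_integral_cong) (auto simp: qker_def psi_def indicator_def)
  also have "\<dots> = 1" using d by (simp add: nn_integral_cmult_indicator ennreal_mult'[symmetric])
  finally show ?thesis .
qed

lemma nn_integral_qker_isq:
  assumes d: "0 < \<delta>"
  shows "(\<integral>\<^sup>+a. ennreal (qker \<delta> u a * isq (a - c)) \<partial>lborel) \<le> ennreal (5 * \<delta> powr (-1/2))"
proof -
  have "(\<integral>\<^sup>+a. ennreal (qker \<delta> u a * isq (a - c)) \<partial>lborel)
    \<le> (\<integral>\<^sup>+a. ennreal (1/\<delta>) * ennreal (indicator {u-\<delta>..u} a * isq (a - c)) \<partial>lborel)"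
    using d by (intro nn_integral_mono) (auto simp: qker_def psi_def indicator_def ennreal_mult'[symmetric])
  also have "\<dots> \<le> ennreal (1/\<delta>) * ennreal (5 * \<delta> powr (1/2))"
    by (subst nn_integral_cmult) (auto intro!: mult_left_mono nn_integral_isq_interval d)
  also have "\<dots> = ennreal (5 * \<delta> powr (-1/2))"
  proof -
    have "\<delta> powr (-1/2) = \<delta> powr (1/2) / \<delta>"
      using d powr_diff[of \<delta> "1/2" 1] by simp
    then show ?thesis using d by (simp add: ennreal_mult'[symmetric] field_simps)
  qed
  finally show ?thesis .
qed

text \<open>Averaging both arguments of the singular kernel costs only a constant, uniformly in the
  two widths. If \<open>u\<close> and \<open>v\<close> are far apart compared with the larger width,
  so are \<open>a\<close> and \<open>b\<close>; otherwise the larger width is more than half of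
  \<open>|u - v|\<close>, and integrating that kernel gives a bound by its width alone.\<close>

lemma nn_integral_qker_qker_isq:
  assumes d: "0 < \<delta>" "0 < \<delta>'" and uv: "u \<noteq> v"
  shows "(\<integral>\<^sup>+a. \<integral>\<^sup>+b. ennreal (qker \<delta> u a * qker \<delta>' v b * isq (a - b)) \<partial>lborel \<partial>lborel) \<le> ennreal (8 * isq (u - v))"
    (is "?J \<le> _")
proof -
  define m where "m = max \<delta> \<delta>'"
  have m: "m > 0" using d by (auto simp: m_def)
  show ?thesis
  proof (cases "\<bar>u - v\<bar> \<ge> 2 * m")
    case True
    have "qker \<delta> u a * qker \<delta>' v b * isq (a - b) \<le> qker \<delta> u a * qker \<delta>' v b * (8 * isq (u - v))" for a b
    proof (cases "qker \<delta> u a = 0 \<or> qker \<delta>' v b = 0")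
      case False
      then have "u - \<delta> \<le> a" "a \<le> u" "v - \<delta>' \<le> b" "b \<le> v"
        by (auto simp: qker_def psi_def indicator_def split: if_splits)
      then have "\<bar>u - v\<bar> - m \<le> \<bar>a - b\<bar>" using d unfolding m_def by linarith
      \<comment> \<open>Half of \<open>|u - v|\<close> would be available; a quarter is taken
        because \<open>isq\<close> then scales by exactly 2.\<close>
      then have "\<bar>(u - v) / 4\<bar> \<le> \<bar>a - b\<bar>" using True m by simp
      then have "isq (a - b) \<le> isq ((u - v) / 4)" using uv by (intro isq_mono) auto
      also have "\<dots> = 2 * isq (u - v)"
        by (simp add: isq_sqrt real_sqrt_divide)
      also have "\<dots> \<le> 8 * isq (u - v)" by simp
      finally show ?thesis using qker_nonneg d by (intro mult_left_mono) auto
    qed auto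
    then have "?J \<le> (\<integral>\<^sup>+a. \<integral>\<^sup>+b. ennreal (8 * isq (u - v)) * (ennreal (qker \<delta> u a) * ennreal (qker \<delta>' v b)) \<partial>lborel \<partial>lborel)"
      using qker_nonneg d by (intro nn_integral_mono) (simp add: ennreal_mult'[symmetric] mult_ac ennreal_leI)
    also have "\<dots> = ennreal (8 * isq (u - v)) * ((\<integral>\<^sup>+a. ennreal (qker \<delta> u a) \<partial>lborel) * (\<integral>\<^sup>+b. ennreal (qker \<delta>' v b) \<partial>lborel))"
      by (simp add: nn_integral_cmult nn_integral_multc mult_ac)
    also have "\<dots> \<le> ennreal (8 * isq (u - v)) * (1 * 1)"
      by (intro mult_left_mono mult_mono nn_integral_qker_le d) auto
    finally show ?thesis by simp
  next
    case False
    \<comment> \<open>Here \<open>|u - v| < 2 * m\<close>, and \<open>5 * sqrt 2 < 8\<close>; this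
      is the origin of the constant 8.\<close>
    have "5 * m powr (-1/2) \<le> 8 * isq (u - v)"
    proof -
      have "isq m = isq (2 * m / 2)" by simp
      have "isq (2 * m) \<le> isq (u - v)" using uv False m by (intro isq_mono) auto
      moreover have "isq (2 * m) = 2 powr (-1/2) * m powr (-1/2)"
        using m by (simp add: isq_def powr_mult)
      moreover have "5/8 \<le> (2::real) powr (-1/2)"
      proof -
        have "sqrt 2 \<le> (8/5::real)" by (rule real_le_lsqrt) (auto simp: power2_eq_square)
        then have "5/8 \<le> isq 2" by (simp add: isq_sqrt field_simps)
        then show ?thesis by (simp add: isq_def)
      qed
      then have "(5/8) * m powr (-1/2) \<le> 2 powr (-1/2) * m powr (-1/2)" by (intro mult_right_mono) auto
      ultimately show ?thesis by simp
    qed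
    then have le: "ennreal (5 * m powr (-1/2)) \<le> ennreal (8 * isq (u - v))" by (rule ennreal_leI)
    \<comment> \<open>The wider kernel is integrated first and absorbs the singularity; the other
      one has mass at most 1.\<close>
    have "?J \<le> ennreal (5 * m powr (-1/2))"
    proof (cases "\<delta>' \<le> \<delta>")
      case True
      then have m': "m = \<delta>" by (simp add: m_def)
      have "?J = (\<integral>\<^sup>+b. \<integral>\<^sup>+a. ennreal (qker \<delta> u a * qker \<delta>' v b * isq (a - b)) \<partial>lborel \<partial>lborel)"
        by (subst lborel_pair.Fubini') auto
      also have "\<dots> = (\<integral>\<^sup>+b. ennreal (qker \<delta>' v b) * (\<integral>\<^sup>+a. ennreal (qker \<delta> u a * isq (a - b)) \<partial>lborel) \<partial>lborel)"
        using qker_nonneg d by (subst nn_integral_cmult[symmetric]) (auto intro!: nn_integral_cong simp: ennreal_mult'[symmetric] mult_ac)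
      also have "\<dots> \<le> (\<integral>\<^sup>+b. ennreal (qker \<delta>' v b) * ennreal (5 * m powr (-1/2)) \<partial>lborel)"
        unfolding m' by (intro nn_integral_mono mult_left_mono nn_integral_qker_isq d) auto
      also have "\<dots> = (\<integral>\<^sup>+b. ennreal (qker \<delta>' v b) \<partial>lborel) * ennreal (5 * m powr (-1/2))"
        by (rule nn_integral_multc) measurable
      also have "\<dots> \<le> 1 * ennreal (5 * m powr (-1/2))"
        by (intro mult_right_mono nn_integral_qker_le d) simp
      finally show ?thesis by simp
    next
      case F: False
      then have m': "m = \<delta>'" by (simp add: m_def)
      have "?J = (\<integral>\<^sup>+a. ennreal (qker \<delta> u a) * (\<integral>\<^sup>+b. ennreal (qker \<delta>' v b * isq (b - a)) \<partial>lborel) \<partial>lborel)"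
        using qker_nonneg d by (subst nn_integral_cmult[symmetric])
          (auto intro!: nn_integral_cong simp: ennreal_mult'[symmetric] mult_ac isq_commute)
      also have "\<dots> \<le> (\<integral>\<^sup>+b. ennreal (qker \<delta> u b) * ennreal (5 * m powr (-1/2)) \<partial>lborel)"
        unfolding m' by (intro nn_integral_mono mult_left_mono nn_integral_qker_isq d) auto
      also have "\<dots> = (\<integral>\<^sup>+b. ennreal (qker \<delta> u b) \<partial>lborel) * ennreal (5 * m powr (-1/2))"
        by (rule nn_integral_multc) measurable
      also have "\<dots> \<le> 1 * ennreal (5 * m powr (-1/2))"
        by (intro mult_right_mono nn_integral_qker_le d) simp
      finally show ?thesis by simp
    qed
    then show ?thesis using le by (rule order_trans)
  qed
qed

text \<open>The covariance of two regularised noises, with parameters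
  \<open>(\<epsilon>, \<delta>)\<close> and \<open>(\<epsilon>', \<delta>')\<close>, at times
  \<open>u\<close>, \<open>v\<close> and spatial displacement \<open>z\<close>; see
  \<open>HN_phi_phi\<close>.\<close>

definition Kn :: "real \<Rightarrow> real \<Rightarrow> real \<Rightarrow> real \<Rightarrow> real \<Rightarrow> real \<Rightarrow> real \<Rightarrow> ennreal" where
  "Kn \<epsilon> \<delta> \<epsilon>' \<delta>' u v z =
     (\<integral>\<^sup>+a. \<integral>\<^sup>+b. ennreal (qker \<delta> u a * qker \<delta>' v b * heat (\<bar>a - b\<bar> + \<epsilon> + \<epsilon>') z) \<partial>lborel \<partial>lborel)"

lemma Kn_measurable [measurable]:
  assumes [measurable]: "f \<in> borel_measurable M" "g \<in> borel_measurable M" "h \<in> borel_measurable M"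
  shows "(\<lambda>x. Kn \<epsilon> \<delta> \<epsilon>' \<delta>' (f x) (g x) (h x)) \<in> borel_measurable M"
  unfolding Kn_def by measurable

text \<open>The time \<open>|a - b|\<close> is kept and the mollification discarded, so the bound is
  free of all four parameters. It supplies the domination in the limits below.\<close>

lemma Kn_le_isq:
  assumes "0 < \<delta>" "0 < \<delta>'" "0 < \<epsilon>" "0 < \<epsilon>'" "u \<noteq> v"
  shows "Kn \<epsilon> \<delta> \<epsilon>' \<delta>' u v z \<le> ennreal (8 * isq (u - v))"
proof -
  have "Kn \<epsilon> \<delta> \<epsilon>' \<delta>' u v z \<le> (\<integral>\<^sup>+a. \<integral>\<^sup>+b. ennreal (qker \<delta> u a * qker \<delta>' v b * isq (a - b)) \<partial>lborel \<partial>lborel)"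
    unfolding Kn_def
  proof (rule nn_integral_mono)
    fix a :: real
    show "(\<integral>\<^sup>+b. ennreal (qker \<delta> u a * qker \<delta>' v b * heat (\<bar>a - b\<bar> + \<epsilon> + \<epsilon>') z) \<partial>lborel)
      \<le> (\<integral>\<^sup>+b. ennreal (qker \<delta> u a * qker \<delta>' v b * isq (a - b)) \<partial>lborel)"
    proof (rule nn_integral_mono_AE)
      show "AE b in lborel. ennreal (qker \<delta> u a * qker \<delta>' v b * heat (\<bar>a - b\<bar> + \<epsilon> + \<epsilon>') z)
        \<le> ennreal (qker \<delta> u a * qker \<delta>' v b * isq (a - b))"
        using AE_lborel_singleton[of a]
      proof eventually_elim
        case (elim b)
        then have "heat (\<bar>a - b\<bar> + \<epsilon> + \<epsilon>') z \<le> isq \<bar>a - b\<bar>" using assms by (intro heat_le_isq) auto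
        then show ?case using assms qker_nonneg
          by (intro ennreal_leI mult_left_mono) (auto simp: isq_def)
      qed
    qed
  qed
  also have "\<dots> \<le> ennreal (8 * isq (u - v))" using assms by (intro nn_integral_qker_qker_isq)
  finally show ?thesis .
qed

text \<open>Here the mollification time is kept instead. The bound also holds for
  \<open>u = v\<close>, as variances require, but it blows up with vanishing
  \<open>\<epsilon>\<close>.\<close>

lemma Kn_le_eps:
  assumes "0 < \<delta>" "0 < \<delta>'" "0 < \<epsilon>" "0 < \<epsilon>'"
  shows "Kn \<epsilon> \<delta> \<epsilon>' \<delta>' u v z \<le> ennreal (isq \<epsilon>)"
proof -
  have "Kn \<epsilon> \<delta> \<epsilon>' \<delta>' u v z \<le> (\<integral>\<^sup>+a. \<integral>\<^sup>+b. ennreal (isq \<epsilon>) * (ennreal (qker \<delta> u a) * ennreal (qker \<delta>' v b)) \<partial>lborel \<partial>lborel)"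
    unfolding Kn_def
  proof (intro nn_integral_mono)
    fix a b :: real
    have "heat (\<bar>a - b\<bar> + \<epsilon> + \<epsilon>') z \<le> isq \<epsilon>" using assms by (intro heat_le_isq) auto
    then have "qker \<delta> u a * qker \<delta>' v b * heat (\<bar>a - b\<bar> + \<epsilon> + \<epsilon>') z \<le> qker \<delta> u a * qker \<delta>' v b * isq \<epsilon>"
      using qker_nonneg assms by (intro mult_left_mono) auto
    then show "ennreal (qker \<delta> u a * qker \<delta>' v b * heat (\<bar>a - b\<bar> + \<epsilon> + \<epsilon>') z)
       \<le> ennreal (isq \<epsilon>) * (ennreal (qker \<delta> u a) * ennreal (qker \<delta>' v b))"
      using qker_nonneg assms by (simp add: ennreal_mult'[symmetric] mult_ac ennreal_leI)
  qed
  also have "\<dots> = ennreal (isq \<epsilon>) * ((\<integral>\<^sup>+a. ennreal (qker \<delta> u a) \<partial>lborel) * (\<integral>\<^sup>+b. ennreal (qker \<delta>' v b) \<partial>lborel))"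
    by (simp add: nn_integral_cmult nn_integral_multc mult_ac)
  also have "\<dots> \<le> ennreal (isq \<epsilon>) * (1 * 1)"
    by (intro mult_left_mono mult_mono nn_integral_qker_le assms) auto
  finally show ?thesis by simp
qed

lemma heat_isCont: "0 < t \<Longrightarrow> isCont (\<lambda>t. heat t x) t"
  unfolding heat_def by (intro continuous_intros) auto

text \<open>For small widths both time kernels are probability densities concentrated near
  \<open>u\<close> and \<open>v\<close>, and the heat kernel is continuous at the time
  \<open>|u - v| > 0\<close>. The two noises may follow different sequences, which
  \<open>good_Wn_tendsto\<close> exploits.\<close>

lemma Kn_tendsto:
  assumes pos: "\<And>n. 0 < \<delta> n" "\<And>n. 0 < \<delta>' n" "\<And>n. 0 < \<epsilon> n" "\<And>n. 0 < \<epsilon>' n"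
    and lim: "\<delta> \<longlonglongrightarrow> 0" "\<delta>' \<longlonglongrightarrow> 0" "\<epsilon> \<longlonglongrightarrow> 0" "\<epsilon>' \<longlonglongrightarrow> 0"
    and uv: "0 < u" "0 < v" "u \<noteq> v"
  shows "(\<lambda>n. enn2real (Kn (\<epsilon> n) (\<delta> n) (\<epsilon>' n) (\<delta>' n) u v z)) \<longlonglongrightarrow> heat \<bar>u - v\<bar> z"
proof (rule tendstoI)
  fix e :: real assume e: "0 < e"
  define h where "h = heat \<bar>u - v\<bar> z"
  have h0: "h \<ge> 0" by (simp add: h_def heat_nonneg)
  have "isCont (\<lambda>t. heat t z) \<bar>u - v\<bar>" using uv by (intro heat_isCont) auto
  then obtain k where k: "k > 0" "\<And>t. \<bar>t - \<bar>u - v\<bar>\<bar> < k \<Longrightarrow> \<bar>heat t z - h\<bar> < e / 2"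
    using e unfolding continuous_at_eps_delta h_def by (metis half_gt_zero real_norm_def dist_real_def)
  \<comment> \<open>Four parameters below \<open>k / 5\<close> move the time by less than
    \<open>k\<close>; widths below \<open>u\<close> and \<open>v\<close> leave both kernels with
    mass exactly 1.\<close>
  define k' where "k' = min (k / 5) (min u v)"
  have k': "k' > 0" using k uv by (auto simp: k'_def)
  have ev: "\<forall>\<^sub>F n in sequentially. \<delta> n < k' \<and> \<delta>' n < k' \<and> \<epsilon> n < k' \<and> \<epsilon>' n < k'"
    using lim[THEN order_tendstoD(2), OF k'] by eventually_elim auto
  show "\<forall>\<^sub>F n in sequentially. dist (enn2real (Kn (\<epsilon> n) (\<delta> n) (\<epsilon>' n) (\<delta>' n) u v z)) (heat \<bar>u - v\<bar> z) < e"
    using ev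
  proof eventually_elim
    case (elim n)
    have near: "\<bar>heat (\<bar>a - b\<bar> + \<epsilon> n + \<epsilon>' n) z - h\<bar> < e / 2"
      if "qker (\<delta> n) u a \<noteq> 0" "qker (\<delta>' n) v b \<noteq> 0" for a b
    proof (rule k(2))
      have "u - \<delta> n \<le> a" "a \<le> u" "v - \<delta>' n \<le> b" "b \<le> v"
        using that by (auto simp: qker_def psi_def indicator_def split: if_splits)
      then show "\<bar>\<bar>a - b\<bar> + \<epsilon> n + \<epsilon>' n - \<bar>u - v\<bar>\<bar> < k"
        using elim pos(3)[of n] pos(4)[of n] by (auto simp: k'_def)
    qed
    have gen1: "p * x \<le> c * p" if "0 \<le> p" "p \<noteq> 0 \<Longrightarrow> x \<le> c" for p x c :: real
      using that by (cases "p = 0") (simp_all add: mult.commute[of p] mult_right_mono)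
    have gen2: "c * p \<le> p * x" if "0 \<le> p" "p \<noteq> 0 \<Longrightarrow> c \<le> x" for p x c :: real
      using that by (cases "p = 0") (simp_all add: mult.commute[of p] mult_right_mono)
    have nq: "0 \<le> qker (\<delta> n) u a * qker (\<delta>' n) v b" for a b
      using qker_nonneg pos by simp
    have em: "ennreal c * (ennreal (qker (\<delta> n) u a) * ennreal (qker (\<delta>' n) v b))
        = ennreal (c * (qker (\<delta> n) u a * qker (\<delta>' n) v b))" for a b c
      using nq[of a b] qker_nonneg[OF pos(2), of n v b] by (simp only: ennreal_mult'')
    have tot: "(\<integral>\<^sup>+a. \<integral>\<^sup>+b. ennreal c * (ennreal (qker (\<delta> n) u a) * ennreal (qker (\<delta>' n) v b)) \<partial>lborel \<partial>lborel) = ennreal c" for c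
    proof -
      have "(\<integral>\<^sup>+a. \<integral>\<^sup>+b. ennreal c * (ennreal (qker (\<delta> n) u a) * ennreal (qker (\<delta>' n) v b)) \<partial>lborel \<partial>lborel)
        = ennreal c * ((\<integral>\<^sup>+a. ennreal (qker (\<delta> n) u a) \<partial>lborel) * (\<integral>\<^sup>+b. ennreal (qker (\<delta>' n) v b) \<partial>lborel))"
        by (simp add: nn_integral_cmult nn_integral_multc mult_ac)
      also have "\<dots> = ennreal c"
        using elim pos by (subst (1 2) nn_integral_qker) (auto simp: k'_def)
      finally show ?thesis .
    qed
    have up: "Kn (\<epsilon> n) (\<delta> n) (\<epsilon>' n) (\<delta>' n) u v z \<le> (\<integral>\<^sup>+a. \<integral>\<^sup>+b. ennreal (h + e / 2) * (ennreal (qker (\<delta> n) u a) * ennreal (qker (\<delta>' n) v b)) \<partial>lborel \<partial>lborel)"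
      unfolding Kn_def
    proof (intro nn_integral_mono)
      fix a b :: real
      have "qker (\<delta> n) u a * qker (\<delta>' n) v b * heat (\<bar>a - b\<bar> + \<epsilon> n + \<epsilon>' n) z
        \<le> (h + e / 2) * (qker (\<delta> n) u a * qker (\<delta>' n) v b)"
      proof (rule gen1[OF nq])
        assume "qker (\<delta> n) u a * qker (\<delta>' n) v b \<noteq> 0"
        then have "qker (\<delta> n) u a \<noteq> 0" "qker (\<delta>' n) v b \<noteq> 0" by auto
        from near[OF this] show "heat (\<bar>a - b\<bar> + \<epsilon> n + \<epsilon>' n) z \<le> h + e / 2" by linarith
      qed
      then show "ennreal (qker (\<delta> n) u a * qker (\<delta>' n) v b * heat (\<bar>a - b\<bar> + \<epsilon> n + \<epsilon>' n) z)
        \<le> ennreal (h + e / 2) * (ennreal (qker (\<delta> n) u a) * ennreal (qker (\<delta>' n) v b))"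
        unfolding em by (rule ennreal_leI)
    qed
    have low: "(\<integral>\<^sup>+a. \<integral>\<^sup>+b. ennreal (h - e / 2) * (ennreal (qker (\<delta> n) u a) * ennreal (qker (\<delta>' n) v b)) \<partial>lborel \<partial>lborel) \<le> Kn (\<epsilon> n) (\<delta> n) (\<epsilon>' n) (\<delta>' n) u v z"
      unfolding Kn_def
    proof (intro nn_integral_mono)
      fix a b :: real
      have "(h - e / 2) * (qker (\<delta> n) u a * qker (\<delta>' n) v b) \<le>
         qker (\<delta> n) u a * qker (\<delta>' n) v b * heat (\<bar>a - b\<bar> + \<epsilon> n + \<epsilon>' n) z"
      proof (rule gen2[OF nq])
        assume "qker (\<delta> n) u a * qker (\<delta>' n) v b \<noteq> 0"
        then have "qker (\<delta> n) u a \<noteq> 0" "qker (\<delta>' n) v b \<noteq> 0" by auto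
        from near[OF this] show "h - e / 2 \<le> heat (\<bar>a - b\<bar> + \<epsilon> n + \<epsilon>' n) z" by linarith
      qed
      then show "ennreal (h - e / 2) * (ennreal (qker (\<delta> n) u a) * ennreal (qker (\<delta>' n) v b)) \<le>
         ennreal (qker (\<delta> n) u a * qker (\<delta>' n) v b * heat (\<bar>a - b\<bar> + \<epsilon> n + \<epsilon>' n) z)"
        unfolding em by (rule ennreal_leI)
    qed
    show ?case
    proof (cases "Kn (\<epsilon> n) (\<delta> n) (\<epsilon>' n) (\<delta>' n) u v z")
      case (real r)
      have "r \<le> h + e / 2" using up h0 e unfolding tot real by (subst (asm) ennreal_le_iff) auto
      moreover have "h - e / 2 \<le> r"
        using low real(1) unfolding tot real(2) by (cases "h - e / 2 \<ge> 0") (simp_all add: ennreal_le_iff)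
      ultimately show ?thesis using real e by (simp add: h_def[symmetric] dist_real_def abs_less_iff)
    next
      case top
      then show ?thesis using up unfolding tot by (simp add: top_unique)
    qed
  qed
qed

subsection \<open>The inner product on nonnegative functions\<close>

definition hk :: "real \<times> real \<Rightarrow> real \<times> real \<Rightarrow> real" where
  "hk z w = indicator {0..} (fst z) * indicator {0..} (fst w) * heat \<bar>fst w - fst z\<bar> (snd z - snd w)"

lemma hk_nonneg [simp]: "0 \<le> hk z w"
  by (simp add: hk_def heat_nonneg)

lemma hk_commute: "hk z w = hk w z"
  by (simp add: hk_def mult.commute abs_minus_commute heat_commute[of _ "snd z"])

lemma hk_measurable [measurable]:
  assumes "f \<in> borel_measurable M" "g \<in> borel_measurable M"
  shows "(\<lambda>x. hk (f x) (g x)) \<in> borel_measurable M"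
proof -
  note [measurable] = assms[unfolded borel_prod[symmetric]]
  show ?thesis unfolding hk_def by measurable
qed

lemma hk_eq_0: "fst z < 0 \<Longrightarrow> hk z w = 0"
  by (simp add: hk_def)

text \<open>The inner product of H for nonnegative functions. Taken in \<open>ennreal\<close>, it
  permits interchange of integrals before finiteness is known.\<close>

definition HN :: "(real \<times> real \<Rightarrow> real) \<Rightarrow> (real \<times> real \<Rightarrow> real) \<Rightarrow> ennreal" where
  "HN f g = (\<integral>\<^sup>+z. \<integral>\<^sup>+w. ennreal (f z * g w * hk z w) \<partial>lborel \<partial>lborel)"

lemma Hset_integrand:
  "indicator Hset p *\<^sub>R (case p of ((s, x), (t, y)) \<Rightarrow> f (s, x) * g (t, y) * heat \<bar>t - s\<bar> (x - y))
    = f (fst p) * g (snd p) * hk (fst p) (snd p)"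
  by (cases p) (auto simp: Hset_def hk_def indicator_def)

lemma Hset_abs_integrand:
  "indicator Hset p *\<^sub>R (\<lambda>((s, x), (t, y)). \<bar>f (s, x)\<bar> * \<bar>f (t, y)\<bar> * heat \<bar>t - s\<bar> (x - y)) p
    = \<bar>f (fst p)\<bar> * \<bar>f (snd p)\<bar> * hk (fst p) (snd p)"
  by (cases p) (auto simp: Hset_def hk_def indicator_def)

lemma HN_pair:
  assumes [measurable]: "f \<in> borel_measurable borel" "g \<in> borel_measurable borel"
  shows "HN f g = (\<integral>\<^sup>+p. ennreal (f (fst p) * g (snd p) * hk (fst p) (snd p)) \<partial>(lborel \<Otimes>\<^sub>M lborel))"
  unfolding HN_def by (subst lborel.nn_integral_fst[symmetric]) auto

lemma Hinner_HN:
  assumes [measurable]: "f \<in> borel_measurable borel" "g \<in> borel_measurable borel"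
    and "\<And>z. 0 \<le> f z" "\<And>z. 0 \<le> g z"
  shows "Hinner f g = enn2real (HN f g)"
  unfolding Hinner_def set_lebesgue_integral_def Hset_integrand HN_pair[OF assms(1,2)]
  by (rule integral_eq_nn_integral) (use assms in auto)

lemma Hdom_HN:
  assumes [measurable]: "f \<in> borel_measurable borel" and "HN (\<lambda>z. \<bar>f z\<bar>) (\<lambda>z. \<bar>f z\<bar>) < \<infinity>"
  shows "Hdom f"
  unfolding Hdom_def set_integrable_def Hset_abs_integrand
proof (intro conjI integrableI_nonneg)
  show "(\<integral>\<^sup>+p. ennreal (\<bar>f (fst p)\<bar> * \<bar>f (snd p)\<bar> * hk (fst p) (snd p)) \<partial>(lborel \<Otimes>\<^sub>M lborel)) < \<infinity>"
    using assms(2) by (subst (asm) HN_pair) auto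
qed auto

lemma Hdom_measurable: "Hdom f \<Longrightarrow> f \<in> borel_measurable borel"
  by (simp add: Hdom_def)

lemma HN_finite:
  assumes "Hdom f"
  shows "HN (\<lambda>z. \<bar>f z\<bar>) (\<lambda>z. \<bar>f z\<bar>) < \<infinity>"
proof -
  note [measurable] = Hdom_measurable[OF assms]
  have "integrable (lborel \<Otimes>\<^sub>M lborel) (\<lambda>p. \<bar>f (fst p)\<bar> * \<bar>f (snd p)\<bar> * hk (fst p) (snd p))"
    using assms unfolding Hdom_def set_integrable_def Hset_abs_integrand by simp
  then have "(\<integral>\<^sup>+p. ennreal (norm (\<bar>f (fst p)\<bar> * \<bar>f (snd p)\<bar> * hk (fst p) (snd p))) \<partial>(lborel \<Otimes>\<^sub>M lborel)) < \<infinity>"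
    by (simp add: integrable_iff_bounded)
  then show ?thesis by (subst HN_pair) (auto simp: abs_mult)
qed

lemma HN_commute:
  assumes [measurable]: "f \<in> borel_measurable borel" "g \<in> borel_measurable borel"
  shows "HN f g = HN g f"
  unfolding HN_def
  by (subst lborel_pair.Fubini') (auto intro!: nn_integral_cong simp: hk_commute mult_ac)

lemma HN_cmult:
  assumes [measurable]: "f \<in> borel_measurable borel" "g \<in> borel_measurable borel"
    and "0 \<le> c"
  shows "HN (\<lambda>z. c * f z) g = ennreal c * HN f g"
proof -
  have "HN (\<lambda>z. c * f z) g = (\<integral>\<^sup>+z. \<integral>\<^sup>+w. ennreal c * ennreal (f z * g w * hk z w) \<partial>lborel \<partial>lborel)"
    unfolding HN_def using assms(3) by (simp add: ennreal_mult'[symmetric] mult.assoc)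
  then show ?thesis unfolding HN_def by (simp add: nn_integral_cmult)
qed

lemma HN_mono: "(\<And>z. 0 \<le> f z \<and> f z \<le> f' z) \<Longrightarrow> (\<And>z. 0 \<le> g z \<and> g z \<le> g' z) \<Longrightarrow> HN f g \<le> HN f' g'"
  unfolding HN_def
proof (intro nn_integral_mono ennreal_leI)
  fix z w
  assume f: "\<And>z. 0 \<le> f z \<and> f z \<le> f' z" and g: "\<And>z. 0 \<le> g z \<and> g z \<le> g' z"
  have "0 \<le> f' z" "0 \<le> g' w" using f[of z] g[of w] by auto
  then show "f z * g w * hk z w \<le> f' z * g' w * hk z w"
    using f[of z] g[of w] by (intro mult_mono) auto
qed

text \<open>Tonelli in the first argument. The representation is asked for at nonnegative times
  only, because \<open>hk\<close> vanishes elsewhere; for \<open>Apath\<close> it would fail at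
  negative times.\<close>

lemma HN_superpose:
  assumes "sigma_finite_measure N"
    and f[measurable]: "f \<in> borel_measurable borel" and g[measurable]: "g \<in> borel_measurable borel"
    and \<phi>[measurable]: "(\<lambda>(r, z). \<phi> r z) \<in> borel_measurable (N \<Otimes>\<^sub>M borel)"
    and pos: "\<And>z. 0 \<le> f z" "\<And>z. 0 \<le> g z" "\<And>r z. 0 \<le> \<phi> r z"
    and f_eq: "\<And>z. 0 \<le> fst z \<Longrightarrow> ennreal (f z) = (\<integral>\<^sup>+r. ennreal (\<phi> r z) \<partial>N)"
  shows "HN f g = (\<integral>\<^sup>+r. HN (\<phi> r) g \<partial>N)"
proof -
  interpret N: sigma_finite_measure N by fact
  interpret P: pair_sigma_finite N lborel ..
  have "HN f g = (\<integral>\<^sup>+z. \<integral>\<^sup>+w. \<integral>\<^sup>+r. ennreal (\<phi> r z * g w * hk z w) \<partial>N \<partial>lborel \<partial>lborel)"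
    unfolding HN_def
  proof (intro nn_integral_cong)
    fix z w
    show "ennreal (f z * g w * hk z w) = (\<integral>\<^sup>+r. ennreal (\<phi> r z * g w * hk z w) \<partial>N)"
    proof (cases "0 \<le> fst z")
      case True
      have "ennreal (f z * g w * hk z w) = ennreal (f z) * ennreal (g w * hk z w)"
        using pos by (simp add: ennreal_mult'[symmetric] mult.assoc)
      also have "\<dots> = (\<integral>\<^sup>+r. ennreal (\<phi> r z) * ennreal (g w * hk z w) \<partial>N)"
        unfolding f_eq[OF True] by (rule nn_integral_multc[symmetric]) measurable
      finally show ?thesis using pos by (simp add: ennreal_mult'[symmetric] mult.assoc)
    qed (simp add: hk_eq_0)
  qed
  also have "\<dots> = (\<integral>\<^sup>+z. \<integral>\<^sup>+r. \<integral>\<^sup>+w. ennreal (\<phi> r z * g w * hk z w) \<partial>lborel \<partial>N \<partial>lborel)"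
    by (intro nn_integral_cong P.Fubini') measurable
  also have "\<dots> = (\<integral>\<^sup>+r. \<integral>\<^sup>+z. \<integral>\<^sup>+w. ennreal (\<phi> r z * g w * hk z w) \<partial>lborel \<partial>lborel \<partial>N)"
    by (intro P.Fubini') measurable
  finally show ?thesis by (simp add: HN_def)
qed

lemma nn_integral_lborel_pair:
  assumes [measurable]: "f \<in> borel_measurable borel"
  shows "(\<integral>\<^sup>+z. f z \<partial>(lborel :: (real \<times> real) measure)) = (\<integral>\<^sup>+a. \<integral>\<^sup>+y. f (a, y) \<partial>lborel \<partial>lborel)"
proof -
  have [measurable]: "f \<in> borel_measurable (lborel \<Otimes>\<^sub>M lborel)" using assms by (simp add: lborel_prod)
  show ?thesis unfolding lborel_prod[symmetric] by (subst lborel.nn_integral_fst[symmetric]) auto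
qed

lemma phi_ed_qker: "phi_ed \<epsilon> \<delta> u x z = qker \<delta> u (fst z) * heat \<epsilon> (x - snd z)"
  by (cases z) (simp add: phi_ed_def qker_def)

lemma phi_ed_nonneg: "0 < \<epsilon> \<Longrightarrow> 0 < \<delta> \<Longrightarrow> 0 \<le> phi_ed \<epsilon> \<delta> u x z"
  by (simp add: phi_ed_qker qker_nonneg heat_nonneg)

lemma phi_ed_measurable [measurable]:
  assumes [measurable]: "f \<in> borel_measurable M" "g \<in> borel_measurable M" and h: "h \<in> borel_measurable M"
  shows "(\<lambda>x. phi_ed \<epsilon> \<delta> (f x) (g x) (h x)) \<in> borel_measurable M"
proof -
  note [measurable] = h[unfolded borel_prod[symmetric]]
  show ?thesis unfolding phi_ed_qker by measurable
qed

text \<open>With time and space separated, the space integral is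
  \<open>nn_integral_heat_triple\<close>. That formula wants \<open>a \<noteq> b\<close>, which
  holds for almost every \<open>b\<close>.\<close>

lemma HN_phi_phi:
  assumes e: "0 < \<epsilon>" "0 < \<delta>" "0 < \<epsilon>'" "0 < \<delta>'"
  shows "HN (phi_ed \<epsilon> \<delta> u x) (phi_ed \<epsilon>' \<delta>' v x') = Kn \<epsilon> \<delta> \<epsilon>' \<delta>' u v (x - x')"
proof -
  let ?F = "\<lambda>a y b y'. ennreal (phi_ed \<epsilon> \<delta> u x (a, y) * phi_ed \<epsilon>' \<delta>' v x' (b, y') * hk (a, y) (b, y'))"
  have "HN (phi_ed \<epsilon> \<delta> u x) (phi_ed \<epsilon>' \<delta>' v x')
    = (\<integral>\<^sup>+a. \<integral>\<^sup>+y. \<integral>\<^sup>+b. \<integral>\<^sup>+y'. ?F a y b y' \<partial>lborel \<partial>lborel \<partial>lborel \<partial>lborel)"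
    unfolding HN_def by (simp add: nn_integral_lborel_pair)
  also have "\<dots> = (\<integral>\<^sup>+a. \<integral>\<^sup>+b. \<integral>\<^sup>+y. \<integral>\<^sup>+y'. ?F a y b y' \<partial>lborel \<partial>lborel \<partial>lborel \<partial>lborel)"
    by (intro nn_integral_cong lborel_pair.Fubini') measurable
  also have "\<dots> = Kn \<epsilon> \<delta> \<epsilon>' \<delta>' u v (x - x')"
    unfolding Kn_def
  proof (rule nn_integral_cong)
    fix a :: real
    show "(\<integral>\<^sup>+b. \<integral>\<^sup>+y. \<integral>\<^sup>+y'. ?F a y b y' \<partial>lborel \<partial>lborel \<partial>lborel)
      = (\<integral>\<^sup>+b. ennreal (qker \<delta> u a * qker \<delta>' v b * heat (\<bar>a - b\<bar> + \<epsilon> + \<epsilon>') (x - x')) \<partial>lborel)"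
    proof (rule nn_integral_cong_AE)
      show "AE b in lborel. (\<integral>\<^sup>+y. \<integral>\<^sup>+y'. ?F a y b y' \<partial>lborel \<partial>lborel)
        = ennreal (qker \<delta> u a * qker \<delta>' v b * heat (\<bar>a - b\<bar> + \<epsilon> + \<epsilon>') (x - x'))"
        using AE_lborel_singleton[of a]
      proof eventually_elim
        case (elim b)
        have q: "0 \<le> qker \<delta> u a * qker \<delta>' v b" using e by (simp add: qker_nonneg)
        have ind: "qker \<delta> u a = qker \<delta> u a * indicator {0..} a" "qker \<delta>' v b = qker \<delta>' v b * indicator {0..} b"
          by (auto simp: qker_def indicator_def)
        have F: "?F a y b y' = ennreal (qker \<delta> u a * qker \<delta>' v b)
            * ennreal (heat \<epsilon> (x - y) * heat \<epsilon>' (x' - y') * heat \<bar>a - b\<bar> (y - y'))" for y y'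
        proof -
          have "phi_ed \<epsilon> \<delta> u x (a, y) * phi_ed \<epsilon>' \<delta>' v x' (b, y') * hk (a, y) (b, y')
             = (qker \<delta> u a * indicator {0..} a) * (qker \<delta>' v b * indicator {0..} b)
               * (heat \<epsilon> (x - y) * heat \<epsilon>' (x' - y') * heat \<bar>a - b\<bar> (y - y'))"
            by (simp add: phi_ed_qker hk_def abs_minus_commute mult_ac)
          then show ?thesis unfolding ind[symmetric] using q by (simp add: ennreal_mult')
        qed
        have "(\<integral>\<^sup>+y. \<integral>\<^sup>+y'. ?F a y b y' \<partial>lborel \<partial>lborel) = ennreal (qker \<delta> u a * qker \<delta>' v b) *
           (\<integral>\<^sup>+y. \<integral>\<^sup>+y'. ennreal (heat \<epsilon> (x - y) * heat \<epsilon>' (x' - y') * heat \<bar>a - b\<bar> (y - y')) \<partial>lborel \<partial>lborel)"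
          unfolding F by (simp add: nn_integral_cmult)
        also have "\<dots> = ennreal (qker \<delta> u a * qker \<delta>' v b) * ennreal (heat (\<bar>a - b\<bar> + \<epsilon> + \<epsilon>') (x - x'))"
          using elim e by (subst nn_integral_heat_triple) auto
        finally show ?case using q by (simp add: ennreal_mult')
      qed
    qed
  qed
  finally show ?thesis .
qed

lemma Hdom_phi:
  assumes e: "0 < \<epsilon>" "0 < \<delta>"
  shows "Hdom (phi_ed \<epsilon> \<delta> u x)"
proof (rule Hdom_HN)
  show "HN (\<lambda>z. \<bar>phi_ed \<epsilon> \<delta> u x z\<bar>) (\<lambda>z. \<bar>phi_ed \<epsilon> \<delta> u x z\<bar>) < \<infinity>"
    using Kn_le_eps[of \<delta> \<delta> \<epsilon> \<epsilon> u u 0] e phi_ed_nonneg[OF e, of u x]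
    by (simp add: HN_phi_phi) (meson ennreal_less_top le_less_trans)
qed measurable

subsection \<open>The kernel attached to a path\<close>

text \<open>\<open>Aed\<close> with the random path replaced by an arbitrary function \<xi>, so that
  the Gaussian computations concern a deterministic path.\<close>

definition Apath :: "(real \<Rightarrow> real) \<Rightarrow> real \<Rightarrow> real \<Rightarrow> real \<Rightarrow> real \<Rightarrow> real \<times> real \<Rightarrow> real" where
  "Apath \<xi> \<epsilon> \<delta> t x = (\<lambda>(r, y). \<integral>s\<in>{0..t}. psi \<delta> (t - s - r) * heat \<epsilon> (\<xi> s + x - y) \<partial>lborel)"

lemma psi_nonneg: "0 < \<delta> \<Longrightarrow> 0 \<le> psi \<delta> r"
  by (simp add: psi_def)

lemma psi_measurable [measurable]:
  assumes [measurable]: "f \<in> borel_measurable M"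
  shows "(\<lambda>x. psi \<delta> (f x)) \<in> borel_measurable M"
proof -
  have "psi \<delta> r = (if 0 \<le> r \<and> r \<le> \<delta> then 1 / \<delta> else 0)" for r
    by (simp add: psi_def indicator_def)
  then show ?thesis by simp
qed

context
  fixes \<xi> :: "real \<Rightarrow> real" and \<epsilon> \<delta> t x :: real
  assumes \<xi>[measurable]: "\<xi> \<in> borel_measurable borel" and e: "0 < \<epsilon>" "0 < \<delta>"
begin

lemma Apath_nonneg: "0 \<le> Apath \<xi> \<epsilon> \<delta> t x z"
  unfolding Apath_def set_lebesgue_integral_def using e
  by (cases z) (auto intro!: Bochner_Integration.integral_nonneg mult_nonneg_nonneg heat_nonneg psi_nonneg)

lemma Apath_measurable [measurable]: "Apath \<xi> \<epsilon> \<delta> t x \<in> borel_measurable borel"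
  unfolding Apath_def set_lebesgue_integral_def borel_prod[symmetric] by measurable

text \<open>At nonnegative times the support of \<open>psi\<close> already implies the cut contained
  in \<open>phi_ed\<close>. The kernel is thus a superposition of noise kernels at the space-time
  points \<open>(t - s, \<xi> s + x)\<close>.\<close>

lemma Apath_superpose:
  assumes "0 \<le> fst z"
  shows "ennreal (Apath \<xi> \<epsilon> \<delta> t x z) = (\<integral>\<^sup>+s. ennreal (indicator {0..t} s * phi_ed \<epsilon> \<delta> (t - s) (\<xi> s + x) z) \<partial>lborel)"
proof -
  obtain r y where z: "z = (r, y)" by (cases z)
  have r: "0 \<le> r" using assms z by simp
  have eq: "indicator {0..t} s *\<^sub>R (psi \<delta> (t - s - r) * heat \<epsilon> (\<xi> s + x - y))
    = indicator {0..t} s * phi_ed \<epsilon> \<delta> (t - s) (\<xi> s + x) z" for s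
    using r by (auto simp: z phi_ed_def psi_def indicator_def)
  have "Apath \<xi> \<epsilon> \<delta> t x z = (\<integral>s. indicator {0..t} s * phi_ed \<epsilon> \<delta> (t - s) (\<xi> s + x) z \<partial>lborel)"
    unfolding Apath_def set_lebesgue_integral_def z
    by (simp only: case_prod_conv eq[unfolded z])
  moreover have "integrable lborel (\<lambda>s. indicator {0..t} s * phi_ed \<epsilon> \<delta> (t - s) (\<xi> s + x) z)"
  proof (rule Bochner_Integration.integrable_bound)
    show "integrable lborel (\<lambda>s. indicator {0..t} s * (isq \<epsilon> / \<delta>))"
      by (intro integrable_mult_left integrable_real_indicator) (auto simp: emeasure_lborel_Icc_eq)
    show "AE s in lborel. norm (indicator {0..t} s * phi_ed \<epsilon> \<delta> (t - s) (\<xi> s + x) z) \<le> norm (indicator {0..t} s * (isq \<epsilon> / \<delta>))"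
    proof (rule AE_I2)
      fix s
      have "qker \<delta> (t - s) r * heat \<epsilon> (\<xi> s + x - y) \<le> (1 / \<delta>) * isq \<epsilon>"
        using e by (intro mult_mono heat_le_isq heat_nonneg) (auto simp: qker_def psi_def indicator_def)
      then show "norm (indicator {0..t} s * phi_ed \<epsilon> \<delta> (t - s) (\<xi> s + x) z) \<le> norm (indicator {0..t} s * (isq \<epsilon> / \<delta>))"
        using e phi_ed_nonneg[OF e, of "t - s" "\<xi> s + x" z] by (auto simp: indicator_def z phi_ed_qker)
    qed
  qed measurable
  ultimately show ?thesis
    using phi_ed_nonneg[OF e] by (subst nn_integral_eq_integral) auto
qed

lemma HN_Apath:
  assumes g[measurable]: "g \<in> borel_measurable borel" and pos: "\<And>z. 0 \<le> g z"
  shows "HN (Apath \<xi> \<epsilon> \<delta> t x) g = (\<integral>\<^sup>+s. ennreal (indicator {0..t} s) * HN (phi_ed \<epsilon> \<delta> (t - s) (\<xi> s + x)) g \<partial>lborel)"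
proof -
  have "HN (Apath \<xi> \<epsilon> \<delta> t x) g = (\<integral>\<^sup>+s. HN (\<lambda>z. indicator {0..t} s * phi_ed \<epsilon> \<delta> (t - s) (\<xi> s + x) z) g \<partial>lborel)"
    by (rule HN_superpose) (use phi_ed_nonneg[OF e] pos Apath_nonneg in
      \<open>auto simp: Apath_superpose lborel.sigma_finite_measure_axioms\<close>)
  then show ?thesis by (simp add: HN_cmult)
qed

end

lemma HN_Apath_phi:
  assumes "\<xi> \<in> borel_measurable borel" "0 < \<epsilon>" "0 < \<delta>" "0 < \<epsilon>'" "0 < \<delta>'"
  shows "HN (Apath \<xi> \<epsilon> \<delta> t x) (phi_ed \<epsilon>' \<delta>' v y)
    = (\<integral>\<^sup>+s. ennreal (indicator {0..t} s) * Kn \<epsilon> \<delta> \<epsilon>' \<delta>' (t - s) v (\<xi> s + x - y) \<partial>lborel)"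
  using assms by (simp add: HN_Apath phi_ed_nonneg HN_phi_phi)

lemma HN_Apath_Apath:
  assumes [measurable]: "\<xi> \<in> borel_measurable borel" "\<xi>' \<in> borel_measurable borel"
    and e: "0 < \<epsilon>" "0 < \<delta>" "0 < \<epsilon>'" "0 < \<delta>'"
  shows "HN (Apath \<xi> \<epsilon> \<delta> t x) (Apath \<xi>' \<epsilon>' \<delta>' t' x')
    = (\<integral>\<^sup>+s. ennreal (indicator {0..t} s) * (\<integral>\<^sup>+r. ennreal (indicator {0..t'} r) *
        Kn \<epsilon> \<delta> \<epsilon>' \<delta>' (t - s) (t' - r) ((\<xi> s + x) - (\<xi>' r + x')) \<partial>lborel) \<partial>lborel)"
proof -
  have Kn_commute: "Kn \<epsilon>' \<delta>' \<epsilon> \<delta> v u z = Kn \<epsilon> \<delta> \<epsilon>' \<delta>' u v (- z)" for u v z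
    using HN_commute[of "phi_ed \<epsilon>' \<delta>' v z" "phi_ed \<epsilon> \<delta> u 0"] e by (simp add: HN_phi_phi)
  have "HN (phi_ed \<epsilon> \<delta> u y) (Apath \<xi>' \<epsilon>' \<delta>' t' x')
    = (\<integral>\<^sup>+r. ennreal (indicator {0..t'} r) * Kn \<epsilon> \<delta> \<epsilon>' \<delta>' u (t' - r) (y - (\<xi>' r + x')) \<partial>lborel)" for u y
    using e by (subst HN_commute) (auto simp: HN_Apath_phi Kn_commute)
  then show ?thesis using e by (simp add: HN_Apath Apath_nonneg)
qed

lemma HN_Apath_Apath_le:
  assumes [measurable]: "\<xi> \<in> borel_measurable borel" "\<xi>' \<in> borel_measurable borel"
    and e: "0 < \<epsilon>" "0 < \<delta>" "0 < \<epsilon>'" "0 < \<delta>'" and t: "0 \<le> t" "0 \<le> t'"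
  shows "HN (Apath \<xi> \<epsilon> \<delta> t x) (Apath \<xi>' \<epsilon>' \<delta>' t' x') \<le> ennreal (t * t' * isq \<epsilon>)"
proof -
  have "HN (Apath \<xi> \<epsilon> \<delta> t x) (Apath \<xi>' \<epsilon>' \<delta>' t' x')
    \<le> (\<integral>\<^sup>+s. ennreal (indicator {0..t} s) * (\<integral>\<^sup>+r. ennreal (indicator {0..t'} r) * ennreal (isq \<epsilon>) \<partial>lborel) \<partial>lborel)"
    unfolding HN_Apath_Apath[OF assms(1-6)]
    by (intro nn_integral_mono mult_left_mono Kn_le_eps e) auto
  also have "\<dots> = ennreal (t * t' * isq \<epsilon>)"
  proof -
    have *: "(\<integral>\<^sup>+s. ennreal (indicator {0..u} s) * c \<partial>lborel) = ennreal u * c" if "0 \<le> u" for u :: real and c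
      using that by (subst nn_integral_multc) (auto simp: ennreal_indicator)
    show ?thesis unfolding *[OF t(1)] *[OF t(2)] using t by (simp add: ennreal_mult'[symmetric] mult_ac)
  qed
  finally show ?thesis .
qed

lemma Hdom_Apath:
  assumes [measurable]: "\<xi> \<in> borel_measurable borel" and e: "0 < \<epsilon>" "0 < \<delta>" and t: "0 \<le> t"
  shows "Hdom (Apath \<xi> \<epsilon> \<delta> t x)"
proof (rule Hdom_HN)
  show "HN (\<lambda>z. \<bar>Apath \<xi> \<epsilon> \<delta> t x z\<bar>) (\<lambda>z. \<bar>Apath \<xi> \<epsilon> \<delta> t x z\<bar>) < \<infinity>"
    using HN_Apath_Apath_le[of \<xi> \<xi> \<epsilon> \<delta> \<epsilon> \<delta> t t x x] e t Apath_nonneg[of \<xi> \<epsilon> \<delta> t x]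
    by simp (meson ennreal_less_top le_less_trans)
qed (use e in measurable)

subsection \<open>Interchanging path integrals and expectations\<close>

lemma sqi_nn_integral:
  assumes [measurable]: "f \<in> borel_measurable M" and "(\<integral>\<^sup>+\<omega>. ennreal ((f \<omega>)\<^sup>2) \<partial>M) < \<infinity>"
  shows "sqi M f"
  unfolding sqi_def using assms by (auto intro!: integrableI_nonneg)

lemma nn_integral_sqi: "sqi M f \<Longrightarrow> (\<integral>\<^sup>+\<omega>. ennreal ((f \<omega>)\<^sup>2) \<partial>M) = ennreal (\<integral>\<omega>. (f \<omega>)\<^sup>2 \<partial>M)"
  unfolding sqi_def by (intro nn_integral_eq_integral) auto

context
  fixes N :: "'c measure" and P :: "'b measure" and V :: "'c \<Rightarrow> 'b \<Rightarrow> real" and C :: real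
  assumes N: "finite_measure N" and P: "prob_space P"
    and V[measurable]: "(\<lambda>(n, \<omega>). V n \<omega>) \<in> borel_measurable (N \<Otimes>\<^sub>M P)"
    and bound: "AE n in N. (\<integral>\<^sup>+\<omega>. ennreal ((V n \<omega>)\<^sup>2) \<partial>P) \<le> ennreal C"
begin

interpretation N: finite_measure N by (rule N)
interpretation P: prob_space P by (rule P)
interpretation NP: pair_sigma_finite N P ..

private lemma N_finite: "emeasure N (space N) < \<top>"
  using N.emeasure_finite[of "space N"] unfolding infinity_ennreal_def less_top .

text \<open>The bounded second moments and the finite mass of \<open>N\<close> make \<open>V\<close>
  square integrable on the product; the other Fubini statements of this block rest on this.\<close>

lemma sfubini_total: "(\<integral>\<^sup>+\<omega>. \<integral>\<^sup>+n. ennreal ((V n \<omega>)\<^sup>2) \<partial>N \<partial>P) < \<infinity>"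
proof -
  have "(\<integral>\<^sup>+\<omega>. \<integral>\<^sup>+n. ennreal ((V n \<omega>)\<^sup>2) \<partial>N \<partial>P) = (\<integral>\<^sup>+n. \<integral>\<^sup>+\<omega>. ennreal ((V n \<omega>)\<^sup>2) \<partial>P \<partial>N)"
    by (rule NP.Fubini') measurable
  also have "\<dots> \<le> (\<integral>\<^sup>+n. ennreal C \<partial>N)"
    by (rule nn_integral_mono_AE[OF bound])
  also have "\<dots> < \<infinity>"
    using N_finite by (simp add: ennreal_mult_less_top)
  finally show ?thesis .
qed

lemma sfubini_sqi: "AE \<omega> in P. sqi N (\<lambda>n. V n \<omega>)"
proof -
  have "AE \<omega> in P. (\<integral>\<^sup>+n. ennreal ((V n \<omega>)\<^sup>2) \<partial>N) \<noteq> \<infinity>"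
    by (rule nn_integral_PInf_AE) (use sfubini_total in auto)
  then show ?thesis
    by (rule AE_mp) (auto intro!: AE_I2 sqi_nn_integral simp: less_top)
qed

lemma sfubini_integrable: "AE \<omega> in P. integrable N (\<lambda>n. V n \<omega>)"
  using sfubini_sqi by eventually_elim (rule N.sqi_integrable)

lemma sfubini_sqi_integral: "sqi P (\<lambda>\<omega>. \<integral>n. V n \<omega> \<partial>N)"
proof (rule sqi_nn_integral)
  show m: "(\<lambda>\<omega>. \<integral>n. V n \<omega> \<partial>N) \<in> borel_measurable P" by measurable
  have "(\<integral>\<^sup>+\<omega>. ennreal ((\<integral>n. V n \<omega> \<partial>N)\<^sup>2) \<partial>P) \<le> (\<integral>\<^sup>+\<omega>. ennreal (measure N (space N)) * (\<integral>\<^sup>+n. ennreal ((V n \<omega>)\<^sup>2) \<partial>N) \<partial>P)"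
  proof (rule nn_integral_mono_AE, use sfubini_sqi in eventually_elim)
    case (elim \<omega>)
    have "\<bar>\<integral>n. V n \<omega> * 1 \<partial>N\<bar> \<le> sqrt (\<integral>n. (V n \<omega>)\<^sup>2 \<partial>N) * sqrt (\<integral>n. 1\<^sup>2 \<partial>N)"
      by (rule sqi_Cauchy_Schwarz[OF elim]) (simp add: sqi_def)
    then have "\<bar>\<integral>n. V n \<omega> \<partial>N\<bar>\<^sup>2 \<le> (sqrt (\<integral>n. (V n \<omega>)\<^sup>2 \<partial>N) * sqrt (measure N (space N)))\<^sup>2"
      by (intro power_mono) auto
    then have "(\<integral>n. V n \<omega> \<partial>N)\<^sup>2 \<le> measure N (space N) * (\<integral>n. (V n \<omega>)\<^sup>2 \<partial>N)"
      by (simp add: power_mult_distrib mult.commute)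
    then have "ennreal ((\<integral>n. V n \<omega> \<partial>N)\<^sup>2) \<le> ennreal (measure N (space N)) * ennreal (\<integral>n. (V n \<omega>)\<^sup>2 \<partial>N)"
      by (simp add: ennreal_mult'[symmetric] ennreal_leI)
    then show ?case by (simp add: nn_integral_sqi[OF elim])
  qed
  also have "\<dots> < \<infinity>"
    using sfubini_total by (subst nn_integral_cmult) (auto simp: ennreal_mult_less_top)
  finally show "(\<integral>\<^sup>+\<omega>. ennreal ((\<integral>n. V n \<omega> \<partial>N)\<^sup>2) \<partial>P) < \<infinity>" .
qed

text \<open>The product is dominated by \<open>V^2 + Y^2\<close>, whose integral is finite. Testing
  against a square-integrable \<open>Y\<close> is the form in which covariances of path integrals
  are computed.\<close>

lemma sfubini_mult:
  assumes Y: "sqi P Y"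
  shows "(\<integral>\<omega>. (\<integral>n. V n \<omega> \<partial>N) * Y \<omega> \<partial>P) = (\<integral>n. (\<integral>\<omega>. V n \<omega> * Y \<omega> \<partial>P) \<partial>N)"
proof -
  note [measurable] = sqi_measurable[OF Y]
  have i: "integrable (N \<Otimes>\<^sub>M P) (\<lambda>(n, \<omega>). V n \<omega> * Y \<omega>)"
  proof (rule integrableI_bounded)
    have "(\<integral>\<^sup>+p. ennreal (norm (case p of (n, \<omega>) \<Rightarrow> V n \<omega> * Y \<omega>)) \<partial>(N \<Otimes>\<^sub>M P))
      = (\<integral>\<^sup>+\<omega>. \<integral>\<^sup>+n. ennreal \<bar>V n \<omega> * Y \<omega>\<bar> \<partial>N \<partial>P)"
      by (subst NP.nn_integral_snd[symmetric]) auto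
    also have "\<dots> \<le> (\<integral>\<^sup>+\<omega>. \<integral>\<^sup>+n. ennreal ((V n \<omega>)\<^sup>2) + ennreal ((Y \<omega>)\<^sup>2) \<partial>N \<partial>P)"
    proof (intro nn_integral_mono)
      fix \<omega> n
      have "\<bar>a * b\<bar> \<le> a\<^sup>2 + b\<^sup>2" for a b :: real
      proof -
        have "0 \<le> (\<bar>a\<bar> - \<bar>b\<bar>)\<^sup>2" by simp
        then have "2 * \<bar>a * b\<bar> \<le> a\<^sup>2 + b\<^sup>2" by (simp add: power2_diff abs_mult)
        then show ?thesis by linarith
      qed
      then show "ennreal \<bar>V n \<omega> * Y \<omega>\<bar> \<le> ennreal ((V n \<omega>)\<^sup>2) + ennreal ((Y \<omega>)\<^sup>2)"
        by (simp flip: ennreal_plus)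
    qed
    also have "\<dots> = (\<integral>\<^sup>+\<omega>. \<integral>\<^sup>+n. ennreal ((V n \<omega>)\<^sup>2) \<partial>N \<partial>P) + (\<integral>\<^sup>+\<omega>. ennreal ((Y \<omega>)\<^sup>2) \<partial>P) * emeasure N (space N)"
    proof -
      have "(\<integral>\<^sup>+n. ennreal ((V n \<omega>)\<^sup>2) + ennreal ((Y \<omega>)\<^sup>2) \<partial>N)
        = (\<integral>\<^sup>+n. ennreal ((V n \<omega>)\<^sup>2) \<partial>N) + ennreal ((Y \<omega>)\<^sup>2) * emeasure N (space N)" if [measurable]: "\<omega> \<in> space P" for \<omega>
        by (subst nn_integral_add) auto
      then have "(\<integral>\<^sup>+\<omega>. \<integral>\<^sup>+n. ennreal ((V n \<omega>)\<^sup>2) + ennreal ((Y \<omega>)\<^sup>2) \<partial>N \<partial>P)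
        = (\<integral>\<^sup>+\<omega>. (\<integral>\<^sup>+n. ennreal ((V n \<omega>)\<^sup>2) \<partial>N) + ennreal ((Y \<omega>)\<^sup>2) * emeasure N (space N) \<partial>P)"
        by (intro nn_integral_cong)
      then show ?thesis by (simp add: nn_integral_add nn_integral_multc)
    qed
    also have "\<dots> < \<infinity>"
      using sfubini_total N_finite
      by (simp add: nn_integral_sqi[OF Y] ennreal_mult_less_top)
    finally show "(\<integral>\<^sup>+p. ennreal (norm (case p of (n, \<omega>) \<Rightarrow> V n \<omega> * Y \<omega>)) \<partial>(N \<Otimes>\<^sub>M P)) < \<infinity>" .
  qed measurable
  have "(\<integral>\<omega>. (\<integral>n. V n \<omega> \<partial>N) * Y \<omega> \<partial>P) = (\<integral>\<omega>. (\<integral>n. V n \<omega> * Y \<omega> \<partial>N) \<partial>P)"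
    by simp
  also have "\<dots> = (\<integral>n. (\<integral>\<omega>. V n \<omega> * Y \<omega> \<partial>P) \<partial>N)"
    by (rule NP.Fubini_integral[OF i])
  finally show ?thesis .
qed

end

subsection \<open>The regularised noise along a path\<close>

text \<open>Lebesgue measure on \<open>[0, t]\<close>, kept as a finite measure on the whole line,
  so that constants are integrable and the preceding Fubini lemmas apply.\<close>

definition seg :: "real \<Rightarrow> real measure" where
  "seg t = density lborel (\<lambda>s. ennreal (indicator {0..t} s))"

lemma sets_seg [simp, measurable_cong]: "sets (seg t) = sets borel"
  by (simp add: seg_def)

lemma space_seg [simp]: "space (seg t) = UNIV"
  by (simp add: seg_def)

lemma AE_seg: "AE s in seg t. 0 \<le> s \<and> s \<le> t"
  unfolding seg_def by (subst AE_density) (auto simp: indicator_def)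

lemma AE_segI: "AE s in lborel. 0 \<le> s \<longrightarrow> s \<le> t \<longrightarrow> Q s \<Longrightarrow> AE s in seg t. Q s"
  unfolding seg_def by (subst AE_density) (auto simp: indicator_def elim!: AE_mp)

lemma nn_integral_seg:
  "f \<in> borel_measurable borel \<Longrightarrow> (\<integral>\<^sup>+s. f s \<partial>seg t) = (\<integral>\<^sup>+s. ennreal (indicator {0..t} s) * f s \<partial>lborel)"
  unfolding seg_def by (subst nn_integral_density) auto

lemma integral_seg:
  fixes f :: "real \<Rightarrow> real"
  shows "f \<in> borel_measurable borel \<Longrightarrow> (\<integral>s. f s \<partial>seg t) = (\<integral>s\<in>{0..t}. f s \<partial>lborel)"
  unfolding seg_def set_lebesgue_integral_def by (subst integral_density) auto

lemma finite_measure_seg: "finite_measure (seg t)"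
proof
  show "emeasure (seg t) (space (seg t)) \<noteq> \<infinity>"
    unfolding seg_def by (simp add: emeasure_density ennreal_indicator emeasure_lborel_Icc_eq)
qed

lemma nn_integral_seg_const: "0 \<le> t \<Longrightarrow> (\<integral>\<^sup>+s. c \<partial>seg t) = ennreal t * c"
  by (subst nn_integral_seg) (auto simp: nn_integral_multc ennreal_indicator)

lemma integral_enn2real:
  assumes [measurable]: "k \<in> borel_measurable M" and "(\<integral>\<^sup>+s. k s \<partial>M) < \<infinity>"
  shows "(\<integral>s. enn2real (k s) \<partial>M) = enn2real (\<integral>\<^sup>+s. k s \<partial>M)"
proof -
  have "AE s in M. k s \<noteq> \<infinity>" by (rule nn_integral_PInf_AE) (use assms in auto)
  then have "(\<integral>\<^sup>+s. ennreal (enn2real (k s)) \<partial>M) = (\<integral>\<^sup>+s. k s \<partial>M)"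
    by (intro nn_integral_cong_AE) (auto elim!: AE_mp simp: less_top)
  then show ?thesis by (subst integral_eq_nn_integral) auto
qed

lemma (in noise) W_covariance_nonneg:
  assumes f: "Hdom f" "\<And>z. 0 \<le> f z" and g: "Hdom g" "\<And>z. 0 \<le> g z"
  shows "(\<integral>\<omega>. W f \<omega> * W g \<omega> \<partial>Pw) = enn2real (HN f g)"
  using W_covariance[OF f(1) g(1)] f g HN_commute[of f g]
  by (simp add: Hinner_HN Hdom_measurable)

text \<open>The exceptional set in the almost sure equality depends on the point
  \<open>(t, x)\<close>, so nothing follows directly for integrals of the noise along a
  path.\<close>

locale reg_noise = noise Pw W for Pw :: "'b measure" and W +
  fixes Wd :: "real \<Rightarrow> real \<Rightarrow> real \<Rightarrow> real \<Rightarrow> 'b \<Rightarrow> real"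
  assumes Wd_joint: "0 < \<epsilon> \<Longrightarrow> 0 < \<delta> \<Longrightarrow>
      (\<lambda>(z, \<omega>). Wd \<epsilon> \<delta> (fst z) (snd z) \<omega>) \<in> borel_measurable ((lborel :: (real \<times> real) measure) \<Otimes>\<^sub>M Pw)"
    and Wd_AE: "0 < \<epsilon> \<Longrightarrow> 0 < \<delta> \<Longrightarrow> 0 \<le> t \<Longrightarrow> AE \<omega> in Pw. Wd \<epsilon> \<delta> t x \<omega> = W (phi_ed \<epsilon> \<delta> t x) \<omega>"
begin

lemma Wd_measurable:
  assumes e: "0 < \<epsilon>" "0 < \<delta>"
    and [measurable]: "f \<in> borel_measurable M" "g \<in> borel_measurable M" "h \<in> measurable M Pw"
  shows "(\<lambda>x. Wd \<epsilon> \<delta> (f x) (g x) (h x)) \<in> borel_measurable M"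
proof -
  have "(\<lambda>x. ((f x, g x), h x)) \<in> measurable M ((lborel :: (real \<times> real) measure) \<Otimes>\<^sub>M Pw)"
    unfolding lborel_prod[symmetric] by measurable
  from measurable_compose[OF this Wd_joint[OF e]] show ?thesis by simp
qed

lemma Wd_gspace:
  assumes "0 < \<epsilon>" "0 < \<delta>" "0 \<le> t"
  shows "Wd \<epsilon> \<delta> t x \<in> gspace Pw W"
proof (rule gspace_cong_AE)
  show "W (phi_ed \<epsilon> \<delta> t x) \<in> gspace Pw W" by (intro gspace_W Hdom_phi assms)
  show "Wd \<epsilon> \<delta> t x \<in> borel_measurable Pw" by (intro Wd_measurable assms) auto
  show "AE \<omega> in Pw. W (phi_ed \<epsilon> \<delta> t x) \<omega> = Wd \<epsilon> \<delta> t x \<omega>"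
    using Wd_AE[OF assms, of x] by eventually_elim simp
qed

lemma Wd_W_covariance:
  assumes e: "0 < \<epsilon>" "0 < \<delta>" "0 \<le> t" and g: "Hdom g" "\<And>z. 0 \<le> g z"
  shows "(\<integral>\<omega>. Wd \<epsilon> \<delta> t x \<omega> * W g \<omega> \<partial>Pw) = enn2real (HN (phi_ed \<epsilon> \<delta> t x) g)"
proof -
  have "(\<integral>\<omega>. Wd \<epsilon> \<delta> t x \<omega> * W g \<omega> \<partial>Pw) = (\<integral>\<omega>. W (phi_ed \<epsilon> \<delta> t x) \<omega> * W g \<omega> \<partial>Pw)"
  proof (rule integral_cong_AE)
    note [measurable] = sqi_measurable[OF gspace_sqi[OF Wd_gspace[OF e]]] W_measurable[OF g(1)] W_measurable[OF Hdom_phi[OF e(1,2)]]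
    show "(\<lambda>\<omega>. Wd \<epsilon> \<delta> t x \<omega> * W g \<omega>) \<in> borel_measurable Pw" "(\<lambda>\<omega>. W (phi_ed \<epsilon> \<delta> t x) \<omega> * W g \<omega>) \<in> borel_measurable Pw"
      by measurable
    show "AE \<omega> in Pw. Wd \<epsilon> \<delta> t x \<omega> * W g \<omega> = W (phi_ed \<epsilon> \<delta> t x) \<omega> * W g \<omega>"
      using Wd_AE[OF e, of x] by eventually_elim simp
  qed
  then show ?thesis using e g by (simp add: W_covariance_nonneg Hdom_phi phi_ed_nonneg)
qed

lemma Wd_covariance:
  assumes e: "0 < \<epsilon>" "0 < \<delta>" "0 \<le> u" and e': "0 < \<epsilon>'" "0 < \<delta>'" "0 \<le> v"
  shows "(\<integral>\<omega>. Wd \<epsilon> \<delta> u x \<omega> * Wd \<epsilon>' \<delta>' v x' \<omega> \<partial>Pw) = enn2real (Kn \<epsilon> \<delta> \<epsilon>' \<delta>' u v (x - x'))"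
proof -
  have "(\<integral>\<omega>. Wd \<epsilon> \<delta> u x \<omega> * Wd \<epsilon>' \<delta>' v x' \<omega> \<partial>Pw) = (\<integral>\<omega>. Wd \<epsilon> \<delta> u x \<omega> * W (phi_ed \<epsilon>' \<delta>' v x') \<omega> \<partial>Pw)"
  proof (rule integral_cong_AE)
    note [measurable] = sqi_measurable[OF gspace_sqi[OF Wd_gspace[OF e]]] sqi_measurable[OF gspace_sqi[OF Wd_gspace[OF e']]]
      W_measurable[OF Hdom_phi[OF e'(1,2)]]
    show "(\<lambda>\<omega>. Wd \<epsilon> \<delta> u x \<omega> * Wd \<epsilon>' \<delta>' v x' \<omega>) \<in> borel_measurable Pw"
      "(\<lambda>\<omega>. Wd \<epsilon> \<delta> u x \<omega> * W (phi_ed \<epsilon>' \<delta>' v x') \<omega>) \<in> borel_measurable Pw"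
      by measurable
    show "AE \<omega> in Pw. Wd \<epsilon> \<delta> u x \<omega> * Wd \<epsilon>' \<delta>' v x' \<omega> = Wd \<epsilon> \<delta> u x \<omega> * W (phi_ed \<epsilon>' \<delta>' v x') \<omega>"
      using Wd_AE[OF e', of x'] by eventually_elim simp
  qed
  then show ?thesis using e e' by (simp add: Wd_W_covariance Hdom_phi phi_ed_nonneg HN_phi_phi)
qed

text \<open>For each sample this is an ordinary Lebesgue integral, which later allows
  \<open>exp_integral_identity\<close> to be used sample by sample.\<close>

definition Ipath :: "real \<Rightarrow> real \<Rightarrow> (real \<Rightarrow> real) \<Rightarrow> real \<Rightarrow> real \<Rightarrow> 'b \<Rightarrow> real" where
  "Ipath \<epsilon> \<delta> \<xi> t x \<omega> = (\<integral>s\<in>{0..t}. Wd \<epsilon> \<delta> (t - s) (\<xi> s + x) \<omega> \<partial>lborel)"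

context
  fixes \<epsilon> \<delta> t x :: real and \<xi> :: "real \<Rightarrow> real"
  assumes e: "0 < \<epsilon>" "0 < \<delta>" and t: "0 \<le> t" and \<xi>[measurable]: "\<xi> \<in> borel_measurable borel"
begin

private abbreviation "V \<equiv> \<lambda>s \<omega>. Wd \<epsilon> \<delta> (t - s) (\<xi> s + x) \<omega>"

private lemma V_measurable: "(\<lambda>(s, \<omega>). V s \<omega>) \<in> borel_measurable (seg t \<Otimes>\<^sub>M Pw)"
  unfolding split_beta' by (intro Wd_measurable e) measurable

private lemma V_bound: "AE s in seg t. (\<integral>\<^sup>+\<omega>. ennreal ((V s \<omega>)\<^sup>2) \<partial>Pw) \<le> ennreal (isq \<epsilon>)"
  using AE_seg
proof eventually_elim
  case (elim s)
  then have s: "0 \<le> t - s" by simp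
  have "(\<integral>\<^sup>+\<omega>. ennreal ((V s \<omega>)\<^sup>2) \<partial>Pw) = ennreal (\<integral>\<omega>. V s \<omega> * V s \<omega> \<partial>Pw)"
    using nn_integral_sqi[OF gspace_sqi[OF Wd_gspace[OF e s]]] by (simp add: power2_eq_square)
  also have "\<dots> = ennreal (enn2real (Kn \<epsilon> \<delta> \<epsilon> \<delta> (t - s) (t - s) 0))"
    using Wd_covariance[OF e s e s] by simp
  also have "\<dots> \<le> Kn \<epsilon> \<delta> \<epsilon> \<delta> (t - s) (t - s) 0" by (cases "Kn \<epsilon> \<delta> \<epsilon> \<delta> (t - s) (t - s) 0") auto
  also have "\<dots> \<le> ennreal (isq \<epsilon>)" using e by (intro Kn_le_eps)
  finally show ?case .
qed

private lemmas SF = finite_measure_seg[of t] prob_space_axioms V_measurable V_bound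

lemma Ipath_integrable: "AE \<omega> in Pw. set_integrable lborel {0..t} (\<lambda>s. Wd \<epsilon> \<delta> (t - s) (\<xi> s + x) \<omega>)"
proof -
  have "AE \<omega> in Pw. integrable (seg t) (\<lambda>s. V s \<omega>)" by (rule sfubini_integrable[OF SF])
  then show ?thesis
  proof (rule AE_mp, intro AE_I2 impI)
    fix \<omega> assume \<omega>: "\<omega> \<in> space Pw" "integrable (seg t) (\<lambda>s. V s \<omega>)"
    have "(\<lambda>s. V s \<omega>) \<in> borel_measurable lborel" using \<omega>(1) by (intro Wd_measurable e) auto
    then show "set_integrable lborel {0..t} (\<lambda>s. V s \<omega>)"
      using \<omega>(2) unfolding seg_def set_integrable_def by (subst (asm) integrable_density) auto
  qed
qed

lemma Ipath_seg: "\<omega> \<in> space Pw \<Longrightarrow> Ipath \<epsilon> \<delta> \<xi> t x \<omega> = (\<integral>s. Wd \<epsilon> \<delta> (t - s) (\<xi> s + x) \<omega> \<partial>seg t)"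
  unfolding Ipath_def by (intro integral_seg[symmetric] Wd_measurable e) auto

lemma Ipath_mult:
  assumes Y: "sqi Pw Y"
  shows "(\<integral>\<omega>. Ipath \<epsilon> \<delta> \<xi> t x \<omega> * Y \<omega> \<partial>Pw) = (\<integral>s. (\<integral>\<omega>. Wd \<epsilon> \<delta> (t - s) (\<xi> s + x) \<omega> * Y \<omega> \<partial>Pw) \<partial>seg t)"
proof -
  have "(\<integral>\<omega>. Ipath \<epsilon> \<delta> \<xi> t x \<omega> * Y \<omega> \<partial>Pw) = (\<integral>\<omega>. (\<integral>s. V s \<omega> \<partial>seg t) * Y \<omega> \<partial>Pw)"
    by (intro Bochner_Integration.integral_cong) (auto simp: Ipath_seg)
  also have "\<dots> = (\<integral>s. (\<integral>\<omega>. V s \<omega> * Y \<omega> \<partial>Pw) \<partial>seg t)"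
    by (rule sfubini_mult[OF SF Y])
  finally show ?thesis .
qed

lemma Ipath_sqi: "sqi Pw (Ipath \<epsilon> \<delta> \<xi> t x)"
proof -
  have "sqi Pw (\<lambda>\<omega>. \<integral>s. V s \<omega> \<partial>seg t)" by (rule sfubini_sqi_integral[OF SF])
  moreover have "Ipath \<epsilon> \<delta> \<xi> t x \<in> borel_measurable Pw \<longleftrightarrow> (\<lambda>\<omega>. \<integral>s. V s \<omega> \<partial>seg t) \<in> borel_measurable Pw"
    by (rule measurable_cong) (rule Ipath_seg)
  ultimately show ?thesis by (auto intro!: sqi_cong_AE[of _ "\<lambda>\<omega>. \<integral>s. V s \<omega> \<partial>seg t"] simp: Ipath_seg sqi_measurable)
qed

private lemma HN_phi_measurable: 
  assumes [measurable]: "g \<in> borel_measurable borel" 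
  shows "(\<lambda>s. HN (phi_ed \<epsilon> \<delta> (t - s) (\<xi> s + x)) g) \<in> borel_measurable borel"
  unfolding HN_def by measurable

text \<open>Transfers a covariance formula from the noise at single points to its integral along the
  path: by \<open>cov\<close> the kernel \<open>g\<close> represents \<open>Y\<close>, and the
  kernels \<open>phi_ed\<close> along the path superpose to \<open>Apath\<close>.\<close>

lemma Ipath_nonneg_covariance:
  assumes Y: "sqi Pw Y" and g[measurable]: "g \<in> borel_measurable borel" and pos: "\<And>z. 0 \<le> g z"
    and fin: "HN (Apath \<xi> \<epsilon> \<delta> t x) g < \<infinity>"
    and cov: "\<And>u y. 0 \<le> u \<Longrightarrow> (\<integral>\<omega>. Wd \<epsilon> \<delta> u y \<omega> * Y \<omega> \<partial>Pw) = enn2real (HN (phi_ed \<epsilon> \<delta> u y) g)"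
  shows "(\<integral>\<omega>. Ipath \<epsilon> \<delta> \<xi> t x \<omega> * Y \<omega> \<partial>Pw) = enn2real (HN (Apath \<xi> \<epsilon> \<delta> t x) g)"
proof -
  have HN: "HN (Apath \<xi> \<epsilon> \<delta> t x) g = (\<integral>\<^sup>+s. HN (phi_ed \<epsilon> \<delta> (t - s) (\<xi> s + x)) g \<partial>seg t)"
    using e pos by (simp add: HN_Apath nn_integral_seg HN_phi_measurable)
  note [measurable] = sqi_measurable[OF Y] HN_phi_measurable
  have [measurable]: "(\<lambda>s. \<integral>\<omega>. V s \<omega> * Y \<omega> \<partial>Pw) \<in> borel_measurable (seg t)"
    using V_measurable by measurable
  have "(\<integral>\<omega>. Ipath \<epsilon> \<delta> \<xi> t x \<omega> * Y \<omega> \<partial>Pw) = (\<integral>s. (\<integral>\<omega>. V s \<omega> * Y \<omega> \<partial>Pw) \<partial>seg t)"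
    by (rule Ipath_mult[OF Y])
  also have "\<dots> = (\<integral>s. enn2real (HN (phi_ed \<epsilon> \<delta> (t - s) (\<xi> s + x)) g) \<partial>seg t)"
    using AE_seg[of t] by (intro integral_cong_AE) (auto elim!: AE_mp simp: cov)
  also have "\<dots> = enn2real (HN (Apath \<xi> \<epsilon> \<delta> t x) g)"
    unfolding HN using fin[unfolded HN] by (intro integral_enn2real) auto
  finally show ?thesis .
qed

end

text \<open>A stochastic Fubini theorem for \<open>W\<close>. Both variances and the covariance
  equal the squared norm of \<open>Apath\<close>, so the mean square of the difference is 0.\<close>

lemma Ipath_eq_W:
  assumes e: "0 < \<epsilon>" "0 < \<delta>" and t: "0 \<le> t" and \<xi>: "\<xi> \<in> borel_measurable borel"
  shows "AE \<omega> in Pw. Ipath \<epsilon> \<delta> \<xi> t x \<omega> = W (Apath \<xi> \<epsilon> \<delta> t x) \<omega>"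
proof -
  let ?A = "Apath \<xi> \<epsilon> \<delta> t x" and ?J = "Ipath \<epsilon> \<delta> \<xi> t x"
  let ?c = "enn2real (HN ?A ?A)"
  note A = Apath_measurable[OF \<xi> e, of t x] Apath_nonneg[OF \<xi> e, of t x] Hdom_Apath[OF \<xi> e t, of x]
  have sJ: "sqi Pw ?J" by (rule Ipath_sqi[OF e t \<xi>])
  have sA: "sqi Pw (W ?A)" by (intro gspace_sqi gspace_W A)
  have AA: "HN ?A ?A < \<infinity>"
    using HN_finite[OF A(3)] A(2) by simp
  have c1: "(\<integral>\<omega>. ?J \<omega> * W ?A \<omega> \<partial>Pw) = ?c"
    by (rule Ipath_nonneg_covariance[OF e t \<xi> sA A(1,2) AA]) (rule Wd_W_covariance[OF e _ A(3,2)])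
  have Aphi: "HN ?A (phi_ed \<epsilon> \<delta> u y) < \<infinity>" for u y
  proof -
    have "HN ?A (phi_ed \<epsilon> \<delta> u y) \<le> (\<integral>\<^sup>+s. ennreal (indicator {0..t} s) * ennreal (isq \<epsilon>) \<partial>lborel)"
      unfolding HN_Apath_phi[OF \<xi> e e] by (intro nn_integral_mono mult_left_mono Kn_le_eps e) auto
    also have "\<dots> < \<infinity>" using t by (subst nn_integral_multc) (auto simp: ennreal_indicator ennreal_mult_less_top)
    finally show ?thesis .
  qed
  have c2: "(\<integral>\<omega>. ?J \<omega> * Wd \<epsilon> \<delta> u y \<omega> \<partial>Pw) = enn2real (HN ?A (phi_ed \<epsilon> \<delta> u y))" if "0 \<le> u" for u y
    by (rule Ipath_nonneg_covariance[OF e t \<xi> _ _ _ Aphi])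
      (use that e in \<open>auto intro!: gspace_sqi Wd_gspace phi_ed_nonneg simp: Wd_covariance HN_phi_phi\<close>)
  \<comment> \<open>The covariance formula is used twice: first, in \<open>c2\<close>, with the
    noise at a point as test variable, and then with the path integral itself.\<close>
  have c3: "(\<integral>\<omega>. ?J \<omega> * ?J \<omega> \<partial>Pw) = ?c"
  proof (rule Ipath_nonneg_covariance[OF e t \<xi> sJ A(1,2) AA])
    fix u y :: real assume "0 \<le> u"
    then show "(\<integral>\<omega>. Wd \<epsilon> \<delta> u y \<omega> * ?J \<omega> \<partial>Pw) = enn2real (HN (phi_ed \<epsilon> \<delta> u y) ?A)"
      using c2[of u y] A(1) by (simp add: mult.commute HN_commute[of ?A])
  qed
  have c4: "(\<integral>\<omega>. W ?A \<omega> * W ?A \<omega> \<partial>Pw) = ?c"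
    using A by (intro W_covariance_nonneg)
  have "(\<integral>\<omega>. (?J \<omega> - W ?A \<omega>)\<^sup>2 \<partial>Pw) = (\<integral>\<omega>. ?J \<omega> * ?J \<omega> - 2 * (?J \<omega> * W ?A \<omega>) + W ?A \<omega> * W ?A \<omega> \<partial>Pw)"
    by (intro Bochner_Integration.integral_cong) (auto simp: power2_eq_square algebra_simps)
  also have "\<dots> = 0"
    using sqi_mult[OF sJ sJ] sqi_mult[OF sJ sA] sqi_mult[OF sA sA] by (simp add: c1 c3 c4)
  finally have "AE \<omega> in Pw. (?J \<omega> - W ?A \<omega>)\<^sup>2 = 0"
    using sqi_diff[OF sJ sA] by (subst (asm) integral_nonneg_eq_0_iff_AE) (auto simp: sqi_def)
  then show ?thesis by eventually_elim simp
qed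

end

subsection \<open>Covariance bounds and limits along a path\<close>

text \<open>The constant 40 is the 8 of \<open>Kn_le_isq\<close> times the 5 of
  \<open>nn_integral_isq_interval\<close>. The case \<open>t = 0\<close> is apart because the latter
  is about intervals of positive length.\<close>

lemma nn_integral_seg_isq:
  assumes "0 \<le> t"
  shows "(\<integral>\<^sup>+s. ennreal (8 * isq (t - s - v)) \<partial>seg t) \<le> ennreal (40 * sqrt t)"
proof (cases "t = 0")
  case True
  have "AE s in lborel. s \<noteq> (0::real)" by (rule AE_lborel_singleton)
  then have "AE s in seg t. ennreal (8 * isq (t - s - v)) = 0"
    using True by (intro AE_segI) (auto elim!: AE_mp)
  then have "(\<integral>\<^sup>+s. ennreal (8 * isq (t - s - v)) \<partial>seg t) = (\<integral>\<^sup>+s. 0 \<partial>seg t)"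
    by (rule nn_integral_cong_AE)
  then show ?thesis by simp
next
  case False
  then have t: "0 < t" using assms by simp
  have eq: "isq (t - s - v) = isq (s - (t - v))" for s
    using isq_minus[of "s - (t - v)"] by (simp add: algebra_simps)
  have "(\<integral>\<^sup>+s. ennreal (8 * isq (t - s - v)) \<partial>seg t)
    = ennreal 8 * (\<integral>\<^sup>+s. ennreal (indicator {t - t..t} s * isq (s - (t - v))) \<partial>lborel)"
    unfolding eq by (subst nn_integral_seg, measurable, subst nn_integral_cmult[symmetric])
      (auto intro!: nn_integral_cong simp: indicator_def ennreal_mult')
  also have "\<dots> \<le> ennreal 8 * ennreal (5 * t powr (1/2))"
    by (intro mult_left_mono nn_integral_isq_interval t) auto
  also have "\<dots> = ennreal (40 * sqrt t)"
    using t by (simp add: powr_half_sqrt flip: ennreal_mult' ennreal_numeral)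
  finally show ?thesis .
qed

lemma HN_Apath_phi_seg:
  assumes [measurable]: "\<xi> \<in> borel_measurable borel" and e: "0 < \<epsilon>" "0 < \<delta>" "0 < \<epsilon>'" "0 < \<delta>'"
  shows "HN (Apath \<xi> \<epsilon> \<delta> t x) (phi_ed \<epsilon>' \<delta>' v y) = (\<integral>\<^sup>+s. Kn \<epsilon> \<delta> \<epsilon>' \<delta>' (t - s) v (\<xi> s + x - y) \<partial>seg t)"
  unfolding HN_Apath_phi[OF assms] by (subst nn_integral_seg) auto

lemma AE_seg_neq: "AE s in seg t. t - s \<noteq> v"
proof (rule AE_segI)
  show "AE s in lborel. 0 \<le> s \<longrightarrow> s \<le> t \<longrightarrow> t - s \<noteq> v"
    using AE_lborel_singleton[of "t - v"] by eventually_elim auto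
qed

lemma HN_Apath_phi_le:
  assumes [measurable]: "\<xi> \<in> borel_measurable borel" and e: "0 < \<epsilon>" "0 < \<delta>" "0 < \<epsilon>'" "0 < \<delta>'" and t: "0 \<le> t"
  shows "HN (Apath \<xi> \<epsilon> \<delta> t x) (phi_ed \<epsilon>' \<delta>' v y) \<le> ennreal (40 * sqrt t)"
proof -
  have "HN (Apath \<xi> \<epsilon> \<delta> t x) (phi_ed \<epsilon>' \<delta>' v y) \<le> (\<integral>\<^sup>+s. ennreal (8 * isq (t - s - v)) \<partial>seg t)"
    unfolding HN_Apath_phi_seg[OF assms(1-5)]
  proof (rule nn_integral_mono_AE)
    show "AE s in seg t. Kn \<epsilon> \<delta> \<epsilon>' \<delta>' (t - s) v (\<xi> s + x - y) \<le> ennreal (8 * isq (t - s - v))"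
      using AE_seg_neq[of t v] by eventually_elim (intro Kn_le_isq e)
  qed
  also have "\<dots> \<le> ennreal (40 * sqrt t)" by (rule nn_integral_seg_isq[OF t])
  finally show ?thesis .
qed

lemma HN_Apath_Apath_seg:
  assumes \<xi>[measurable]: "\<xi> \<in> borel_measurable borel" and \<xi>'[measurable]: "\<xi>' \<in> borel_measurable borel"
    and e: "0 < \<epsilon>" "0 < \<delta>" "0 < \<epsilon>'" "0 < \<delta>'"
  shows "HN (Apath \<xi> \<epsilon> \<delta> t x) (Apath \<xi>' \<epsilon>' \<delta>' t' x')
    = (\<integral>\<^sup>+s. HN (Apath \<xi>' \<epsilon>' \<delta>' t' x') (phi_ed \<epsilon> \<delta> (t - s) (\<xi> s + x)) \<partial>seg t)"
proof -
  note [measurable] = Apath_measurable[OF \<xi>' e(3,4)]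
  have "(\<lambda>s. HN (Apath \<xi>' \<epsilon>' \<delta>' t' x') (phi_ed \<epsilon> \<delta> (t - s) (\<xi> s + x))) \<in> borel_measurable borel"
    unfolding HN_def by measurable
  then show ?thesis
    using Apath_nonneg[OF \<xi>' e(3,4), of t' x']
    by (subst HN_Apath) (auto simp: e nn_integral_seg intro!: nn_integral_cong arg_cong2[of _ _ _ _ "(*)"] HN_commute)
qed

lemma HN_Apath_Apath_le':
  assumes "\<xi> \<in> borel_measurable borel" "\<xi>' \<in> borel_measurable borel"
    and e: "0 < \<epsilon>" "0 < \<delta>" "0 < \<epsilon>'" "0 < \<delta>'" and t: "0 \<le> t" "0 \<le> t'"
  shows "HN (Apath \<xi> \<epsilon> \<delta> t x) (Apath \<xi>' \<epsilon>' \<delta>' t' x') \<le> ennreal (40 * t * sqrt t')"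
proof -
  have "HN (Apath \<xi> \<epsilon> \<delta> t x) (Apath \<xi>' \<epsilon>' \<delta>' t' x') \<le> (\<integral>\<^sup>+s. ennreal (40 * sqrt t') \<partial>seg t)"
    unfolding HN_Apath_Apath_seg[OF assms(1-6)]
    by (intro nn_integral_mono HN_Apath_phi_le assms)
  also have "\<dots> = ennreal (40 * t * sqrt t')"
    unfolding nn_integral_seg_const[OF t(1)] using t by (simp add: ennreal_mult'[symmetric] mult_ac)
  finally show ?thesis .
qed

locale vanishing =
  fixes \<epsilon> \<delta> :: "nat \<Rightarrow> real"
  assumes pos: "0 < \<epsilon> n" "0 < \<delta> n"
    and lim: "\<epsilon> \<longlonglongrightarrow> 0" "\<delta> \<longlonglongrightarrow> 0"

text \<open>Dominated convergence in \<open>s\<close> under \<open>Kn_le_isq\<close>. With two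
  vanishing sequences, the path integral and the noise may be at different stages of
  regularisation.\<close>

lemma HN_Apath_phi_tendsto:
  assumes \<xi>[measurable]: "\<xi> \<in> borel_measurable borel"
    and "vanishing \<epsilon> \<delta>" "vanishing \<epsilon>' \<delta>'" and t: "0 \<le> t" "0 < v"
  shows "(\<lambda>n. enn2real (HN (Apath \<xi> (\<epsilon> n) (\<delta> n) t x) (phi_ed (\<epsilon>' n) (\<delta>' n) v y)))
    \<longlonglongrightarrow> (\<integral>s. heat \<bar>t - s - v\<bar> (\<xi> s + x - y) \<partial>seg t)"
proof -
  interpret a: vanishing \<epsilon> \<delta> by fact
  interpret b: vanishing \<epsilon>' \<delta>' by fact
  have eq: "enn2real (HN (Apath \<xi> (\<epsilon> n) (\<delta> n) t x) (phi_ed (\<epsilon>' n) (\<delta>' n) v y))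
    = (\<integral>s. enn2real (Kn (\<epsilon> n) (\<delta> n) (\<epsilon>' n) (\<delta>' n) (t - s) v (\<xi> s + x - y)) \<partial>seg t)" for n
    using HN_Apath_phi_le[OF \<xi> a.pos(1)[of n] a.pos(2)[of n] b.pos(1)[of n] b.pos(2)[of n] t(1), of x v y]
    unfolding HN_Apath_phi_seg[OF \<xi> a.pos(1) a.pos(2) b.pos(1) b.pos(2)]
    by (subst integral_enn2real) (auto simp: le_less_trans)
  show ?thesis
    unfolding eq
  proof (rule integral_dominated_convergence)
    show "integrable (seg t) (\<lambda>s. 8 * isq (t - s - v))"
      using nn_integral_seg_isq[OF t(1), of v]
      by (intro integrableI_nonneg) (auto simp: le_less_trans)
    show "AE s in seg t. (\<lambda>n. enn2real (Kn (\<epsilon> n) (\<delta> n) (\<epsilon>' n) (\<delta>' n) (t - s) v (\<xi> s + x - y)))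
      \<longlonglongrightarrow> heat \<bar>t - s - v\<bar> (\<xi> s + x - y)"
      using AE_seg[of t] AE_seg_neq[of t v] AE_seg_neq[of t 0]
      by eventually_elim (intro Kn_tendsto a.pos b.pos a.lim b.lim t; simp)
    show "AE s in seg t. norm (enn2real (Kn (\<epsilon> n) (\<delta> n) (\<epsilon>' n) (\<delta>' n) (t - s) v (\<xi> s + x - y))) \<le> 8 * isq (t - s - v)" for n
      using AE_seg_neq[of t v]
    proof eventually_elim
      case (elim s)
      then have "Kn (\<epsilon> n) (\<delta> n) (\<epsilon>' n) (\<delta>' n) (t - s) v (\<xi> s + x - y) \<le> ennreal (8 * isq (t - s - v))"
        by (intro Kn_le_isq a.pos b.pos)
      then show ?case by (simp add: enn2real_leI)
    qed
  qed measurable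
qed

lemma HN_Apath_Apath_tendsto:
  assumes \<xi>[measurable]: "\<xi> \<in> borel_measurable borel" and \<xi>'[measurable]: "\<xi>' \<in> borel_measurable borel"
    and "vanishing \<epsilon> \<delta>" "vanishing \<epsilon>' \<delta>'" and t: "0 \<le> t" "0 \<le> t'"
  shows "(\<lambda>n. enn2real (HN (Apath \<xi> (\<epsilon> n) (\<delta> n) t x) (Apath \<xi>' (\<epsilon>' n) (\<delta>' n) t' x')))
    \<longlonglongrightarrow> (\<integral>s. (\<integral>r. heat \<bar>t' - r - (t - s)\<bar> (\<xi>' r + x' - (\<xi> s + x)) \<partial>seg t') \<partial>seg t)"
proof -
  interpret a: vanishing \<epsilon> \<delta> by fact
  interpret b: vanishing \<epsilon>' \<delta>' by fact
  let ?H = "\<lambda>n s. HN (Apath \<xi>' (\<epsilon>' n) (\<delta>' n) t' x') (phi_ed (\<epsilon> n) (\<delta> n) (t - s) (\<xi> s + x))"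
  note [measurable] = Apath_measurable[OF \<xi>' b.pos]
  have [measurable]: "?H n \<in> borel_measurable borel" for n
    unfolding HN_def by measurable
  have le: "?H n s \<le> ennreal (40 * sqrt t')" for n s
    by (intro HN_Apath_phi_le \<xi>' a.pos b.pos t)
  have eq: "enn2real (HN (Apath \<xi> (\<epsilon> n) (\<delta> n) t x) (Apath \<xi>' (\<epsilon>' n) (\<delta>' n) t' x'))
    = (\<integral>s. enn2real (?H n s) \<partial>seg t)" for n
    using HN_Apath_Apath_le'[OF \<xi> \<xi>' a.pos(1)[of n] a.pos(2)[of n] b.pos(1)[of n] b.pos(2)[of n] t, of x x']
    unfolding HN_Apath_Apath_seg[OF \<xi> \<xi>' a.pos(1) a.pos(2) b.pos(1) b.pos(2)]
    by (subst integral_enn2real) (auto simp: le_less_trans)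
  interpret S: finite_measure "seg t" by (rule finite_measure_seg)
  interpret S': finite_measure "seg t'" by (rule finite_measure_seg)
  show ?thesis
    unfolding eq
  proof (rule integral_dominated_convergence)
    show "integrable (seg t) (\<lambda>s. 40 * sqrt t')" by simp
    show "AE s in seg t. (\<lambda>n. enn2real (?H n s)) \<longlonglongrightarrow> (\<integral>r. heat \<bar>t' - r - (t - s)\<bar> (\<xi>' r + x' - (\<xi> s + x)) \<partial>seg t')"
      using AE_seg[of t] AE_seg_neq[of t 0]
    proof eventually_elim
      case (elim s)
      then show ?case by (intro HN_Apath_phi_tendsto assms) auto
    qed
    show "AE s in seg t. norm (enn2real (?H n s)) \<le> 40 * sqrt t'" for n
      using le[of n] t by (auto intro!: enn2real_leI)
  qed measurable
qed

context reg_noise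
begin

lemma Ipath_gspace:
  assumes e: "0 < \<epsilon>" "0 < \<delta>" and t: "0 \<le> t" and \<xi>: "\<xi> \<in> borel_measurable borel"
  shows "Ipath \<epsilon> \<delta> \<xi> t x \<in> gspace Pw W"
proof (rule gspace_cong_AE)
  show "W (Apath \<xi> \<epsilon> \<delta> t x) \<in> gspace Pw W" by (intro gspace_W Hdom_Apath assms)
  show "Ipath \<epsilon> \<delta> \<xi> t x \<in> borel_measurable Pw" by (rule sqi_measurable[OF Ipath_sqi[OF assms]])
  show "AE \<omega> in Pw. W (Apath \<xi> \<epsilon> \<delta> t x) \<omega> = Ipath \<epsilon> \<delta> \<xi> t x \<omega>"
    using Ipath_eq_W[OF assms, of x] by eventually_elim simp
qed

lemma Ipath_Wd_covariance:
  assumes e: "0 < \<epsilon>" "0 < \<delta>" and t: "0 \<le> t" and \<xi>: "\<xi> \<in> borel_measurable borel"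
    and e': "0 < \<epsilon>'" "0 < \<delta>'" and v: "0 \<le> v"
  shows "(\<integral>\<omega>. Ipath \<epsilon> \<delta> \<xi> t x \<omega> * Wd \<epsilon>' \<delta>' v y \<omega> \<partial>Pw) = enn2real (HN (Apath \<xi> \<epsilon> \<delta> t x) (phi_ed \<epsilon>' \<delta>' v y))"
proof (rule Ipath_nonneg_covariance[OF e t \<xi>])
  show "sqi Pw (Wd \<epsilon>' \<delta>' v y)" by (intro gspace_sqi Wd_gspace e' v)
  show "HN (Apath \<xi> \<epsilon> \<delta> t x) (phi_ed \<epsilon>' \<delta>' v y) < \<infinity>"
    using HN_Apath_phi_le[OF \<xi> e e' t, of x v y] by (auto simp: le_less_trans)
qed (use e e' v in \<open>auto simp: phi_ed_nonneg Wd_covariance HN_phi_phi\<close>)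

lemma Ipath_Ipath_covariance:
  assumes e: "0 < \<epsilon>" "0 < \<delta>" and t: "0 \<le> t" and \<xi>: "\<xi> \<in> borel_measurable borel"
    and e': "0 < \<epsilon>'" "0 < \<delta>'" and t': "0 \<le> t'" and \<xi>': "\<xi>' \<in> borel_measurable borel"
  shows "(\<integral>\<omega>. Ipath \<epsilon> \<delta> \<xi> t x \<omega> * Ipath \<epsilon>' \<delta>' \<xi>' t' x' \<omega> \<partial>Pw)
    = enn2real (HN (Apath \<xi> \<epsilon> \<delta> t x) (Apath \<xi>' \<epsilon>' \<delta>' t' x'))"
proof (rule Ipath_nonneg_covariance[OF e t \<xi>])
  show "sqi Pw (Ipath \<epsilon>' \<delta>' \<xi>' t' x')" by (intro Ipath_sqi e' t' \<xi>')
  show "Apath \<xi>' \<epsilon>' \<delta>' t' x' \<in> borel_measurable borel" by (intro Apath_measurable e' \<xi>')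
  show "0 \<le> Apath \<xi>' \<epsilon>' \<delta>' t' x' z" for z by (intro Apath_nonneg e' \<xi>')
  show "HN (Apath \<xi> \<epsilon> \<delta> t x) (Apath \<xi>' \<epsilon>' \<delta>' t' x') < \<infinity>"
    using HN_Apath_Apath_le'[OF \<xi> \<xi>' e e' t t', of x x'] by (auto simp: le_less_trans)
  fix u y :: real assume u: "0 \<le> u"
  have "(\<integral>\<omega>. Wd \<epsilon> \<delta> u y \<omega> * Ipath \<epsilon>' \<delta>' \<xi>' t' x' \<omega> \<partial>Pw) = enn2real (HN (Apath \<xi>' \<epsilon>' \<delta>' t' x') (phi_ed \<epsilon> \<delta> u y))"
    using Ipath_Wd_covariance[OF e' t' \<xi>' e u] by (simp add: mult.commute)
  then show "(\<integral>\<omega>. Wd \<epsilon> \<delta> u y \<omega> * Ipath \<epsilon>' \<delta>' \<xi>' t' x' \<omega> \<partial>Pw) = enn2real (HN (phi_ed \<epsilon> \<delta> u y) (Apath \<xi>' \<epsilon>' \<delta>' t' x'))"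
    using Apath_measurable[OF \<xi>' e'] by (simp add: HN_commute)
qed

end

locale reg_noise_seq = reg_noise Pw W Wd + vanishing \<epsilon> \<delta>
  for Pw :: "'b measure" and W Wd \<epsilon> \<delta>
begin

abbreviation "In \<equiv> \<lambda>n. Ipath (\<epsilon> n) (\<delta> n)"
abbreviation "Wn \<equiv> \<lambda>n. Wd (\<epsilon> n) (\<delta> n)"

text \<open>\<open>Y\<close> is the stochastic integral of the Dirac mass along the path \<open>\<xi>\<close>, started at \<open>x\<close> and run backwards from time \<open>t\<close>.\<close>

definition good :: "(real \<Rightarrow> real) \<Rightarrow> real \<Rightarrow> real \<Rightarrow> ('b \<Rightarrow> real) \<Rightarrow> bool" where
  "good \<xi> t x Y \<longleftrightarrow> \<xi> \<in> borel_measurable borel \<and> 0 \<le> t \<and> l2lim Pw (\<lambda>n. In n \<xi> t x) Y"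

lemma good_gspace: "good \<xi> t x Y \<Longrightarrow> Y \<in> gspace Pw W"
  unfolding good_def by (rule gspace_l2lim[of "\<lambda>n. In n \<xi> t x"]) (auto intro!: Ipath_gspace pos)

text \<open>Both sides are limits of the covariances of the approximations, one by L2 continuity and
  the other by dominated convergence of the kernels.\<close>

lemma good_covariance:
  assumes g: "good \<xi> t x Y" "good \<xi>' t' x' Y'"
  shows "(\<integral>\<omega>. Y \<omega> * Y' \<omega> \<partial>Pw) = (\<integral>s. (\<integral>r. heat \<bar>t' - r - (t - s)\<bar> (\<xi>' r + x' - (\<xi> s + x)) \<partial>seg t') \<partial>seg t)"
proof (rule LIMSEQ_unique)
  show "(\<lambda>n. \<integral>\<omega>. In n \<xi> t x \<omega> * In n \<xi>' t' x' \<omega> \<partial>Pw) \<longlonglongrightarrow> (\<integral>\<omega>. Y \<omega> * Y' \<omega> \<partial>Pw)"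
    using g unfolding good_def by (intro l2lim_inner) auto
  show "(\<lambda>n. \<integral>\<omega>. In n \<xi> t x \<omega> * In n \<xi>' t' x' \<omega> \<partial>Pw)
    \<longlonglongrightarrow> (\<integral>s. (\<integral>r. heat \<bar>t' - r - (t - s)\<bar> (\<xi>' r + x' - (\<xi> s + x)) \<partial>seg t') \<partial>seg t)"
    using HN_Apath_Apath_tendsto[of \<xi> \<xi>' \<epsilon> \<delta> \<epsilon> \<delta> t t' x x'] g vanishing_axioms
    by (simp add: good_def Ipath_Ipath_covariance pos)
qed

lemma In_variance:
  assumes "\<xi> \<in> borel_measurable borel" "0 \<le> t"
  shows "(\<integral>\<omega>. (In n \<xi> t x \<omega>)\<^sup>2 \<partial>Pw) \<le> 40 * t * sqrt t"
  using Ipath_Ipath_covariance[OF pos(1)[of n] pos(2)[of n] assms(2,1) pos(1)[of n] pos(2)[of n] assms(2,1), of x x]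
    HN_Apath_Apath_le'[OF assms(1,1) pos(1)[of n] pos(2)[of n] pos(1)[of n] pos(2)[of n] assms(2,2), of x x] assms(2)
  by (simp add: power2_eq_square enn2real_leI)

lemma good_variance:
  assumes g: "good \<xi> t x Y"
  shows "(\<integral>\<omega>. (Y \<omega>)\<^sup>2 \<partial>Pw) \<le> 40 * t * sqrt t"
proof (rule LIMSEQ_le_const2)
  show "(\<lambda>n. \<integral>\<omega>. (In n \<xi> t x \<omega>)\<^sup>2 \<partial>Pw) \<longlonglongrightarrow> (\<integral>\<omega>. (Y \<omega>)\<^sup>2 \<partial>Pw)"
    using g l2lim_inner[of Pw "\<lambda>n. In n \<xi> t x" Y "\<lambda>n. In n \<xi> t x" Y] by (simp add: good_def power2_eq_square)
  show "\<exists>N. \<forall>n\<ge>N. (\<integral>\<omega>. (In n \<xi> t x \<omega>)\<^sup>2 \<partial>Pw) \<le> 40 * t * sqrt t"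
    using g In_variance by (auto simp: good_def)
qed

lemma In_Wn_covariance:
  assumes "\<xi> \<in> borel_measurable borel" "0 \<le> t" "0 \<le> v"
  shows "\<bar>\<integral>\<omega>. In m \<xi> t x \<omega> * Wn n v y \<omega> \<partial>Pw\<bar> \<le> 40 * sqrt t"
  using Ipath_Wd_covariance[OF pos(1)[of m] pos(2)[of m] assms(2,1) pos(1)[of n] pos(2)[of n] assms(3), of x y]
    HN_Apath_phi_le[OF assms(1) pos(1)[of m] pos(2)[of m] pos(1)[of n] pos(2)[of n] assms(2), of x v y] assms(2)
  by (simp add: enn2real_leI)

lemma good_Wn_lim:
  assumes g: "good \<xi> t x Y" and v: "0 \<le> v"
  shows "(\<lambda>m. \<integral>\<omega>. In m \<xi> t x \<omega> * Wn n v y \<omega> \<partial>Pw) \<longlonglongrightarrow> (\<integral>\<omega>. Y \<omega> * Wn n v y \<omega> \<partial>Pw)"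
  using g v by (intro l2lim_inner l2lim_const gspace_sqi Wd_gspace pos) (auto simp: good_def)

lemma good_Wn_covariance:
  assumes g: "good \<xi> t x Y" and v: "0 \<le> v"
  shows "\<bar>\<integral>\<omega>. Y \<omega> * Wn n v y \<omega> \<partial>Pw\<bar> \<le> 40 * sqrt t"
proof (rule LIMSEQ_le_const2)
  show "(\<lambda>m. \<bar>\<integral>\<omega>. In m \<xi> t x \<omega> * Wn n v y \<omega> \<partial>Pw\<bar>) \<longlonglongrightarrow> \<bar>\<integral>\<omega>. Y \<omega> * Wn n v y \<omega> \<partial>Pw\<bar>"
    by (intro tendsto_rabs good_Wn_lim assms)
  show "\<exists>N. \<forall>m\<ge>N. \<bar>\<integral>\<omega>. In m \<xi> t x \<omega> * Wn n v y \<omega> \<partial>Pw\<bar> \<le> 40 * sqrt t"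
    using g v In_Wn_covariance by (auto simp: good_def)
qed

lemma In_Wn_tendsto:
  assumes "\<xi> \<in> borel_measurable borel" "0 \<le> t" "0 < v"
  shows "(\<lambda>n. \<integral>\<omega>. In n \<xi> t x \<omega> * Wn n v y \<omega> \<partial>Pw) \<longlonglongrightarrow> (\<integral>s. heat \<bar>t - s - v\<bar> (\<xi> s + x - y) \<partial>seg t)"
  using HN_Apath_phi_tendsto[OF assms(1) vanishing_axioms vanishing_axioms assms(2,3), of x y] assms
  by (simp add: Ipath_Wd_covariance pos)

text \<open>For each \<open>n\<close>, approximate \<open>Y\<close> by \<open>In m\<close> with \<open>m \<ge> n\<close> so large that the covariance with
  \<open>Wn n\<close> changes by less than \<open>1/(n+1)\<close>; the limit is then that of a pair of vanishing sequences.\<close>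

lemma good_Wn_tendsto:
  assumes g: "good \<xi> t x Y" and v: "0 < v"
  shows "(\<lambda>n. \<integral>\<omega>. Y \<omega> * Wn n v y \<omega> \<partial>Pw) \<longlonglongrightarrow> (\<integral>s. heat \<bar>t - s - v\<bar> (\<xi> s + x - y) \<partial>seg t)"
proof -
  have \<xi>: "\<xi> \<in> borel_measurable borel" and t: "0 \<le> t" using g by (auto simp: good_def)
  let ?a = "\<lambda>m n. \<integral>\<omega>. In m \<xi> t x \<omega> * Wn n v y \<omega> \<partial>Pw" and ?b = "\<lambda>n. \<integral>\<omega>. Y \<omega> * Wn n v y \<omega> \<partial>Pw"
  have "\<exists>m\<ge>n. \<bar>?a m n - ?b n\<bar> < 1 / real (Suc n)" for n
  proof -
    have "(\<lambda>m. ?a m n) \<longlonglongrightarrow> ?b n" using g v by (intro good_Wn_lim) auto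
    then have "\<forall>\<^sub>F m in sequentially. dist (?a m n) (?b n) < 1 / real (Suc n)" by (rule tendstoD) simp
    then obtain M where "\<And>m. m \<ge> M \<Longrightarrow> dist (?a m n) (?b n) < 1 / real (Suc n)"
      by (auto simp: eventually_sequentially)
    from this[of "max M n"] show ?thesis by (intro exI[of _ "max M n"]) (simp add: dist_real_def)
  qed
  then obtain k where k: "\<And>n. n \<le> k n" "\<And>n. \<bar>?a (k n) n - ?b n\<bar> < 1 / real (Suc n)" by metis
  have kl: "filterlim k at_top sequentially"
    by (rule filterlim_at_top_mono[OF filterlim_ident]) (use k(1) in auto)
  have v1: "vanishing (\<lambda>n. \<epsilon> (k n)) (\<lambda>n. \<delta> (k n))"
    by unfold_locales (use pos lim filterlim_compose[OF _ kl] in auto)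
  have 1: "(\<lambda>n. ?a (k n) n) \<longlonglongrightarrow> (\<integral>s. heat \<bar>t - s - v\<bar> (\<xi> s + x - y) \<partial>seg t)"
    using HN_Apath_phi_tendsto[OF \<xi> v1 vanishing_axioms t v, of x y] \<xi> t v
    by (simp add: Ipath_Wd_covariance pos)
  have 2: "(\<lambda>n. ?b n - ?a (k n) n) \<longlonglongrightarrow> 0"
  proof (rule Lim_null_comparison)
    show "\<forall>\<^sub>F n in sequentially. norm (?b n - ?a (k n) n) \<le> 1 / real (Suc n)"
      using k(2) by (intro always_eventually allI) (simp add: abs_minus_commute less_imp_le)
  qed real_asymp
  from tendsto_add[OF 1 2] show ?thesis by simp
qed

subsection \<open>The exponential weights\<close>

text \<open>Read off from \<open>gspace_exp_mult\<close>; the factor 2 in the variance hypothesis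
  cancels the half in the exponent.\<close>

lemma exp_Wn_bound:
  assumes "Y \<in> gspace Pw W" "Z1 \<in> gspace Pw W" "Z2 \<in> gspace Pw W"
    and "(\<integral>\<omega>. (Y \<omega>)\<^sup>2 \<partial>Pw) \<le> 2 * a" "\<bar>\<integral>\<omega>. Y \<omega> * Z1 \<omega> \<partial>Pw\<bar> \<le> b" "\<bar>\<integral>\<omega>. Y \<omega> * Z2 \<omega> \<partial>Pw\<bar> \<le> b"
  shows "\<bar>\<integral>\<omega>. exp (Y \<omega>) * (Z1 \<omega> * Z2 \<omega>) \<partial>Pw\<bar> \<le> exp a * (\<bar>\<integral>\<omega>. Z1 \<omega> * Z2 \<omega> \<partial>Pw\<bar> + b * b)"
proof -
  have b: "0 \<le> b" using assms(5) by linarith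
  have "\<bar>\<integral>\<omega>. exp (Y \<omega>) * (Z1 \<omega> * Z2 \<omega>) \<partial>Pw\<bar> = exp ((\<integral>\<omega>. (Y \<omega>)\<^sup>2 \<partial>Pw) / 2) *
      \<bar>(\<integral>\<omega>. Z1 \<omega> * Z2 \<omega> \<partial>Pw) + (\<integral>\<omega>. Y \<omega> * Z1 \<omega> \<partial>Pw) * (\<integral>\<omega>. Y \<omega> * Z2 \<omega> \<partial>Pw)\<bar>"
    by (simp add: gspace_exp_mult(2)[OF assms(1-3)] abs_mult)
  also have "\<dots> \<le> exp a * (\<bar>\<integral>\<omega>. Z1 \<omega> * Z2 \<omega> \<partial>Pw\<bar> + b * b)"
  proof (intro mult_mono order_trans[OF abs_triangle_ineq] add_mono)
    show "\<bar>(\<integral>\<omega>. Y \<omega> * Z1 \<omega> \<partial>Pw) * (\<integral>\<omega>. Y \<omega> * Z2 \<omega> \<partial>Pw)\<bar> \<le> b * b"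
      unfolding abs_mult using assms b by (intro mult_mono) auto
  qed (use assms b in auto)
  finally show ?thesis .
qed

end

subsection \<open>An exponential identity for integrable functions\<close>

context
  fixes f :: "real \<Rightarrow> real" and t :: real
  assumes f[measurable]: "f \<in> borel_measurable borel" and int_f: "integrable (seg t) f"
begin

private definition F :: "real \<Rightarrow> real" where
  "F u = (\<integral>s. of_bool (u \<le> s) * f s \<partial>seg t)"

private abbreviation "B \<equiv> (\<integral>s. \<bar>f s\<bar> \<partial>seg t)"

interpretation S: finite_measure "seg t" by (rule finite_measure_seg)
interpretation SS: pair_sigma_finite "seg t" "seg t" ..

private lemma F_measurable [measurable]: "F \<in> borel_measurable borel"
proof -
  have "F \<in> borel_measurable (seg t)" unfolding F_def[abs_def] by measurable
  then show ?thesis by simp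
qed

private lemma int_ind: "Measurable.pred borel Q \<Longrightarrow> integrable (seg t) (\<lambda>s. of_bool (Q s) * f s)"
  by (rule Bochner_Integration.integrable_bound[OF int_f]) auto

private lemma F_bound: "\<bar>F u\<bar> \<le> B"
proof -
  have "\<bar>F u\<bar> \<le> (\<integral>s. \<bar>of_bool (u \<le> s) * f s\<bar> \<partial>seg t)"
    unfolding F_def by (rule integral_abs_bound)
  also have "\<dots> \<le> B"
    by (intro integral_mono integrable_abs int_ind int_f) auto
  finally show ?thesis .
qed

private lemma int_fF: "Measurable.pred borel Q \<Longrightarrow> integrable (seg t) (\<lambda>s. of_bool (Q s) * f s * F s ^ n)"
proof (rule Bochner_Integration.integrable_bound)
  assume [measurable]: "Measurable.pred borel Q"
  show "integrable (seg t) (\<lambda>s. \<bar>f s\<bar> * B ^ n)" using int_f by auto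
  show "AE s in seg t. norm (of_bool (Q s) * f s * F s ^ n) \<le> norm (\<bar>f s\<bar> * B ^ n)"
  proof (rule AE_I2)
    fix s
    have "\<bar>F s\<bar> ^ n \<le> B ^ n" using F_bound by (intro power_mono) auto
    moreover have "0 \<le> B" by simp
    ultimately have "\<bar>of_bool (Q s) * f s\<bar> * \<bar>F s\<bar> ^ n \<le> \<bar>f s\<bar> * B ^ n"
      by (intro mult_mono) (auto simp: abs_mult)
    then show "norm (of_bool (Q s) * f s * F s ^ n) \<le> norm (\<bar>f s\<bar> * B ^ n)"
      by (simp add: abs_mult power_abs)
  qed
  show "(\<lambda>s. of_bool (Q s) * f s * F s ^ n) \<in> borel_measurable (seg t)" by measurable
qed

private lemma F_diff: "u \<le> r \<Longrightarrow> (\<integral>s. of_bool (u \<le> s \<and> s \<le> r) * f s \<partial>seg t) = F u - F r"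
proof -
  assume ur: "u \<le> r"
  have "F u - F r = (\<integral>s. of_bool (u \<le> s) * f s - of_bool (r \<le> s) * f s \<partial>seg t)"
    unfolding F_def by (subst Bochner_Integration.integral_diff) (auto intro!: int_ind)
  also have "\<dots> = (\<integral>s. of_bool (u \<le> s \<and> s \<le> r) * f s \<partial>seg t)"
  proof (rule integral_cong_AE)
    have "AE s in seg t. s \<noteq> r"
      using AE_lborel_singleton[of r] by (intro AE_segI) (auto elim!: AE_mp)
    then show "AE s in seg t. of_bool (u \<le> s) * f s - of_bool (r \<le> s) * f s = of_bool (u \<le> s \<and> s \<le> r) * f s"
    proof eventually_elim
      case (elim s)
      then show ?case using ur by auto
    qed
  qed auto
  finally show ?thesis by simp
qed

text \<open>Induction on \<open>n\<close>: insert the identity for \<open>F s ^ Suc n\<close> and interchange the order of integration.\<close>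

private lemma int_power: "(\<integral>s. of_bool (u \<le> s) * f s * F s ^ n \<partial>seg t) = F u ^ Suc n / real (Suc n)"
proof (induction n arbitrary: u)
  case 0
  then show ?case by (simp add: F_def)
next
  case (Suc n)
  let ?G = "\<lambda>u. \<integral>s. of_bool (u \<le> s) * f s * F s ^ Suc n \<partial>seg t"
  have i2: "integrable (seg t \<Otimes>\<^sub>M seg t) (\<lambda>(s, r). (of_bool (u \<le> s) * f s) * (of_bool (s \<le> r) * f r * F r ^ n))"
  proof (rule Bochner_Integration.integrable_bound)
    show "integrable (seg t \<Otimes>\<^sub>M seg t) (\<lambda>p. f (fst p) * (f (snd p) * F (snd p) ^ n))"
    proof (rule SS.Fubini_integrable)
      have i: "integrable (seg t) (\<lambda>s. f s * F s ^ n)" using int_fF[of "\<lambda>_. True" n] by simp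
      show "integrable (seg t) (\<lambda>s. \<integral>r. norm (f (fst (s, r)) * (f (snd (s, r)) * F (snd (s, r)) ^ n)) \<partial>seg t)"
        using int_f by (simp add: abs_mult integrable_abs)
      show "AE s in seg t. integrable (seg t) (\<lambda>r. f (fst (s, r)) * (f (snd (s, r)) * F (snd (s, r)) ^ n))"
        using i by simp
    qed measurable
  qed (auto simp: abs_mult intro!: AE_I2)
  have "?G u = (\<integral>s. (of_bool (u \<le> s) * f s) * (real (Suc n) * (\<integral>r. of_bool (s \<le> r) * f r * F r ^ n \<partial>seg t)) \<partial>seg t)"
    unfolding Suc.IH by simp
  also have "\<dots> = real (Suc n) * (\<integral>s. (\<integral>r. (of_bool (u \<le> s) * f s) * (of_bool (s \<le> r) * f r * F r ^ n) \<partial>seg t) \<partial>seg t)"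
    by (simp add: mult.left_commute flip: integral_mult_right_zero)
  also have "(\<integral>s. (\<integral>r. (of_bool (u \<le> s) * f s) * (of_bool (s \<le> r) * f r * F r ^ n) \<partial>seg t) \<partial>seg t)
    = (\<integral>r. (\<integral>s. (of_bool (u \<le> s) * f s) * (of_bool (s \<le> r) * f r * F r ^ n) \<partial>seg t) \<partial>seg t)"
    by (rule SS.Fubini_integral[OF i2, symmetric])
  also have "\<dots> = (\<integral>r. F u * (of_bool (u \<le> r) * f r * F r ^ n) - of_bool (u \<le> r) * f r * F r ^ Suc n \<partial>seg t)"
  proof (rule Bochner_Integration.integral_cong[OF refl])
    fix r
    have "(\<integral>s. (of_bool (u \<le> s) * f s) * (of_bool (s \<le> r) * f r * F r ^ n) \<partial>seg t)
       = (\<integral>s. (f r * F r ^ n) * (of_bool (u \<le> s \<and> s \<le> r) * f s) \<partial>seg t)"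
      by (intro Bochner_Integration.integral_cong) auto
    also have "\<dots> = (f r * F r ^ n) * (\<integral>s. of_bool (u \<le> s \<and> s \<le> r) * f s \<partial>seg t)"
      by (rule integral_mult_right_zero)
    also have "(\<integral>s. of_bool (u \<le> s \<and> s \<le> r) * f s \<partial>seg t) = of_bool (u \<le> r) * (F u - F r)"
    proof (cases "u \<le> r")
      case False
      then have "(\<lambda>s. of_bool (u \<le> s \<and> s \<le> r) * f s) = (\<lambda>_. 0)" by (auto simp: fun_eq_iff)
      then show ?thesis using False by simp
    qed (simp add: F_diff)
    finally show "(\<integral>s. (of_bool (u \<le> s) * f s) * (of_bool (s \<le> r) * f r * F r ^ n) \<partial>seg t)
       = F u * (of_bool (u \<le> r) * f r * F r ^ n) - of_bool (u \<le> r) * f r * F r ^ Suc n"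
      by (simp add: algebra_simps)
  qed
  also have "\<dots> = F u * (\<integral>r. of_bool (u \<le> r) * f r * F r ^ n \<partial>seg t) - ?G u"
    by (subst Bochner_Integration.integral_diff) (auto intro!: int_fF simp del: power_Suc)
  finally have geq: "?G u = real (Suc n) * (F u * (F u ^ Suc n / real (Suc n)) - ?G u)"
    unfolding Suc.IH .
  \<comment> \<open>The integral reappears on the right with coefficient -(n + 1); solving for it
    produces the denominator n + 2.\<close>
  have alg: "g = x * y / (1 + m)" if "g = m * (x * (y / m) - g)" "0 < m" for g m x y :: real
  proof -
    have "g = x * y - m * g" using that by (simp add: right_diff_distrib)
    then have "g * (1 + m) = x * y" by (simp add: algebra_simps)
    then show ?thesis using that(2) by (simp add: field_simps)
  qed
  have "?G u = F u * F u ^ Suc n / (1 + real (Suc n))"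
    by (rule alg[OF geq]) simp
  then show ?case by (simp add: add.commute)
qed

text \<open>Let \<open>F s\<close> be the integral of \<open>f\<close> over \<open>[s, t]\<close>.
  Formally \<open>f * exp F\<close> is minus the derivative of \<open>exp F\<close>. Since
  \<open>f\<close> is merely integrable, the exponential is expanded and each power integrated by
  \<open>int_power\<close>; the terms add up to the series of \<open>exp (F 0)\<close> without its
  constant term.\<close>

lemma exp_integral_identity:
  "(\<integral>s. f s * exp (\<integral>r. of_bool (s \<le> r) * f r \<partial>seg t) \<partial>seg t) = exp (\<integral>s. f s \<partial>seg t) - 1"
proof -
  let ?g = "\<lambda>n s. f s * F s ^ n / fact n"
  have i: "integrable (seg t) (\<lambda>s. f s * F s ^ n)" for n using int_fF[of "\<lambda>_. True" n] by simp
  have ex: "(\<lambda>n. ?g n s) sums (f s * exp (F s))" for s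
    using sums_mult[OF exp_converges[of "F s"], of "f s"] by (simp add: scaleR_conv_of_real field_simps)
  have sumB: "summable (\<lambda>n. c * (B ^ n / fact n))" for c
    using summable_exp[of B] by (intro summable_mult) (simp add: field_simps)
  have le: "norm (?g n s) \<le> \<bar>f s\<bar> * (B ^ n / fact n)" for n s
  proof -
    have "\<bar>F s\<bar> ^ n \<le> B ^ n" using F_bound by (intro power_mono) auto
    then have "\<bar>f s\<bar> * (\<bar>F s\<bar> ^ n / fact n) \<le> \<bar>f s\<bar> * (B ^ n / fact n)"
      by (intro mult_left_mono divide_right_mono) auto
    then show ?thesis by (simp add: abs_mult power_abs)
  qed
  have "(\<lambda>n. \<integral>s. ?g n s \<partial>seg t) sums (\<integral>s. (\<Sum>n. ?g n s) \<partial>seg t)"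
  proof (rule sums_integral)
    show "integrable (seg t) (?g n)" for n using i[of n] by simp
    show "AE s in seg t. summable (\<lambda>n. norm (?g n s))"
      by (intro AE_I2 summable_comparison_test[OF _ sumB]) (use le in auto)
    show "summable (\<lambda>n. \<integral>s. norm (?g n s) \<partial>seg t)"
    proof (rule summable_comparison_test[OF _ sumB[of B]], intro exI[of _ 0] allI impI)
      fix n
      have "(\<integral>s. norm (?g n s) \<partial>seg t) \<le> (\<integral>s. \<bar>f s\<bar> * (B ^ n / fact n) \<partial>seg t)"
        using i[of n] int_f by (intro integral_mono le integrable_norm) auto
      then show "norm (\<integral>s. norm (?g n s) \<partial>seg t) \<le> B * (B ^ n / fact n)" by simp
    qed
  qed
  moreover have "(\<integral>s. ?g n s \<partial>seg t) = F 0 ^ Suc n / fact (Suc n)" for n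
  proof -
    have "(\<integral>s. f s * F s ^ n \<partial>seg t) = (\<integral>s. of_bool (0 \<le> s) * f s * F s ^ n \<partial>seg t)"
      by (rule integral_cong_AE) (use AE_seg[of t] in \<open>auto elim!: AE_mp\<close>)
    also have "\<dots> = F 0 ^ Suc n / real (Suc n)" by (rule int_power)
    finally show ?thesis by (simp del: power_Suc of_nat_Suc add: mult.commute)
  qed
  moreover have "(\<lambda>n. F 0 ^ Suc n / fact (Suc n)) sums (exp (F 0) - 1)"
    using exp_converges[of "F 0"] by (subst sums_Suc_iff) (simp add: scaleR_conv_of_real field_simps)
  moreover have "F 0 = (\<integral>s. f s \<partial>seg t)"
    unfolding F_def by (rule integral_cong_AE) (use AE_seg[of t] in \<open>auto elim!: AE_mp\<close>)
  ultimately show ?thesis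
    using ex[THEN sums_unique] sums_unique2 unfolding F_def by simp
qed

end

subsection \<open>The stable process\<close>

text \<open>Grid points approaching \<open>s\<close> from the right, so that a right-continuous path is a
  measurable function of its countably many values on the grids.\<close>

definition anx :: "nat \<Rightarrow> real \<Rightarrow> real" where
  "anx n s = real (nat \<lfloor>real (Suc n) * max 0 s\<rfloor> + 1) / real (Suc n)"

lemma anx_bounds: "max 0 s < anx n s" "anx n s \<le> max 0 s + 1 / real (Suc n)"
proof -
  let ?y = "real (Suc n) * max 0 s"
  have y: "?y \<ge> 0" by simp
  have "real (nat \<lfloor>?y\<rfloor>) = of_int \<lfloor>?y\<rfloor>" using y by simp
  then have b: "?y < real (nat \<lfloor>?y\<rfloor> + 1)" "real (nat \<lfloor>?y\<rfloor> + 1) \<le> ?y + 1" by linarith+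
  then show "max 0 s < anx n s" 
    using pos_less_divide_eq[of "real (Suc n)" "max 0 s" "real (nat \<lfloor>?y\<rfloor> + 1)"]
    unfolding anx_def by (simp only: mult.commute[of "max 0 s"] of_nat_0_less_iff zero_less_Suc)
  have "anx n s \<le> (?y + 1) / real (Suc n)" unfolding anx_def using b by (intro divide_right_mono) auto
  also have "\<dots> = max 0 s + 1 / real (Suc n)" by (simp add: add_divide_distrib del: of_nat_Suc)
  finally show "anx n s \<le> max 0 s + 1 / real (Suc n)" .
qed

lemma anx_nonneg: "0 \<le> anx n s"
  by (simp add: anx_def)

lemma filterlim_anx: "filterlim (\<lambda>n. anx n s) (at_right (max 0 s)) sequentially"
proof (rule filterlim_at_withinI)
  have 1: "(\<lambda>n. max 0 s + 1 / real (Suc n)) \<longlonglongrightarrow> max 0 s + 0"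
    by (intro tendsto_add tendsto_const) real_asymp
  show "(\<lambda>n. anx n s) \<longlonglongrightarrow> max 0 s"
    by (rule tendsto_sandwich[of "\<lambda>_. max 0 s"])
      (use 1 anx_bounds in \<open>auto intro!: always_eventually less_imp_le\<close>)
  show "\<forall>\<^sub>F n in sequentially. anx n s \<in> {max 0 s<..} - {max 0 s}"
    using anx_bounds by auto
qed

text \<open>Evaluation through countably many coordinates, hence jointly measurable in time and path
  for the product sigma-algebra. A path that is right-continuous on nonnegative times is returned at
  \<open>max 0 s\<close>.\<close>

definition ev :: "real \<Rightarrow> (real \<Rightarrow> real) \<Rightarrow> real" where
  "ev s w = lim (\<lambda>n. w (anx n s))"

abbreviation "idx \<equiv> insert (-1) {0::real..}"
abbreviation "paths \<equiv> (\<Pi>\<^sub>M i\<in>idx. (borel :: real measure))"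

lemma ev_measurable [measurable]:
  assumes [measurable]: "f \<in> borel_measurable M" "g \<in> measurable M paths"
  shows "(\<lambda>x. ev (f x) (g x)) \<in> borel_measurable M"
proof -
  have 1: "(\<lambda>x. g x (real (k + 1) / real (Suc n))) \<in> borel_measurable M" for k n
    by (rule measurable_compose[OF assms(2) measurable_component_singleton]) simp
  have "(\<lambda>x. g x (anx n (f x))) \<in> borel_measurable M" for n
    unfolding anx_def
    by (rule measurable_compose_countable[where f = "\<lambda>k x. g x (real (k + 1) / real (Suc n))"
        and g = "\<lambda>x. nat \<lfloor>real (Suc n) * max 0 (f x)\<rfloor>", OF 1]) measurable
  then show ?thesis unfolding ev_def by measurable
qed

locale stable = prob_space Px for Px :: "'a measure" +
  fixes X :: "real \<Rightarrow> 'a \<Rightarrow> real" and c \<alpha> :: real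
  assumes stable_process: "stable_process Px X c \<alpha>" and c: "0 < c" and \<alpha>: "0 < \<alpha>"
begin

lemma X_measurable [measurable]: "X t \<in> borel_measurable Px"
  using stable_process by (simp add: stable_process_def)

lemma X_zero: "\<omega> \<in> space Px \<Longrightarrow> X 0 \<omega> = 0"
  using stable_process by (simp add: stable_process_def)

lemma X_anx: "\<omega> \<in> space Px \<Longrightarrow> 0 \<le> a \<Longrightarrow> (\<lambda>n. X (a + anx n s) \<omega>) \<longlonglongrightarrow> X (a + max 0 s) \<omega>"
proof -
  assume \<omega>: "\<omega> \<in> space Px" and a: "0 \<le> a"
  have "continuous (at_right (a + max 0 s)) (\<lambda>s. X s \<omega>)"
    using stable_process \<omega> a by (auto simp: stable_process_def)
  then have "((\<lambda>s. X s \<omega>) \<longlongrightarrow> X (a + max 0 s) \<omega>) (at_right (a + max 0 s))"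
    by (simp add: continuous_within)
  moreover have "filterlim (\<lambda>n. a + anx n s) (at_right (a + max 0 s)) sequentially"
  proof (rule filterlim_at_withinI)
    show "(\<lambda>n. a + anx n s) \<longlonglongrightarrow> a + max 0 s"
      using filterlim_anx[of s] by (intro tendsto_add tendsto_const) (simp add: filterlim_at)
    show "\<forall>\<^sub>F n in sequentially. a + anx n s \<in> {a + max 0 s<..} - {a + max 0 s}"
      using anx_bounds by auto
  qed
  ultimately show ?thesis by (rule filterlim_compose)
qed

text \<open>The path frozen at its starting value for negative times, so that it is a Borel function
  on the whole line.\<close>

definition Xp :: "'a \<Rightarrow> real \<Rightarrow> real" where
  "Xp \<omega> s = X (max 0 s) \<omega>"

lemma Xp_measurable:
  assumes [measurable]: "f \<in> borel_measurable M" "g \<in> measurable M Px"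
  shows "(\<lambda>x. Xp (g x) (f x)) \<in> borel_measurable M"
proof (rule borel_measurable_LIMSEQ_real)
  show "(\<lambda>n. X (anx n (f x)) (g x)) \<longlonglongrightarrow> Xp (g x) (f x)" if "x \<in> space M" for x
    using X_anx[of "g x" 0 "f x"] measurable_space[OF assms(2) that] by (simp add: Xp_def)
  show "(\<lambda>x. X (anx n (f x)) (g x)) \<in> borel_measurable M" for n
    unfolding anx_def
    by (rule measurable_compose_countable[where f = "\<lambda>k x. X (real (k + 1) / real (Suc n)) (g x)"
        and g = "\<lambda>x. nat \<lfloor>real (Suc n) * max 0 (f x)\<rfloor>"]) measurable
qed

lemma Xp_path_measurable: "\<omega> \<in> space Px \<Longrightarrow> Xp \<omega> \<in> borel_measurable borel"
  using Xp_measurable[of "\<lambda>s. s" borel "\<lambda>_. \<omega>"] by simp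

text \<open>The prescribed characteristic function of an increment depends only on the length of the
  time interval.\<close>

lemma increment_distr:
  assumes "0 \<le> s" "s \<le> t" "0 \<le> s'" "s' \<le> t'" "t - s = t' - s'"
  shows "distr Px borel (\<lambda>\<omega>. X t \<omega> - X s \<omega>) = distr Px borel (\<lambda>\<omega>. X t' \<omega> - X s' \<omega>)"
proof (rule Levy_uniqueness)
  show "char (distr Px borel (\<lambda>\<omega>. X t \<omega> - X s \<omega>)) = char (distr Px borel (\<lambda>\<omega>. X t' \<omega> - X s' \<omega>))"
    using stable_process assms unfolding stable_process_def by (auto simp: fun_eq_iff)
qed (auto intro!: real_distribution_distr)

text \<open>The path after time \<open>a\<close> relative to its value at \<open>a\<close>; the value itself is stored at index \<open>-1\<close>.\<close>

definition after :: "real \<Rightarrow> 'a \<Rightarrow> real \<Rightarrow> real" where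
  "after a \<omega> = (\<lambda>i\<in>idx. if i = -1 then X a \<omega> else X (a + i) \<omega> - X a \<omega>)"

definition restart :: "real \<Rightarrow> 'a \<times> 'a \<Rightarrow> real \<Rightarrow> real" where
  "restart a p = (\<lambda>i\<in>idx. if i = -1 then X a (fst p) else X i (snd p))"

lemma after_measurable [measurable]: "after a \<in> measurable Px paths"
  unfolding after_def[abs_def] by (rule measurable_restrict) measurable

lemma restart_measurable [measurable]: "restart a \<in> measurable (Px \<Otimes>\<^sub>M Px) paths"
  unfolding restart_def[abs_def] by (rule measurable_restrict) measurable

lemma after_start: "after a \<omega> (-1) = X a \<omega>"
  by (simp add: after_def)

lemma restart_start: "restart a p (-1) = X a (fst p)"
  by (simp add: restart_def)

lemma ev_after: "\<omega> \<in> space Px \<Longrightarrow> 0 \<le> a \<Longrightarrow> ev s (after a \<omega>) = X (a + max 0 s) \<omega> - X a \<omega>"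
proof -
  assume \<omega>: "\<omega> \<in> space Px" and a: "0 \<le> a"
  have "after a \<omega> (anx n s) = X (a + anx n s) \<omega> - X a \<omega>" for n
    using anx_nonneg[of n s] by (simp add: after_def)
  then have "(\<lambda>n. after a \<omega> (anx n s)) \<longlonglongrightarrow> X (a + max 0 s) \<omega> - X a \<omega>"
    using X_anx[OF \<omega> a, of s] by (auto intro!: tendsto_intros)
  then show ?thesis unfolding ev_def by (rule limI)
qed

lemma ev_restart: "p \<in> space (Px \<Otimes>\<^sub>M Px) \<Longrightarrow> ev s (restart a p) = Xp (snd p) s"
proof -
  assume p: "p \<in> space (Px \<Otimes>\<^sub>M Px)"
  have "restart a p (anx n s) = X (anx n s) (snd p)" for n
    using anx_nonneg[of n s] by (simp add: restart_def)
  then have "(\<lambda>n. restart a p (anx n s)) \<longlonglongrightarrow> Xp (snd p) s"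
    using X_anx[of "snd p" 0 s] p by (auto simp: Xp_def space_pair_measure)
  then show ?thesis unfolding ev_def by (rule limI)
qed

text \<open>Independence is applied to the increments over the grid consisting of 0,
  \<open>a\<close> and the points \<open>a + j\<close>. The first increment is \<open>X a\<close>,
  the others determine the shifted path, and by stationarity their joint law is the one for
  \<open>a = 0\<close>.\<close>

lemma Markov_finite_nonempty:
  assumes J: "finite J" "J \<subseteq> {0..}" "J \<noteq> {}" and A[measurable]: "\<And>j. A j \<in> sets borel" "A0 \<in> sets borel" and a: "0 \<le> a"
  shows "prob {\<omega>\<in>space Px. X a \<omega> \<in> A0 \<and> (\<forall>j\<in>J. X (a + j) \<omega> - X a \<omega> \<in> A j)}
    = prob {\<omega>\<in>space Px. X a \<omega> \<in> A0} * prob {\<omega>\<in>space Px. \<forall>j\<in>J. X j \<omega> \<in> A j}"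
proof -
  define l where "l = sorted_list_of_set J"
  define n where "n = length l"
  define ts where "ts = (\<lambda>i. case i of 0 \<Rightarrow> 0 | Suc i \<Rightarrow> l ! i)"
  have l: "set l = J" "sorted l" using J by (auto simp: l_def)
  have n: "0 < n" using J l(1) by (auto simp: n_def)
  have ts0: "0 \<le> ts i" if "i \<le> n" for i
    using that l J by (cases i) (auto simp: ts_def n_def)
  have mono: "ts i \<le> ts (Suc i)" if "i < n" for i
    using that l J by (cases i) (auto simp: ts_def n_def sorted_iff_nth_Suc)
  \<comment> \<open>The grid begins with 0 and \<open>a\<close>, so increment 0 is
    \<open>X a\<close> and the increments with index at least 1 lie after time
    \<open>a\<close>.\<close>
  define u where "u = (\<lambda>a i. case i of 0 \<Rightarrow> 0 | Suc i \<Rightarrow> a + ts i)"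
  define D where "D = (\<lambda>a i \<omega>. X (u a (Suc i)) \<omega> - X (u a i) \<omega>)"
  have u_mono: "u a i \<le> u a (Suc i)" if "i < Suc n" "0 \<le> a" for a i
    using that mono by (cases i) (auto simp: u_def ts_def)
  have u_nonneg: "0 \<le> u a i" if "i \<le> Suc n" "0 \<le> a" for a i
    using that ts0 by (cases i) (auto simp: u_def)
  have indep: "indep_vars (\<lambda>_. borel) (D a) {..<Suc n}" if "0 \<le> a" for a
  proof -
    have "0 \<le> u a 0 \<and> (\<forall>i<Suc n. u a i \<le> u a (Suc i))"
      using u_mono[OF _ that] by (simp add: u_def)
    then show ?thesis using stable_process unfolding stable_process_def D_def by blast
  qed
  have D_meas[measurable]: "D a i \<in> borel_measurable Px" for a i by (simp add: D_def)
  let ?I = "{Suc 0..<Suc n}"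
  have law: "distr Px borel (D a i) = distr Px borel (D 0 i)" if i: "i \<in> ?I" and that: "0 \<le> a" for i a
  proof (unfold D_def, rule increment_distr)
    obtain i' where i': "i = Suc i'" using i by (cases i) auto
    show "0 \<le> u a i" "0 \<le> u 0 i" using that i by (auto intro!: u_nonneg)
    show "u a i \<le> u a (Suc i)" "u 0 i \<le> u 0 (Suc i)" using that i by (auto intro!: u_mono)
    show "u a (Suc i) - u a i = u 0 (Suc i) - u 0 i" by (simp add: u_def i')
  qed
  have sumD: "(\<Sum>i\<in>{Suc 0..<Suc (Suc k)}. D a i \<omega>) = X (a + l ! k) \<omega> - X a \<omega>" if "k < n" for a k \<omega>
  proof -
    have "(\<Sum>i\<in>{Suc 0..<Suc m}. D a i \<omega>) = X (u a (Suc m)) \<omega> - X a \<omega>" for m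
      by (induction m) (auto simp: D_def u_def ts_def)
    from this[of "Suc k"] show ?thesis by (simp add: u_def ts_def)
  qed
  \<comment> \<open>The event about the shifted path, expressed in increments: positions are their
    partial sums.\<close>
  define B where "B = {d \<in> space (\<Pi>\<^sub>M i\<in>?I. (borel :: real measure)). \<forall>k\<in>{..<n}. (\<Sum>i\<in>{Suc 0..<Suc (Suc k)}. d i) \<in> A (l ! k)}"
  have B[measurable]: "B \<in> sets (\<Pi>\<^sub>M i\<in>?I. (borel :: real measure))"
    unfolding B_def
  proof (rule sets.sets_Collect_finite_All)
    fix k assume "k \<in> {..<n}"
    then have "(\<lambda>d. \<Sum>i\<in>{Suc 0..<Suc (Suc k)}. d i) \<in> borel_measurable (\<Pi>\<^sub>M i\<in>?I. (borel :: real measure))"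
      by (intro borel_measurable_sum measurable_component_singleton) auto
    from measurable_sets[OF this A(1), of "l ! k"]
    show "{d \<in> space (\<Pi>\<^sub>M i\<in>?I. (borel :: real measure)). (\<Sum>i\<in>{Suc 0..<Suc (Suc k)}. d i) \<in> A (l ! k)} \<in> sets (\<Pi>\<^sub>M i\<in>?I. borel)"
      by (simp add: vimage_def Int_def conj_commute)
  qed simp
  have inB: "(\<lambda>i\<in>?I. D a i \<omega>) \<in> B \<longleftrightarrow> (\<forall>j\<in>J. X (a + j) \<omega> - X a \<omega> \<in> A j)" for a \<omega>
  proof -
    have "(\<Sum>i\<in>{Suc 0..<Suc (Suc k)}. (\<lambda>i\<in>?I. D a i \<omega>) i) = X (a + l ! k) \<omega> - X a \<omega>" if "k < n" for k
      using sumD[OF that, of a \<omega>] that by (subst sum.cong[of _ _ _ "\<lambda>i. D a i \<omega>"]) auto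
    moreover have "(\<lambda>i\<in>?I. D a i \<omega>) \<in> space (\<Pi>\<^sub>M i\<in>?I. (borel :: real measure))"
      by (simp add: space_PiM)
    ultimately have "(\<lambda>i\<in>?I. D a i \<omega>) \<in> B \<longleftrightarrow> (\<forall>k<n. X (a + l ! k) \<omega> - X a \<omega> \<in> A (l ! k))"
      unfolding B_def mem_Collect_eq by (metis lessThan_iff)
    also have "\<dots> \<longleftrightarrow> (\<forall>j\<in>J. X (a + j) \<omega> - X a \<omega> \<in> A j)"
      unfolding l(1)[symmetric] n_def all_set_conv_all_nth ..
    finally show ?thesis .
  qed
  have PB: "prob {\<omega>\<in>space Px. \<forall>j\<in>J. X (a + j) \<omega> - X a \<omega> \<in> A j} = measure (\<Pi>\<^sub>M i\<in>?I. distr Px borel (D 0 i)) B"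
    if a: "0 \<le> a" for a
  proof -
    have "prob {\<omega>\<in>space Px. \<forall>j\<in>J. X (a + j) \<omega> - X a \<omega> \<in> A j}
      = measure (distr Px (\<Pi>\<^sub>M i\<in>?I. borel) (\<lambda>\<omega>. \<lambda>i\<in>?I. D a i \<omega>)) B"
      by (subst measure_distr) (auto simp: inB[symmetric] vimage_def Int_def conj_commute)
    also have "distr Px (\<Pi>\<^sub>M i\<in>?I. borel) (\<lambda>\<omega>. \<lambda>i\<in>?I. D a i \<omega>) = (\<Pi>\<^sub>M i\<in>?I. distr Px borel (D a i))"
      using indep_vars_iff_distr_eq_PiM[where I = ?I and M' = "\<lambda>_. borel" and X = "D a"] indep_vars_subset[OF indep[OF a], of ?I] n
      by (auto simp: subset_eq)
    also have "\<dots> = (\<Pi>\<^sub>M i\<in>?I. distr Px borel (D 0 i))"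
      by (intro PiM_cong law a) auto
    finally show ?thesis .
  qed
  have iv: "indep_var (\<Pi>\<^sub>M i\<in>{0}. borel) (\<lambda>\<omega>. restrict (\<lambda>i. D a i \<omega>) {0}) (\<Pi>\<^sub>M i\<in>?I. borel) (\<lambda>\<omega>. restrict (\<lambda>i. D a i \<omega>) ?I)"
    by (rule indep_var_restrict[OF indep[OF a]]) auto
  have D0: "D a 0 \<omega> = X a \<omega>" if "\<omega> \<in> space Px" for \<omega>
    using X_zero[OF that] by (simp add: D_def u_def ts_def)
  define A0' where "A0' = {d \<in> space (\<Pi>\<^sub>M i\<in>{0::nat}. (borel :: real measure)). d 0 \<in> A0}"
  have A0'[measurable]: "A0' \<in> sets (\<Pi>\<^sub>M i\<in>{0}. (borel :: real measure))"
    unfolding A0'_def by measurable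
  have "prob ((\<lambda>\<omega>. (restrict (\<lambda>i. D a i \<omega>) {0}, restrict (\<lambda>i. D a i \<omega>) ?I)) -` (A0' \<times> B) \<inter> space Px)
    = prob ((\<lambda>\<omega>. restrict (\<lambda>i. D a i \<omega>) {0}) -` A0' \<inter> space Px) * prob ((\<lambda>\<omega>. restrict (\<lambda>i. D a i \<omega>) ?I) -` B \<inter> space Px)"
    by (rule indep_varD[OF iv A0' B])
  moreover have "(\<lambda>\<omega>. restrict (\<lambda>i. D a i \<omega>) {0}) -` A0' \<inter> space Px = {\<omega>\<in>space Px. X a \<omega> \<in> A0}"
    unfolding A0'_def by (auto simp: space_PiM D0)
  moreover have "(\<lambda>\<omega>. restrict (\<lambda>i. D a i \<omega>) ?I) -` B \<inter> space Px = {\<omega>\<in>space Px. \<forall>j\<in>J. X (a + j) \<omega> - X a \<omega> \<in> A j}"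
    using inB by auto
  moreover have "(\<lambda>\<omega>. (restrict (\<lambda>i. D a i \<omega>) {0}, restrict (\<lambda>i. D a i \<omega>) ?I)) -` (A0' \<times> B) \<inter> space Px
    = {\<omega>\<in>space Px. X a \<omega> \<in> A0 \<and> (\<forall>j\<in>J. X (a + j) \<omega> - X a \<omega> \<in> A j)}"
    unfolding A0'_def using inB by (auto simp: space_PiM D0)
  moreover have "prob {\<omega>\<in>space Px. \<forall>j\<in>J. X (a + j) \<omega> - X a \<omega> \<in> A j} = prob {\<omega>\<in>space Px. \<forall>j\<in>J. X j \<omega> \<in> A j}"
  proof -
    have "prob {\<omega>\<in>space Px. \<forall>j\<in>J. X j \<omega> \<in> A j} = prob {\<omega>\<in>space Px. \<forall>j\<in>J. X (0 + j) \<omega> - X 0 \<omega> \<in> A j}"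
      using X_zero by (intro arg_cong[where f = prob]) auto
    then show ?thesis using PB[OF a] PB[of 0] by simp
  qed
  ultimately show ?thesis by simp
qed

lemma Markov_finite:
  assumes J: "finite J" "J \<subseteq> {0..}" and A: "\<And>j. A j \<in> sets borel" "A0 \<in> sets borel" and a: "0 \<le> a"
  shows "prob {\<omega>\<in>space Px. X a \<omega> \<in> A0 \<and> (\<forall>j\<in>J. X (a + j) \<omega> - X a \<omega> \<in> A j)}
    = prob {\<omega>\<in>space Px. X a \<omega> \<in> A0} * prob {\<omega>\<in>space Px. \<forall>j\<in>J. X j \<omega> \<in> A j}"
  using Markov_finite_nonempty[OF J _ A a] by (cases "J = {}") (auto simp: prob_space)

text \<open>Finite measures on the product are determined by finitely many coordinates, where
  \<open>Markov_finite\<close> applies. Equality of the laws of entire paths is what permits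
  restarting a functional that integrates along the path.\<close>

lemma Markov:
  assumes a: "0 \<le> a"
  shows "distr Px paths (after a) = distr (Px \<Otimes>\<^sub>M Px) paths (restart a)"
proof (rule measure_eqI_PiM_infinite)
  interpret PP: pair_prob_space Px Px ..
  show "finite_measure (distr Px paths (after a))"
    by (intro prob_space.finite_measure prob_space_distr) measurable
  fix A :: "real \<Rightarrow> real set" and J
  assume J: "finite J" "J \<subseteq> idx" and A: "\<And>i. i \<in> J \<Longrightarrow> A i \<in> sets borel"
  let ?E = "prod_emb idx (\<lambda>_. borel) J (Pi\<^sub>E J A)"
  have E[measurable]: "?E \<in> sets paths" using J A by (intro sets_PiM_I) auto
  define J' where "J' = J - {-1}"
  \<comment> \<open>Coordinates outside \<open>J\<close> are left unconstrained; this covers the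
    case that the start value, index -1, does not occur in \<open>J\<close>.\<close>
  define A' where "A' = (\<lambda>j. if j \<in> J then A j else UNIV)"
  have A': "A' j \<in> sets borel" for j using A by (simp add: A'_def)
  have J': "finite J'" "J' \<subseteq> {0..}" using J by (auto simp: J'_def)
  have mem: "w \<in> ?E \<longleftrightarrow> w (-1) \<in> A' (-1) \<and> (\<forall>j\<in>J'. w j \<in> A' j)" if "w \<in> space paths" for w
    using that J by (auto simp: prod_emb_def space_PiM PiE_iff J'_def A'_def)
  have sp: "after a \<omega> \<in> space paths" "restart a p \<in> space paths" for \<omega> p
    by (auto simp: after_def restart_def space_PiM)
  have "emeasure (distr Px paths (after a)) ?E = emeasure Px (after a -` ?E \<inter> space Px)"
    by (rule emeasure_distr) measurable
  also have "after a -` ?E \<inter> space Px = {\<omega>\<in>space Px. X a \<omega> \<in> A' (-1) \<and> (\<forall>j\<in>J'. X (a + j) \<omega> - X a \<omega> \<in> A' j)}"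
  proof -
    have "after a \<omega> \<in> ?E \<longleftrightarrow> X a \<omega> \<in> A' (-1) \<and> (\<forall>j\<in>J'. X (a + j) \<omega> - X a \<omega> \<in> A' j)" for \<omega>
      unfolding mem[OF sp(1)] using J'(2) by (auto simp: after_def)
    then show ?thesis by auto
  qed
  also have "emeasure Px \<dots> = ennreal (prob {\<omega>\<in>space Px. X a \<omega> \<in> A' (-1)} * prob {\<omega>\<in>space Px. \<forall>j\<in>J'. X j \<omega> \<in> A' j})"
    using Markov_finite[OF J' A' A' a] by (simp add: emeasure_eq_measure)
  also have "\<dots> = emeasure (Px \<Otimes>\<^sub>M Px) ({\<omega>\<in>space Px. X a \<omega> \<in> A' (-1)} \<times> {\<omega>\<in>space Px. \<forall>j\<in>J'. X j \<omega> \<in> A' j})"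
  proof (subst emeasure_pair_measure_Times)
    note [measurable] = A'
    show "{\<omega> \<in> space Px. X a \<omega> \<in> A' (- 1)} \<in> sets Px" by measurable
    show "{\<omega> \<in> space Px. \<forall>j\<in>J'. X j \<omega> \<in> A' j} \<in> sets Px"
      using J'(1) by measurable
  qed (simp add: emeasure_eq_measure ennreal_mult')
  also have "{\<omega>\<in>space Px. X a \<omega> \<in> A' (-1)} \<times> {\<omega>\<in>space Px. \<forall>j\<in>J'. X j \<omega> \<in> A' j} = restart a -` ?E \<inter> space (Px \<Otimes>\<^sub>M Px)"
  proof -
    have "restart a p \<in> ?E \<longleftrightarrow> X a (fst p) \<in> A' (-1) \<and> (\<forall>j\<in>J'. X j (snd p) \<in> A' j)" for p
      unfolding mem[OF sp(2)] using J'(2) by (auto simp: restart_def)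
    then show ?thesis by (auto simp: space_pair_measure)
  qed
  also have "emeasure (Px \<Otimes>\<^sub>M Px) \<dots> = emeasure (distr (Px \<Otimes>\<^sub>M Px) paths (restart a)) ?E"
    by (rule emeasure_distr[symmetric]) measurable
  finally show "emeasure (distr Px paths (after a)) ?E = emeasure (distr (Px \<Otimes>\<^sub>M Px) paths (restart a)) ?E" .
qed simp_all

lemma Markov_integral:
  fixes G :: "(real \<Rightarrow> real) \<Rightarrow> real"
  assumes a: "0 \<le> a" and [measurable]: "G \<in> borel_measurable paths"
  shows "(\<integral>\<omega>. G (after a \<omega>) \<partial>Px) = (\<integral>p. G (restart a p) \<partial>(Px \<Otimes>\<^sub>M Px))"
proof -
  have "(\<integral>\<omega>. G (after a \<omega>) \<partial>Px) = (\<integral>w. G w \<partial>distr Px paths (after a))" by (rule integral_distr[symmetric]) measurable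
  also have "\<dots> = (\<integral>p. G (restart a p) \<partial>(Px \<Otimes>\<^sub>M Px))" unfolding Markov[OF a] by (rule integral_distr) measurable
  finally show ?thesis .
qed

end

subsection \<open>The density of the stable process\<close>

text \<open>Domination by a multiple of \<open>1 / (1 + \<xi>^2)\<close>: for
  \<open>n * \<alpha> \<ge> 2\<close> the bound \<open>z^n / n! \<le> exp z\<close> gives decay of
  order at least 2.\<close>

lemma integrable_exp_powr:
  fixes k \<alpha> :: real
  assumes k: "0 < k" and \<alpha>: "0 < \<alpha>"
  shows "integrable lborel (\<lambda>\<xi>. exp (- (k * \<bar>\<xi>\<bar> powr \<alpha>)))"
proof -
  obtain n :: nat where n: "2 / \<alpha> < real n" using reals_Archimedean2 by blast
  then have n2: "2 \<le> real n * \<alpha>" using \<alpha> by (simp add: field_simps)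
  \<comment> \<open>The 2 serves for \<open>|\<xi>| \<le> 1\<close>; outside,
    \<open>1 + \<xi>^2 \<le> 2 * \<xi>^2\<close> accounts for the factor of
    \<open>n! / k^n\<close>.\<close>
  define C where "C = 2 + 2 * (fact n / k ^ n :: real)"
  have C: "C \<ge> 0" "C \<ge> 2" using k by (auto simp: C_def)
  show ?thesis
  proof (rule Bochner_Integration.integrable_bound)
    have "integrable lborel (\<lambda>x::real. inverse (1 + x\<^sup>2))"
      using integrable_inverse_1_plus_square by (simp add: set_integrable_def)
    then show "integrable lborel (\<lambda>x::real. C * inverse (1 + x\<^sup>2))" by simp
    show "AE \<xi> in lborel. norm (exp (- (k * \<bar>\<xi>\<bar> powr \<alpha>))) \<le> norm (C * inverse (1 + \<xi>\<^sup>2))"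
    proof (rule AE_I2)
      fix \<xi> :: real
      have p: "0 < 1 + \<xi>\<^sup>2" by (simp add: add_pos_nonneg)
      have "exp (- (k * \<bar>\<xi>\<bar> powr \<alpha>)) * (1 + \<xi>\<^sup>2) \<le> C"
      proof (cases "\<bar>\<xi>\<bar> \<le> 1")
        case True
        then have "\<xi>\<^sup>2 \<le> 1" using power_mono[of "\<bar>\<xi>\<bar>" 1 2] by simp
        moreover have "exp (- (k * \<bar>\<xi>\<bar> powr \<alpha>)) \<le> 1" using k by simp
        ultimately have "exp (- (k * \<bar>\<xi>\<bar> powr \<alpha>)) * (1 + \<xi>\<^sup>2) \<le> 1 * 2" by (intro mult_mono) auto
        then show ?thesis using C by simp
      next
        case False
        let ?z = "k * \<bar>\<xi>\<bar> powr \<alpha>"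
        have z: "0 < ?z" using k False by auto
        have "(\<Sum>k\<in>{n}. ?z ^ k /\<^sub>R fact k) \<le> exp ?z"
          unfolding exp_def using z by (intro sum_le_suminf summable_exp_generic) auto
        then have "?z ^ n / fact n \<le> exp ?z" by (simp add: divide_inverse mult.commute)
        then have "exp (- ?z) \<le> fact n / ?z ^ n"
        proof -
          have "inverse E \<le> F / A" if "A / F \<le> E" "0 < A" "0 < F" "0 < E" for A E F :: real
            using that by (simp add: field_simps)
          from this[of "?z ^ n" "fact n" "exp ?z"] show ?thesis
            using z \<open>?z ^ n / fact n \<le> exp ?z\<close> zero_less_power[OF z, of n] by (simp add: exp_minus)
        qed
        also have "?z ^ n = k ^ n * \<bar>\<xi>\<bar> powr (real n * \<alpha>)"
          using False by (simp add: power_mult_distrib powr_powr[symmetric] powr_realpow mult.commute)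
        finally have "exp (- ?z) \<le> fact n / (k ^ n * \<bar>\<xi>\<bar> powr (real n * \<alpha>))" .
        moreover have "\<xi>\<^sup>2 \<le> \<bar>\<xi>\<bar> powr (real n * \<alpha>)"
          using powr_mono[OF n2, of "\<bar>\<xi>\<bar>"] False by simp
        ultimately have "exp (- ?z) \<le> fact n / (k ^ n * \<xi>\<^sup>2)"
          using k False by (elim order_trans) (intro divide_left_mono mult_left_mono mult_pos_pos, auto)
        then have "exp (- ?z) * (1 + \<xi>\<^sup>2) \<le> fact n / (k ^ n * \<xi>\<^sup>2) * (2 * \<xi>\<^sup>2)"
        proof (intro mult_mono)
          show "1 + \<xi>\<^sup>2 \<le> 2 * \<xi>\<^sup>2" using False power_mono[of 1 "\<bar>\<xi>\<bar>" 2] by simp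
        qed (use k in auto)
        also have "\<dots> = 2 * (fact n / k ^ n)" using False k by (auto simp: field_simps)
        finally show ?thesis by (simp add: C_def)
      qed
      then have "exp (- (k * \<bar>\<xi>\<bar> powr \<alpha>)) \<le> C / (1 + \<xi>\<^sup>2)" using p by (simp add: field_simps)
      then show "norm (exp (- (k * \<bar>\<xi>\<bar> powr \<alpha>))) \<le> norm (C * inverse (1 + \<xi>\<^sup>2))"
        using C p by (simp add: divide_inverse abs_mult)
    qed
  qed measurable
qed

lemma g_alpha_measurable [measurable]:
  assumes [measurable]: "f \<in> borel_measurable M" "h \<in> borel_measurable M"
  shows "(\<lambda>x. g_alpha c \<alpha> (f x) (h x)) \<in> borel_measurable M"
  unfolding g_alpha_def by measurable

lemma g_alpha_minus: "g_alpha c \<alpha> t (- x) = g_alpha c \<alpha> t x"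
  by (simp add: g_alpha_def)

section \<open>Fourier inversion by Gaussian smoothing\<close>

lemma heat_cos_transform:
  assumes \<sigma>: "0 < \<sigma>"
  shows "integrable lborel (\<lambda>\<xi>. exp (- (\<sigma>\<^sup>2 * \<xi>\<^sup>2) / 2))"
    "heat (\<sigma>\<^sup>2) u = 1 / (2 * pi) * (\<integral>\<xi>. cos (\<xi> * u) * exp (- (\<sigma>\<^sup>2 * \<xi>\<^sup>2) / 2) \<partial>lborel)"
proof -
  have n: "exp (- (\<sigma>\<^sup>2 * \<xi>\<^sup>2) / 2) = sqrt (2 * pi) / \<sigma> * normal_density 0 (1 / \<sigma>) \<xi>" for \<xi>
    using \<sigma> by (simp add: normal_density_def real_sqrt_divide real_sqrt_mult field_simps)
  show "integrable lborel (\<lambda>\<xi>. exp (- (\<sigma>\<^sup>2 * \<xi>\<^sup>2) / 2))"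
    unfolding n using \<sigma> by simp
  have "(\<integral>\<xi>. cos (\<xi> * u) * exp (- (\<sigma>\<^sup>2 * \<xi>\<^sup>2) / 2) \<partial>lborel)
    = 1 / \<sigma> * (\<integral>z. cos (z * (u / \<sigma>)) * exp (- z\<^sup>2 / 2) \<partial>lborel)"
    using lborel_integral_real_affine[of "1 / \<sigma>" "\<lambda>\<xi>. cos (\<xi> * u) * exp (- (\<sigma>\<^sup>2 * \<xi>\<^sup>2) / 2)" 0] \<sigma>
    by (simp add: power_divide)
  also have "(\<integral>z. cos (z * (u / \<sigma>)) * exp (- z\<^sup>2 / 2) \<partial>lborel) = sqrt (2 * pi) * (\<integral>z. cos (z * (u / \<sigma>)) \<partial>std_normal_distribution)"
    by (subst integral_density) (auto simp: normal_density_def field_simps)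
  also have "(\<integral>z. cos (z * (u / \<sigma>)) \<partial>std_normal_distribution) = Re (char std_normal_distribution (u / \<sigma>))"
  proof -
    interpret N: real_distribution std_normal_distribution by (rule real_dist_normal_dist)
    have "Re (char std_normal_distribution (u / \<sigma>)) = (\<integral>z. Re (iexp (u / \<sigma> * z)) \<partial>std_normal_distribution)"
      unfolding char_def by (intro integral_Re[symmetric] N.integrable_iexp) auto
    then show ?thesis by (simp add: Re_exp mult.commute)
  qed
  also have "\<dots> = exp (- (u / \<sigma>)\<^sup>2 / 2)" by (simp add: char_std_normal_distribution)
  finally have I: "(\<integral>\<xi>. cos (\<xi> * u) * exp (- (\<sigma>\<^sup>2 * \<xi>\<^sup>2) / 2) \<partial>lborel) = 1 / \<sigma> * (sqrt (2 * pi) * exp (- (u / \<sigma>)\<^sup>2 / 2))" .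
  have "sqrt (2 * pi) * sqrt (2 * pi) = 2 * pi" by simp
  then show "heat (\<sigma>\<^sup>2) u = 1 / (2 * pi) * (\<integral>\<xi>. cos (\<xi> * u) * exp (- (\<sigma>\<^sup>2 * \<xi>\<^sup>2) / 2) \<partial>lborel)"
    unfolding I heat_def using \<sigma> by (simp add: real_sqrt_mult power_divide field_simps)
qed

context
  fixes \<mu> :: "real measure" and \<phi> :: "real \<Rightarrow> real" and g :: "real \<Rightarrow> real"
  assumes \<mu>: "real_distribution \<mu>" and ch: "\<And>\<xi>. char \<mu> \<xi> = complex_of_real (\<phi> \<xi>)"
    and \<phi>_int: "integrable lborel \<phi>" and \<phi>_nonneg: "\<And>\<xi>. 0 \<le> \<phi> \<xi>"
    and g_def: "\<And>x. g x = 1 / (2 * pi) * (\<integral>\<xi>. cos (\<xi> * x) * \<phi> \<xi> \<partial>lborel)"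
begin

interpretation \<mu>: real_distribution \<mu> by (rule \<mu>)

text \<open>The density of \<mu> convolved with the centred normal law of standard deviation
  \<sigma>.\<close>

private definition gs :: "real \<Rightarrow> real \<Rightarrow> real" where
  "gs \<sigma> x = (\<integral>y. heat (\<sigma>\<^sup>2) (x - y) \<partial>\<mu>)"

private lemma \<phi>_measurable: "\<phi> \<in> borel_measurable borel"
  using borel_measurable_integrable[OF \<phi>_int] by simp

private lemma g_measurable: "g \<in> borel_measurable borel"
proof -
  note [measurable] = \<phi>_measurable
  show ?thesis unfolding g_def[abs_def] by measurable
qed

private lemma integral_cos_shift: "(\<integral>y. cos (\<xi> * (x - y)) \<partial>\<mu>) = cos (\<xi> * x) * \<phi> \<xi>"
proof -
  have i: "integrable \<mu> (\<lambda>y. cos (\<xi> * y))" "integrable \<mu> (\<lambda>y. sin (\<xi> * y))"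
    by (auto intro!: \<mu>.integrable_const_bound[where B = 1])
  have "Re (char \<mu> \<xi>) = (\<integral>y. Re (iexp (\<xi> * y)) \<partial>\<mu>)" "Im (char \<mu> \<xi>) = (\<integral>y. Im (iexp (\<xi> * y)) \<partial>\<mu>)"
    unfolding char_def by (auto intro!: integral_Re[symmetric] integral_Im[symmetric] \<mu>.integrable_iexp)
  then have e: "(\<integral>y. cos (\<xi> * y) \<partial>\<mu>) = \<phi> \<xi>" "(\<integral>y. sin (\<xi> * y) \<partial>\<mu>) = 0"
    by (auto simp: ch Re_exp Im_exp)
  have "(\<integral>y. cos (\<xi> * (x - y)) \<partial>\<mu>) = (\<integral>y. cos (\<xi> * x) * cos (\<xi> * y) + sin (\<xi> * x) * sin (\<xi> * y) \<partial>\<mu>)"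
    by (simp add: right_diff_distrib cos_diff)
  then show ?thesis using i by (simp add: e)
qed

text \<open>The Gaussian is written as a Fourier integral, and Fubini brings in the characteristic
  function of \<mu>; the Gaussian factor makes the double integral absolutely convergent.\<close>

private lemma gs_eq: "0 < \<sigma> \<Longrightarrow> gs \<sigma> x = 1 / (2 * pi) * (\<integral>\<xi>. cos (\<xi> * x) * \<phi> \<xi> * exp (- (\<sigma>\<^sup>2 * \<xi>\<^sup>2) / 2) \<partial>lborel)"
proof -
  note [measurable] = \<phi>_measurable g_measurable
  assume \<sigma>: "0 < \<sigma>"
  interpret P: pair_sigma_finite lborel \<mu> ..
  have i: "integrable (lborel \<Otimes>\<^sub>M \<mu>) (\<lambda>(\<xi>, y). cos (\<xi> * (x - y)) * exp (- (\<sigma>\<^sup>2 * \<xi>\<^sup>2) / 2))"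
  proof (rule Bochner_Integration.integrable_bound)
    show "integrable (lborel \<Otimes>\<^sub>M \<mu>) (\<lambda>p. exp (- (\<sigma>\<^sup>2 * (fst p)\<^sup>2) / 2))"
      using heat_cos_transform(1)[OF \<sigma>]
      by (intro P.Fubini_integrable) (auto simp: \<mu>.prob_space)
  qed (auto intro!: AE_I2 mult_left_le_one_le simp: abs_mult)
  have "gs \<sigma> x = (\<integral>y. 1 / (2 * pi) * (\<integral>\<xi>. cos (\<xi> * (x - y)) * exp (- (\<sigma>\<^sup>2 * \<xi>\<^sup>2) / 2) \<partial>lborel) \<partial>\<mu>)"
    unfolding gs_def heat_cos_transform(2)[OF \<sigma>] ..
  also have "\<dots> = 1 / (2 * pi) * (\<integral>\<xi>. (\<integral>y. cos (\<xi> * (x - y)) * exp (- (\<sigma>\<^sup>2 * \<xi>\<^sup>2) / 2) \<partial>\<mu>) \<partial>lborel)"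
    using P.Fubini_integral[OF i] by simp
  finally show ?thesis by (simp add: integral_cos_shift)
qed

private lemma gs_nonneg: "0 \<le> gs \<sigma> x"
  unfolding gs_def by (intro Bochner_Integration.integral_nonneg heat_nonneg) auto

private lemma gs_bound: "0 < \<sigma> \<Longrightarrow> gs \<sigma> x \<le> 1 / (2 * pi) * (\<integral>\<xi>. \<phi> \<xi> \<partial>lborel)"
proof -
  note [measurable] = \<phi>_measurable g_measurable
  assume \<sigma>: "0 < \<sigma>"
  have le: "\<bar>cos (\<xi> * x) * \<phi> \<xi> * exp (- (\<sigma>\<^sup>2 * \<xi>\<^sup>2) / 2)\<bar> \<le> \<phi> \<xi>" for \<xi>
  proof -
    have "\<bar>cos (\<xi> * x)\<bar> * \<phi> \<xi> * exp (- (\<sigma>\<^sup>2 * \<xi>\<^sup>2) / 2) \<le> 1 * \<phi> \<xi> * 1"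
      using \<phi>_nonneg by (intro mult_mono) auto
    then show ?thesis using \<phi>_nonneg by (simp add: abs_mult)
  qed
  have "(\<integral>\<xi>. cos (\<xi> * x) * \<phi> \<xi> * exp (- (\<sigma>\<^sup>2 * \<xi>\<^sup>2) / 2) \<partial>lborel) \<le> (\<integral>\<xi>. \<phi> \<xi> \<partial>lborel)"
  proof (rule integral_mono[OF _ \<phi>_int])
    show "integrable lborel (\<lambda>\<xi>. cos (\<xi> * x) * \<phi> \<xi> * exp (- (\<sigma>\<^sup>2 * \<xi>\<^sup>2) / 2))"
      by (rule Bochner_Integration.integrable_bound[OF \<phi>_int]) (use le \<phi>_nonneg in auto)
    show "cos (\<xi> * x) * \<phi> \<xi> * exp (- (\<sigma>\<^sup>2 * \<xi>\<^sup>2) / 2) \<le> \<phi> \<xi>" for \<xi>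
      using le[of \<xi>] by linarith
  qed
  then show ?thesis unfolding gs_eq[OF \<sigma>] by (intro mult_left_mono) auto
qed

private definition sg :: "nat \<Rightarrow> real" where "sg n = 1 / real (Suc n)"

private lemma sg: "0 < sg n" "sg \<longlonglongrightarrow> 0"
  unfolding sg_def[abs_def] by (simp, real_asymp)

private lemma gs_tendsto: "(\<lambda>n. gs (sg n) x) \<longlonglongrightarrow> g x"
proof -
  note [measurable] = \<phi>_measurable g_measurable
  have "(\<lambda>n. \<integral>\<xi>. cos (\<xi> * x) * \<phi> \<xi> * exp (- ((sg n)\<^sup>2 * \<xi>\<^sup>2) / 2) \<partial>lborel) \<longlonglongrightarrow> (\<integral>\<xi>. cos (\<xi> * x) * \<phi> \<xi> \<partial>lborel)"
  proof (rule integral_dominated_convergence[OF _ _ \<phi>_int])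
    show "AE \<xi> in lborel. (\<lambda>n. cos (\<xi> * x) * \<phi> \<xi> * exp (- ((sg n)\<^sup>2 * \<xi>\<^sup>2) / 2)) \<longlonglongrightarrow> cos (\<xi> * x) * \<phi> \<xi>"
    proof (rule AE_I2)
      fix \<xi>
      have "(\<lambda>n. cos (\<xi> * x) * \<phi> \<xi> * exp (- ((sg n)\<^sup>2 * \<xi>\<^sup>2) / 2)) \<longlonglongrightarrow> cos (\<xi> * x) * \<phi> \<xi> * exp (- (0\<^sup>2 * \<xi>\<^sup>2) / 2)"
        by (intro tendsto_intros sg) auto
      then show "(\<lambda>n. cos (\<xi> * x) * \<phi> \<xi> * exp (- ((sg n)\<^sup>2 * \<xi>\<^sup>2) / 2)) \<longlonglongrightarrow> cos (\<xi> * x) * \<phi> \<xi>" by simp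
    qed
    show "AE \<xi> in lborel. norm (cos (\<xi> * x) * \<phi> \<xi> * exp (- ((sg n)\<^sup>2 * \<xi>\<^sup>2) / 2)) \<le> \<phi> \<xi>" for n
    proof (rule AE_I2)
      fix \<xi>
      have "\<bar>cos (\<xi> * x)\<bar> * \<phi> \<xi> * exp (- ((sg n)\<^sup>2 * \<xi>\<^sup>2) / 2) \<le> 1 * \<phi> \<xi> * 1"
        using \<phi>_nonneg by (intro mult_mono) auto
      then show "norm (cos (\<xi> * x) * \<phi> \<xi> * exp (- ((sg n)\<^sup>2 * \<xi>\<^sup>2) / 2)) \<le> \<phi> \<xi>"
        using \<phi>_nonneg by (simp add: abs_mult)
    qed
  qed measurable
  then show ?thesis unfolding gs_eq[OF sg(1)] g_def by (intro tendsto_mult_left)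
qed

text \<open>Positivity is not visible in the oscillating integral defining \<open>g\<close>, but
  \<open>g\<close> is a pointwise limit of densities.\<close>

lemma inversion_nonneg: "0 \<le> g x"
  by (rule LIMSEQ_le_const[OF gs_tendsto]) (use gs_nonneg in auto)

private lemma g_bound: "g x \<le> 1 / (2 * pi) * (\<integral>\<xi>. \<phi> \<xi> \<partial>lborel)"
  by (rule LIMSEQ_le_const2[OF gs_tendsto]) (use gs_bound[OF sg(1)] in auto)

text \<open>Integrating \<open>f\<close> against the smoothed density averages
  \<open>f (y + \<sigma> * z)\<close> over \<mu> and a standard normal \<open>z\<close>. As \<sigma>
  tends to 0 this tends to the integral over \<mu> by continuity of \<open>f\<close>, while the
  densities converge under a common bound on the support of \<open>f\<close>.\<close>

private lemma integral_inversion: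
  assumes f: "continuous_on UNIV f" and ind: "\<And>x. 0 \<le> f x \<and> f x \<le> indicator {l..r} (x::real)"
  shows "(\<integral>x. f x \<partial>\<mu>) = (\<integral>x. f x * g x \<partial>lborel)"
proof (rule LIMSEQ_unique)
  note [measurable] = \<phi>_measurable g_measurable
  have [measurable]: "f \<in> borel_measurable borel" using f by (rule borel_measurable_continuous_onI)
  have f1: "\<bar>f x\<bar> \<le> 1" for x using ind[of x] by (cases "x \<in> {l..r}") auto
  let ?C = "1 / (2 * pi) * (\<integral>\<xi>. \<phi> \<xi> \<partial>lborel)"
  have C: "0 \<le> ?C" using \<phi>_nonneg by simp
  have [measurable]: "gs \<sigma> \<in> borel_measurable borel" for \<sigma>
    unfolding gs_def[abs_def] by measurable
  show "(\<lambda>n. \<integral>x. f x * gs (sg n) x \<partial>lborel) \<longlonglongrightarrow> (\<integral>x. f x * g x \<partial>lborel)"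
  proof (rule integral_dominated_convergence)
    show "integrable lborel (\<lambda>x. indicator {l..r} x * ?C)"
      by (intro integrable_mult_left integrable_real_indicator) (auto simp: emeasure_lborel_Icc_eq)
    show "AE x in lborel. (\<lambda>n. f x * gs (sg n) x) \<longlonglongrightarrow> f x * g x"
      by (intro AE_I2 tendsto_mult_left gs_tendsto)
    show "AE x in lborel. norm (f x * gs (sg n) x) \<le> indicator {l..r} x * ?C" for n
    proof (rule AE_I2)
      fix x
      have "f x * gs (sg n) x \<le> indicator {l..r} x * ?C"
        using ind[of x] gs_bound[OF sg(1)] gs_nonneg by (intro mult_mono) auto
      then show "norm (f x * gs (sg n) x) \<le> indicator {l..r} x * ?C"
        using ind[of x] gs_nonneg[of "sg n" x] by (simp add: abs_mult)
    qed
  qed measurable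
  interpret P: pair_sigma_finite lborel \<mu> ..
  have sm: "(\<integral>x. f x * gs (sg n) x \<partial>lborel) = (\<integral>y. (\<integral>z. f (y + sg n * z) \<partial>std_normal_distribution) \<partial>\<mu>)" for n
  proof -
    have h: "heat ((sg n)\<^sup>2) u = normal_density 0 (sg n) u" for u
      using sg(1)[of n] by (simp add: heat_normal_density)
    have nh: "(\<integral>x. heat ((sg n)\<^sup>2) (x - y) \<partial>lborel) = 1" "integrable lborel (\<lambda>x. heat ((sg n)\<^sup>2) (x - y))" for y
    proof -
      have "heat ((sg n)\<^sup>2) (x - y) = normal_density y (sg n) x" for x
        using sg(1)[of n] by (simp add: heat_def normal_density_def)
      then show "(\<integral>x. heat ((sg n)\<^sup>2) (x - y) \<partial>lborel) = 1" "integrable lborel (\<lambda>x. heat ((sg n)\<^sup>2) (x - y))"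
        using sg(1)[of n] by (auto simp: integral_normal_density)
    qed
    have i: "integrable (lborel \<Otimes>\<^sub>M \<mu>) (\<lambda>(x, y). f x * heat ((sg n)\<^sup>2) (x - y))"
    proof (rule integrableI_bounded)
      have "(\<integral>\<^sup>+p. ennreal (norm (case p of (x, y) \<Rightarrow> f x * heat ((sg n)\<^sup>2) (x - y))) \<partial>(lborel \<Otimes>\<^sub>M \<mu>))
        = (\<integral>\<^sup>+y. \<integral>\<^sup>+x. ennreal \<bar>f x * heat ((sg n)\<^sup>2) (x - y)\<bar> \<partial>lborel \<partial>\<mu>)"
        by (subst P.nn_integral_snd[symmetric]) auto
      also have "\<dots> \<le> (\<integral>\<^sup>+y. \<integral>\<^sup>+x. ennreal (heat ((sg n)\<^sup>2) (x - y)) \<partial>lborel \<partial>\<mu>)"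
        by (intro nn_integral_mono ennreal_leI)
          (auto simp: abs_mult heat_nonneg intro!: mult_left_le_one_le f1)
      also have "\<dots> = (\<integral>\<^sup>+y. 1 \<partial>\<mu>)"
      proof (rule nn_integral_cong)
        fix y
        show "(\<integral>\<^sup>+x. ennreal (heat ((sg n)\<^sup>2) (x - y)) \<partial>lborel) = 1"
          using nn_integral_heat[of "(sg n)\<^sup>2" y] sg(1)[of n] by (simp add: heat_commute[of _ _ y])
      qed
      also have "\<dots> < \<infinity>" by (simp add: less_top[symmetric])
      finally show "(\<integral>\<^sup>+p. ennreal (norm (case p of (x, y) \<Rightarrow> f x * heat ((sg n)\<^sup>2) (x - y))) \<partial>(lborel \<Otimes>\<^sub>M \<mu>)) < \<infinity>" .
    qed measurable
    have "(\<integral>x. f x * gs (sg n) x \<partial>lborel) = (\<integral>x. (\<integral>y. f x * heat ((sg n)\<^sup>2) (x - y) \<partial>\<mu>) \<partial>lborel)"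
      by (simp add: gs_def)
    also have "\<dots> = (\<integral>y. (\<integral>x. f x * heat ((sg n)\<^sup>2) (x - y) \<partial>lborel) \<partial>\<mu>)"
      by (rule P.Fubini_integral[OF i, symmetric])
    also have "(\<lambda>y. \<integral>x. f x * heat ((sg n)\<^sup>2) (x - y) \<partial>lborel) = (\<lambda>y. \<integral>z. f (y + sg n * z) \<partial>std_normal_distribution)"
    proof
      fix y
      have "(\<integral>x. f x * heat ((sg n)\<^sup>2) (x - y) \<partial>lborel) = sg n * (\<integral>z. f (y + sg n * z) * heat ((sg n)\<^sup>2) (sg n * z) \<partial>lborel)"
        using lborel_integral_real_affine[of "sg n" "\<lambda>x. f x * heat ((sg n)\<^sup>2) (x - y)" y] sg(1)[of n] by simp
      also have "\<dots> = (\<integral>z. sg n * (f (y + sg n * z) * heat ((sg n)\<^sup>2) (sg n * z)) \<partial>lborel)" by simp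
      also have "\<dots> = (\<integral>z. std_normal_density z * f (y + sg n * z) \<partial>lborel)"
        using sg(1)[of n]
        by (intro Bochner_Integration.integral_cong) (auto simp: heat_def normal_density_def power_mult_distrib real_sqrt_mult)
      also have "\<dots> = (\<integral>z. f (y + sg n * z) \<partial>std_normal_distribution)"
        by (subst integral_density) auto
      finally show "(\<integral>x. f x * heat ((sg n)\<^sup>2) (x - y) \<partial>lborel) = (\<integral>z. f (y + sg n * z) \<partial>std_normal_distribution)" .
    qed
    finally show ?thesis .
  qed
  interpret N: real_distribution std_normal_distribution by (rule real_dist_normal_dist)
  show "(\<lambda>n. \<integral>x. f x * gs (sg n) x \<partial>lborel) \<longlonglongrightarrow> (\<integral>x. f x \<partial>\<mu>)"
    unfolding sm
  proof (rule integral_dominated_convergence)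
    show "integrable \<mu> (\<lambda>_. 1)" by simp
    have lim: "(\<lambda>n. \<integral>z. f (y + sg n * z) \<partial>std_normal_distribution) \<longlonglongrightarrow> (\<integral>z. f y \<partial>std_normal_distribution)" for y
    proof (rule integral_dominated_convergence)
      show "integrable std_normal_distribution (\<lambda>_. 1)" by simp
      have "(\<lambda>n. f (y + sg n * z)) \<longlonglongrightarrow> f y" for z
      proof (rule isCont_tendsto_compose[where g = f and f = "\<lambda>n. y + sg n * z"])
        show "isCont f y" using f by (simp add: continuous_on_eq_continuous_at)
        show "(\<lambda>n. y + sg n * z) \<longlonglongrightarrow> y" using sg(2) by (auto intro!: tendsto_eq_intros)
      qed
      then show "AE z in std_normal_distribution. (\<lambda>n. f (y + sg n * z)) \<longlonglongrightarrow> f y" by simp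
    qed (use f1 in auto)
    then show "AE y in \<mu>. (\<lambda>n. \<integral>z. f (y + sg n * z) \<partial>std_normal_distribution) \<longlonglongrightarrow> f y"
      using N.prob_space by simp
    show "AE y in \<mu>. norm (\<integral>z. f (y + sg n * z) \<partial>std_normal_distribution) \<le> 1" for n
    proof (rule AE_I2)
      fix y
      have "norm (\<integral>z. f (y + sg n * z) \<partial>std_normal_distribution) \<le> (\<integral>z. \<bar>f (y + sg n * z)\<bar> \<partial>std_normal_distribution)"
        using integral_abs_bound by simp
      also have "\<dots> \<le> 1"
        using f1 by (intro N.integral_le_const N.integrable_const_bound[where B = 1]) auto
      finally show "norm (\<integral>z. f (y + sg n * z) \<partial>std_normal_distribution) \<le> 1" .
    qed
    show "(\<lambda>y. \<integral>z. f (y + sg n * z) \<partial>std_normal_distribution) \<in> borel_measurable \<mu>" for n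
      by (intro N.borel_measurable_lebesgue_integral) measurable
  qed measurable
qed

text \<open>Continuous trapezoids, with support within distance 1 of the interval, converge to its
  indicator and carry the identity over to it.\<close>

private lemma inversion_interval:
  assumes lr: "l \<le> r"
  shows "emeasure \<mu> {l..r} = (\<integral>\<^sup>+x. ennreal (g x) * indicator {l..r} x \<partial>lborel)"
proof -
  note [measurable] = \<phi>_measurable g_measurable
  let ?C = "1 / (2 * pi) * (\<integral>\<xi>. \<phi> \<xi> \<partial>lborel)"
  define f where "f = (\<lambda>k (x::real). max 0 (1 - real (Suc k) * infdist x {l..r}))"
  have ne: "{l..r} \<noteq> {}" using lr by auto
  have fc: "continuous_on UNIV (f k)" for k
    unfolding f_def by (intro continuous_intros)
  have f0: "0 \<le> f k x" "f k x \<le> 1" for k x by (auto simp: f_def infdist_nonneg)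
  have fi: "0 \<le> f k x \<and> f k x \<le> indicator {l - 1..r + 1} x" for k x
  proof (cases "x \<in> {l - 1..r + 1}")
    case False
    have "1 \<le> infdist x {l..r}"
      unfolding infdist_notempty[OF ne]
      by (rule cINF_greatest[OF ne]) (use False in \<open>auto simp: dist_real_def\<close>)
    then have "1 \<le> real (Suc k) * infdist x {l..r}"
      using mult_mono[of 1 "real (Suc k)" 1 "infdist x {l..r}"] by simp
    then show ?thesis using False by (simp add: f_def)
  qed (use f0 in auto)
  have lim: "(\<lambda>k. f k x) \<longlonglongrightarrow> indicator {l..r} x" for x
  proof (cases "x \<in> {l..r}")
    case True
    then show ?thesis by (simp add: f_def)
  next
    case False
    then have d: "0 < infdist x {l..r}"
      using infdist_pos_not_in_closed[of "{l..r}" x] ne by auto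
    have "\<forall>\<^sub>F k in sequentially. 1 / infdist x {l..r} \<le> real k"
      using real_arch_simple[of "1 / infdist x {l..r}"] by (metis eventually_sequentiallyI of_nat_mono order_trans)
    then have "\<forall>\<^sub>F k in sequentially. f k x = 0"
    proof eventually_elim
      case (elim k)
      then have "1 \<le> real k * infdist x {l..r}" using d by (simp add: field_simps)
      also have "\<dots> \<le> real (Suc k) * infdist x {l..r}" using d by (intro mult_right_mono) auto
      finally show ?case by (simp add: f_def)
    qed
    then show ?thesis using False by (simp add: tendsto_eventually)
  qed
  have [measurable]: "f k \<in> borel_measurable borel" for k
    using fc by (rule borel_measurable_continuous_onI)
  have "(\<lambda>k. \<integral>x. f k x \<partial>\<mu>) \<longlonglongrightarrow> (\<integral>x. indicator {l..r} x \<partial>\<mu>)"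
    by (rule integral_dominated_convergence[where w = "\<lambda>_. 1"]) (use lim f0 in auto)
  moreover have ig: "integrable lborel (\<lambda>x. indicator {l - 1..r + 1} x * ?C)"
    by (intro integrable_mult_left integrable_real_indicator) (auto simp: emeasure_lborel_Icc_eq)
  have dom: "norm (f k x * g x) \<le> indicator {l - 1..r + 1} x * ?C" for k x
  proof -
    have "f k x * g x \<le> indicator {l - 1..r + 1} x * ?C"
      using fi[of k x] g_bound[of x] inversion_nonneg[of x] by (intro mult_mono) auto
    then show ?thesis using f0[of k x] inversion_nonneg[of x] by (simp add: abs_mult)
  qed
  have "(\<lambda>k. \<integral>x. f k x * g x \<partial>lborel) \<longlonglongrightarrow> (\<integral>x. indicator {l..r} x * g x \<partial>lborel)"
    by (rule integral_dominated_convergence[OF _ _ ig]) (use lim dom in \<open>auto intro!: tendsto_intros\<close>)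
  ultimately have eq: "(\<integral>x. indicator {l..r} x \<partial>\<mu>) = (\<integral>x. indicator {l..r} x * g x \<partial>lborel)"
    using integral_inversion[OF fc fi] LIMSEQ_unique by simp
  have "integrable lborel (\<lambda>x. indicator {l..r} x * g x)"
    by (rule Bochner_Integration.integrable_bound[OF ig])
      (use g_bound inversion_nonneg \<phi>_nonneg in \<open>auto simp: indicator_def\<close>)
  then have "(\<integral>\<^sup>+x. ennreal (indicator {l..r} x * g x) \<partial>lborel) = ennreal (\<integral>x. indicator {l..r} x * g x \<partial>lborel)"
    by (rule nn_integral_eq_integral) (use inversion_nonneg in auto)
  moreover have "ennreal (indicator {l..r} x * g x) = ennreal (g x) * indicator {l..r} x" for x
    by (auto simp: indicator_def)
  ultimately show ?thesis
    using eq by (simp add: \<mu>.emeasure_eq_measure)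
qed

lemma inversion_density: "\<mu> = density lborel (\<lambda>x. ennreal (g x))"
proof (rule measure_eqI_generator_eq[where E = "range (\<lambda>(a, b). {a..b::real})" and \<Omega> = UNIV and A = "\<lambda>n. {- real n..real n}"])
  show "Int_stable (range (\<lambda>(a, b). {a..b::real}))"
    by (auto simp: Int_stable_def)
  show "sets \<mu> = sigma_sets UNIV (range (\<lambda>(a, b). {a..b::real}))"
    by (subst \<mu>.events_eq_borel, subst borel_eq_atLeastAtMost) (simp add: case_prod_unfold)
  show "sets (density lborel (\<lambda>x. ennreal (g x))) = sigma_sets UNIV (range (\<lambda>(a, b). {a..b::real}))"
    by (subst sets_density, subst sets_lborel, subst borel_eq_atLeastAtMost) (simp add: case_prod_unfold)
  show "emeasure \<mu> Y = emeasure (density lborel (\<lambda>x. ennreal (g x))) Y" if Y_in: "Y \<in> range (\<lambda>(a, b). {a..b::real})" for Y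
  proof -
    obtain l r where Y: "Y = {l..r}" using Y_in by auto
    show ?thesis
    proof (cases "l \<le> r")
      case True
      then show ?thesis unfolding Y using g_measurable by (subst inversion_interval) (auto simp: emeasure_density)
    qed (simp add: Y)
  qed
  show "(\<Union>i. {- real i..real i}) = UNIV"
    by (auto simp: real_arch_simple) (metis abs_le_iff minus_le_iff real_arch_simple)
qed (auto simp: \<mu>.emeasure_finite)

end

context stable
begin

context
  fixes a :: real
  assumes a: "0 < a"
begin

private lemma char_X: "char (distr Px borel (X a)) \<xi> = complex_of_real (exp (- (c * a * \<bar>\<xi>\<bar> powr \<alpha>)))"
proof -
  have "distr Px borel (X a) = distr Px borel (\<lambda>\<omega>. X a \<omega> - X 0 \<omega>)"
    by (rule distr_cong) (auto simp: X_zero)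
  then show ?thesis using stable_process a by (simp add: stable_process_def)
qed

private lemmas inversion_assms = real_distribution_distr[OF X_measurable] char_X
  integrable_exp_powr[OF mult_pos_pos[OF c a] \<alpha>] exp_ge_zero g_alpha_def

lemma g_alpha_nonneg: "0 \<le> g_alpha c \<alpha> a x"
  by (rule inversion_nonneg[OF inversion_assms])

lemma distr_X: "distr Px borel (X a) = density lborel (\<lambda>x. ennreal (g_alpha c \<alpha> a x))"
  by (rule inversion_density[OF inversion_assms])

text \<open>The density of \<open>X a\<close> is even, so convolution with \<open>g_alpha\<close> is
  the expectation over the process started at \<open>x\<close>. This turns the mild equation into a
  statement about paths.\<close>

lemma nn_integral_g_alpha:
  assumes [measurable]: "f \<in> borel_measurable borel"
  shows "(\<integral>\<^sup>+y. ennreal (g_alpha c \<alpha> a (x - y)) * f y \<partial>lborel) = (\<integral>\<^sup>+\<omega>. f (X a \<omega> + x) \<partial>Px)"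
proof -
  have "(\<integral>\<^sup>+\<omega>. f (X a \<omega> + x) \<partial>Px) = (\<integral>\<^sup>+z. f (z + x) \<partial>distr Px borel (X a))"
    by (subst nn_integral_distr) auto
  also have "\<dots> = (\<integral>\<^sup>+z. ennreal (g_alpha c \<alpha> a z) * f (z + x) \<partial>lborel)"
    unfolding distr_X by (subst nn_integral_density) auto
  also have "\<dots> = (\<integral>\<^sup>+y. ennreal (g_alpha c \<alpha> a (y - x)) * f y \<partial>lborel)"
    using nn_integral_real_affine[of "\<lambda>y. ennreal (g_alpha c \<alpha> a (y - x)) * f y" 1 x] by (simp add: add.commute)
  also have "\<dots> = (\<integral>\<^sup>+y. ennreal (g_alpha c \<alpha> a (x - y)) * f y \<partial>lborel)"
    using g_alpha_minus[of c \<alpha> a "y - x" for y] by simp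
  finally show ?thesis by simp
qed

lemma integral_g_alpha:
  fixes f :: "real \<Rightarrow> real"
  assumes [measurable]: "f \<in> borel_measurable borel"
  shows "(\<integral>y. g_alpha c \<alpha> a (x - y) * f y \<partial>lborel) = (\<integral>\<omega>. f (X a \<omega> + x) \<partial>Px)"
proof -
  have "(\<integral>\<omega>. f (X a \<omega> + x) \<partial>Px) = (\<integral>z. f (z + x) \<partial>distr Px borel (X a))"
    by (subst integral_distr) auto
  also have "\<dots> = (\<integral>z. g_alpha c \<alpha> a z * f (z + x) \<partial>lborel)"
    unfolding distr_X using g_alpha_nonneg by (subst integral_density) auto
  also have "\<dots> = (\<integral>y. g_alpha c \<alpha> a (y - x) * f y \<partial>lborel)"
    using lborel_integral_real_affine[of 1 "\<lambda>y. g_alpha c \<alpha> a (y - x) * f y" x] by (simp add: add.commute)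
  also have "\<dots> = (\<integral>y. g_alpha c \<alpha> a (x - y) * f y \<partial>lborel)"
    using g_alpha_minus[of c \<alpha> a "y - x" for y] by simp
  finally show ?thesis by simp
qed

end

end

subsection \<open>The Feynman-Kac functional\<close>

lemma set_integral_seg_pair:
  fixes f :: "real \<times> real \<Rightarrow> real"
  assumes f[measurable]: "f \<in> borel_measurable borel" and pos: "\<And>z. 0 \<le> f z"
    and fin: "(\<integral>\<^sup>+s. \<integral>\<^sup>+r. ennreal (f (s, r)) \<partial>seg t \<partial>seg t) < \<infinity>"
  shows "(\<integral>z\<in>{0..t} \<times> {0..t}. f z \<partial>lborel) = (\<integral>s. (\<integral>r. f (s, r) \<partial>seg t) \<partial>seg t)"
proof -
  have fp[measurable]: "f \<in> borel_measurable (borel \<Otimes>\<^sub>M borel)" using f by (simp add: borel_prod)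
  interpret S: finite_measure "seg t" by (rule finite_measure_seg)
  have fs[measurable]: "(\<lambda>r. f (s, r)) \<in> borel_measurable (seg t)" for s by measurable
  have m: "(\<lambda>s. \<integral>\<^sup>+r. ennreal (f (s, r)) \<partial>seg t) \<in> borel_measurable borel"
  proof -
    have "(\<lambda>s. \<integral>\<^sup>+r. ennreal (f (s, r)) \<partial>seg t) \<in> borel_measurable (seg t)" by measurable
    then show ?thesis by simp
  qed
  have "(\<integral>\<^sup>+z. ennreal (indicator ({0..t} \<times> {0..t}) z * f z) \<partial>lborel)
    = (\<integral>\<^sup>+s. \<integral>\<^sup>+r. ennreal (indicator ({0..t} \<times> {0..t}) (s, r) * f (s, r)) \<partial>lborel \<partial>lborel)"
  proof (rule nn_integral_lborel_pair)
    have "{0..t} \<times> {0..t} \<in> sets (borel :: (real \<times> real) measure)" by (intro borel_closed closed_Times) auto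
    then show "(\<lambda>z. ennreal (indicator ({0..t} \<times> {0..t}) z * f z)) \<in> borel_measurable borel" by measurable
  qed
  also have "\<dots> = (\<integral>\<^sup>+s. ennreal (indicator {0..t} s) * (\<integral>\<^sup>+r. ennreal (indicator {0..t} r) * ennreal (f (s, r)) \<partial>lborel) \<partial>lborel)"
  proof (rule nn_integral_cong)
    fix s
    show "(\<integral>\<^sup>+r. ennreal (indicator ({0..t} \<times> {0..t}) (s, r) * f (s, r)) \<partial>lborel)
      = ennreal (indicator {0..t} s) * (\<integral>\<^sup>+r. ennreal (indicator {0..t} r) * ennreal (f (s, r)) \<partial>lborel)"
      using pos by (cases "s \<in> {0..t}") (auto intro!: nn_integral_cong simp: indicator_def)
  qed
  also have "\<dots> = (\<integral>\<^sup>+s. \<integral>\<^sup>+r. ennreal (f (s, r)) \<partial>seg t \<partial>seg t)"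
    by (subst nn_integral_seg[OF m]) (auto intro!: nn_integral_cong arg_cong2[of _ _ _ _ "(*)"] nn_integral_seg[symmetric])
  finally have nn: "(\<integral>\<^sup>+z. ennreal (indicator ({0..t} \<times> {0..t}) z * f z) \<partial>lborel)
    = (\<integral>\<^sup>+s. \<integral>\<^sup>+r. ennreal (f (s, r)) \<partial>seg t \<partial>seg t)" .
  have "(\<integral>z\<in>{0..t} \<times> {0..t}. f z \<partial>lborel) = enn2real (\<integral>\<^sup>+z. ennreal (indicator ({0..t} \<times> {0..t}) z * f z) \<partial>lborel)"
  proof -
    have "{0..t} \<times> {0..t} \<in> sets (borel :: (real \<times> real) measure)" by (intro borel_closed closed_Times) auto
    then show ?thesis unfolding set_lebesgue_integral_def
      using pos by (subst integral_eq_nn_integral) auto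
  qed
  also have "\<dots> = (\<integral>s. enn2real (\<integral>\<^sup>+r. ennreal (f (s, r)) \<partial>seg t) \<partial>seg t)"
    unfolding nn using fin m by (intro integral_enn2real[symmetric]) auto
  also have "\<dots> = (\<integral>s. (\<integral>r. f (s, r) \<partial>seg t) \<partial>seg t)"
    using pos by (intro Bochner_Integration.integral_cong integral_eq_nn_integral[symmetric]) auto
  finally show ?thesis .
qed

locale fk = S: stable Px X c \<alpha> + reg_noise Pw W Wd
  for Px :: "'a measure" and X c \<alpha> and Pw :: "'b measure" and W Wd +
  fixes I :: "real \<Rightarrow> real \<Rightarrow> 'a \<Rightarrow> 'b \<Rightarrow> real" and u0 :: "real \<Rightarrow> real" and U :: real
  assumes I_joint: "(\<lambda>(z, w). I (fst z) (snd z) (fst w) (snd w))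
        \<in> borel_measurable ((lborel :: (real \<times> real) measure) \<Otimes>\<^sub>M (Px \<Otimes>\<^sub>M Pw))"
    and I_limit: "0 \<le> t \<Longrightarrow> AE \<omega>x in Px. L2_conv Pw ed0 (\<lambda>(\<epsilon>, \<delta>). W (Aed X \<epsilon> \<delta> t x \<omega>x)) (I t x \<omega>x)"
    and u0_measurable [measurable]: "u0 \<in> borel_measurable borel" and u0_bound: "\<bar>u0 x\<bar> \<le> U"

locale fk_seq = fk Px X c \<alpha> Pw W Wd I u0 U + reg_noise_seq Pw W Wd \<epsilon> \<delta>
  for Px :: "'a measure" and X c \<alpha> and Pw :: "'b measure" and W Wd I u0 U \<epsilon> \<delta>

context fk
begin

lemma U_nonneg: "0 \<le> U"
  using u0_bound[of 0] by linarith

lemma I_measurable: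
  assumes [measurable]: "f \<in> borel_measurable M" "g \<in> borel_measurable M" "h \<in> measurable M Px" "k \<in> measurable M Pw"
  shows "(\<lambda>x. I (f x) (g x) (h x) (k x)) \<in> borel_measurable M"
proof -
  have "(\<lambda>x. ((f x, g x), (h x, k x))) \<in> measurable M ((lborel :: (real \<times> real) measure) \<Otimes>\<^sub>M (Px \<Otimes>\<^sub>M Pw))"
    unfolding lborel_prod[symmetric] by measurable
  from measurable_compose[OF this I_joint] show ?thesis by simp
qed

lemma Ipath_measurable:
  assumes e: "0 < \<epsilon>" "0 < \<delta>"
    and [measurable]: "f \<in> borel_measurable M" "g \<in> borel_measurable M" "h \<in> measurable M Px" "k \<in> measurable M Pw"
  shows "(\<lambda>x. Ipath \<epsilon> \<delta> (S.Xp (h x)) (f x) (g x) (k x)) \<in> borel_measurable M"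
proof -
  have [measurable]: "(\<lambda>p. S.Xp (h (fst p)) (snd p)) \<in> borel_measurable (M \<Otimes>\<^sub>M borel)"
    by (rule S.Xp_measurable) measurable
  have [measurable]: "(\<lambda>p. Wd \<epsilon> \<delta> (f (fst p) - snd p) (S.Xp (h (fst p)) (snd p) + g (fst p)) (k (fst p))) \<in> borel_measurable (M \<Otimes>\<^sub>M borel)"
    by (rule Wd_measurable[OF e]) measurable
  have eq: "Ipath \<epsilon> \<delta> (S.Xp (h x)) (f x) (g x) (k x)
    = (\<integral>s. of_bool (0 \<le> s \<and> s \<le> f x) * Wd \<epsilon> \<delta> (f x - s) (S.Xp (h x) s + g x) (k x) \<partial>lborel)" for x
    unfolding Ipath_def set_lebesgue_integral_def by (intro Bochner_Integration.integral_cong) (auto simp: indicator_def)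
  show ?thesis unfolding eq
  proof (rule lborel.borel_measurable_lebesgue_integral)
    show "(\<lambda>(x, s). of_bool (0 \<le> s \<and> s \<le> f x) * Wd \<epsilon> \<delta> (f x - s) (S.Xp (h x) s + g x) (k x)) \<in> borel_measurable (M \<Otimes>\<^sub>M lborel)"
      unfolding split_beta' by measurable
  qed
qed

lemma Aed_Apath: "Aed X \<epsilon> \<delta> t x \<omega>x = Apath (S.Xp \<omega>x) \<epsilon> \<delta> t x"
  unfolding Aed_def Apath_def S.Xp_def by (auto simp: fun_eq_iff intro!: set_lebesgue_integral_cong)

definition nice :: "real \<Rightarrow> real \<Rightarrow> 'a \<Rightarrow> 'b \<Rightarrow> real" where
  "nice t x \<omega>x \<omega> = u0 (X t \<omega>x + x) * exp (I t x \<omega>x \<omega>)"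

lemma fk_sol_nice: "fk_sol Px X I u0 t x \<omega> = (\<integral>\<omega>x. nice t x \<omega>x \<omega> \<partial>Px)"
  by (simp add: fk_sol_def nice_def)

end

context fk_seq
begin

definition err :: "nat \<Rightarrow> real \<Rightarrow> real \<Rightarrow> 'a \<Rightarrow> ennreal" where
  "err n t x \<omega>x = (\<integral>\<^sup>+\<omega>. ennreal ((In n (S.Xp \<omega>x) t x \<omega> - I t x \<omega>x \<omega>)\<^sup>2) \<partial>Pw)"

text \<open>L2 convergence of the path integrals to \<open>I\<close>, with countable quantifiers and
  an error in \<open>ennreal\<close>. Unlike \<open>good\<close> it is visibly measurable in time,
  starting point and path, as statements almost everywhere on product spaces require.\<close>

definition goodI :: "real \<Rightarrow> real \<Rightarrow> 'a \<Rightarrow> bool" where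
  "goodI t x \<omega>x \<longleftrightarrow> (\<forall>k::nat. \<exists>N::nat. \<forall>n\<ge>N. err n t x \<omega>x < ennreal (1 / real (Suc k)))"

lemma goodI_measurable:
  assumes [measurable]: "f \<in> borel_measurable M" "g \<in> borel_measurable M" "h \<in> measurable M Px"
  shows "Measurable.pred M (\<lambda>x. goodI (f x) (g x) (h x))"
proof -
  have [measurable]: "(\<lambda>p. In n (S.Xp (h (fst p))) (f (fst p)) (g (fst p)) (snd p)) \<in> borel_measurable (M \<Otimes>\<^sub>M Pw)" for n
    by (rule Ipath_measurable[OF pos]) measurable
  have [measurable]: "(\<lambda>p. I (f (fst p)) (g (fst p)) (h (fst p)) (snd p)) \<in> borel_measurable (M \<Otimes>\<^sub>M Pw)"
    by (rule I_measurable) measurable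
  have [measurable]: "(\<lambda>x. err n (f x) (g x) (h x)) \<in> borel_measurable M" for n
    unfolding err_def by measurable
  show ?thesis unfolding goodI_def by measurable
qed

text \<open>Square integrability of \<open>I\<close> is recovered from a single finite error, since
  \<open>In n\<close> is square integrable.\<close>

lemma goodI_good:
  assumes g: "goodI t x \<omega>x" and t: "0 \<le> t" and \<omega>x: "\<omega>x \<in> space Px"
  shows "good (S.Xp \<omega>x) t x (I t x \<omega>x)"
proof -
  have \<xi>: "S.Xp \<omega>x \<in> borel_measurable borel" by (rule S.Xp_path_measurable[OF \<omega>x])
  have sIn: "sqi Pw (In n (S.Xp \<omega>x) t x)" for n by (rule Ipath_sqi[OF pos t \<xi>])
  note [measurable] = sqi_measurable[OF sIn]
  have [measurable]: "I t x \<omega>x \<in> borel_measurable Pw"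
    using \<omega>x by (intro I_measurable) auto
  have sI: "sqi Pw (I t x \<omega>x)"
  proof -
    obtain n where "err n t x \<omega>x < ennreal (1 / real (Suc 0))" using g unfolding goodI_def by blast
    then have "sqi Pw (\<lambda>\<omega>. In n (S.Xp \<omega>x) t x \<omega> - I t x \<omega>x \<omega>)"
      unfolding err_def by (intro sqi_nn_integral) (auto intro: less_trans)
    from sqi_diff[OF sIn[of n] this] show ?thesis by simp
  qed
  have E: "err n t x \<omega>x = ennreal (\<integral>\<omega>. (In n (S.Xp \<omega>x) t x \<omega> - I t x \<omega>x \<omega>)\<^sup>2 \<partial>Pw)" for n
    unfolding err_def by (rule nn_integral_sqi[OF sqi_diff[OF sIn sI]])
  have "(\<lambda>n. \<integral>\<omega>. (In n (S.Xp \<omega>x) t x \<omega> - I t x \<omega>x \<omega>)\<^sup>2 \<partial>Pw) \<longlonglongrightarrow> 0"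
  proof (rule LIMSEQ_I)
    fix r :: real assume "0 < r"
    then obtain k where k: "1 / real (Suc k) < r" using reals_Archimedean by (auto simp: inverse_eq_divide)
    obtain N where "\<And>n. n \<ge> N \<Longrightarrow> err n t x \<omega>x < ennreal (1 / real (Suc k))" using g unfolding goodI_def by blast
    then have "\<And>n. n \<ge> N \<Longrightarrow> (\<integral>\<omega>. (In n (S.Xp \<omega>x) t x \<omega> - I t x \<omega>x \<omega>)\<^sup>2 \<partial>Pw) < 1 / real (Suc k)"
      unfolding E by (simp add: ennreal_less_iff del: of_nat_Suc)
    then show "\<exists>N. \<forall>n\<ge>N. norm ((\<integral>\<omega>. (In n (S.Xp \<omega>x) t x \<omega> - I t x \<omega>x \<omega>)\<^sup>2 \<partial>Pw) - 0) < r"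
      using k by (intro exI[of _ N]) (auto intro: less_trans)
  qed
  then show ?thesis using \<xi> t sIn sI by (simp add: good_def l2lim_def)
qed

lemma filterlim_ed0: "filterlim (\<lambda>n. (\<epsilon> n, \<delta> n)) ed0 sequentially"
  by (intro filterlim_Pair filterlim_at_withinI lim) (use pos in auto)

text \<open>The assumed limit is restricted to the given sequence of parameters, and
  \<open>Ipath_eq_W\<close> replaces the noise integral of the kernel by the path integral.\<close>

lemma AE_goodI:
  assumes t: "0 \<le> t"
  shows "AE \<omega>x in Px. goodI t x \<omega>x"
  using I_limit[OF t, of x] AE_space
proof eventually_elim
  case (elim \<omega>x)
  let ?I = "I t x \<omega>x" and ?A = "\<lambda>n. Apath (S.Xp \<omega>x) (\<epsilon> n) (\<delta> n) t x"
  have \<xi>: "S.Xp \<omega>x \<in> borel_measurable borel" by (rule S.Xp_path_measurable[OF elim(2)])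
  have L: "\<forall>\<^sub>F n in sequentially. integrable Pw (\<lambda>\<omega>. (W (?A n) \<omega> - ?I \<omega>)\<^sup>2)"
    "(\<lambda>n. \<integral>\<omega>. (W (?A n) \<omega> - ?I \<omega>)\<^sup>2 \<partial>Pw) \<longlonglongrightarrow> 0" "?I \<in> borel_measurable Pw"
  proof -
    show "?I \<in> borel_measurable Pw" using elim(1) by (simp add: L2_conv_def)
    have "\<forall>\<^sub>F e in ed0. integrable Pw (\<lambda>\<omega>. ((case e of (\<epsilon>, \<delta>) \<Rightarrow> W (Aed X \<epsilon> \<delta> t x \<omega>x)) \<omega> - ?I \<omega>)\<^sup>2)"
      using elim(1) unfolding L2_conv_def by (auto elim: eventually_mono)
    from eventually_compose_filterlim[OF this filterlim_ed0]
    show "\<forall>\<^sub>F n in sequentially. integrable Pw (\<lambda>\<omega>. (W (?A n) \<omega> - ?I \<omega>)\<^sup>2)" by (simp add: Aed_Apath)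
    have "((\<lambda>e. \<integral>\<omega>. ((case e of (\<epsilon>, \<delta>) \<Rightarrow> W (Aed X \<epsilon> \<delta> t x \<omega>x)) \<omega> - ?I \<omega>)\<^sup>2 \<partial>Pw) \<longlongrightarrow> 0) ed0"
      using elim(1) unfolding L2_conv_def by blast
    from filterlim_compose[OF this filterlim_ed0]
    show "(\<lambda>n. \<integral>\<omega>. (W (?A n) \<omega> - ?I \<omega>)\<^sup>2 \<partial>Pw) \<longlonglongrightarrow> 0" by (simp add: Aed_Apath)
  qed
  have E: "err n t x \<omega>x = (\<integral>\<^sup>+\<omega>. ennreal ((W (?A n) \<omega> - ?I \<omega>)\<^sup>2) \<partial>Pw)" for n
    unfolding err_def using Ipath_eq_W[OF pos t \<xi>, of n n x]
    by (intro nn_integral_cong_AE) (auto elim!: AE_mp)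
  show ?case
    unfolding goodI_def
  proof
    fix k :: nat
    have k: "0 < 1 / real (Suc k)" by simp
    have "\<forall>\<^sub>F n in sequentially. err n t x \<omega>x < ennreal (1 / real (Suc k))"
      using L(1) order_tendstoD(2)[OF L(2) k]
    proof eventually_elim
      case (elim n)
      then show ?case unfolding E
        by (subst nn_integral_eq_integral) (auto simp: ennreal_less_iff)
    qed
    then show "\<exists>N. \<forall>n\<ge>N. err n t x \<omega>x < ennreal (1 / real (Suc k))"
      by (simp add: eventually_sequentially)
  qed
qed

lemma AE_good:
  assumes t: "0 \<le> t"
  shows "AE \<omega>x in Px. good (S.Xp \<omega>x) t x (I t x \<omega>x)"
  using AE_goodI[OF t, of x] AE_space by eventually_elim (rule goodI_good[OF _ t])

lemma nice_measurable [measurable]: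
  assumes [measurable]: "h \<in> measurable M Px" "k \<in> measurable M Pw"
  shows "(\<lambda>z. nice t x (h z) (k z)) \<in> borel_measurable M"
proof -
  have [measurable]: "(\<lambda>z. I t x (h z) (k z)) \<in> borel_measurable M" by (rule I_measurable) measurable
  show ?thesis unfolding nice_def by measurable
qed

text \<open>A Gaussian exponential moment is the exponential of half the variance, and 20 is half of
  40.\<close>

lemma nn_integral_exp_good_le:
  assumes "good \<xi> t x Y"
  shows "(\<integral>\<^sup>+\<omega>. ennreal (exp (Y \<omega>)) \<partial>Pw) \<le> ennreal (exp (20 * t * sqrt t))"
proof -
  have "(\<integral>\<^sup>+\<omega>. ennreal (exp (Y \<omega>)) \<partial>Pw) = ennreal (exp ((\<integral>\<omega>. (Y \<omega>)\<^sup>2 \<partial>Pw) / 2))"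
    using gspace_exp[OF good_gspace[OF assms]] by (subst nn_integral_eq_integral) auto
  then show ?thesis using good_variance[OF assms] by simp
qed

lemma nn_integral_abs_nice:
  assumes t: "0 \<le> t"
  shows "(\<integral>\<^sup>+\<omega>. \<integral>\<^sup>+\<omega>x. ennreal \<bar>nice t x \<omega>x \<omega>\<bar> \<partial>Px \<partial>Pw) \<le> ennreal (U * exp (20 * t * sqrt t))"
proof -
  interpret PP: pair_sigma_finite Px Pw ..
  have "(\<integral>\<^sup>+\<omega>. \<integral>\<^sup>+\<omega>x. ennreal \<bar>nice t x \<omega>x \<omega>\<bar> \<partial>Px \<partial>Pw) = (\<integral>\<^sup>+\<omega>x. \<integral>\<^sup>+\<omega>. ennreal \<bar>nice t x \<omega>x \<omega>\<bar> \<partial>Pw \<partial>Px)"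
    by (rule PP.Fubini') measurable
  also have "\<dots> \<le> (\<integral>\<^sup>+\<omega>x. ennreal (U * exp (20 * t * sqrt t)) \<partial>Px)"
  proof (rule nn_integral_mono_AE, use AE_good[OF t, of x] in eventually_elim)
    case (elim \<omega>x)
    have [measurable]: "I t x \<omega>x \<in> borel_measurable Pw"
      using gspace_sqi[OF good_gspace[OF elim]] by (rule sqi_measurable)
    have "(\<integral>\<^sup>+\<omega>. ennreal \<bar>nice t x \<omega>x \<omega>\<bar> \<partial>Pw) \<le> (\<integral>\<^sup>+\<omega>. ennreal U * ennreal (exp (I t x \<omega>x \<omega>)) \<partial>Pw)"
      using u0_bound U_nonneg
      by (intro nn_integral_mono) (auto simp: nice_def abs_mult ennreal_mult'[symmetric] intro!: ennreal_leI mult_right_mono)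
    also have "\<dots> = ennreal U * (\<integral>\<^sup>+\<omega>. ennreal (exp (I t x \<omega>x \<omega>)) \<partial>Pw)" by (rule nn_integral_cmult) measurable
    also have "\<dots> \<le> ennreal U * ennreal (exp (20 * t * sqrt t))"
      by (intro mult_left_mono nn_integral_exp_good_le[OF elim]) auto
    finally show ?case using U_nonneg by (simp add: ennreal_mult')
  qed
  also have "\<dots> = ennreal (U * exp (20 * t * sqrt t))" by (simp add: S.emeasure_space_1)
  finally show ?thesis .
qed

lemma nice_integrable:
  assumes t: "0 \<le> t"
  shows "AE \<omega> in Pw. integrable Px (\<lambda>\<omega>x. nice t x \<omega>x \<omega>)"
proof -
  have "AE \<omega> in Pw. (\<integral>\<^sup>+\<omega>x. ennreal \<bar>nice t x \<omega>x \<omega>\<bar> \<partial>Px) \<noteq> \<infinity>"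
    by (rule nn_integral_PInf_AE) (use nn_integral_abs_nice[OF t, of x] in \<open>auto simp: top_unique\<close>)
  then show ?thesis
  proof (rule AE_mp, intro AE_I2 impI)
    fix \<omega> assume \<omega>: "\<omega> \<in> space Pw" "(\<integral>\<^sup>+\<omega>x. ennreal \<bar>nice t x \<omega>x \<omega>\<bar> \<partial>Px) \<noteq> \<infinity>"
    then show "integrable Px (\<lambda>\<omega>x. nice t x \<omega>x \<omega>)"
      by (intro integrableI_bounded nice_measurable) (auto simp: less_top)
  qed
qed

subsection \<open>The moment formula\<close>

lemma good_covariance_same:
  assumes g: "good \<xi> t x Y" "good \<xi>' t x Y'"
  shows "(\<integral>\<omega>. Y \<omega> * Y' \<omega> \<partial>Pw) = (\<integral>z\<in>{0..t} \<times> {0..t}. heat \<bar>fst z - snd z\<bar> (\<xi> (fst z) - \<xi>' (snd z)) \<partial>lborel)"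
proof -
  have [measurable]: "\<xi> \<in> borel_measurable borel" "\<xi>' \<in> borel_measurable borel" and t: "0 \<le> t"
    using g by (auto simp: good_def)
  let ?f = "\<lambda>z. heat \<bar>fst z - snd z\<bar> (\<xi> (fst z) - \<xi>' (snd z))"
  have fp: "?f \<in> borel_measurable borel"
    unfolding borel_prod[symmetric] by measurable
  have "(\<integral>z\<in>{0..t} \<times> {0..t}. ?f z \<partial>lborel) = (\<integral>s. (\<integral>r. ?f (s, r) \<partial>seg t) \<partial>seg t)"
  proof (rule set_integral_seg_pair[OF fp])
    show "0 \<le> ?f z" for z by (simp add: heat_nonneg)
    have "(\<integral>\<^sup>+s. \<integral>\<^sup>+r. ennreal (?f (s, r)) \<partial>seg t \<partial>seg t) \<le> (\<integral>\<^sup>+s. ennreal (40 * sqrt t) \<partial>seg t)"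
    proof (rule nn_integral_mono)
      fix s
      have "(\<integral>\<^sup>+r. ennreal (?f (s, r)) \<partial>seg t) \<le> (\<integral>\<^sup>+r. ennreal (8 * isq (t - r - (t - s))) \<partial>seg t)"
      proof (rule nn_integral_mono_AE, use AE_seg_neq[of t "t - s"] in eventually_elim)
        case (elim r)
        then have "heat \<bar>s - r\<bar> (\<xi> s - \<xi>' r) \<le> isq \<bar>s - r\<bar>" by (intro heat_le_isq) auto
        also have "\<dots> \<le> 8 * isq \<bar>s - r\<bar>" by simp
        also have "\<dots> = 8 * isq (t - r - (t - s))" by (simp add: isq_def)
        finally show ?case by (simp add: ennreal_leI)
      qed
      also have "\<dots> \<le> ennreal (40 * sqrt t)" by (rule nn_integral_seg_isq[OF t])
      finally show "(\<integral>\<^sup>+r. ennreal (?f (s, r)) \<partial>seg t) \<le> ennreal (40 * sqrt t)" .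
    qed
    also have "\<dots> < \<infinity>" unfolding nn_integral_seg_const[OF t] by (simp add: ennreal_mult_less_top)
    finally show "(\<integral>\<^sup>+s. \<integral>\<^sup>+r. ennreal (?f (s, r)) \<partial>seg t \<partial>seg t) < \<infinity>" .
  qed
  moreover have "?f (s, r) = heat \<bar>t - r - (t - s)\<bar> (\<xi>' r + x - (\<xi> s + x))" for s r
    by (simp add: heat_commute[of _ "\<xi> s"])
  ultimately show ?thesis by (simp add: good_covariance[OF g])
qed

context
  fixes p :: nat and t x :: real
  assumes p: "0 < p" and t: "0 \<le> t"
begin

private abbreviation "PX \<equiv> (\<Pi>\<^sub>M j\<in>{1..p}. Px)"

interpretation PX: prob_space PX by (intro prob_space_PiM) unfold_locales

interpretation PS: product_sigma_finite "\<lambda>_::nat. Px" by unfold_locales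

private definition G :: "(nat \<Rightarrow> 'a) \<Rightarrow> 'b \<Rightarrow> real" where
  "G w \<omega> = (\<Prod>j\<in>{1..p}. nice t x (w j) \<omega>)"

private lemma G_measurable: "(\<lambda>(w, \<omega>). G w \<omega>) \<in> borel_measurable (PX \<Otimes>\<^sub>M Pw)"
  unfolding G_def split_beta' by measurable

private lemma G_power: "AE \<omega> in Pw. (fk_sol Px X I u0 t x \<omega>) ^ p = (\<integral>w. G w \<omega> \<partial>PX)"
  using nice_integrable[OF t, of x]
proof eventually_elim
  case (elim \<omega>)
  have "(\<integral>w. G w \<omega> \<partial>PX) = (\<Prod>j\<in>{1..p}. \<integral>\<omega>x. nice t x \<omega>x \<omega> \<partial>Px)"
    unfolding G_def by (rule PS.product_integral_prod) (use elim in auto)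
  then show ?case by (simp add: fk_sol_nice)
qed

private lemma AE_good_all: "AE w in PX. \<forall>j\<in>{1..p}. good (S.Xp (w j)) t x (I t x (w j))"
proof -
  have "AE w in PX. good (S.Xp (w j)) t x (I t x (w j))" if "j \<in> {1..p}" for j
    by (rule AE_PiM_component) (use that AE_good[OF t] in \<open>auto intro: S.prob_space_axioms\<close>)
  then show ?thesis by (subst AE_finite_all) auto
qed

private lemma sum_gspace:
  assumes "\<forall>j\<in>{1..p}. good (S.Xp (w j)) t x (I t x (w j))"
  shows "(\<lambda>\<omega>. \<Sum>j\<in>{1..p}. I t x (w j) \<omega>) \<in> gspace Pw W"
    "(\<integral>\<omega>. (\<Sum>j\<in>{1..p}. I t x (w j) \<omega>)\<^sup>2 \<partial>Pw)
      = (\<Sum>j\<in>{1..p}. \<Sum>k\<in>{1..p}. \<integral>\<omega>. I t x (w j) \<omega> * I t x (w k) \<omega> \<partial>Pw)"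
proof -
  have g: "I t x (w j) \<in> gspace Pw W" if "j \<in> {1..p}" for j
    using assms that by (intro good_gspace) auto
  then show "(\<lambda>\<omega>. \<Sum>j\<in>{1..p}. I t x (w j) \<omega>) \<in> gspace Pw W" by (intro gspace_sum) auto
  have i: "integrable Pw (\<lambda>\<omega>. I t x (w j) \<omega> * I t x (w k) \<omega>)" if "j \<in> {1..p}" "k \<in> {1..p}" for j k
    using that by (intro sqi_mult gspace_sqi g)
  show "(\<integral>\<omega>. (\<Sum>j\<in>{1..p}. I t x (w j) \<omega>)\<^sup>2 \<partial>Pw)
      = (\<Sum>j\<in>{1..p}. \<Sum>k\<in>{1..p}. \<integral>\<omega>. I t x (w j) \<omega> * I t x (w k) \<omega> \<partial>Pw)"
    unfolding power2_eq_square sum_product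
    by (subst Bochner_Integration.integral_sum, (intro Bochner_Integration.integrable_sum i; assumption),
        intro sum.cong refl Bochner_Integration.integral_sum i)
qed

private lemma prod_nice: "G w \<omega> = (\<Prod>j\<in>{1..p}. u0 (X t (w j) + x)) * exp (\<Sum>j\<in>{1..p}. I t x (w j) \<omega>)"
  by (simp add: G_def nice_def prod.distrib exp_sum)

private lemma G_expectation:
  assumes g: "\<forall>j\<in>{1..p}. good (S.Xp (w j)) t x (I t x (w j))"
  shows "(\<integral>\<omega>. G w \<omega> \<partial>Pw) = moment_rhs X u0 p t x w"
proof -
  have cov: "(\<integral>\<omega>. I t x (w j) \<omega> * I t x (w k) \<omega> \<partial>Pw)
    = (\<integral>z\<in>{0..t} \<times> {0..t}. (case z of (s, r) \<Rightarrow> heat \<bar>s - r\<bar> (X s (w j) - X r (w k))) \<partial>lborel)"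
    if "j \<in> {1..p}" "k \<in> {1..p}" for j k
  proof -
    have "(\<integral>\<omega>. I t x (w j) \<omega> * I t x (w k) \<omega> \<partial>Pw)
      = (\<integral>z\<in>{0..t} \<times> {0..t}. heat \<bar>fst z - snd z\<bar> (S.Xp (w j) (fst z) - S.Xp (w k) (snd z)) \<partial>lborel)"
      using g that by (intro good_covariance_same) auto
    also have "\<dots> = (\<integral>z\<in>{0..t} \<times> {0..t}. (case z of (s, r) \<Rightarrow> heat \<bar>s - r\<bar> (X s (w j) - X r (w k))) \<partial>lborel)"
      unfolding set_lebesgue_integral_def
      by (intro Bochner_Integration.integral_cong) (auto simp: S.Xp_def indicator_def)
    finally show ?thesis .
  qed
  have "(\<integral>\<omega>. G w \<omega> \<partial>Pw) = (\<Prod>j\<in>{1..p}. u0 (X t (w j) + x)) *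
     exp ((\<Sum>j\<in>{1..p}. \<Sum>k\<in>{1..p}. \<integral>\<omega>. I t x (w j) \<omega> * I t x (w k) \<omega> \<partial>Pw) / 2)"
    unfolding prod_nice by (simp only: integral_mult_right_zero gspace_exp(2)[OF sum_gspace(1)[OF g]] sum_gspace(2)[OF g])
  moreover have "(\<Sum>j\<in>{1..p}. \<Sum>k\<in>{1..p}. \<integral>\<omega>. I t x (w j) \<omega> * I t x (w k) \<omega> \<partial>Pw) = (\<Sum>j\<in>{1..p}. \<Sum>k\<in>{1..p}.
      (\<integral>z\<in>{0..t} \<times> {0..t}. (case z of (s, r) \<Rightarrow> heat \<bar>s - r\<bar> (X s (w j) - X r (w k))) \<partial>lborel))"
    by (intro sum.cong refl cov)
  ultimately show ?thesis unfolding moment_rhs_def by (simp only: mult_1 times_divide_eq_left)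
qed

text \<open>By Cauchy-Schwarz each of the \<open>p * p\<close> covariances is at most
  \<open>40 * t * sqrt t\<close>, uniformly in the paths. This gives the integrability that Fubini
  needs.\<close>

private lemma G_bound:
  assumes g: "\<forall>j\<in>{1..p}. good (S.Xp (w j)) t x (I t x (w j))"
  shows "(\<integral>\<^sup>+\<omega>. ennreal \<bar>G w \<omega>\<bar> \<partial>Pw) \<le> ennreal (U ^ p * exp (real p * real p * (40 * t * sqrt t) / 2))"
proof -
  let ?Y = "\<lambda>\<omega>. \<Sum>j\<in>{1..p}. I t x (w j) \<omega>"
  let ?B = "40 * t * sqrt t"
  have B: "0 \<le> ?B" using t by simp
  have cov: "(\<integral>\<omega>. I t x (w j) \<omega> * I t x (w k) \<omega> \<partial>Pw) \<le> ?B" if "j \<in> {1..p}" "k \<in> {1..p}" for j k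
  proof -
    have gj: "good (S.Xp (w j)) t x (I t x (w j))" and gk: "good (S.Xp (w k)) t x (I t x (w k))"
      using g that by auto
    have "\<bar>\<integral>\<omega>. I t x (w j) \<omega> * I t x (w k) \<omega> \<partial>Pw\<bar>
      \<le> sqrt (\<integral>\<omega>. (I t x (w j) \<omega>)\<^sup>2 \<partial>Pw) * sqrt (\<integral>\<omega>. (I t x (w k) \<omega>)\<^sup>2 \<partial>Pw)"
      by (intro sqi_Cauchy_Schwarz gspace_sqi good_gspace[OF gj] good_gspace[OF gk])
    also have "\<dots> \<le> sqrt ?B * sqrt ?B"
      using good_variance[OF gj] good_variance[OF gk] t by (intro mult_mono real_sqrt_le_mono) auto
    also have "\<dots> = ?B" using B by simp
    finally show ?thesis by simp
  qed
  have "(\<integral>\<omega>. (?Y \<omega>)\<^sup>2 \<partial>Pw) \<le> (\<Sum>j\<in>{1..p}. \<Sum>k\<in>{1..p}. ?B)"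
    unfolding sum_gspace(2)[OF g] by (intro sum_mono cov)
  then have var: "(\<integral>\<omega>. (?Y \<omega>)\<^sup>2 \<partial>Pw) \<le> real p * real p * ?B" by simp
  have [measurable]: "?Y \<in> borel_measurable Pw"
    using sum_gspace(1)[OF g] gspace_sqi sqi_measurable by blast
  have "\<bar>\<Prod>j\<in>{1..p}. u0 (X t (w j) + x)\<bar> \<le> (\<Prod>j\<in>{1..p}. U)"
    unfolding abs_prod using u0_bound by (intro prod_mono) auto
  then have "(\<integral>\<^sup>+\<omega>. ennreal \<bar>G w \<omega>\<bar> \<partial>Pw) \<le> (\<integral>\<^sup>+\<omega>. ennreal (U ^ p) * ennreal (exp (?Y \<omega>)) \<partial>Pw)"
    unfolding prod_nice using U_nonneg
    by (intro nn_integral_mono) (auto simp: abs_mult ennreal_mult'[symmetric] intro!: ennreal_leI mult_right_mono)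
  also have "\<dots> = ennreal (U ^ p) * ennreal (exp ((\<integral>\<omega>. (?Y \<omega>)\<^sup>2 \<partial>Pw) / 2))"
    using gspace_exp[OF sum_gspace(1)[OF g]] by (subst nn_integral_cmult) (auto simp: nn_integral_eq_integral)
  also have "\<dots> \<le> ennreal (U ^ p * exp (real p * real p * ?B / 2))"
  proof -
    have "U ^ p * exp ((\<integral>\<omega>. (?Y \<omega>)\<^sup>2 \<partial>Pw) / 2) \<le> U ^ p * exp (real p * real p * ?B / 2)"
      using var U_nonneg by (intro mult_left_mono iffD2[OF exp_le_cancel_iff] divide_right_mono) auto
    then show ?thesis using U_nonneg by (subst ennreal_mult'[symmetric]) (auto intro: ennreal_leI)
  qed
  finally show ?thesis .
qed

private lemma G_integrable: "integrable (PX \<Otimes>\<^sub>M Pw) (\<lambda>(w, \<omega>). G w \<omega>)"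
proof (rule integrableI_bounded[OF G_measurable])
  have "(\<integral>\<^sup>+z. ennreal (norm (case z of (w, \<omega>) \<Rightarrow> G w \<omega>)) \<partial>(PX \<Otimes>\<^sub>M Pw)) = (\<integral>\<^sup>+w. \<integral>\<^sup>+\<omega>. ennreal \<bar>G w \<omega>\<bar> \<partial>Pw \<partial>PX)"
    using G_measurable by (subst nn_integral_fst[symmetric]) auto
  also have "\<dots> \<le> (\<integral>\<^sup>+w. ennreal (U ^ p * exp (real p * real p * (40 * t * sqrt t) / 2)) \<partial>PX)"
    by (rule nn_integral_mono_AE, use AE_good_all in eventually_elim) (rule G_bound)
  also have "\<dots> < \<infinity>" unfolding nn_integral_const PX.emeasure_space_1 by simp
  finally show "(\<integral>\<^sup>+z. ennreal (norm (case z of (w, \<omega>) \<Rightarrow> G w \<omega>)) \<partial>(PX \<Otimes>\<^sub>M Pw)) < \<infinity>" .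
qed

private lemma moment_rhs_measurable: "moment_rhs X u0 p t x \<in> borel_measurable PX"
proof -
  have eq: "(\<integral>z\<in>{0..t} \<times> {0..t}. (case z of (s, r) \<Rightarrow> heat \<bar>s - r\<bar> (X s (w j) - X r (w k))) \<partial>lborel)
    = (\<integral>z. of_bool (0 \<le> fst z \<and> fst z \<le> t \<and> 0 \<le> snd z \<and> snd z \<le> t) *
        heat \<bar>fst z - snd z\<bar> (S.Xp (w j) (fst z) - S.Xp (w k) (snd z)) \<partial>(lborel \<Otimes>\<^sub>M lborel))" for w j k
    unfolding set_lebesgue_integral_def lborel_prod
    by (intro Bochner_Integration.integral_cong) (auto simp: S.Xp_def indicator_def)
  have [measurable]: "(\<lambda>q. S.Xp (fst q j) (fst (snd q))) \<in> borel_measurable (PX \<Otimes>\<^sub>M (lborel \<Otimes>\<^sub>M lborel))"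
    "(\<lambda>q. S.Xp (fst q j) (snd (snd q))) \<in> borel_measurable (PX \<Otimes>\<^sub>M (lborel \<Otimes>\<^sub>M lborel))" if "j \<in> {1..p}" for j
    using that by (auto intro!: S.Xp_measurable)
  have [measurable]: "(\<lambda>w. \<integral>z\<in>{0..t} \<times> {0..t}. (case z of (s, r) \<Rightarrow> heat \<bar>s - r\<bar> (X s (w j) - X r (w k))) \<partial>lborel) \<in> borel_measurable PX"
    if [measurable]: "j \<in> {1..p}" "k \<in> {1..p}" for j k
    unfolding eq
  proof (rule sigma_finite_measure.borel_measurable_lebesgue_integral)
    show "sigma_finite_measure (lborel \<Otimes>\<^sub>M lborel :: (real \<times> real) measure)" unfolding lborel_prod ..
    show "(\<lambda>(w, z). of_bool (0 \<le> fst z \<and> fst z \<le> t \<and> 0 \<le> snd z \<and> snd z \<le> t) *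
        heat \<bar>fst z - snd z\<bar> (S.Xp (w j) (fst z) - S.Xp (w k) (snd z))) \<in> borel_measurable (PX \<Otimes>\<^sub>M (lborel \<Otimes>\<^sub>M lborel))"
      unfolding split_beta' by measurable
  qed
  show ?thesis unfolding moment_rhs_def[abs_def] by measurable
qed

lemma moment_formula:
  "integrable Pw (\<lambda>\<omega>. (fk_sol Px X I u0 t x \<omega>) ^ p)"
  "integrable PX (moment_rhs X u0 p t x)"
  "(\<integral>\<omega>. (fk_sol Px X I u0 t x \<omega>) ^ p \<partial>Pw) = (\<integral>w. moment_rhs X u0 p t x w \<partial>PX)"
proof -
  interpret PP: pair_sigma_finite PX Pw ..
  have [measurable]: "fk_sol Px X I u0 t x \<in> borel_measurable Pw"
    unfolding fk_sol_nice[abs_def] by measurable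
  have m2: "(\<lambda>\<omega>. \<integral>w. G w \<omega> \<partial>PX) \<in> borel_measurable Pw"
    using PP.integrable_snd[OF G_integrable] by (rule borel_measurable_integrable)
  have m1: "(\<lambda>w. \<integral>\<omega>. G w \<omega> \<partial>Pw) \<in> borel_measurable PX"
    using PP.integrable_fst[OF G_integrable] by (rule borel_measurable_integrable)
  have eq1: "AE w in PX. (\<integral>\<omega>. G w \<omega> \<partial>Pw) = moment_rhs X u0 p t x w"
    using AE_good_all by eventually_elim (rule G_expectation)
  show "integrable Pw (\<lambda>\<omega>. (fk_sol Px X I u0 t x \<omega>) ^ p)"
    using PP.integrable_snd[OF G_integrable] G_power m2 by (subst integrable_cong_AE) auto
  show "integrable PX (moment_rhs X u0 p t x)"
    using PP.integrable_fst[OF G_integrable] eq1 m1 moment_rhs_measurable integrable_cong_AE by blast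
  have "(\<integral>\<omega>. (fk_sol Px X I u0 t x \<omega>) ^ p \<partial>Pw) = (\<integral>\<omega>. (\<integral>w. G w \<omega> \<partial>PX) \<partial>Pw)"
    using G_power m2 by (intro integral_cong_AE) auto
  also have "\<dots> = (\<integral>w. (\<integral>\<omega>. G w \<omega> \<partial>Pw) \<partial>PX)" by (rule PP.Fubini_integral[OF G_integrable])
  also have "\<dots> = (\<integral>w. moment_rhs X u0 p t x w \<partial>PX)"
    using eq1 m1 moment_rhs_measurable by (intro integral_cong_AE) auto
  finally show "(\<integral>\<omega>. (fk_sol Px X I u0 t x \<omega>) ^ p \<partial>Pw) = (\<integral>w. moment_rhs X u0 p t x w \<partial>PX)" .
qed

end

end

subsection \<open>The noise filtration\<close>

context noise
begin

section \<open>Additivity and continuity of the noise on nonnegative kernels\<close>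

lemma W_sqi: "Hdom f \<Longrightarrow> sqi Pw (W f)"
  by (intro gspace_sqi gspace_W)

lemma HN_add_left:
  assumes [measurable]: "f \<in> borel_measurable borel" "g \<in> borel_measurable borel" "h \<in> borel_measurable borel" "k \<in> borel_measurable borel"
    and pos: "\<And>z. 0 \<le> g z" "\<And>z. 0 \<le> h z" "\<And>z. 0 \<le> k z"
    and eq: "AE z in lborel. 0 \<le> fst z \<longrightarrow> f z = g z + h z"
  shows "HN f k = HN g k + HN h k"
proof -
  have "HN f k = (\<integral>\<^sup>+z. (\<integral>\<^sup>+w. ennreal (g z * k w * hk z w) + ennreal (h z * k w * hk z w) \<partial>lborel) \<partial>lborel)"
    unfolding HN_def
  proof (rule nn_integral_cong_AE, use eq in eventually_elim)
    case (elim z)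
    have "f z * k w * hk z w = g z * k w * hk z w + h z * k w * hk z w" for w
    proof (cases "0 \<le> fst z")
      case True
      then show ?thesis using elim by (simp add: distrib_right)
    qed (simp add: hk_eq_0)
    then show ?case using pos by (intro nn_integral_cong) (simp add: ennreal_plus)
  qed
  then show ?thesis unfolding HN_def by (simp add: nn_integral_add)
qed

text \<open>Expanding the mean square of \<open>W f - (W g + W h)\<close> into covariances,
  additivity of \<open>HN\<close> makes everything cancel. Nonnegativity gives finite norms of both
  parts from that of \<open>f\<close>.\<close>

lemma W_add:
  assumes f: "Hdom f" "\<And>z. 0 \<le> f z"
    and [measurable]: "g \<in> borel_measurable borel" "h \<in> borel_measurable borel"
    and pos: "\<And>z. 0 \<le> g z" "\<And>z. 0 \<le> h z"
    and eq: "AE z in lborel. 0 \<le> fst z \<longrightarrow> f z = g z + h z"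
  shows "Hdom g" "Hdom h" "AE \<omega> in Pw. W f \<omega> = W g \<omega> + W h \<omega>"
proof -
  note fm[measurable] = Hdom_measurable[OF f(1)]
  note add = HN_add_left[OF fm assms(3,4) _ pos _ eq]
  have ff: "HN f f = HN g g + HN g h + (HN g h + HN h h)" and fg: "HN f g = HN g g + HN g h"
    and fh: "HN f h = HN g h + HN h h"
    using add[OF fm f(2)] add[OF assms(3) pos(1)] add[OF assms(4) pos(2)]
      HN_commute[of f g] HN_commute[of f h] HN_commute[of h g] by simp_all
  have "HN f f < \<infinity>" using HN_finite[OF f(1)] f(2) by simp
  then have fin: "HN g g < \<infinity>" "HN g h < \<infinity>" "HN h h < \<infinity>" unfolding ff by auto
  show g: "Hdom g" using fin(1) pos by (intro Hdom_HN) auto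
  show h: "Hdom h" using fin(3) pos by (intro Hdom_HN) auto
  obtain a b c where abc: "HN g g = ennreal a" "HN g h = ennreal b" "HN h h = ennreal c" "0 \<le> a" "0 \<le> b" "0 \<le> c"
    using fin by (cases "HN g g"; cases "HN g h"; cases "HN h h") auto
  have r: "enn2real (HN f f) = a + b + (b + c)" "enn2real (HN f g) = a + b" "enn2real (HN f h) = b + c"
    unfolding ff fg fh abc using abc(4-6) by (simp_all flip: ennreal_plus)
  note s = W_sqi[OF f(1)] W_sqi[OF g] W_sqi[OF h]
  have "(\<integral>\<omega>. (W f \<omega> - (W g \<omega> + W h \<omega>))\<^sup>2 \<partial>Pw) = (\<integral>\<omega>. W f \<omega> * W f \<omega> - 2 * (W f \<omega> * W g \<omega>) - 2 * (W f \<omega> * W h \<omega>)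
      + W g \<omega> * W g \<omega> + 2 * (W g \<omega> * W h \<omega>) + W h \<omega> * W h \<omega> \<partial>Pw)"
    by (intro Bochner_Integration.integral_cong) (auto simp: power2_eq_square algebra_simps)
  also have "\<dots> = 0"
    using sqi_mult[OF s(1) s(1)] sqi_mult[OF s(1) s(2)] sqi_mult[OF s(1) s(3)] sqi_mult[OF s(2) s(2)] sqi_mult[OF s(2) s(3)] sqi_mult[OF s(3) s(3)] abc(4-6)
    by (simp add: W_covariance_nonneg f g h pos r abc(1-3))
  finally have "AE \<omega> in Pw. (W f \<omega> - (W g \<omega> + W h \<omega>))\<^sup>2 = 0"
    using sqi_diff[OF s(1) sqi_add[OF s(2,3)]] by (subst (asm) integral_nonneg_eq_0_iff_AE) (auto simp: sqi_def)
  then show "AE \<omega> in Pw. W f \<omega> = W g \<omega> + W h \<omega>" by eventually_elim simp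
qed

lemma W_cmult:
  assumes f: "Hdom f" "\<And>z. 0 \<le> f z" and c: "0 \<le> c"
  shows "AE \<omega> in Pw. W (\<lambda>z. c * f z) \<omega> = c * W f \<omega>"
proof -
  note fm[measurable] = Hdom_measurable[OF f(1)]
  have cm: "(\<lambda>z. c * f z) \<in> borel_measurable borel" by measurable
  have e1: "HN (\<lambda>z. c * f z) f = ennreal c * HN f f" by (rule HN_cmult[OF fm fm c])
  have e2: "HN (\<lambda>z. c * f z) (\<lambda>z. c * f z) = ennreal c * (ennreal c * HN f f)"
    using HN_cmult[OF fm cm c] e1 HN_commute[OF fm cm] by simp
  obtain a where a: "HN f f = ennreal a" "0 \<le> a" using HN_finite[OF f(1)] f(2) by (cases "HN f f") auto
  have cf: "Hdom (\<lambda>z. c * f z)" using f(2) c by (intro Hdom_HN) (auto simp: e2 a abs_mult ennreal_mult'[symmetric])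
  note s = W_sqi[OF f(1)] W_sqi[OF cf]
  have "(\<integral>\<omega>. (W (\<lambda>z. c * f z) \<omega> - c * W f \<omega>)\<^sup>2 \<partial>Pw) = (\<integral>\<omega>. W (\<lambda>z. c * f z) \<omega> * W (\<lambda>z. c * f z) \<omega>
      - 2 * c * (W (\<lambda>z. c * f z) \<omega> * W f \<omega>) + c * c * (W f \<omega> * W f \<omega>) \<partial>Pw)"
    by (intro Bochner_Integration.integral_cong) (auto simp: power2_eq_square algebra_simps)
  also have "\<dots> = 0"
    using sqi_mult[OF s(1) s(1)] sqi_mult[OF s(2) s(1)] sqi_mult[OF s(2) s(2)] c a(2)
    by (simp add: W_covariance_nonneg f cf e1 e2 a(1) enn2real_mult)
  finally have "AE \<omega> in Pw. (W (\<lambda>z. c * f z) \<omega> - c * W f \<omega>)\<^sup>2 = 0"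
    using sqi_diff[OF s(2) sqi_cmult[OF s(1)]] by (subst (asm) integral_nonneg_eq_0_iff_AE) (auto simp: sqi_def)
  then show ?thesis by eventually_elim simp
qed

text \<open>Domination by \<open>f\<close> is enough: the squared norm of \<open>f - fn n\<close>
  tends to 0 by dominated convergence, and by \<open>W_add\<close> it is the mean square distance of
  the noise integrals.\<close>

lemma W_monotone_limit:
  assumes f: "Hdom f" "\<And>z. 0 \<le> f z" and fn[measurable]: "\<And>n. fn n \<in> borel_measurable borel"
    and pos: "\<And>n z. 0 \<le> fn n z" and le: "\<And>n z. fn n z \<le> f z"
    and lim: "\<And>z. 0 \<le> fst z \<Longrightarrow> (\<lambda>n. fn n z) \<longlonglongrightarrow> f z"
  shows "Hdom (fn n)" "l2lim Pw (\<lambda>n. W (fn n)) (W f)"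
proof -
  note fm[measurable] = Hdom_measurable[OF f(1)]
  let ?g = "\<lambda>n z. f z - fn n z"
  have eq: "AE z in lborel. 0 \<le> fst z \<longrightarrow> f z = fn n z + ?g n z" for n by simp
  have gp: "0 \<le> ?g n z" for n z using le by simp
  have gm: "?g n \<in> borel_measurable borel" for n by measurable
  note add = W_add[OF f fn gm pos gp eq]
  show "Hdom (fn n)" for n by (rule add(1))
  have fin: "HN f f < \<infinity>" using HN_finite[OF f(1)] f(2) by simp
  have "(\<lambda>n. HN (?g n) (?g n)) \<longlonglongrightarrow> (\<integral>\<^sup>+p. 0 \<partial>((lborel :: (real \<times> real) measure) \<Otimes>\<^sub>M (lborel :: (real \<times> real) measure)))"
    unfolding HN_pair[OF gm gm]
  proof (rule nn_integral_dominated_convergence[where u = "\<lambda>n p. ennreal (?g n (fst p) * ?g n (snd p) * hk (fst p) (snd p))"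
      and u' = "\<lambda>_. 0" and w = "\<lambda>p. ennreal (f (fst p) * f (snd p) * hk (fst p) (snd p))"])
    show "(\<integral>\<^sup>+p. ennreal (f (fst p) * f (snd p) * hk (fst p) (snd p)) \<partial>(lborel \<Otimes>\<^sub>M lborel)) < \<infinity>"
      using fin by (simp add: HN_pair)
    show "AE p in lborel \<Otimes>\<^sub>M lborel. ennreal (?g n (fst p) * ?g n (snd p) * hk (fst p) (snd p))
        \<le> ennreal (f (fst p) * f (snd p) * hk (fst p) (snd p))" for n
      using pos le f(2) by (intro AE_I2 ennreal_leI mult_right_mono mult_mono) auto
    show "AE p in lborel \<Otimes>\<^sub>M lborel. (\<lambda>n. ennreal (?g n (fst p) * ?g n (snd p) * hk (fst p) (snd p))) \<longlonglongrightarrow> 0"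
    proof (rule AE_I2)
      fix p :: "(real \<times> real) \<times> (real \<times> real)"
      show "(\<lambda>n. ennreal (?g n (fst p) * ?g n (snd p) * hk (fst p) (snd p))) \<longlonglongrightarrow> 0"
      proof (cases "0 \<le> fst (fst p) \<and> 0 \<le> fst (snd p)")
        case True
        then have "(\<lambda>n. ?g n (fst p) * ?g n (snd p) * hk (fst p) (snd p)) \<longlonglongrightarrow> (f (fst p) - f (fst p)) * (f (snd p) - f (snd p)) * hk (fst p) (snd p)"
          by (intro tendsto_intros lim) auto
        then have "(\<lambda>n. ?g n (fst p) * ?g n (snd p) * hk (fst p) (snd p)) \<longlonglongrightarrow> 0" by simp
        then show ?thesis using tendsto_ennrealI by fastforce
      next
        case False
        then have "hk (fst p) (snd p) = 0" by (auto simp: hk_def)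
        then show ?thesis by simp
      qed
    qed
  qed measurable
  then have HN0: "(\<lambda>n. HN (?g n) (?g n)) \<longlonglongrightarrow> 0" by simp
  have "(\<integral>\<omega>. (W (fn n) \<omega> - W f \<omega>)\<^sup>2 \<partial>Pw) = enn2real (HN (?g n) (?g n))" for n
  proof -
    have "(\<integral>\<omega>. (W (fn n) \<omega> - W f \<omega>)\<^sup>2 \<partial>Pw) = (\<integral>\<omega>. W (?g n) \<omega> * W (?g n) \<omega> \<partial>Pw)"
    proof (rule integral_cong_AE)
      show "AE \<omega> in Pw. (W (fn n) \<omega> - W f \<omega>)\<^sup>2 = W (?g n) \<omega> * W (?g n) \<omega>"
        using add(3)[of n] by eventually_elim (simp add: power2_eq_square)
    qed (use W_measurable[OF add(1)] W_measurable[OF add(2)] W_measurable[OF f(1)] in auto)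
    then show ?thesis using W_covariance_nonneg[OF add(2) gp add(2) gp] by simp
  qed
  moreover have "(\<lambda>n. enn2real (HN (?g n) (?g n))) \<longlonglongrightarrow> 0"
    using tendsto_enn2real[OF HN0[folded ennreal_0]] by simp
  ultimately show "l2lim Pw (\<lambda>n. W (fn n)) (W f)"
    unfolding l2lim_def using W_sqi[OF f(1)] W_sqi[OF add(1)] by simp
qed

end

text \<open>At a fixed time different from that of \<open>z\<close>, the space integral of the heat
  kernel is at most 1. So the inner integral is at most \<open>t\<close>, and the outer one runs
  over a bounded set.\<close>

lemma Hdom_indicator:
  assumes B: "B \<in> sets borel" "B \<subseteq> {0..t} \<times> {- N..N}"
  shows "Hdom (indicator B)"
proof (rule Hdom_HN)
  have [measurable]: "{0..t} \<times> {- N..N} \<in> sets (borel :: (real \<times> real) measure)" by (intro borel_closed closed_Times) auto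
  show "(indicator B :: real \<times> real \<Rightarrow> real) \<in> borel_measurable borel" using B by measurable
  have inner: "(\<integral>\<^sup>+w. ennreal (indicator ({0..t} \<times> {- N..N}) w * hk z w) \<partial>lborel) \<le> ennreal t" for z
  proof (cases "0 \<le> t")
    case True
    have "(\<integral>\<^sup>+w. ennreal (indicator ({0..t} \<times> {- N..N}) w * hk z w) \<partial>lborel)
      = (\<integral>\<^sup>+b. \<integral>\<^sup>+y. ennreal (indicator ({0..t} \<times> {- N..N}) (b, y) * hk z (b, y)) \<partial>lborel \<partial>lborel)"
      by (rule nn_integral_lborel_pair) measurable
    also have "\<dots> \<le> (\<integral>\<^sup>+b. indicator {0..t} b \<partial>lborel)"
    proof (rule nn_integral_mono)
      fix b
      show "(\<integral>\<^sup>+y. ennreal (indicator ({0..t} \<times> {- N..N}) (b, y) * hk z (b, y)) \<partial>lborel) \<le> indicator {0..t} b"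
      proof (cases "b \<in> {0..t} \<and> b \<noteq> fst z")
        case True
        then have "(\<integral>\<^sup>+y. ennreal (indicator ({0..t} \<times> {- N..N}) (b, y) * hk z (b, y)) \<partial>lborel)
          \<le> (\<integral>\<^sup>+y. ennreal (heat \<bar>b - fst z\<bar> (snd z - y)) \<partial>lborel)"
          by (intro nn_integral_mono ennreal_leI) (auto simp: hk_def indicator_def heat_nonneg)
        also have "\<dots> = 1" using True by (intro nn_integral_heat) auto
        finally show ?thesis using True by simp
      next
        case False
        then have "indicator ({0..t} \<times> {- N..N}) (b, y) * hk z (b, y) = 0" for y by (auto simp: hk_def)
        then show ?thesis by (simp only: ennreal_0 nn_integral_const) simp
      qed
    qed
    also have "\<dots> = ennreal t" using True by simp
    finally show ?thesis .
  qed (simp add: indicator_def)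
  have "HN (\<lambda>z. \<bar>indicator B z\<bar>) (\<lambda>z. \<bar>indicator B z\<bar>) \<le> HN (indicator ({0..t} \<times> {- N..N})) (indicator ({0..t} \<times> {- N..N}))"
    using B by (intro HN_mono) (auto simp: indicator_def)
  also have "\<dots> = (\<integral>\<^sup>+z. indicator ({0..t} \<times> {- N..N}) z * (\<integral>\<^sup>+w. ennreal (indicator ({0..t} \<times> {- N..N}) w * hk z w) \<partial>lborel) \<partial>lborel)"
    unfolding HN_def by (intro nn_integral_cong) (auto simp: indicator_def)
  also have "\<dots> \<le> (\<integral>\<^sup>+z. indicator ({0..t} \<times> {- N..N}) z * ennreal t \<partial>lborel)"
    by (intro nn_integral_mono mult_left_mono inner) auto
  also have "\<dots> = ennreal t * emeasure lborel ({0..t} \<times> {- N..N})"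
    by (subst mult.commute, subst nn_integral_cmult_indicator) auto
  also have "\<dots> < \<infinity>"
  proof -
    have "{0..t} \<times> {- N..N} = {(0, - N)..(t, N)}" by auto
    then show ?thesis using emeasure_bounded_finite[of "{0..t} \<times> {- N..N}"] by (simp add: bounded_Times ennreal_mult_less_top)
  qed
  finally show "HN (\<lambda>z. \<bar>indicator B z\<bar>) (\<lambda>z. \<bar>indicator B z\<bar>) < \<infinity>" .
qed

context noise
begin

section \<open>Kernels supported up to time t give adapted variables\<close>

context
  fixes t :: real
  assumes t: "0 \<le> t"
begin

private abbreviation "F \<equiv> Wfilt Pw W t"

private definition "gens = {(W (indicator ({0..s} \<times> {min 0 y..max 0 y}))) -` B \<inter> space Pw | s y B.
          0 \<le> s \<and> s \<le> t \<and> B \<in> sets borel} \<union> {N \<in> sets Pw. emeasure Pw N = 0}"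

private lemma Hdom_rect: "Hdom (indicator ({0..s} \<times> {min 0 y..max 0 y}))"
proof (rule Hdom_indicator)
  show "{0..s} \<times> {min 0 y..max 0 y} \<in> sets borel" by (intro borel_closed closed_Times) auto
  show "{0..s} \<times> {min 0 y..max 0 y} \<subseteq> {0..s} \<times> {- \<bar>y\<bar>..\<bar>y\<bar>}" by auto
qed

private lemma gens_sets: "gens \<subseteq> sets Pw"
  unfolding gens_def using W_measurable[OF Hdom_rect] by (auto intro: measurable_sets)

private lemma gens_Pow: "gens \<subseteq> Pow (space Pw)"
  using gens_sets sets.sets_into_space by blast

lemma space_Wfilt: "space F = space Pw"
  unfolding Wfilt_def gens_def[symmetric] using gens_Pow by (simp add: space_measure_of)

private lemma sets_Wfilt: "sets F = sigma_sets (space Pw) gens"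
  unfolding Wfilt_def gens_def[symmetric] using gens_Pow by (simp add: sets_measure_of)

lemma Wfilt_subalgebra: "subalgebra Pw F"
  unfolding subalgebra_def space_Wfilt sets_Wfilt
  using sets.sigma_sets_subset[OF gens_sets] by simp

lemma Wfilt_measurable: "Y \<in> borel_measurable F \<Longrightarrow> Y \<in> borel_measurable Pw"
  by (rule measurable_from_subalg[OF Wfilt_subalgebra])

lemma Wfilt_null: "N \<in> sets Pw \<Longrightarrow> emeasure Pw N = 0 \<Longrightarrow> N \<in> sets F"
  unfolding sets_Wfilt by (rule sigma_sets.Basic) (simp add: gens_def)

text \<open>Null sets are among the generators, so a change on a null set preserves adaptedness.
  This is essential because the identities for \<open>W\<close> hold only almost surely.\<close>

lemma Wfilt_cong_AE:
  fixes Y Z :: "'b \<Rightarrow> real"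
  assumes Y: "Y \<in> borel_measurable F" and Z[measurable]: "Z \<in> borel_measurable Pw" and eq: "AE \<omega> in Pw. Y \<omega> = Z \<omega>"
  shows "Z \<in> borel_measurable F"
proof (rule measurableI)
  note [measurable] = Wfilt_measurable[OF Y]
  fix B :: "real set" assume B[measurable]: "B \<in> sets borel"
  let ?N1 = "{\<omega>\<in>space Pw. Y \<omega> \<in> B \<and> Z \<omega> \<notin> B}" and ?N2 = "{\<omega>\<in>space Pw. Z \<omega> \<in> B \<and> Y \<omega> \<notin> B}"
  have "emeasure Pw ?N1 = 0" "emeasure Pw ?N2 = 0"
    using eq by (auto intro!: emeasure_eq_0_AE elim!: AE_mp)
  then have N: "?N1 \<in> sets F" "?N2 \<in> sets F" by (auto intro!: Wfilt_null)
  have "Z -` B \<inter> space F = ((Y -` B \<inter> space F) - ?N1) \<union> ?N2" by (auto simp: space_Wfilt)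
  then show "Z -` B \<inter> space F \<in> sets F" using N measurable_sets[OF Y B] by auto
qed simp

text \<open>L2 convergence yields an almost surely convergent subsequence, and its pointwise limit
  is adapted.\<close>

lemma Wfilt_l2lim:
  assumes Y: "\<And>n. Yn n \<in> borel_measurable F" and lim: "l2lim Pw Yn Z"
  shows "Z \<in> borel_measurable F"
proof -
  have s: "\<And>n. sqi Pw (Yn n)" "sqi Pw Z" and l: "(\<lambda>n. \<integral>\<omega>. (Yn n \<omega> - Z \<omega>)\<^sup>2 \<partial>Pw) \<longlonglongrightarrow> 0"
    using lim by (auto simp: l2lim_def)
  have "\<exists>r::nat \<Rightarrow> nat. strict_mono r \<and> (AE \<omega> in Pw. (\<lambda>n. (Yn (r n) \<omega> - Z \<omega>)\<^sup>2) \<longlonglongrightarrow> 0)"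
  proof (rule tendsto_L1_AE_subseq)
    show "integrable Pw (\<lambda>\<omega>. (Yn n \<omega> - Z \<omega>)\<^sup>2)" for n using sqi_diff[OF s(1) s(2)] by (simp add: sqi_def)
    show "(\<lambda>n. \<integral>\<omega>. norm ((Yn n \<omega> - Z \<omega>)\<^sup>2) \<partial>Pw) \<longlonglongrightarrow> 0" using l by simp
  qed
  then obtain r :: "nat \<Rightarrow> nat" where r: "AE \<omega> in Pw. (\<lambda>n. (Yn (r n) \<omega> - Z \<omega>)\<^sup>2) \<longlonglongrightarrow> 0" by blast
  show ?thesis
  proof (rule Wfilt_cong_AE)
    show "(\<lambda>\<omega>. lim (\<lambda>n. Yn (r n) \<omega>)) \<in> borel_measurable F" using Y by measurable
    show "AE \<omega> in Pw. lim (\<lambda>n. Yn (r n) \<omega>) = Z \<omega>"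
      using r
    proof eventually_elim
      case (elim \<omega>)
      then have "(\<lambda>n. sqrt ((Yn (r n) \<omega> - Z \<omega>)\<^sup>2)) \<longlonglongrightarrow> sqrt 0" by (rule tendsto_real_sqrt)
      then have "(\<lambda>n. Yn (r n) \<omega> - Z \<omega>) \<longlonglongrightarrow> 0" by (simp add: tendsto_rabs_zero_iff)
      then have "(\<lambda>n. Yn (r n) \<omega>) \<longlonglongrightarrow> Z \<omega>" by (simp add: LIM_zero_iff)
      then show ?case by (rule limI)
    qed
  qed (rule sqi_measurable[OF s(2)])
qed

private lemma W_rect: "0 \<le> s \<Longrightarrow> s \<le> t \<Longrightarrow> W (indicator ({0..s} \<times> {min 0 y..max 0 y})) \<in> borel_measurable F"
proof (rule measurableI)
  fix B :: "real set" assume st: "0 \<le> s" "s \<le> t" and B: "B \<in> sets borel"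
  show "W (indicator ({0..s} \<times> {min 0 y..max 0 y})) -` B \<inter> space F \<in> sets F"
    unfolding space_Wfilt sets_Wfilt by (rule sigma_sets.Basic) (use st B in \<open>auto simp: gens_def\<close>)
qed simp

private definition box :: "real \<Rightarrow> (real \<times> real) set" where "box N = {0..t} \<times> {- N..N}"

private lemma box_sets: "box N \<in> sets borel"
  unfolding box_def by (intro borel_closed closed_Times) auto

private lemma Hdom_box: "B \<in> sets borel \<Longrightarrow> Hdom (indicator (B \<inter> box N))"
  using box_sets by (intro Hdom_indicator[of _ t N]) (auto simp: box_def)

private lemma W_add_Wfilt:
  assumes f: "Hdom f" "\<And>z. 0 \<le> f z"
    and m: "g \<in> borel_measurable borel" "h \<in> borel_measurable borel"
    and pos: "\<And>z. 0 \<le> g z" "\<And>z. 0 \<le> h z"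
    and eq: "AE z in lborel. 0 \<le> fst z \<longrightarrow> f z = g z + h z"
  shows "W g \<in> borel_measurable F \<Longrightarrow> W h \<in> borel_measurable F \<Longrightarrow> W f \<in> borel_measurable F"
    "W f \<in> borel_measurable F \<Longrightarrow> W g \<in> borel_measurable F \<Longrightarrow> W h \<in> borel_measurable F"
proof -
  note add = W_add[OF f m pos eq]
  show "W f \<in> borel_measurable F" if [measurable]: "W g \<in> borel_measurable F" "W h \<in> borel_measurable F"
    by (rule Wfilt_cong_AE[of "\<lambda>\<omega>. W g \<omega> + W h \<omega>"]) (use add(3) W_measurable[OF f(1)] in \<open>auto elim!: AE_mp\<close>)
  show "W h \<in> borel_measurable F" if [measurable]: "W f \<in> borel_measurable F" "W g \<in> borel_measurable F"
    by (rule Wfilt_cong_AE[of "\<lambda>\<omega>. W f \<omega> - W g \<omega>"]) (use add(3) W_measurable[OF add(2)] in \<open>auto elim!: AE_mp\<close>)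
qed

text \<open>The noise of the zero function vanishes only almost surely, being 0 times a noise
  variable by \<open>W_cmult\<close>.\<close>

private lemma W_null: "W (indicator {}) \<in> borel_measurable F"
proof (rule Wfilt_cong_AE[of "\<lambda>_. 0"])
  have d: "Hdom (indicator {})" using Hdom_box[of "{}"] by simp
  show "W (indicator {}) \<in> borel_measurable Pw" by (rule W_measurable[OF d])
  have "AE \<omega> in Pw. W (\<lambda>z. 0 * indicator {} z) \<omega> = 0 * W (indicator {}) \<omega>"
    by (rule W_cmult[OF d]) auto
  moreover have "(\<lambda>z. 0 * indicator {} z :: real) = indicator ({} :: (real \<times> real) set)" by auto
  ultimately show "AE \<omega> in Pw. 0 = W (indicator {}) \<omega>" by (auto elim!: AE_mp)
qed simp

private lemma AE_snd_neq: "AE z in (lborel :: (real \<times> real) measure). snd z \<noteq> a"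
  unfolding lborel_prod[symmetric]
proof (rule lborel_pair.AE_pair_measure)
  show "{z \<in> space (lborel \<Otimes>\<^sub>M lborel). snd z \<noteq> a} \<in> sets ((lborel :: real measure) \<Otimes>\<^sub>M lborel)" by measurable
  show "AE x in (lborel :: real measure). AE y in lborel. snd (x, y) \<noteq> a" using AE_lborel_singleton[of a] by simp
qed

text \<open>The generating rectangles extend from height 0 to height \<open>y\<close>. A rectangle
  starting at height \<open>- N\<close> is a union of two of them if it reaches 0 and otherwise a
  difference of two; the overlaps are segments, of measure 0.\<close>

private lemma W_basic:
  assumes N: "0 \<le> N"
  shows "W (indicator ({..(s, y)} \<inter> box N)) \<in> borel_measurable F"
proof (cases "s < 0 \<or> y < - N")
  case True
  then have "{..(s, y)} \<inter> box N = {}" by (auto simp: box_def)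
  then show ?thesis using W_null by (simp only:)
next
  case False
  define s' where "s' = min s t"
  define y' where "y' = min y N"
  have s': "0 \<le> s'" "s' \<le> t" and y': "- N \<le> y'" using False t N by (auto simp: s'_def y'_def)
  have E: "{..(s, y)} \<inter> box N = {0..s'} \<times> {- N..y'}" by (auto simp: box_def s'_def y'_def)
  let ?R = "\<lambda>y. {0..s'} \<times> {min 0 y..max 0 y}"
  have R: "W (indicator (?R a)) \<in> borel_measurable F" for a by (rule W_rect[OF s'])
  have m: "(indicator (?R a) :: real \<times> real \<Rightarrow> real) \<in> borel_measurable borel" for a
    using Hdom_measurable[OF Hdom_rect] .
  have mE: "(indicator ({..(s, y)} \<inter> box N) :: real \<times> real \<Rightarrow> real) \<in> borel_measurable borel"
    by (intro Hdom_measurable Hdom_box) auto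
  show ?thesis
  proof (cases "0 \<le> y'")
    case True
    have "AE z in lborel. 0 \<le> fst z \<longrightarrow> indicator ({..(s, y)} \<inter> box N) z = (indicator (?R (- N)) z + indicator (?R y') z :: real)"
      using AE_snd_neq[of 0] unfolding E by eventually_elim (use True N in \<open>auto simp: indicator_def\<close>)
    from W_add_Wfilt(1)[OF Hdom_box _ m m _ _ this] show ?thesis using R by simp
  next
    case F: False
    have "AE z in lborel. 0 \<le> fst z \<longrightarrow> indicator (?R (- N)) z = (indicator (?R y') z + indicator ({..(s, y)} \<inter> box N) z :: real)"
      using AE_snd_neq[of y'] unfolding E by eventually_elim (use F N y' in \<open>auto simp: indicator_def\<close>)
    from W_add_Wfilt(2)[OF Hdom_rect _ m mE _ _ this] show ?thesis using R by simp
  qed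
qed

text \<open>Dynkin's argument, starting from the quadrants \<open>{..a}\<close>; intersecting with
  \<open>box N\<close> keeps every indicator in the domain of \<open>W\<close>.\<close>

private lemma W_indicator_Wfilt:
  assumes N: "0 \<le> N" and B: "B \<in> sets borel"
  shows "W (indicator (B \<inter> box N)) \<in> borel_measurable F"
proof -
  let ?G = "range (\<lambda>a. {..a :: real \<times> real})"
  have sig: "sigma_sets UNIV ?G = sets borel"
    by (subst borel_eq_atMost) simp
  have int: "Int_stable ?G"
  proof (rule Int_stableI_image)
    fix a b :: "real \<times> real"
    show "\<exists>c\<in>UNIV. {..a} \<inter> {..b} = {..c}"
      by (rule bexI[of _ "(min (fst a) (fst b), min (snd a) (snd b))"]) (auto simp: less_eq_prod_def)
  qed
  have B': "B \<in> sigma_sets UNIV ?G" unfolding sig by (rule B)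
  have GP: "?G \<subseteq> Pow UNIV" by simp
  from int GP B' show ?thesis
  proof (induction rule: sigma_sets_induct_disjoint)
    case (basic A)
    then obtain s y where "A = {..(s, y)}" by auto
    then show ?case using W_basic[OF N] by simp
  next
    case empty
    then show ?case using W_null by (simp only: Int_empty_left)
  next
    case (compl A)
    have A: "A \<in> sets borel" using compl.hyps unfolding sig .
    have full: "W (indicator (UNIV \<inter> box N)) \<in> borel_measurable F"
    proof -
      have "UNIV \<inter> box N = {..(t, N)} \<inter> box N" by (auto simp: box_def)
      then show ?thesis using W_basic[OF N, of t N] by simp
    qed
    have "AE z in lborel. 0 \<le> fst z \<longrightarrow> indicator (UNIV \<inter> box N) z = (indicator (A \<inter> box N) z + indicator ((UNIV - A) \<inter> box N) z :: real)"
      by (auto simp: indicator_def)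
    from W_add_Wfilt(2)[OF Hdom_box _ Hdom_measurable[OF Hdom_box] Hdom_measurable[OF Hdom_box] _ _ this]
    show ?case using full compl.IH A by auto
  next
    case (union A)
    have A: "A i \<in> sets borel" for i using union.hyps unfolding sig by auto
    have fin: "W (indicator ((\<Union>i<n. A i) \<inter> box N)) \<in> borel_measurable F" for n
    proof (induction n)
      case 0
      have "(\<Union>i<0::nat. A i) \<inter> box N = {}" by simp
      then show ?case using W_null by (simp only:)
    next
      case (Suc n)
      have "AE z in lborel. 0 \<le> fst z \<longrightarrow> indicator ((\<Union>i<Suc n. A i) \<inter> box N) z
         = (indicator ((\<Union>i<n. A i) \<inter> box N) z + indicator (A n \<inter> box N) z :: real)"
      proof (intro AE_I2 impI)
        fix z :: "real \<times> real"
        have "z \<notin> A i" if "z \<in> A n" "i < n" for i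
          using disjoint_family_onD[OF union.hyps(1), of n i] that by auto
        then show "indicator ((\<Union>i<Suc n. A i) \<inter> box N) z = (indicator ((\<Union>i<n. A i) \<inter> box N) z + indicator (A n \<inter> box N) z :: real)"
          by (auto simp: indicator_def lessThan_Suc)
      qed
      from W_add_Wfilt(1)[OF Hdom_box _ Hdom_measurable[OF Hdom_box] Hdom_measurable[OF Hdom_box] _ _ this]
      show ?case using Suc union.IH A by auto
    qed
    have lim: "(\<lambda>n. indicator ((\<Union>i<n. A i) \<inter> box N) z :: real) \<longlonglongrightarrow> indicator ((\<Union>i. A i) \<inter> box N) z" for z
    proof (rule tendsto_eventually)
      show "\<forall>\<^sub>F n in sequentially. indicator ((\<Union>i<n. A i) \<inter> box N) z = (indicator ((\<Union>i. A i) \<inter> box N) z :: real)"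
      proof (cases "\<exists>i. z \<in> A i")
        case True
        then obtain i where "z \<in> A i" by blast
        then show ?thesis unfolding eventually_sequentially
          by (intro exI[of _ "Suc i"]) (auto simp: indicator_def)
      qed (auto simp: indicator_def)
    qed
    have "l2lim Pw (\<lambda>n. W (indicator ((\<Union>i<n. A i) \<inter> box N))) (W (indicator ((\<Union>i. A i) \<inter> box N)))"
      by (rule W_monotone_limit(2)[OF Hdom_box]) (use A lim in \<open>auto intro!: Hdom_measurable[OF Hdom_box] simp: indicator_def\<close>)
    then show ?case by (rule Wfilt_l2lim[OF fin])
  qed
qed

text \<open>Approximation by simple functions. Membership in \<open>Hdom\<close> is a premise inside
  the induction formula, because at each step the smaller pieces must inherit it from the
  whole.\<close>

private lemma W_box_Wfilt:
  assumes N: "0 \<le> N" and u: "u \<in> borel_measurable borel" "\<And>z. 0 \<le> u z"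
  shows "Hdom (\<lambda>z. u z * indicator (box N) z) \<longrightarrow> W (\<lambda>z. u z * indicator (box N) z) \<in> borel_measurable F"
  using u
proof (induction u rule: borel_measurable_induct_real)
  case (set A)
  have "(\<lambda>z. indicator A z * indicator (box N) z :: real) = indicator (A \<inter> box N)"
    by (auto simp: indicator_def)
  then show ?case using W_indicator_Wfilt[OF N set] by simp
next
  case (mult u c)
  have bm[measurable]: "box N \<in> sets borel" by (rule box_sets)
  show ?case
  proof
    assume D: "Hdom (\<lambda>z. c * u z * indicator (box N) z)"
    show "W (\<lambda>z. c * u z * indicator (box N) z) \<in> borel_measurable F"
    \<comment> \<open>For \<open>c = 0\<close>, membership of the multiple in \<open>Hdom\<close>
      says nothing about \<open>u\<close>.\<close>
    proof (cases "c = 0")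
      case True
      have "(\<lambda>z. c * u z * indicator (box N) z) = indicator {}" using True by auto
      then show ?thesis using W_null by simp
    next
      case False
      then have c: "0 < c" using mult by simp
      let ?v = "\<lambda>z. u z * indicator (box N) z"
      have cv: "(\<lambda>z. c * u z * indicator (box N) z) = (\<lambda>z. c * ?v z)" by (auto simp: mult.assoc)
      have vm[measurable]: "?v \<in> borel_measurable borel" using mult by measurable
      have vp: "0 \<le> ?v z" for z using mult by simp
      have cvm: "(\<lambda>z. c * ?v z) \<in> borel_measurable borel" by measurable
      have "HN ?v ?v \<le> ennreal (1 / c) * (ennreal (1 / c) * HN (\<lambda>z. c * ?v z) (\<lambda>z. c * ?v z))"
      proof -
        have "HN (\<lambda>z. c * ?v z) (\<lambda>z. c * ?v z) = ennreal c * (ennreal c * HN ?v ?v)"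
          using c HN_cmult[OF vm cvm] HN_commute[OF vm cvm] HN_cmult[OF vm vm] by simp
        moreover have "ennreal (1 / c) * (ennreal (1 / c) * (ennreal c * (ennreal c * e))) = e" for e
          using c by (simp add: mult.assoc[symmetric] ennreal_mult'[symmetric])
        ultimately show ?thesis by simp
      qed
      also have "\<dots> < \<infinity>"
      proof -
        have "(\<lambda>z. \<bar>c * ?v z\<bar>) = (\<lambda>z. c * ?v z)"
          by (intro ext abs_of_nonneg mult_nonneg_nonneg vp) (use c in auto)
        then have "HN (\<lambda>z. c * ?v z) (\<lambda>z. c * ?v z) < \<infinity>" using HN_finite[OF D[unfolded cv]] by simp
        then show ?thesis using c by (simp only: ennreal_mult_less_top infinity_ennreal_def) simp
      qed
      finally have "Hdom ?v" using vp by (intro Hdom_HN) auto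
      then have Wv[measurable]: "W ?v \<in> borel_measurable F" and ae: "AE \<omega> in Pw. W (\<lambda>z. c * ?v z) \<omega> = c * W ?v \<omega>"
        using mult.IH W_cmult[of ?v c] vp c by auto
      show ?thesis unfolding cv
      proof (rule Wfilt_cong_AE[of "\<lambda>\<omega>. c * W ?v \<omega>"])
        show "(\<lambda>\<omega>. c * W ?v \<omega>) \<in> borel_measurable F" by measurable
        show "W (\<lambda>z. c * ?v z) \<in> borel_measurable Pw" by (rule W_measurable[OF D[unfolded cv]])
        show "AE \<omega> in Pw. c * W ?v \<omega> = W (\<lambda>z. c * ?v z) \<omega>"
          using ae by eventually_elim (rule sym)
      qed
    qed
  qed
next
  case (add u v)
  have bm[measurable]: "box N \<in> sets borel" by (rule box_sets)
  note [measurable] = add.hyps(1,3)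
  show ?case
  proof
    assume D: "Hdom (\<lambda>z. (v z + u z) * indicator (box N) z)"
    have p: "0 \<le> (v z + u z) * indicator (box N) z" "0 \<le> v z * indicator (box N) z" "0 \<le> u z * indicator (box N) z" for z
      using add by auto
    have e: "AE z in lborel. 0 \<le> fst z \<longrightarrow> (v z + u z) * indicator (box N) z = v z * indicator (box N) z + u z * indicator (box N) z"
      by (simp add: distrib_right)
    have m: "(\<lambda>z. v z * indicator (box N) z) \<in> borel_measurable borel" "(\<lambda>z. u z * indicator (box N) z) \<in> borel_measurable borel"
      by measurable
    from W_add[OF D p(1) m p(2,3) e] W_add_Wfilt(1)[OF D p(1) m p(2,3) e] add.IH
    show "W (\<lambda>z. (v z + u z) * indicator (box N) z) \<in> borel_measurable F" by blast
  qed
next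
  case (seq V)
  have bm[measurable]: "box N \<in> sets borel" by (rule box_sets)
  note [measurable] = seq.hyps(1)
  show ?case
  proof
    assume D: "Hdom (\<lambda>z. u z * indicator (box N) z)"
    have lim: "(\<lambda>n. V n z) \<longlonglongrightarrow> u z" for z using seq.hyps by simp
    have inc: "incseq (\<lambda>n. V n z)" for z using seq.hyps(3) unfolding incseq_def le_fun_def by blast
    have le: "V n z \<le> u z" for n z by (rule incseq_le[OF inc lim])
    have u0: "0 \<le> u z" for z using seq.hyps(2)[of 0 z] le[of 0 z] by linarith
    have up: "0 \<le> u z * indicator (box N) z" for z using u0 by simp
    have Vm: "(\<lambda>z. V n z * indicator (box N) z) \<in> borel_measurable borel" for n by measurable
    have Vp: "0 \<le> V n z * indicator (box N) z" for n z using seq.hyps(2) by simp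
    have Vle: "V n z * indicator (box N) z \<le> u z * indicator (box N) z" for n z
      by (intro mult_right_mono le) simp
    have Vlim: "(\<lambda>n. V n z * indicator (box N) z) \<longlonglongrightarrow> u z * indicator (box N) z" for z
      by (intro tendsto_mult_right lim)
    note L = W_monotone_limit[OF D up Vm Vp Vle Vlim]
    show "W (\<lambda>z. u z * indicator (box N) z) \<in> borel_measurable F"
      by (rule Wfilt_l2lim[OF _ L(2)]) (use seq.IH L(1) in auto)
  qed
qed

text \<open>Truncation to growing boxes; the cut in time changes nothing at nonnegative times since
  \<open>f\<close> vanishes after \<open>t\<close>.\<close>

lemma W_Wfilt:
  assumes f: "Hdom f" "\<And>z. 0 \<le> f z" and supp: "\<And>z. t < fst z \<Longrightarrow> f z = 0"
  shows "W f \<in> borel_measurable F"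
proof -
  note [measurable] = Hdom_measurable[OF f(1)] box_sets
  let ?fn = "\<lambda>n z. f z * indicator (box (real n)) z"
  have "?fn n z \<le> f z" for n z using f(2)[of z] by (auto simp: indicator_def)
  moreover have "(\<lambda>n. ?fn n z) \<longlonglongrightarrow> f z" if "0 \<le> fst z" for z
  proof (rule tendsto_eventually)
    show "\<forall>\<^sub>F n in sequentially. ?fn n z = f z"
    proof (cases "fst z \<le> t")
      case True
      obtain m :: nat where m: "\<bar>snd z\<bar> \<le> real m" using real_arch_simple by blast
      have "?fn n z = f z" if "n \<ge> m" for n
      proof -
        have "real m \<le> real n" using that by simp
        then have "z \<in> box (real n)" using m True \<open>0 \<le> fst z\<close> by (cases z) (auto simp: box_def)
        then show ?thesis by simp
      qed
      then show ?thesis by (rule eventually_sequentiallyI)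
    qed (simp add: supp)
  qed
  ultimately have L: "Hdom (?fn n)" "l2lim Pw (\<lambda>n. W (?fn n)) (W f)" for n
    using W_monotone_limit[OF f, of ?fn] f(2) by auto
  show ?thesis by (rule Wfilt_l2lim[OF _ L(2)]) (use W_box_Wfilt[of "real n" f for n] f(2) L(1) in auto)
qed

end

end

context fk_seq
begin

subsection \<open>Adaptedness\<close>

text \<open>The approximating kernels vanish after time \<open>t\<close>, because \<open>psi\<close>
  is 0 at negative arguments.\<close>

lemma good_Wfilt:
  assumes g: "good \<xi> t x Y"
  shows "Y \<in> borel_measurable (Wfilt Pw W t)"
proof -
  have \<xi>: "\<xi> \<in> borel_measurable borel" and t: "0 \<le> t" and l: "l2lim Pw (\<lambda>n. In n \<xi> t x) Y"
    using g by (auto simp: good_def)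
  have "In n \<xi> t x \<in> borel_measurable (Wfilt Pw W t)" for n
  proof (rule Wfilt_cong_AE[OF t])
    show "W (Apath \<xi> (\<epsilon> n) (\<delta> n) t x) \<in> borel_measurable (Wfilt Pw W t)"
    proof (rule W_Wfilt[OF t])
      show "Hdom (Apath \<xi> (\<epsilon> n) (\<delta> n) t x)" by (intro Hdom_Apath \<xi> pos t)
      show "0 \<le> Apath \<xi> (\<epsilon> n) (\<delta> n) t x z" for z by (intro Apath_nonneg \<xi> pos)
      show "Apath \<xi> (\<epsilon> n) (\<delta> n) t x z = 0" if z: "t < fst z" for z
      proof -
        obtain r y where zr: "z = (r, y)" by (cases z)
        have "(\<lambda>s. indicator {0..t} s *\<^sub>R (psi (\<delta> n) (t - s - r) * heat (\<epsilon> n) (\<xi> s + x - y))) = (\<lambda>_. 0)"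
          using z zr by (auto simp: psi_def indicator_def)
        then show ?thesis unfolding Apath_def set_lebesgue_integral_def zr case_prod_conv by simp
      qed
    qed
    show "In n \<xi> t x \<in> borel_measurable Pw" by (rule sqi_measurable[OF Ipath_sqi[OF pos t \<xi>]])
    show "AE \<omega> in Pw. W (Apath \<xi> (\<epsilon> n) (\<delta> n) t x) \<omega> = In n \<xi> t x \<omega>"
      using Ipath_eq_W[OF pos t \<xi>, of n n x] by eventually_elim simp
  qed
  then show ?thesis by (rule Wfilt_l2lim[OF t _ l])
qed

text \<open>Since \<open>exp (I t x \<omega>x)\<close> is adapted only for almost every fixed \<open>\<omega>x\<close>, the solution is compared
  with its conditional expectation by testing against indicators of arbitrary events.\<close>

lemma fk_sol_Wfilt:
  assumes t: "0 \<le> t"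
  shows "fk_sol Px X I u0 t x \<in> borel_measurable (Wfilt Pw W t)"
proof -
  let ?F = "Wfilt Pw W t" and ?u = "fk_sol Px X I u0 t x"
  interpret FS: finite_measure_subalgebra Pw ?F
    by unfold_locales (rule Wfilt_subalgebra[OF t])
  interpret PP: pair_sigma_finite Px Pw ..
  have um[measurable]: "?u \<in> borel_measurable Pw"
    unfolding fk_sol_nice[abs_def] by measurable
  have ui: "integrable Pw ?u" using moment_formula(1)[of 1 t x] t by simp
  have ni: "integrable (Px \<Otimes>\<^sub>M Pw) (\<lambda>(\<omega>x, \<omega>). nice t x \<omega>x \<omega>)"
  proof (rule integrableI_bounded)
    have "(\<integral>\<^sup>+p. ennreal (norm (case p of (\<omega>x, \<omega>) \<Rightarrow> nice t x \<omega>x \<omega>)) \<partial>(Px \<Otimes>\<^sub>M Pw))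
      = (\<integral>\<^sup>+\<omega>. \<integral>\<^sup>+\<omega>x. ennreal \<bar>nice t x \<omega>x \<omega>\<bar> \<partial>Px \<partial>Pw)"
      by (subst PP.nn_integral_snd[symmetric]) auto
    also have "\<dots> < \<infinity>" using nn_integral_abs_nice[OF t, of x] by (auto simp: le_less_trans)
    finally show "(\<integral>\<^sup>+p. ennreal (norm (case p of (\<omega>x, \<omega>) \<Rightarrow> nice t x \<omega>x \<omega>)) \<partial>(Px \<Otimes>\<^sub>M Pw)) < \<infinity>" .
  qed measurable
  have swap: "(\<integral>\<omega>. ?u \<omega> * Z \<omega> \<partial>Pw) = (\<integral>\<omega>x. (\<integral>\<omega>. nice t x \<omega>x \<omega> * Z \<omega> \<partial>Pw) \<partial>Px)"
    "AE \<omega>x in Px. integrable Pw (\<lambda>\<omega>. nice t x \<omega>x \<omega> * Z \<omega>)"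
    if Z[measurable]: "Z \<in> borel_measurable Pw" and Z1: "\<And>\<omega>. \<bar>Z \<omega>\<bar> \<le> 1" for Z
  proof -
    have i: "integrable (Px \<Otimes>\<^sub>M Pw) (\<lambda>(\<omega>x, \<omega>). nice t x \<omega>x \<omega> * Z \<omega>)"
      by (rule Bochner_Integration.integrable_bound[OF ni]) (auto simp: abs_mult intro!: AE_I2 mult_left_le Z1)
    have "(\<integral>\<omega>. ?u \<omega> * Z \<omega> \<partial>Pw) = (\<integral>\<omega>. (\<integral>\<omega>x. nice t x \<omega>x \<omega> * Z \<omega> \<partial>Px) \<partial>Pw)"
      by (simp add: fk_sol_nice)
    also have "\<dots> = (\<integral>\<omega>x. (\<integral>\<omega>. nice t x \<omega>x \<omega> * Z \<omega> \<partial>Pw) \<partial>Px)"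
      by (rule PP.Fubini_integral[OF i])
    finally show "(\<integral>\<omega>. ?u \<omega> * Z \<omega> \<partial>Pw) = (\<integral>\<omega>x. (\<integral>\<omega>. nice t x \<omega>x \<omega> * Z \<omega> \<partial>Pw) \<partial>Px)" .
    show "AE \<omega>x in Px. integrable Pw (\<lambda>\<omega>. nice t x \<omega>x \<omega> * Z \<omega>)"
      using PP.AE_integrable_fst[OF i] by simp
  qed
  have "AE \<omega> in Pw. real_cond_exp Pw ?F ?u \<omega> = ?u \<omega>"
  proof (rule AE_symmetric, rule density_unique_real[OF ui FS.real_cond_exp_int(1)[OF ui]])
    fix A assume A[measurable]: "A \<in> sets Pw"
    let ?J = "indicator A :: 'b \<Rightarrow> real"
    have i1: "integrable Pw ?J"
      by (rule integrable_const_bound[of _ 1]) (auto simp: indicator_def)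
    \<comment> \<open>A conditional expectation of an indicator lies in the unit interval only
      almost surely; clamping gives a version bounded everywhere, as \<open>swap\<close>
      demands.\<close>
    define a where "a = (\<lambda>\<omega>. max 0 (min 1 (real_cond_exp Pw ?F ?J \<omega>)))"
    have aF: "a \<in> borel_measurable ?F" unfolding a_def by measurable
    have aP[measurable]: "a \<in> borel_measurable Pw" by (rule Wfilt_measurable[OF t aF])
    have a1: "\<bar>a \<omega>\<bar> \<le> 1" for \<omega> by (simp add: a_def)
    have a_eq: "AE \<omega> in Pw. real_cond_exp Pw ?F ?J \<omega> = a \<omega>"
    proof -
      have "AE \<omega> in Pw. 0 \<le> real_cond_exp Pw ?F ?J \<omega>" by (rule FS.real_cond_exp_ge_c[OF i1]) simp
      moreover have "AE \<omega> in Pw. real_cond_exp Pw ?F ?J \<omega> \<le> 1" by (rule FS.real_cond_exp_le_c[OF i1]) (auto simp: indicator_def)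
      ultimately show ?thesis by eventually_elim (simp add: a_def)
    qed
    have ind: "\<bar>?J \<omega>\<bar> \<le> 1" for \<omega> by (simp add: indicator_def)
    \<comment> \<open>For a fixed good path the weight is adapted, so the indicator may be replaced
      by its conditional expectation. Self-adjointness of conditional expectation then moves the
      conditioning from the indicator to \<open>?u\<close>.\<close>
    have "(\<integral>\<omega>. ?u \<omega> * ?J \<omega> \<partial>Pw) = (\<integral>\<omega>x. (\<integral>\<omega>. nice t x \<omega>x \<omega> * ?J \<omega> \<partial>Pw) \<partial>Px)"
      by (rule swap(1)) (use ind in auto)
    also have "\<dots> = (\<integral>\<omega>x. (\<integral>\<omega>. nice t x \<omega>x \<omega> * a \<omega> \<partial>Pw) \<partial>Px)"
    proof (rule integral_cong_AE)
      have "AE \<omega>x in Px. integrable Pw (\<lambda>\<omega>. nice t x \<omega>x \<omega> * ?J \<omega>)" by (rule swap(2)) (use ind in auto)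
      then show "AE \<omega>x in Px. (\<integral>\<omega>. nice t x \<omega>x \<omega> * ?J \<omega> \<partial>Pw) = (\<integral>\<omega>. nice t x \<omega>x \<omega> * a \<omega> \<partial>Pw)"
        using AE_good[OF t, of x] AE_space
      proof eventually_elim
        case (elim \<omega>x)
        have Im[measurable]: "I t x \<omega>x \<in> borel_measurable ?F" by (rule good_Wfilt[OF elim(2)])
        have nF: "nice t x \<omega>x \<in> borel_measurable ?F" unfolding nice_def[abs_def] by measurable
        have "(\<integral>\<omega>. nice t x \<omega>x \<omega> * ?J \<omega> \<partial>Pw) = (\<integral>\<omega>. nice t x \<omega>x \<omega> * real_cond_exp Pw ?F ?J \<omega> \<partial>Pw)"
          by (rule FS.real_cond_exp_intg(2)[symmetric, OF elim(1) nF]) measurable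
        also have "\<dots> = (\<integral>\<omega>. nice t x \<omega>x \<omega> * a \<omega> \<partial>Pw)"
          using a_eq Wfilt_measurable[OF t nF] by (intro integral_cong_AE) (auto elim!: AE_mp)
        finally show ?case .
      qed
    qed measurable
    also have "\<dots> = (\<integral>\<omega>. ?u \<omega> * a \<omega> \<partial>Pw)"
      by (rule swap(1)[symmetric]) (use a1 in auto)
    also have "\<dots> = (\<integral>\<omega>. a \<omega> * ?u \<omega> \<partial>Pw)" by (simp add: mult.commute)
    also have "\<dots> = (\<integral>\<omega>. a \<omega> * real_cond_exp Pw ?F ?u \<omega> \<partial>Pw)"
    proof (rule FS.real_cond_exp_intg(2)[symmetric, OF _ aF um])
      show "integrable Pw (\<lambda>\<omega>. a \<omega> * ?u \<omega>)"
        by (rule Bochner_Integration.integrable_bound[OF ui]) (auto simp: abs_mult intro!: AE_I2 mult_left_le_one_le a1)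
    qed
    also have "\<dots> = (\<integral>\<omega>. real_cond_exp Pw ?F ?u \<omega> * real_cond_exp Pw ?F ?J \<omega> \<partial>Pw)"
      using a_eq by (intro integral_cong_AE) (auto elim!: AE_mp)
    also have "\<dots> = (\<integral>\<omega>. real_cond_exp Pw ?F ?u \<omega> * ?J \<omega> \<partial>Pw)"
    proof (rule FS.real_cond_exp_intg(2))
      show "integrable Pw (\<lambda>\<omega>. real_cond_exp Pw ?F ?u \<omega> * ?J \<omega>)"
        using integrable_mult_indicator[OF A FS.real_cond_exp_int(1)[OF ui]] by (simp add: mult.commute)
    qed measurable
    finally show "(\<integral>\<omega>\<in>A. ?u \<omega> \<partial>Pw) = (\<integral>\<omega>\<in>A. real_cond_exp Pw ?F ?u \<omega> \<partial>Pw)"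
      by (simp add: set_lebesgue_integral_def mult.commute)
  qed
  then show ?thesis by (intro Wfilt_cong_AE[OF t _ um]) auto
qed

subsection \<open>Replacing the approximate weights\<close>

context
  fixes t x :: real
  assumes t: "0 \<le> t"
begin

text \<open>A point \<open>(s, \<omega>'', \<omega>')\<close> encodes the space-time point \<open>(s, y)\<close> with \<open>y = X\<^bsub>t-s\<^esub>(\<omega>'') + x\<close>, distributed with
  density \<open>g(t-s, x-y)\<close>, and an independent path started at \<open>y\<close>.\<close>

definition base :: "(real \<times> 'a \<times> 'a) measure" where
  "base = seg t \<Otimes>\<^sub>M (Px \<Otimes>\<^sub>M Px)"

abbreviation "pt \<equiv> \<lambda>m :: real \<times> 'a \<times> 'a. S.Xp (fst (snd m)) (t - fst m) + x"
abbreviation "pa \<equiv> \<lambda>m :: real \<times> 'a \<times> 'a. snd (snd m)"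

lemma sets_base [measurable_cong]: "sets base = sets (borel \<Otimes>\<^sub>M (Px \<Otimes>\<^sub>M Px))"
  unfolding base_def by (intro sets_pair_measure_cong) auto

lemma finite_measure_base: "finite_measure base"
proof -
  interpret A: finite_measure "seg t" by (rule finite_measure_seg)
  interpret PP: pair_prob_space Px Px ..
  show ?thesis unfolding base_def
    by (intro finite_measure_pair_measure finite_measure_seg PP.finite_measure_axioms)
qed

interpretation base: finite_measure base by (rule finite_measure_base)

lemma nn_integral_base:
  assumes [measurable]: "f \<in> borel_measurable (borel \<Otimes>\<^sub>M (Px \<Otimes>\<^sub>M Px))"
  shows "(\<integral>\<^sup>+m. f m \<partial>base) = (\<integral>\<^sup>+s. \<integral>\<^sup>+p. f (s, p) \<partial>(Px \<Otimes>\<^sub>M Px) \<partial>seg t)"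
proof -
  interpret PP: pair_prob_space Px Px ..
  show ?thesis unfolding base_def by (subst PP.nn_integral_fst[symmetric]) auto
qed

lemma AE_base:
  assumes "Measurable.pred (borel \<Otimes>\<^sub>M (Px \<Otimes>\<^sub>M Px)) Q"
    and "\<And>s. 0 \<le> s \<Longrightarrow> s \<le> t \<Longrightarrow> AE \<omega>2 in Px. AE \<omega>1 in Px. Q (s, \<omega>2, \<omega>1)"
  shows "AE m in base. Q m"
proof -
  interpret A: finite_measure "seg t" by (rule finite_measure_seg)
  interpret PP: pair_prob_space Px Px ..
  interpret AP: pair_sigma_finite "seg t" "Px \<Otimes>\<^sub>M Px" ..
  note [measurable] = assms(1)
  show ?thesis unfolding base_def
  proof (rule AP.AE_pair_measure)
    show "{m \<in> space (seg t \<Otimes>\<^sub>M (Px \<Otimes>\<^sub>M Px)). Q m} \<in> sets (seg t \<Otimes>\<^sub>M (Px \<Otimes>\<^sub>M Px))" by measurable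
    show "AE s in seg t. AE p in Px \<Otimes>\<^sub>M Px. Q (s, p)"
      using AE_seg
    proof eventually_elim
      case (elim s)
      show ?case
      proof (rule PP.AE_pair_measure)
        show "{p \<in> space (Px \<Otimes>\<^sub>M Px). Q (s, p)} \<in> sets (Px \<Otimes>\<^sub>M Px)" by measurable
      qed (use assms(2)[of s] elim in auto)
    qed
  qed
qed

lemma AE_base_time: "AE s in seg t. R s \<Longrightarrow> Measurable.pred borel R \<Longrightarrow> AE m in base. R (fst m)"
proof -
  assume R: "AE s in seg t. R s" and [measurable]: "Measurable.pred borel R"
  interpret A: finite_measure "seg t" by (rule finite_measure_seg)
  interpret PP: pair_prob_space Px Px ..
  interpret AP: pair_sigma_finite "seg t" "Px \<Otimes>\<^sub>M Px" ..
  show ?thesis unfolding base_def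
  proof (rule AP.AE_pair_measure)
    show "{m \<in> space (seg t \<Otimes>\<^sub>M (Px \<Otimes>\<^sub>M Px)). R (fst m)} \<in> sets (seg t \<Otimes>\<^sub>M (Px \<Otimes>\<^sub>M Px))" by measurable
  qed (use R in simp)
qed

lemma pt_measurable [measurable]:
  "(\<lambda>m. S.Xp (fst (snd m)) (t - fst m) + x) \<in> borel_measurable (borel \<Otimes>\<^sub>M (Px \<Otimes>\<^sub>M Px))"
  using S.Xp_measurable[of "\<lambda>m. t - fst m" "borel \<Otimes>\<^sub>M (Px \<Otimes>\<^sub>M Px)" "\<lambda>m. fst (snd m)"] by measurable

text \<open>The limit is known for each fixed starting point and almost every path. Here the
  starting point is random but independent of the path, so measurability of \<open>goodI\<close> and
  Fubini suffice.\<close>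

lemma AE_base_good: "AE m in base. 0 \<le> fst m \<and> fst m \<le> t \<and> good (S.Xp (pa m)) (fst m) (pt m) (I (fst m) (pt m) (pa m))"
proof -
  have "AE m in base. goodI (fst m) (pt m) (pa m)"
  proof (rule AE_base)
    show "Measurable.pred (borel \<Otimes>\<^sub>M (Px \<Otimes>\<^sub>M Px)) (\<lambda>m. goodI (fst m) (pt m) (pa m))"
      by (rule goodI_measurable) measurable
  qed (auto intro!: AE_I2 AE_goodI)
  moreover have "AE m in base. 0 \<le> fst m \<and> fst m \<le> t"
    by (rule AE_base_time[OF AE_seg]) measurable
  ultimately show ?thesis using AE_space
    by eventually_elim (auto intro!: goodI_good simp: base_def space_pair_measure)
qed

definition pn :: "nat \<Rightarrow> real \<times> 'a \<times> 'a \<Rightarrow> 'b \<Rightarrow> real" where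
  "pn n m \<omega> = u0 (S.Xp (pa m) (fst m) + pt m) * exp (I (fst m) (pt m) (pa m) \<omega>) * Wn n (fst m) (pt m) \<omega>"

definition qn :: "nat \<Rightarrow> real \<times> 'a \<times> 'a \<Rightarrow> 'b \<Rightarrow> real" where
  "qn n m \<omega> = u0 (S.Xp (pa m) (fst m) + pt m) * exp (In n (S.Xp (pa m)) (fst m) (pt m) \<omega>) * Wn n (fst m) (pt m) \<omega>"

lemma pn_measurable: "(\<lambda>(m, \<omega>). pn n m \<omega>) \<in> borel_measurable (base \<Otimes>\<^sub>M Pw)"
  and qn_measurable: "(\<lambda>(m, \<omega>). qn n m \<omega>) \<in> borel_measurable (base \<Otimes>\<^sub>M Pw)"
proof -
  have [measurable]: "(\<lambda>p. pt (fst p)) \<in> borel_measurable (base \<Otimes>\<^sub>M Pw)"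
    by measurable
  have [measurable]: "(\<lambda>p. S.Xp (pa (fst p)) (fst (fst p))) \<in> borel_measurable (base \<Otimes>\<^sub>M Pw)"
    by (rule S.Xp_measurable) measurable
  have [measurable]: "(\<lambda>p. I (fst (fst p)) (pt (fst p)) (pa (fst p)) (snd p)) \<in> borel_measurable (base \<Otimes>\<^sub>M Pw)"
    by (rule I_measurable) measurable
  have [measurable]: "(\<lambda>p. In n (S.Xp (pa (fst p))) (fst (fst p)) (pt (fst p)) (snd p)) \<in> borel_measurable (base \<Otimes>\<^sub>M Pw)"
    by (rule Ipath_measurable[OF pos]) measurable
  have [measurable]: "(\<lambda>p. Wn n (fst (fst p)) (pt (fst p)) (snd p)) \<in> borel_measurable (base \<Otimes>\<^sub>M Pw)"
    by (rule Wd_measurable[OF pos]) measurable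
  show "(\<lambda>(m, \<omega>). pn n m \<omega>) \<in> borel_measurable (base \<Otimes>\<^sub>M Pw)"
    "(\<lambda>(m, \<omega>). qn n m \<omega>) \<in> borel_measurable (base \<Otimes>\<^sub>M Pw)"
    unfolding pn_def qn_def split_beta' by measurable
qed

text \<open>A second-moment bound for fixed \<open>n\<close>: the term
  \<open>isq (\<epsilon> n)\<close>, from the variance of the noise at a point, diverges as
  \<open>n\<close> grows. It serves integrability and interchange of integrals, not the
  limit.\<close>

definition Cn :: "nat \<Rightarrow> real" where
  "Cn n = U\<^sup>2 * (exp (80 * t * sqrt t) * (isq (\<epsilon> n) + 80 * sqrt t * (80 * sqrt t)))"

lemma time_mono: "0 \<le> s \<Longrightarrow> s \<le> t \<Longrightarrow> 40 * s * sqrt s \<le> 40 * t * sqrt t \<and> 40 * sqrt s \<le> 40 * sqrt t"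
  using t by (auto intro!: mult_mono)

text \<open>The properties common to the limit \<open>I\<close> and to its approximation
  \<open>In\<close>. Each estimate is thereby proved once for all four combinations of the
  two.\<close>

definition adm :: "nat \<Rightarrow> ('b \<Rightarrow> real) \<Rightarrow> bool" where
  "adm n Y \<longleftrightarrow> Y \<in> gspace Pw W \<and> (\<integral>\<omega>. (Y \<omega>)\<^sup>2 \<partial>Pw) \<le> 40 * t * sqrt t \<and>
     (\<forall>v y. 0 \<le> v \<longrightarrow> \<bar>\<integral>\<omega>. Y \<omega> * Wn n v y \<omega> \<partial>Pw\<bar> \<le> 40 * sqrt t)"

lemma adm_good: "good \<xi> s y Y \<Longrightarrow> s \<le> t \<Longrightarrow> adm n Y"
  unfolding adm_def using time_mono[of s] good_gspace[of \<xi> s y Y] good_variance[of \<xi> s y Y] good_Wn_covariance[of \<xi> s y Y]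
  by (meson good_def order_trans)

lemma adm_In: "\<xi> \<in> borel_measurable borel \<Longrightarrow> 0 \<le> s \<Longrightarrow> s \<le> t \<Longrightarrow> adm n (In n \<xi> s y)"
  unfolding adm_def using time_mono[of s] Ipath_gspace[OF pos, of s \<xi> n n y] In_variance[of \<xi> s n y] In_Wn_covariance[of \<xi> s _ n y n]
  by (meson order_trans)

text \<open>The variance of \<open>A + B\<close> is at most four times
  \<open>40 * t * sqrt t\<close>, which is twice \<open>80 * t * sqrt t\<close>; covariances with
  the noise double to \<open>80 * sqrt t\<close>.\<close>

lemma adm_sum_bound:
  assumes A: "adm n A" and B: "adm n B" and v: "0 \<le> v" "0 \<le> v'"
  shows "\<bar>\<integral>\<omega>. exp (A \<omega> + B \<omega>) * (Wn n v y \<omega> * Wn n v' y' \<omega>) \<partial>Pw\<bar>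
    \<le> exp (80 * t * sqrt t) * (\<bar>\<integral>\<omega>. Wn n v y \<omega> * Wn n v' y' \<omega> \<partial>Pw\<bar> + 80 * sqrt t * (80 * sqrt t))"
proof (rule exp_Wn_bound)
  have g: "A \<in> gspace Pw W" "B \<in> gspace Pw W" using A B by (auto simp: adm_def)
  note s = g[THEN gspace_sqi]
  have W: "Wn n v y \<in> gspace Pw W" if "0 \<le> v" for v y by (intro Wd_gspace pos that)
  show "(\<lambda>\<omega>. A \<omega> + B \<omega>) \<in> gspace Pw W" by (intro gspace_add g)
  show "Wn n v y \<in> gspace Pw W" "Wn n v' y' \<in> gspace Pw W" using v W by auto
  have "\<bar>\<integral>\<omega>. A \<omega> * B \<omega> \<partial>Pw\<bar> \<le> sqrt (40 * t * sqrt t) * sqrt (40 * t * sqrt t)"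
    using A B t by (intro order_trans[OF sqi_Cauchy_Schwarz[OF s]] mult_mono real_sqrt_le_mono) (auto simp: adm_def)
  then have AB: "\<bar>\<integral>\<omega>. A \<omega> * B \<omega> \<partial>Pw\<bar> \<le> 40 * t * sqrt t" using t by simp
  have "(\<integral>\<omega>. (A \<omega> + B \<omega>)\<^sup>2 \<partial>Pw) = (\<integral>\<omega>. (A \<omega>)\<^sup>2 + 2 * (A \<omega> * B \<omega>) + (B \<omega>)\<^sup>2 \<partial>Pw)"
    by (intro Bochner_Integration.integral_cong) (auto simp: power2_eq_square algebra_simps)
  also have "\<dots> = (\<integral>\<omega>. (A \<omega>)\<^sup>2 \<partial>Pw) + 2 * (\<integral>\<omega>. A \<omega> * B \<omega> \<partial>Pw) + (\<integral>\<omega>. (B \<omega>)\<^sup>2 \<partial>Pw)"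
    using s sqi_mult[OF s] by (simp add: sqi_def)
  also have "\<dots> \<le> 2 * (80 * t * sqrt t)" using AB A B unfolding adm_def by linarith
  finally show "(\<integral>\<omega>. (A \<omega> + B \<omega>)\<^sup>2 \<partial>Pw) \<le> 2 * (80 * t * sqrt t)" .
  have "\<bar>\<integral>\<omega>. (A \<omega> + B \<omega>) * Wn n v y \<omega> \<partial>Pw\<bar> \<le> 80 * sqrt t" if v: "0 \<le> v" for v y
  proof -
    have "(\<integral>\<omega>. (A \<omega> + B \<omega>) * Wn n v y \<omega> \<partial>Pw) = (\<integral>\<omega>. A \<omega> * Wn n v y \<omega> \<partial>Pw) + (\<integral>\<omega>. B \<omega> * Wn n v y \<omega> \<partial>Pw)"
      using sqi_mult[OF s(1) gspace_sqi[OF W[OF v]]] sqi_mult[OF s(2) gspace_sqi[OF W[OF v]]] by (simp add: distrib_right)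
    moreover have "\<bar>\<integral>\<omega>. A \<omega> * Wn n v y \<omega> \<partial>Pw\<bar> \<le> 40 * sqrt t" "\<bar>\<integral>\<omega>. B \<omega> * Wn n v y \<omega> \<partial>Pw\<bar> \<le> 40 * sqrt t"
      using A B v unfolding adm_def by blast+
    ultimately show ?thesis by linarith
  qed
  then show "\<bar>\<integral>\<omega>. (A \<omega> + B \<omega>) * Wn n v y \<omega> \<partial>Pw\<bar> \<le> 80 * sqrt t"
    "\<bar>\<integral>\<omega>. (A \<omega> + B \<omega>) * Wn n v' y' \<omega> \<partial>Pw\<bar> \<le> 80 * sqrt t" using v by auto
qed

lemma Wn_variance: "0 \<le> v \<Longrightarrow> \<bar>\<integral>\<omega>. Wn n v y \<omega> * Wn n v y \<omega> \<partial>Pw\<bar> \<le> isq (\<epsilon> n)"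
  using Kn_le_eps[of "\<delta> n" "\<delta> n" "\<epsilon> n" "\<epsilon> n" v v 0] pos[of n] by (simp add: Wd_covariance pos enn2real_leI)

lemma Wn_covariance_le: "0 \<le> v \<Longrightarrow> 0 \<le> v' \<Longrightarrow> v \<noteq> v' \<Longrightarrow> \<bar>\<integral>\<omega>. Wn n v y \<omega> * Wn n v' y' \<omega> \<partial>Pw\<bar> \<le> 8 * isq (v - v')"
  using Kn_le_isq[of "\<delta> n" "\<delta> n" "\<epsilon> n" "\<epsilon> n" v v' "y - y'"] pos[of n] by (simp add: Wd_covariance pos enn2real_leI)

lemma adm_sq_bound:
  assumes A: "adm n A" and v: "0 \<le> v" and r: "\<bar>r\<bar> \<le> U"
  shows "(\<integral>\<^sup>+\<omega>. ennreal ((r * exp (A \<omega>) * Wn n v y \<omega>)\<^sup>2) \<partial>Pw) \<le> ennreal (Cn n)"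
proof -
  have g: "A \<in> gspace Pw W" using A by (simp add: adm_def)
  have W: "Wn n v y \<in> gspace Pw W" by (intro Wd_gspace pos v)
  have eq: "(r * exp (A \<omega>) * Wn n v y \<omega>)\<^sup>2 = r\<^sup>2 * (exp (A \<omega> + A \<omega>) * (Wn n v y \<omega> * Wn n v y \<omega>))" for \<omega>
    by (simp only: power2_eq_square exp_add mult_ac)
  have i: "integrable Pw (\<lambda>\<omega>. exp (A \<omega> + A \<omega>) * (Wn n v y \<omega> * Wn n v y \<omega>))"
    by (rule gspace_exp_mult(1)[OF gspace_add[OF g g] W W])
  have "(\<integral>\<^sup>+\<omega>. ennreal ((r * exp (A \<omega>) * Wn n v y \<omega>)\<^sup>2) \<partial>Pw)
    = ennreal (r\<^sup>2 * (\<integral>\<omega>. exp (A \<omega> + A \<omega>) * (Wn n v y \<omega> * Wn n v y \<omega>) \<partial>Pw))"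
    unfolding eq using i by (subst nn_integral_eq_integral) auto
  also have "\<dots> \<le> ennreal (Cn n)"
  proof (intro ennreal_leI, unfold Cn_def, intro mult_mono)
    show "r\<^sup>2 \<le> U\<^sup>2" using power_mono[OF r, of 2] by simp
    have "(\<integral>\<omega>. exp (A \<omega> + A \<omega>) * (Wn n v y \<omega> * Wn n v y \<omega>) \<partial>Pw)
      \<le> exp (80 * t * sqrt t) * (\<bar>\<integral>\<omega>. Wn n v y \<omega> * Wn n v y \<omega> \<partial>Pw\<bar> + 80 * sqrt t * (80 * sqrt t))"
      using adm_sum_bound[OF A A v v, of y y] by linarith
    also have "\<dots> \<le> exp (80 * t * sqrt t) * (isq (\<epsilon> n) + 80 * sqrt t * (80 * sqrt t))"
      by (intro mult_left_mono add_right_mono Wn_variance v) auto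
    finally show "(\<integral>\<omega>. exp (A \<omega> + A \<omega>) * (Wn n v y \<omega> * Wn n v y \<omega>) \<partial>Pw) \<le> \<dots>" .
  qed auto
  finally show ?thesis .
qed

lemma pn_bound: "AE m in base. (\<integral>\<^sup>+\<omega>. ennreal ((pn n m \<omega>)\<^sup>2) \<partial>Pw) \<le> ennreal (Cn n)"
  using AE_base_good unfolding pn_def
  by eventually_elim (intro adm_sq_bound adm_good u0_bound; auto)

lemma qn_bound: "AE m in base. (\<integral>\<^sup>+\<omega>. ennreal ((qn n m \<omega>)\<^sup>2) \<partial>Pw) \<le> ennreal (Cn n)"
  using AE_base_good unfolding qn_def
  by eventually_elim (intro adm_sq_bound adm_In u0_bound; auto simp: good_def)

definition hn :: "nat \<Rightarrow> real \<times> 'a \<times> 'a \<Rightarrow> 'b \<Rightarrow> real" where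
  "hn n m \<omega> = pn n m \<omega> - qn n m \<omega>"

lemma hn_measurable: "(\<lambda>(m, \<omega>). hn n m \<omega>) \<in> borel_measurable (base \<Otimes>\<^sub>M Pw)"
  using pn_measurable[of n] qn_measurable[of n] unfolding hn_def split_beta' by measurable

lemma hn_bound: "AE m in base. (\<integral>\<^sup>+\<omega>. ennreal ((hn n m \<omega>)\<^sup>2) \<partial>Pw) \<le> ennreal (4 * Cn n)"
  using pn_bound[of n] qn_bound[of n] AE_space
proof eventually_elim
  case (elim m)
  have [measurable]: "pn n m \<in> borel_measurable Pw" "qn n m \<in> borel_measurable Pw"
    using pn_measurable[of n] qn_measurable[of n] elim(3) by (auto dest: measurable_Pair2)
  have C: "0 \<le> Cn n" by (simp add: Cn_def t)
  have "(\<integral>\<^sup>+\<omega>. ennreal ((hn n m \<omega>)\<^sup>2) \<partial>Pw) \<le> (\<integral>\<^sup>+\<omega>. 2 * ennreal ((pn n m \<omega>)\<^sup>2) + 2 * ennreal ((qn n m \<omega>)\<^sup>2) \<partial>Pw)"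
  proof (rule nn_integral_mono)
    fix \<omega>
    have "(hn n m \<omega>)\<^sup>2 \<le> 2 * (pn n m \<omega>)\<^sup>2 + 2 * (qn n m \<omega>)\<^sup>2"
      using zero_le_power2[of "pn n m \<omega> + qn n m \<omega>"] by (simp add: hn_def power2_eq_square algebra_simps)
    then show "ennreal ((hn n m \<omega>)\<^sup>2) \<le> 2 * ennreal ((pn n m \<omega>)\<^sup>2) + 2 * ennreal ((qn n m \<omega>)\<^sup>2)"
      by (simp add: ennreal_leI flip: ennreal_plus ennreal_mult' ennreal_numeral)
  qed
  also have "\<dots> = 2 * (\<integral>\<^sup>+\<omega>. ennreal ((pn n m \<omega>)\<^sup>2) \<partial>Pw) + 2 * (\<integral>\<^sup>+\<omega>. ennreal ((qn n m \<omega>)\<^sup>2) \<partial>Pw)"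
    by (simp add: nn_integral_add nn_integral_cmult)
  also have "\<dots> \<le> 2 * ennreal (Cn n) + 2 * ennreal (Cn n)"
    by (intro add_mono mult_left_mono elim) auto
  also have "\<dots> = ennreal (4 * Cn n)" using C by (simp flip: ennreal_plus ennreal_mult' ennreal_numeral)
  finally show ?case .
qed

text \<open>The point of the argument: after expanding the four exponentials, every term converges to the same limit.\<close>

lemma cross_tendsto:
  assumes g1: "good \<xi>1 s1 y1 Y1" and g2: "good \<xi>2 s2 y2 Y2" and s: "0 < s1" "0 < s2" "s1 \<noteq> s2"
  shows "(\<lambda>n. \<integral>\<omega>. (exp (Y1 \<omega>) - exp (In n \<xi>1 s1 y1 \<omega>)) * Wn n s1 y1 \<omega> *
      ((exp (Y2 \<omega>) - exp (In n \<xi>2 s2 y2 \<omega>)) * Wn n s2 y2 \<omega>) \<partial>Pw) \<longlonglongrightarrow> 0"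
proof -
  have \<xi>: "\<xi>1 \<in> borel_measurable borel" "\<xi>2 \<in> borel_measurable borel"
    and l: "l2lim Pw (\<lambda>n. In n \<xi>1 s1 y1) Y1" "l2lim Pw (\<lambda>n. In n \<xi>2 s2 y2) Y2"
    using g1 g2 by (auto simp: good_def)
  let ?Z1 = "\<lambda>n. Wn n s1 y1" and ?Z2 = "\<lambda>n. Wn n s2 y2"
  have Z: "?Z1 n \<in> gspace Pw W" "?Z2 n \<in> gspace Pw W" for n using s by (auto intro!: Wd_gspace pos)
  define H where "H = heat \<bar>s1 - s2\<bar> (y1 - y2)"
  have ZZ: "(\<lambda>n. \<integral>\<omega>. ?Z1 n \<omega> * ?Z2 n \<omega> \<partial>Pw) \<longlonglongrightarrow> H"
    using Kn_tendsto[of \<delta> \<delta> \<epsilon> \<epsilon> s1 s2 "y1 - y2"] pos lim s by (simp add: Wd_covariance H_def)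
  \<comment> \<open>\<open>L\<close> is the limiting covariance of a path integral with the noise at
    \<open>(v, y)\<close>. It is the same for the constant sequence \<open>Y\<close> and for
    \<open>In n\<close>, the two instances of \<open>app\<close>, so all four combinations share the
    limit \<open>e\<close>.\<close>
  define L where "L = (\<lambda>\<xi> s' y' v y. \<integral>s. heat \<bar>s' - s - v\<bar> (\<xi> s + y' - y :: real) \<partial>seg s')"
  define app where "app = (\<lambda>\<xi> s' y' Y (A :: nat \<Rightarrow> 'b \<Rightarrow> real). l2lim Pw A Y \<and> (\<forall>n. A n \<in> gspace Pw W) \<and>
      (\<forall>v y. 0 < v \<longrightarrow> (\<lambda>n. \<integral>\<omega>. A n \<omega> * Wn n v y \<omega> \<partial>Pw) \<longlonglongrightarrow> L \<xi> s' y' v y))"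
  have a1: "app \<xi>1 s1 y1 Y1 (\<lambda>n. Y1)" "app \<xi>1 s1 y1 Y1 (\<lambda>n. In n \<xi>1 s1 y1)"
    unfolding app_def L_def using l(1) s \<xi> good_gspace[OF g1]
    by (auto intro!: l2lim_const gspace_sqi good_Wn_tendsto[OF g1] In_Wn_tendsto Ipath_gspace pos)
  have a2: "app \<xi>2 s2 y2 Y2 (\<lambda>n. Y2)" "app \<xi>2 s2 y2 Y2 (\<lambda>n. In n \<xi>2 s2 y2)"
    unfolding app_def L_def using l(2) s \<xi> good_gspace[OF g2]
    by (auto intro!: l2lim_const gspace_sqi good_Wn_tendsto[OF g2] In_Wn_tendsto Ipath_gspace pos)
  define E where "E = (\<lambda>A B n. \<integral>\<omega>. exp (A n \<omega> + B n \<omega>) * (?Z1 n \<omega> * ?Z2 n \<omega>) \<partial>Pw)"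
  define e where "e = exp ((\<integral>\<omega>. (Y1 \<omega> + Y2 \<omega>)\<^sup>2 \<partial>Pw) / 2) *
      (H + (L \<xi>1 s1 y1 s1 y1 + L \<xi>2 s2 y2 s1 y1) * (L \<xi>1 s1 y1 s2 y2 + L \<xi>2 s2 y2 s2 y2))"
  have int: "integrable Pw (\<lambda>\<omega>. exp (A n \<omega> + B n \<omega>) * (?Z1 n \<omega> * ?Z2 n \<omega>))"
    if "app \<xi>1 s1 y1 Y1 A" "app \<xi>2 s2 y2 Y2 B" for A B n
    using that Z unfolding app_def by (intro gspace_exp_mult(1) gspace_add) auto
  have lim4: "E A B \<longlonglongrightarrow> e" if A: "app \<xi>1 s1 y1 Y1 A" and B: "app \<xi>2 s2 y2 Y2 B" for A B
  proof -
    have gA: "A n \<in> gspace Pw W" "B n \<in> gspace Pw W" for n using A B by (auto simp: app_def)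
    have "E A B = (\<lambda>n. exp ((\<integral>\<omega>. (A n \<omega> + B n \<omega>)\<^sup>2 \<partial>Pw) / 2) * ((\<integral>\<omega>. ?Z1 n \<omega> * ?Z2 n \<omega> \<partial>Pw)
        + ((\<integral>\<omega>. A n \<omega> * ?Z1 n \<omega> \<partial>Pw) + (\<integral>\<omega>. B n \<omega> * ?Z1 n \<omega> \<partial>Pw))
        * ((\<integral>\<omega>. A n \<omega> * ?Z2 n \<omega> \<partial>Pw) + (\<integral>\<omega>. B n \<omega> * ?Z2 n \<omega> \<partial>Pw))))"
    proof
      fix n
      note i = sqi_mult[OF gspace_sqi[OF gA(1)] gspace_sqi[OF Z(1)]] sqi_mult[OF gspace_sqi[OF gA(2)] gspace_sqi[OF Z(1)]]
        sqi_mult[OF gspace_sqi[OF gA(1)] gspace_sqi[OF Z(2)]] sqi_mult[OF gspace_sqi[OF gA(2)] gspace_sqi[OF Z(2)]]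
      have d: "(\<integral>\<omega>. (A n \<omega> + B n \<omega>) * ?Z1 n \<omega> \<partial>Pw) = (\<integral>\<omega>. A n \<omega> * ?Z1 n \<omega> \<partial>Pw) + (\<integral>\<omega>. B n \<omega> * ?Z1 n \<omega> \<partial>Pw)"
        "(\<integral>\<omega>. (A n \<omega> + B n \<omega>) * ?Z2 n \<omega> \<partial>Pw) = (\<integral>\<omega>. A n \<omega> * ?Z2 n \<omega> \<partial>Pw) + (\<integral>\<omega>. B n \<omega> * ?Z2 n \<omega> \<partial>Pw)"
        using i[of n n] by (simp_all add: distrib_right)
      show "E A B n = exp ((\<integral>\<omega>. (A n \<omega> + B n \<omega>)\<^sup>2 \<partial>Pw) / 2) * ((\<integral>\<omega>. ?Z1 n \<omega> * ?Z2 n \<omega> \<partial>Pw)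
        + ((\<integral>\<omega>. A n \<omega> * ?Z1 n \<omega> \<partial>Pw) + (\<integral>\<omega>. B n \<omega> * ?Z1 n \<omega> \<partial>Pw))
        * ((\<integral>\<omega>. A n \<omega> * ?Z2 n \<omega> \<partial>Pw) + (\<integral>\<omega>. B n \<omega> * ?Z2 n \<omega> \<partial>Pw)))"
        unfolding E_def gspace_exp_mult(2)[OF gspace_add[OF gA] Z] d ..
    qed
    moreover have "(\<lambda>n. \<integral>\<omega>. (A n \<omega> + B n \<omega>)\<^sup>2 \<partial>Pw) \<longlonglongrightarrow> (\<integral>\<omega>. (Y1 \<omega> + Y2 \<omega>)\<^sup>2 \<partial>Pw)"
    proof -
      have "l2lim Pw (\<lambda>n \<omega>. A n \<omega> + B n \<omega>) (\<lambda>\<omega>. Y1 \<omega> + Y2 \<omega>)" using A B by (intro l2lim_add) (auto simp: app_def)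
      from l2lim_inner[OF this this] show ?thesis by (simp add: power2_eq_square)
    qed
    ultimately show ?thesis unfolding e_def
      using A B s ZZ by (auto simp: app_def intro!: tendsto_intros)
  qed
  have "(\<lambda>n. E (\<lambda>n. Y1) (\<lambda>n. Y2) n - E (\<lambda>n. Y1) (\<lambda>n. In n \<xi>2 s2 y2) n - E (\<lambda>n. In n \<xi>1 s1 y1) (\<lambda>n. Y2) n
      + E (\<lambda>n. In n \<xi>1 s1 y1) (\<lambda>n. In n \<xi>2 s2 y2) n) \<longlonglongrightarrow> e - e - e + e"
    by (intro tendsto_intros lim4 a1 a2)
  moreover have "(\<integral>\<omega>. (exp (Y1 \<omega>) - exp (In n \<xi>1 s1 y1 \<omega>)) * Wn n s1 y1 \<omega> *
      ((exp (Y2 \<omega>) - exp (In n \<xi>2 s2 y2 \<omega>)) * Wn n s2 y2 \<omega>) \<partial>Pw)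
    = E (\<lambda>n. Y1) (\<lambda>n. Y2) n - E (\<lambda>n. Y1) (\<lambda>n. In n \<xi>2 s2 y2) n - E (\<lambda>n. In n \<xi>1 s1 y1) (\<lambda>n. Y2) n
      + E (\<lambda>n. In n \<xi>1 s1 y1) (\<lambda>n. In n \<xi>2 s2 y2) n" for n
  proof -
    have "(exp a - exp a') * z * ((exp b - exp b') * z') = exp (a + b) * (z * z') - exp (a + b') * (z * z')
      - exp (a' + b) * (z * z') + exp (a' + b') * (z * z')" for a a' b b' z z' :: real
      by (simp add: exp_add algebra_simps)
    then show ?thesis unfolding E_def
      using int[OF a1(1) a2(1), of n] int[OF a1(1) a2(2), of n] int[OF a1(2) a2(1), of n] int[OF a1(2) a2(2), of n] by simp
  qed
  ultimately show ?thesis by simp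
qed

text \<open>Dominates the cross moments of \<open>hn\<close> at times \<open>s1\<close> and
  \<open>s2\<close> for every \<open>n\<close>, with an integrable singularity at equal times. The 4
  counts the terms of the expanded product.\<close>

definition Dn :: "real \<Rightarrow> real \<Rightarrow> real" where
  "Dn s1 s2 = U\<^sup>2 * (4 * (exp (80 * t * sqrt t) * (8 * isq (s1 - s2) + 80 * sqrt t * (80 * sqrt t))))"

lemma Dn_nonneg: "0 \<le> Dn s1 s2"
  using t by (simp add: Dn_def)

lemma cross_bound:
  assumes A: "adm n A" "adm n A'" and B: "adm n B" "adm n B'" and v: "0 \<le> v" "0 \<le> v'" "v \<noteq> v'" and r: "\<bar>r\<bar> \<le> U" "\<bar>r'\<bar> \<le> U"
  shows "\<bar>\<integral>\<omega>. (r * exp (A \<omega>) * Wn n v y \<omega> - r * exp (A' \<omega>) * Wn n v y \<omega>) *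
      (r' * exp (B \<omega>) * Wn n v' y' \<omega> - r' * exp (B' \<omega>) * Wn n v' y' \<omega>) \<partial>Pw\<bar> \<le> Dn v v'"
proof -
  let ?E = "\<lambda>A B. \<integral>\<omega>. exp (A \<omega> + B \<omega>) * (Wn n v y \<omega> * Wn n v' y' \<omega>) \<partial>Pw"
  let ?d = "exp (80 * t * sqrt t) * (8 * isq (v - v') + 80 * sqrt t * (80 * sqrt t))"
  have b: "\<bar>?E A B\<bar> \<le> ?d" if "adm n A" "adm n B" for A B
  proof -
    note adm_sum_bound[OF that v(1,2), of y y']
    also have "exp (80 * t * sqrt t) * (\<bar>\<integral>\<omega>. Wn n v y \<omega> * Wn n v' y' \<omega> \<partial>Pw\<bar> + 80 * sqrt t * (80 * sqrt t)) \<le> ?d"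
      by (intro mult_left_mono add_right_mono Wn_covariance_le v) auto
    finally show ?thesis .
  qed
  have i: "integrable Pw (\<lambda>\<omega>. exp (A \<omega> + B \<omega>) * (Wn n v y \<omega> * Wn n v' y' \<omega>))" if "adm n A" "adm n B" for A B
    using that v by (intro gspace_exp_mult(1) gspace_add Wd_gspace pos) (auto simp: adm_def)
  have alg: "(r * exp a * z - r * exp a' * z) * (r' * exp b * z' - r' * exp b' * z') = (r * r') * (exp (a + b) * (z * z') - exp (a + b') * (z * z')
      - exp (a' + b) * (z * z') + exp (a' + b') * (z * z'))" for a a' b b' z z' :: real
    by (simp add: exp_add algebra_simps)
  have "(\<integral>\<omega>. (r * exp (A \<omega>) * Wn n v y \<omega> - r * exp (A' \<omega>) * Wn n v y \<omega>) *
      (r' * exp (B \<omega>) * Wn n v' y' \<omega> - r' * exp (B' \<omega>) * Wn n v' y' \<omega>) \<partial>Pw)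
    = (r * r') * (?E A B - ?E A B' - ?E A' B + ?E A' B')"
    unfolding alg using i A B by simp
  then have "\<bar>\<integral>\<omega>. (r * exp (A \<omega>) * Wn n v y \<omega> - r * exp (A' \<omega>) * Wn n v y \<omega>) *
      (r' * exp (B \<omega>) * Wn n v' y' \<omega> - r' * exp (B' \<omega>) * Wn n v' y' \<omega>) \<partial>Pw\<bar>
    = (\<bar>r\<bar> * \<bar>r'\<bar>) * \<bar>?E A B - ?E A B' - ?E A' B + ?E A' B'\<bar>"
    by (simp add: abs_mult)
  also have "\<dots> \<le> (U * U) * (4 * ?d)"
  proof (intro mult_mono r)
    show "\<bar>?E A B - ?E A B' - ?E A' B + ?E A' B'\<bar> \<le> 4 * ?d"
      using b[OF A(1) B(1)] b[OF A(1) B(2)] b[OF A(2) B(1)] b[OF A(2) B(2)] by linarith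
  qed (use U_nonneg in auto)
  finally show ?thesis by (simp add: Dn_def power2_eq_square)
qed

text \<open>Bounds the integral of \<open>Dn s1\<close> over \<open>base\<close> uniformly in
  \<open>s1\<close>, and so dominates the outer of two successive limits.\<close>

definition DK :: real where
  "DK = U\<^sup>2 * (4 * exp (80 * t * sqrt t)) * (40 * sqrt t + t * (80 * sqrt t * (80 * sqrt t)))"

lemma nn_integral_Dn: "(\<integral>\<^sup>+m. ennreal (Dn s1 (fst m)) \<partial>base) \<le> ennreal DK"
proof -
  interpret PP: pair_prob_space Px Px ..
  let ?k = "U\<^sup>2 * (4 * exp (80 * t * sqrt t))" and ?c = "80 * sqrt t * (80 * sqrt t)"
  have eq: "ennreal (Dn s1 s) = ennreal ?k * (ennreal (8 * isq (t - s - (t - s1))) + ennreal ?c)" for s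
  proof -
    have "isq (t - s - (t - s1)) = isq (s1 - s)" by simp
    then have "Dn s1 s = ?k * (8 * isq (t - s - (t - s1)) + ?c)" by (simp only: Dn_def)
    moreover have "ennreal (k * (a + b)) = ennreal k * (ennreal a + ennreal b)" if "0 \<le> k" "0 \<le> a" "0 \<le> b" for k a b :: real
      using that by (simp add: ennreal_mult)
    moreover have "0 \<le> ?k" "0 \<le> 8 * isq (t - s - (t - s1))" "0 \<le> ?c" using t by auto
    ultimately show ?thesis by (simp only:)
  qed
  have Dm: "(\<lambda>s. ennreal (Dn s1 s)) \<in> borel_measurable borel" unfolding Dn_def by measurable
  have "(\<integral>\<^sup>+m. ennreal (Dn s1 (fst m)) \<partial>base) = (\<integral>\<^sup>+s. ennreal (Dn s1 s) \<partial>seg t)"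
    using Dm by (subst nn_integral_base) (auto simp: PP.emeasure_space_1)
  also have "\<dots> = ennreal ?k * ((\<integral>\<^sup>+s. ennreal (8 * isq (t - s - (t - s1))) \<partial>seg t) + (\<integral>\<^sup>+s. ennreal ?c \<partial>seg t))"
    unfolding eq by (subst nn_integral_cmult, measurable, subst nn_integral_add) auto
  also have "\<dots> \<le> ennreal ?k * (ennreal (40 * sqrt t) + ennreal t * ennreal ?c)"
    unfolding nn_integral_seg_const[OF t] by (intro mult_left_mono add_right_mono nn_integral_seg_isq t) auto
  also have "\<dots> = ennreal DK"
  proof -
    have "ennreal (k * (a + r * b)) = ennreal k * (ennreal a + ennreal r * ennreal b)" if "0 \<le> k" "0 \<le> a" "0 \<le> r" "0 \<le> b" for k a b r :: real
      using that by (simp add: ennreal_mult)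
    moreover have "0 \<le> ?k" "0 \<le> 40 * sqrt t" "0 \<le> ?c" using t by auto
    ultimately show ?thesis using t by (simp only: DK_def)
  qed
  finally show ?thesis .
qed

lemma hn_sqi: "sqi Pw (\<lambda>\<omega>. \<integral>m. hn n m \<omega> \<partial>base)"
  by (rule sfubini_sqi_integral[OF finite_measure_base prob_space_axioms hn_measurable hn_bound])

text \<open>The second moment of the integral is a double integral of cross moments. Equal times
  form a null set; elsewhere \<open>cross_tendsto\<close> applies, and domination by
  \<open>Dn\<close> inside and by \<open>DK\<close> outside allows both limits to be taken.\<close>

lemma hn_tendsto: "(\<lambda>n. \<integral>\<omega>. (\<integral>m. hn n m \<omega> \<partial>base)\<^sup>2 \<partial>Pw) \<longlonglongrightarrow> 0"
proof -
  note SF = finite_measure_base prob_space_axioms hn_measurable hn_bound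
  let ?\<Phi> = "\<lambda>n m m'. \<integral>\<omega>. hn n m' \<omega> * hn n m \<omega> \<partial>Pw"
  have hm[measurable]: "(\<lambda>p. hn n (f p) (g p)) \<in> borel_measurable M" if [measurable]: "f \<in> measurable M base" "g \<in> measurable M Pw" for n f g and M :: "'z measure"
    using measurable_compose[OF measurable_Pair[OF that] hn_measurable[of n]] by simp
  have hm2[measurable]: "(\<lambda>p. hn n (snd (fst p)) (snd p) * hn n (fst (fst p)) (snd p)) \<in> borel_measurable ((base \<Otimes>\<^sub>M base) \<Otimes>\<^sub>M Pw)" for n
    using measurable_compose[OF _ hn_measurable[of n], of "\<lambda>p. (snd (fst p), snd p)" "(base \<Otimes>\<^sub>M base) \<Otimes>\<^sub>M Pw"]
      measurable_compose[OF _ hn_measurable[of n], of "\<lambda>p. (fst (fst p), snd p)" "(base \<Otimes>\<^sub>M base) \<Otimes>\<^sub>M Pw"] by simp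
  have \<Phi>m[measurable]: "(\<lambda>(m, m'). ?\<Phi> n m m') \<in> borel_measurable (base \<Otimes>\<^sub>M base)" for n
    unfolding split_beta' by (rule borel_measurable_lebesgue_integral) (use hm2 in \<open>simp add: split_beta'\<close>)
  have eq: "(\<integral>\<omega>. (\<integral>m. hn n m \<omega> \<partial>base)\<^sup>2 \<partial>Pw) = (\<integral>m. (\<integral>m'. ?\<Phi> n m m' \<partial>base) \<partial>base)" for n
  proof -
    have "(\<integral>\<omega>. (\<integral>m. hn n m \<omega> \<partial>base)\<^sup>2 \<partial>Pw) = (\<integral>m. (\<integral>\<omega>. hn n m \<omega> * (\<integral>m. hn n m \<omega> \<partial>base) \<partial>Pw) \<partial>base)"
      unfolding power2_eq_square by (rule sfubini_mult[OF SF hn_sqi])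
    also have "\<dots> = (\<integral>m. (\<integral>m'. ?\<Phi> n m m' \<partial>base) \<partial>base)"
    proof (rule integral_cong_AE)
      show "AE m in base. (\<integral>\<omega>. hn n m \<omega> * (\<integral>m. hn n m \<omega> \<partial>base) \<partial>Pw) = (\<integral>m'. ?\<Phi> n m m' \<partial>base)"
        using hn_bound[of n] AE_space
      proof eventually_elim
        case (elim m)
        have "(\<integral>\<^sup>+\<omega>. ennreal ((hn n m \<omega>)\<^sup>2) \<partial>Pw) < \<infinity>" using elim(1) by (auto simp: le_less_trans)
        then have "sqi Pw (hn n m)" using elim(2) hn_measurable[of n] by (intro sqi_nn_integral) (auto dest: measurable_Pair2)
        from sfubini_mult[OF SF this] show ?case by (simp add: mult.commute)
      qed
      have "(\<lambda>p. \<integral>m. hn n m (snd p) \<partial>base) \<in> borel_measurable (base \<Otimes>\<^sub>M Pw)"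
        using sqi_measurable[OF hn_sqi[of n]] by measurable
      then have "(\<lambda>(m, \<omega>). hn n m \<omega> * (\<integral>m. hn n m \<omega> \<partial>base)) \<in> borel_measurable (base \<Otimes>\<^sub>M Pw)"
        using hn_measurable[of n] unfolding split_beta' by measurable
      then show "(\<lambda>m. \<integral>\<omega>. hn n m \<omega> * (\<integral>m. hn n m \<omega> \<partial>base) \<partial>Pw) \<in> borel_measurable base"
        by (rule borel_measurable_lebesgue_integral)
      show "(\<lambda>m. \<integral>m'. ?\<Phi> n m m' \<partial>base) \<in> borel_measurable base"
        by (rule base.borel_measurable_lebesgue_integral) (rule \<Phi>m)
    qed
    finally show ?thesis .
  qed
  have neq: "AE m' in base. fst m' \<noteq> s" for s :: real
    using AE_seg_neq[of t "t - s"] by (intro AE_base_time) auto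
  have \<Phi>_bound: "AE m' in base. norm (?\<Phi> n m m') \<le> Dn (fst m) (fst m')"
    if m: "0 \<le> fst m" "fst m \<le> t" "good (S.Xp (pa m)) (fst m) (pt m) (I (fst m) (pt m) (pa m))" for n m
    using AE_base_good neq[of "fst m"]
  proof eventually_elim
    case (elim m')
    have "\<bar>\<integral>\<omega>. hn n m \<omega> * hn n m' \<omega> \<partial>Pw\<bar> \<le> Dn (fst m) (fst m')"
      unfolding hn_def pn_def qn_def
    proof (rule cross_bound)
      show "adm n (I (fst m) (pt m) (pa m))" "adm n (I (fst m') (pt m') (pa m'))"
        using m elim by (auto intro: adm_good)
      show "adm n (In n (S.Xp (pa m)) (fst m) (pt m))" "adm n (In n (S.Xp (pa m')) (fst m') (pt m'))"
        using m elim by (auto intro!: adm_In simp: good_def)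
    qed (use m elim u0_bound in auto)
    then show ?case by (simp add: mult.commute)
  qed
  have DI: "integrable base (\<lambda>m'. Dn s (fst m'))" for s
  proof (rule integrableI_nonneg)
    have "Dn s \<in> borel_measurable borel" unfolding Dn_def by measurable
    then show "(\<lambda>m'. Dn s (fst m')) \<in> borel_measurable base" by measurable
    show "(\<integral>\<^sup>+m'. ennreal (Dn s (fst m')) \<partial>base) < \<infinity>"
      using nn_integral_Dn[of s] by (auto simp: le_less_trans)
  qed (use Dn_nonneg in auto)
  \<comment> \<open>Time 0 is excluded because the noise covariances converge only at positive
    times, where the cut time kernels eventually have mass 1.\<close>
  have inner: "(\<lambda>n. \<integral>m'. ?\<Phi> n m m' \<partial>base) \<longlonglongrightarrow> 0"
    if m: "0 < fst m" "fst m \<le> t" "good (S.Xp (pa m)) (fst m) (pt m) (I (fst m) (pt m) (pa m))" "m \<in> space base" for m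
  proof -
    have "(\<lambda>n. \<integral>m'. ?\<Phi> n m m' \<partial>base) \<longlonglongrightarrow> (\<integral>m'. 0 \<partial>base)"
    proof (rule integral_dominated_convergence[OF _ _ DI[of "fst m"]])
      show "AE m' in base. (\<lambda>n. ?\<Phi> n m m') \<longlonglongrightarrow> 0"
        using AE_base_good neq[of "fst m"] neq[of 0]
      proof eventually_elim
        case (elim m')
        have "(\<lambda>n. \<integral>\<omega>. (exp (I (fst m') (pt m') (pa m') \<omega>) - exp (In n (S.Xp (pa m')) (fst m') (pt m') \<omega>)) * Wn n (fst m') (pt m') \<omega> *
          ((exp (I (fst m) (pt m) (pa m) \<omega>) - exp (In n (S.Xp (pa m)) (fst m) (pt m) \<omega>)) * Wn n (fst m) (pt m) \<omega>) \<partial>Pw) \<longlonglongrightarrow> 0"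
          using m elim by (intro cross_tendsto) auto
        then have "(\<lambda>n. (u0 (S.Xp (pa m') (fst m') + pt m') * u0 (S.Xp (pa m) (fst m) + pt m)) *
          (\<integral>\<omega>. (exp (I (fst m') (pt m') (pa m') \<omega>) - exp (In n (S.Xp (pa m')) (fst m') (pt m') \<omega>)) * Wn n (fst m') (pt m') \<omega> *
          ((exp (I (fst m) (pt m) (pa m) \<omega>) - exp (In n (S.Xp (pa m)) (fst m) (pt m) \<omega>)) * Wn n (fst m) (pt m) \<omega>) \<partial>Pw)) \<longlonglongrightarrow> 0"
          by (rule tendsto_mult_right_zero)
        moreover have "hn n m' \<omega> * hn n m \<omega> = (u0 (S.Xp (pa m') (fst m') + pt m') * u0 (S.Xp (pa m) (fst m) + pt m)) *
          ((exp (I (fst m') (pt m') (pa m') \<omega>) - exp (In n (S.Xp (pa m')) (fst m') (pt m') \<omega>)) * Wn n (fst m') (pt m') \<omega> *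
          ((exp (I (fst m) (pt m) (pa m) \<omega>) - exp (In n (S.Xp (pa m)) (fst m) (pt m) \<omega>)) * Wn n (fst m) (pt m) \<omega>))" for n \<omega>
          unfolding hn_def pn_def qn_def by (simp add: right_diff_distrib left_diff_distrib mult_ac)
        ultimately show ?case by simp
      qed
      show "AE m' in base. norm (?\<Phi> n m m') \<le> Dn (fst m) (fst m')" for n
        using m by (intro \<Phi>_bound) auto
    qed (use m(4) \<Phi>m in \<open>auto dest: measurable_Pair2\<close>)
    then show ?thesis by simp
  qed
  have K: "(\<integral>m'. Dn s (fst m') \<partial>base) \<le> DK" for s
  proof -
    have "0 \<le> DK" using t by (simp add: DK_def)
    then show ?thesis using nn_integral_Dn[of s] DI[of s] Dn_nonneg
      by (subst (asm) nn_integral_eq_integral) auto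
  qed
  have "(\<lambda>n. \<integral>m. (\<integral>m'. ?\<Phi> n m m' \<partial>base) \<partial>base) \<longlonglongrightarrow> (\<integral>m. 0 \<partial>base)"
  proof (rule integral_dominated_convergence)
    show "integrable base (\<lambda>_. DK)" by simp
    show "AE m in base. (\<lambda>n. \<integral>m'. ?\<Phi> n m m' \<partial>base) \<longlonglongrightarrow> 0"
      using AE_base_good neq[of 0] AE_space
      by eventually_elim (rule inner; auto)
    show "AE m in base. norm (\<integral>m'. ?\<Phi> n m m' \<partial>base) \<le> DK" for n
      using AE_base_good AE_space
    proof eventually_elim
      case (elim m)
      have b: "AE m' in base. norm (?\<Phi> n m m') \<le> Dn (fst m) (fst m')" using elim by (intro \<Phi>_bound) auto
      have m: "?\<Phi> n m \<in> borel_measurable base"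
        using measurable_compose[OF measurable_Pair1'[OF elim(2)] \<Phi>m[of n]] by simp
      have "integrable base (\<lambda>m'. norm (?\<Phi> n m m'))"
        by (rule Bochner_Integration.integrable_bound[OF DI[of "fst m"]]) (use b m Dn_nonneg in auto)
      then have "norm (\<integral>m'. ?\<Phi> n m m' \<partial>base) \<le> (\<integral>m'. Dn (fst m) (fst m') \<partial>base)"
        using b DI by (intro order_trans[OF integral_norm_bound integral_mono_AE]) auto
      then show ?case using K[of "fst m"] by linarith
    qed
    show "(\<lambda>m. \<integral>m'. ?\<Phi> n m m' \<partial>base) \<in> borel_measurable base" for n
      by (rule base.borel_measurable_lebesgue_integral) (rule \<Phi>m)
  qed simp
  then show ?thesis unfolding eq by simp
qed

end

end

subsection \<open>The stochastic integral as an integral over paths\<close>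

context fk_seq
begin

context
  fixes t x :: real
  assumes t: "0 \<le> t"
begin

interpretation base: finite_measure "base t" by (rule finite_measure_base[OF t])

lemmas [measurable_cong] = sets_base[OF t]

lemma integral_base:
  fixes K :: "real \<times> 'a \<times> 'a \<Rightarrow> real"
  assumes K: "integrable (base t) K"
  shows "(\<integral>m. K m \<partial>base t) = (\<integral>s. (\<integral>\<omega>2. (\<integral>\<omega>1. K (s, \<omega>2, \<omega>1) \<partial>Px) \<partial>Px) \<partial>seg t)"
proof -
  interpret A: finite_measure "seg t" by (rule finite_measure_seg)
  interpret PP: pair_prob_space Px Px ..
  interpret AP: pair_sigma_finite "seg t" "Px \<Otimes>\<^sub>M Px" ..
  note K' = K[unfolded base_def[OF t]]
  have [measurable]: "K \<in> borel_measurable (seg t \<Otimes>\<^sub>M (Px \<Otimes>\<^sub>M Px))" using K' by simp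
  have "(\<integral>m. K m \<partial>base t) = (\<integral>s. (\<integral>p. K (s, p) \<partial>(Px \<Otimes>\<^sub>M Px)) \<partial>seg t)"
    unfolding base_def[OF t] by (rule AP.integral_fst'[OF K', symmetric])
  also have "\<dots> = (\<integral>s. (\<integral>\<omega>2. (\<integral>\<omega>1. K (s, \<omega>2, \<omega>1) \<partial>Px) \<partial>Px) \<partial>seg t)"
  proof (rule integral_cong_AE)
    show "AE s in seg t. (\<integral>p. K (s, p) \<partial>(Px \<Otimes>\<^sub>M Px)) = (\<integral>\<omega>2. (\<integral>\<omega>1. K (s, \<omega>2, \<omega>1) \<partial>Px) \<partial>Px)"
      using AP.AE_integrable_fst'[OF K'] by eventually_elim (rule PP.integral_fst'[symmetric])
  qed measurable
  finally show ?thesis .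
qed

text \<open>For \<open>s < t\<close> the weight \<open>g_alpha c \<alpha> (t - s) (x - y)\<close> is
  the density of the stable process at time \<open>t - s\<close> started at \<open>x\<close>. A
  space-time integral with this weight therefore becomes an integral over \<open>base\<close>; the
  endpoint \<open>s = t\<close> is null.\<close>

lemma g_alpha_base:
  fixes k :: "real \<Rightarrow> real \<Rightarrow> 'a \<Rightarrow> real"
  assumes k: "(\<lambda>(s, y, w). k s y w) \<in> borel_measurable (borel \<Otimes>\<^sub>M (borel \<Otimes>\<^sub>M Px))"
    and i: "integrable (base t) (\<lambda>m. k (fst m) (pt t x m) (pa m))"
  shows "set_integrable lborel ({0..t} \<times> UNIV) (\<lambda>(s, y). g_alpha c \<alpha> (t - s) (x - y) * (\<integral>w. k s y w \<partial>Px))"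
    and "(\<integral>z\<in>{0..t} \<times> UNIV. (case z of (s, y) \<Rightarrow> g_alpha c \<alpha> (t - s) (x - y) * (\<integral>w. k s y w \<partial>Px)) \<partial>lborel)
      = (\<integral>m. k (fst m) (pt t x m) (pa m) \<partial>base t)"
proof -
  interpret PP: pair_prob_space Px Px ..
  have km[measurable]: "(\<lambda>p. k (f p) (g p) (h p)) \<in> borel_measurable M"
    if [measurable]: "f \<in> borel_measurable M" "g \<in> borel_measurable M" "h \<in> measurable M Px" for f g h and M :: "'z measure"
    using measurable_compose[OF _ k, of "\<lambda>p. (f p, g p, h p)" M] by simp
  have km2[measurable]: "(\<lambda>q. k (f (fst q)) (g (fst q)) (snd q)) \<in> borel_measurable (M \<Otimes>\<^sub>M Px)"
    if [measurable]: "f \<in> borel_measurable M" "g \<in> borel_measurable M" for f g and M :: "'z measure"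
    using measurable_compose[OF _ k, of "\<lambda>q. (f (fst q), g (fst q), snd q)" "M \<Otimes>\<^sub>M Px"] by simp
  define Q where "Q s y = (\<integral>w. k s y w \<partial>Px)" for s y
  have Qm[measurable]: "(\<lambda>p. Q (f p) (g p)) \<in> borel_measurable M"
    if [measurable]: "f \<in> borel_measurable M" "g \<in> borel_measurable M" for f g and M :: "'z measure"
    unfolding Q_def using km2[OF that] by (intro S.borel_measurable_lebesgue_integral) (simp add: split_beta')
  have Xm[measurable]: "(\<lambda>\<omega>. S.Xp \<omega> a) \<in> borel_measurable Px" for a by (rule S.Xp_measurable) measurable
  have Xm2[measurable]: "(\<lambda>q. S.Xp (snd q) (t - fst q)) \<in> borel_measurable (borel \<Otimes>\<^sub>M Px)" by (rule S.Xp_measurable) measurable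
  define h where "h = (\<lambda>z::real \<times> real. indicator ({0..t} \<times> UNIV) z * (g_alpha c \<alpha> (t - fst z) (x - snd z) * Q (fst z) (snd z)))"
  have [measurable]: "{0..t} \<times> (UNIV::real set) \<in> sets (borel \<Otimes>\<^sub>M borel)" by measurable
  have hp[measurable]: "h \<in> borel_measurable (borel \<Otimes>\<^sub>M borel)"
    unfolding h_def using g_alpha_measurable[of "\<lambda>z. t - fst z" "borel \<Otimes>\<^sub>M borel" "\<lambda>z. x - snd z"] by measurable
  then have hb: "h \<in> borel_measurable borel" by (simp add: borel_prod)
  have h0: "h (s, y) = 0" if "s \<notin> {0..t}" for s y using that by (simp add: h_def)
  \<comment> \<open>If \<open>k s y\<close> is not integrable, its Bochner integral is 0 by
    convention and the bound still holds.\<close>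
  have Q_le: "ennreal \<bar>Q s y\<bar> \<le> (\<integral>\<^sup>+w. ennreal \<bar>k s y w\<bar> \<partial>Px)" for s y
  proof (cases "integrable Px (k s y)")
    case True
    then show ?thesis unfolding Q_def using integral_norm_bound_ennreal[OF True] by simp
  qed (simp add: Q_def not_integrable_integral_eq)
  have neq: "AE s in seg t. 0 \<le> s \<and> s < t"
    using AE_seg[of t] AE_seg_neq[of t 0] by eventually_elim auto
  have inner: "(\<integral>\<^sup>+y. ennreal \<bar>h (s, y)\<bar> \<partial>lborel) \<le> (\<integral>\<^sup>+\<omega>. \<integral>\<^sup>+w. ennreal \<bar>k s (S.Xp \<omega> (t - s) + x) w\<bar> \<partial>Px \<partial>Px)"
    "(\<integral>y. h (s, y) \<partial>lborel) = (\<integral>\<omega>. Q s (S.Xp \<omega> (t - s) + x) \<partial>Px)" if s: "0 \<le> s \<and> s < t" for s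
  proof -
    have a: "0 < t - s" using s by simp
    have X: "S.Xp \<omega> (t - s) = X (t - s) \<omega>" for \<omega> using s by (simp add: S.Xp_def)
    have "(\<integral>\<^sup>+y. ennreal \<bar>h (s, y)\<bar> \<partial>lborel) = (\<integral>\<^sup>+y. ennreal (g_alpha c \<alpha> (t - s) (x - y)) * ennreal \<bar>Q s y\<bar> \<partial>lborel)"
      using s S.g_alpha_nonneg[OF a] by (intro nn_integral_cong) (simp add: h_def abs_mult ennreal_mult')
    also have "\<dots> = (\<integral>\<^sup>+\<omega>. ennreal \<bar>Q s (X (t - s) \<omega> + x)\<bar> \<partial>Px)"
      by (rule S.nn_integral_g_alpha[OF a]) measurable
    also have "\<dots> \<le> (\<integral>\<^sup>+\<omega>. \<integral>\<^sup>+w. ennreal \<bar>k s (S.Xp \<omega> (t - s) + x) w\<bar> \<partial>Px \<partial>Px)"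
      unfolding X by (intro nn_integral_mono Q_le)
    finally show "(\<integral>\<^sup>+y. ennreal \<bar>h (s, y)\<bar> \<partial>lborel) \<le> \<dots>" .
    have "(\<integral>y. h (s, y) \<partial>lborel) = (\<integral>y. g_alpha c \<alpha> (t - s) (x - y) * Q s y \<partial>lborel)"
      using s by (simp add: h_def)
    also have "\<dots> = (\<integral>\<omega>. Q s (S.Xp \<omega> (t - s) + x) \<partial>Px)"
      unfolding X by (rule S.integral_g_alpha[OF a]) measurable
    finally show "(\<integral>y. h (s, y) \<partial>lborel) = (\<integral>\<omega>. Q s (S.Xp \<omega> (t - s) + x) \<partial>Px)" .
  qed
  have hi: "integrable lborel h"
  proof (rule integrableI_bounded)
    show "h \<in> borel_measurable lborel" using hb by simp
    have "(\<integral>\<^sup>+z. ennreal (norm (h z)) \<partial>lborel) = (\<integral>\<^sup>+s. \<integral>\<^sup>+y. ennreal \<bar>h (s, y)\<bar> \<partial>lborel \<partial>lborel)"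
      using hb by (subst nn_integral_lborel_pair) auto
    also have "\<dots> = (\<integral>\<^sup>+s. ennreal (indicator {0..t} s) * (\<integral>\<^sup>+y. ennreal \<bar>h (s, y)\<bar> \<partial>lborel) \<partial>lborel)"
      by (intro nn_integral_cong) (auto simp: indicator_def h0)
    also have "\<dots> = (\<integral>\<^sup>+s. \<integral>\<^sup>+y. ennreal \<bar>h (s, y)\<bar> \<partial>lborel \<partial>seg t)"
    proof -
      have "(\<lambda>s. \<integral>\<^sup>+y. ennreal \<bar>h (s, y)\<bar> \<partial>lborel) \<in> borel_measurable borel" by measurable
      from nn_integral_seg[OF this] show ?thesis by simp
    qed
    also have "\<dots> \<le> (\<integral>\<^sup>+s. \<integral>\<^sup>+\<omega>. \<integral>\<^sup>+w. ennreal \<bar>k s (S.Xp \<omega> (t - s) + x) w\<bar> \<partial>Px \<partial>Px \<partial>seg t)"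
      by (rule nn_integral_mono_AE, use neq in eventually_elim) (rule inner)
    also have "\<dots> = (\<integral>\<^sup>+s. \<integral>\<^sup>+p. ennreal \<bar>k s (S.Xp (fst p) (t - s) + x) (snd p)\<bar> \<partial>(Px \<Otimes>\<^sub>M Px) \<partial>seg t)"
      by (intro nn_integral_cong, subst S.nn_integral_fst[symmetric]) (auto intro!: S.Xp_measurable)
    also have "\<dots> = (\<integral>\<^sup>+m. ennreal (norm (k (fst m) (pt t x m) (pa m))) \<partial>base t)"
    proof -
      have "(\<lambda>m. k (fst m) (pt t x m) (pa m)) \<in> borel_measurable (borel \<Otimes>\<^sub>M (Px \<Otimes>\<^sub>M Px))"
        by (rule km[OF _ pt_measurable[OF t, of x]]) measurable
      then show ?thesis by (subst nn_integral_base[OF t]) auto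
    qed
    also have "\<dots> < \<infinity>" using i by (simp add: integrable_iff_bounded)
    finally show "(\<integral>\<^sup>+z. ennreal (norm (h z)) \<partial>lborel) < \<infinity>" .
  qed
  have eq: "indicator ({0..t} \<times> UNIV) z *\<^sub>R (case z of (s, y) \<Rightarrow> g_alpha c \<alpha> (t - s) (x - y) * (\<integral>w. k s y w \<partial>Px)) = h z" for z
    by (cases z) (simp add: h_def Q_def)
  show "set_integrable lborel ({0..t} \<times> UNIV) (\<lambda>(s, y). g_alpha c \<alpha> (t - s) (x - y) * (\<integral>w. k s y w \<partial>Px))"
    unfolding set_integrable_def eq by (rule hi)
  have "(\<integral>z. h z \<partial>lborel) = (\<integral>s. (\<integral>y. h (s, y) \<partial>lborel) \<partial>lborel)"
    using lborel_pair.integral_fst'[of h] hi by (simp add: lborel_prod)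
  also have "\<dots> = (\<integral>s\<in>{0..t}. (\<integral>y. h (s, y) \<partial>lborel) \<partial>lborel)"
  proof -
    have "(\<integral>y. h (s, y) \<partial>lborel) = indicator {0..t} s *\<^sub>R (\<integral>y. h (s, y) \<partial>lborel)" for s
      by (cases "s \<in> {0..t}") (simp_all add: h0 del: atLeastAtMost_iff)
    then show ?thesis unfolding set_lebesgue_integral_def by (intro Bochner_Integration.integral_cong) auto
  qed
  also have "\<dots> = (\<integral>s. (\<integral>y. h (s, y) \<partial>lborel) \<partial>seg t)"
    by (rule integral_seg[symmetric]) measurable
  also have "\<dots> = (\<integral>s. (\<integral>\<omega>. Q s (S.Xp \<omega> (t - s) + x) \<partial>Px) \<partial>seg t)"
  proof (rule integral_cong_AE)
    show "AE s in seg t. (\<integral>y. h (s, y) \<partial>lborel) = (\<integral>\<omega>. Q s (S.Xp \<omega> (t - s) + x) \<partial>Px)"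
      using neq by eventually_elim (rule inner)
  qed measurable
  also have "\<dots> = (\<integral>m. k (fst m) (pt t x m) (pa m) \<partial>base t)"
    unfolding integral_base[OF i] by (simp add: Q_def)
  finally show "(\<integral>z\<in>{0..t} \<times> UNIV. (case z of (s, y) \<Rightarrow> g_alpha c \<alpha> (t - s) (x - y) * (\<integral>w. k s y w \<partial>Px)) \<partial>lborel)
      = (\<integral>m. k (fst m) (pt t x m) (pa m) \<partial>base t)"
    unfolding set_lebesgue_integral_def eq .
qed

text \<open>The integrand without the noise factor. Its integrability on \<open>base\<close> gives
  the absolute integrability of the field that the Stratonovich integral presupposes.\<close>

definition rn :: "real \<times> 'a \<times> 'a \<Rightarrow> 'b \<Rightarrow> real" where
  "rn m \<omega> = u0 (S.Xp (pa m) (fst m) + pt t x m) * exp (I (fst m) (pt t x m) (pa m) \<omega>)"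

lemma rn_integrable: "AE \<omega> in Pw. integrable (base t) (\<lambda>m. rn m \<omega>)"
proof (rule sfubini_integrable[OF finite_measure_base[OF t] prob_space_axioms])
  have [measurable]: "(\<lambda>p. pt t x (fst p)) \<in> borel_measurable (base t \<Otimes>\<^sub>M Pw)"
    using pt_measurable[OF t, of x] by measurable
  have [measurable]: "(\<lambda>p. S.Xp (pa (fst p)) (fst (fst p))) \<in> borel_measurable (base t \<Otimes>\<^sub>M Pw)"
    by (rule S.Xp_measurable) measurable
  have [measurable]: "(\<lambda>p. I (fst (fst p)) (pt t x (fst p)) (pa (fst p)) (snd p)) \<in> borel_measurable (base t \<Otimes>\<^sub>M Pw)"
    by (rule I_measurable) measurable
  show "(\<lambda>(m, \<omega>). rn m \<omega>) \<in> borel_measurable (base t \<Otimes>\<^sub>M Pw)"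
    unfolding rn_def split_beta' by measurable
  show "AE m in base t. (\<integral>\<^sup>+\<omega>. ennreal ((rn m \<omega>)\<^sup>2) \<partial>Pw) \<le> ennreal (U\<^sup>2 * exp (80 * t * sqrt t))"
    using AE_base_good[OF t, of x]
  proof eventually_elim
    case (elim m)
    let ?Y = "I (fst m) (pt t x m) (pa m)" and ?u = "u0 (S.Xp (pa m) (fst m) + pt t x m)"
    have g: "(\<lambda>\<omega>. 2 * ?Y \<omega>) \<in> gspace Pw W" using elim by (intro gspace_cmult good_gspace) auto
    have v: "(\<integral>\<omega>. (?Y \<omega>)\<^sup>2 \<partial>Pw) \<le> 40 * t * sqrt t"
      using good_variance[of _ "fst m" "pt t x m" ?Y] time_mono[OF t, of "fst m"] elim by (meson order_trans)
    have "(\<integral>\<^sup>+\<omega>. ennreal ((rn m \<omega>)\<^sup>2) \<partial>Pw) = (\<integral>\<^sup>+\<omega>. ennreal (?u\<^sup>2 * exp (2 * ?Y \<omega>)) \<partial>Pw)"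
      by (intro nn_integral_cong) (simp add: rn_def power_mult_distrib exp_double)
    also have "\<dots> = ennreal (?u\<^sup>2 * exp ((\<integral>\<omega>. (2 * ?Y \<omega>)\<^sup>2 \<partial>Pw) / 2))"
      using gspace_exp[OF g] by (subst nn_integral_eq_integral) auto
    also have "\<dots> \<le> ennreal (U\<^sup>2 * exp (80 * t * sqrt t))"
    proof (intro ennreal_leI mult_mono)
      show "?u\<^sup>2 \<le> U\<^sup>2" using power_mono[OF u0_bound[of "S.Xp (pa m) (fst m) + pt t x m"], of 2] by simp
      show "exp ((\<integral>\<omega>. (2 * ?Y \<omega>)\<^sup>2 \<partial>Pw) / 2) \<le> exp (80 * t * sqrt t)"
        using v by (simp add: power_mult_distrib)
    qed auto
    finally show ?case .
  qed
qed

lemma fk_sol_Xp: "0 \<le> s \<Longrightarrow> fk_sol Px X I u0 s y \<omega> = (\<integral>w. u0 (S.Xp w s + y) * exp (I s y w \<omega>) \<partial>Px)"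
  by (simp add: fk_sol_def S.Xp_def)

lemma strat_set_integrable:
  "AE \<omega> in Pw. set_integrable lborel ({0..t} \<times> UNIV) (\<lambda>(s, y). g_alpha c \<alpha> (t - s) (x - y) * fk_sol Px X I u0 s y \<omega>)"
  using rn_integrable AE_space
proof eventually_elim
  case (elim \<omega>)
  have [measurable]: "(\<lambda>p. I (fst p) (fst (snd p)) (snd (snd p)) \<omega>) \<in> borel_measurable (borel \<Otimes>\<^sub>M (borel \<Otimes>\<^sub>M Px))"
    using elim by (intro I_measurable) auto
  have [measurable]: "(\<lambda>p. S.Xp (snd (snd p)) (fst p)) \<in> borel_measurable (borel \<Otimes>\<^sub>M (borel \<Otimes>\<^sub>M Px))"
    by (rule S.Xp_measurable) measurable
  have "set_integrable lborel ({0..t} \<times> UNIV) (\<lambda>(s, y). g_alpha c \<alpha> (t - s) (x - y) * (\<integral>w. u0 (S.Xp w s + y) * exp (I s y w \<omega>) \<partial>Px))"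
  proof (rule g_alpha_base)
    show "(\<lambda>(s, y, w). u0 (S.Xp w s + y) * exp (I s y w \<omega>)) \<in> borel_measurable (borel \<Otimes>\<^sub>M (borel \<Otimes>\<^sub>M Px))"
      unfolding split_beta' by measurable
  qed (use elim in \<open>simp add: rn_def\<close>)
  then show ?case
    by (rule set_integrable_cong[THEN iffD1, rotated -1]) (auto simp: fk_sol_Xp)
qed

text \<open>The noise at \<open>(s, y)\<close> does not depend on the path, so it can be moved under
  the path expectation that defines the solution.\<close>

lemma strat_integral_pn:
  "AE \<omega> in Pw. (\<integral>z\<in>{0..t} \<times> UNIV. (case z of (s, y) \<Rightarrow> g_alpha c \<alpha> (t - s) (x - y) * fk_sol Px X I u0 s y \<omega> * Wn n s y \<omega>) \<partial>lborel)
    = (\<integral>m. pn t x n m \<omega> \<partial>base t)"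
  using sfubini_integrable[OF finite_measure_base[OF t] prob_space_axioms pn_measurable[OF t] pn_bound[OF t], of x n] AE_space
proof eventually_elim
  case (elim \<omega>)
  have [measurable]: "(\<lambda>p. I (fst p) (fst (snd p)) (snd (snd p)) \<omega>) \<in> borel_measurable (borel \<Otimes>\<^sub>M (borel \<Otimes>\<^sub>M Px))"
    using elim by (intro I_measurable) auto
  have [measurable]: "(\<lambda>p. Wn n (fst p) (fst (snd p)) \<omega>) \<in> borel_measurable (borel \<Otimes>\<^sub>M (borel \<Otimes>\<^sub>M Px))"
    using elim by (intro Wd_measurable pos) auto
  have [measurable]: "(\<lambda>p. S.Xp (snd (snd p)) (fst p)) \<in> borel_measurable (borel \<Otimes>\<^sub>M (borel \<Otimes>\<^sub>M Px))"
    by (rule S.Xp_measurable) measurable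
  have "(\<integral>z\<in>{0..t} \<times> UNIV. (case z of (s, y) \<Rightarrow> g_alpha c \<alpha> (t - s) (x - y) * fk_sol Px X I u0 s y \<omega> * Wn n s y \<omega>) \<partial>lborel)
    = (\<integral>z\<in>{0..t} \<times> UNIV. (case z of (s, y) \<Rightarrow> g_alpha c \<alpha> (t - s) (x - y) *
        (\<integral>w. u0 (S.Xp w s + y) * exp (I s y w \<omega>) * Wn n s y \<omega> \<partial>Px)) \<partial>lborel)"
    unfolding set_lebesgue_integral_def
    by (intro Bochner_Integration.integral_cong refl) (auto simp: fk_sol_Xp indicator_def)
  also have "\<dots> = (\<integral>m. pn t x n m \<omega> \<partial>base t)"
    unfolding pn_def[OF t]
  proof (rule g_alpha_base(2))
    show "(\<lambda>(s, y, w). u0 (S.Xp w s + y) * exp (I s y w \<omega>) * Wn n s y \<omega>) \<in> borel_measurable (borel \<Otimes>\<^sub>M (borel \<Otimes>\<^sub>M Px))"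
      unfolding split_beta' by measurable
  qed (use elim in \<open>simp add: pn_def[OF t]\<close>)
  finally show ?case .
qed

subsection \<open>Convergence of the approximate solutions\<close>

definition nicen :: "nat \<Rightarrow> 'a \<Rightarrow> 'b \<Rightarrow> real" where
  "nicen n w \<omega> = u0 (X t w + x) * exp (In n (S.Xp w) t x \<omega>)"

lemma nicen_measurable: "(\<lambda>(w, \<omega>). nicen n w \<omega>) \<in> borel_measurable (Px \<Otimes>\<^sub>M Pw)"
proof -
  have [measurable]: "(\<lambda>p. In n (S.Xp (fst p)) t x (snd p)) \<in> borel_measurable (Px \<Otimes>\<^sub>M Pw)"
    by (rule Ipath_measurable[OF pos]) measurable
  show ?thesis unfolding nicen_def split_beta' by measurable
qed

definition dn :: "nat \<Rightarrow> 'a \<Rightarrow> 'b \<Rightarrow> real" where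
  "dn n w \<omega> = nicen n w \<omega> - nice t x w \<omega>"

lemma dn_measurable: "(\<lambda>(w, \<omega>). dn n w \<omega>) \<in> borel_measurable (Px \<Otimes>\<^sub>M Pw)"
  using nicen_measurable[of n] unfolding dn_def split_beta' by measurable

text \<open>The square is a combination of three Gaussian exponentials with coefficients 1, -2, 1
  whose variances share one limit. The bound is uniform in the path and so provides a constant
  dominating function.\<close>

lemma dn_sq:
  assumes g: "good (S.Xp w) t x (I t x w)"
  shows "integrable Pw (\<lambda>\<omega>. (dn n w \<omega>)\<^sup>2)"
    and "(\<integral>\<omega>. (dn n w \<omega>)\<^sup>2 \<partial>Pw) \<le> 4 * U\<^sup>2 * exp (80 * t * sqrt t)"
    and "(\<lambda>n. \<integral>\<omega>. (dn n w \<omega>)\<^sup>2 \<partial>Pw) \<longlonglongrightarrow> 0"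
proof -
  let ?A = "\<lambda>n. In n (S.Xp w) t x" and ?Y = "I t x w" and ?u = "u0 (X t w + x)"
  have \<xi>: "S.Xp w \<in> borel_measurable borel" and l: "l2lim Pw ?A ?Y" using g by (auto simp: good_def)
  have gA: "?A n \<in> gspace Pw W" for n by (rule Ipath_gspace[OF pos t \<xi>])
  have gY: "?Y \<in> gspace Pw W" by (rule good_gspace[OF g])
  define V where "V A B = (\<integral>\<omega>. (A \<omega> + B \<omega>)\<^sup>2 \<partial>Pw)" for A B :: "'b \<Rightarrow> real"
  have E: "integrable Pw (\<lambda>\<omega>. exp (A \<omega> + B \<omega>))" "(\<integral>\<omega>. exp (A \<omega> + B \<omega>) \<partial>Pw) = exp (V A B / 2)"
    if "A \<in> gspace Pw W" "B \<in> gspace Pw W" for A B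
    using gspace_exp[OF gspace_add[OF that]] by (auto simp: V_def)
  have sq: "(dn n w \<omega>)\<^sup>2 = ?u\<^sup>2 * (exp (?A n \<omega> + ?A n \<omega>) - 2 * exp (?A n \<omega> + ?Y \<omega>) + exp (?Y \<omega> + ?Y \<omega>))" for n \<omega>
    unfolding dn_def nicen_def nice_def exp_add power2_eq_square by (simp add: algebra_simps)
  show "integrable Pw (\<lambda>\<omega>. (dn n w \<omega>)\<^sup>2)" for n
    unfolding sq using E(1)[OF gA[of n] gA[of n]] E(1)[OF gA[of n] gY] E(1)[OF gY gY] by simp
  have eq: "(\<integral>\<omega>. (dn n w \<omega>)\<^sup>2 \<partial>Pw) = ?u\<^sup>2 * (exp (V (?A n) (?A n) / 2) - 2 * exp (V (?A n) ?Y / 2) + exp (V ?Y ?Y / 2))" for n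
    unfolding sq using E[OF gA[of n] gA[of n]] E[OF gA[of n] gY] E[OF gY gY] by simp
  have V2: "V A A = 4 * (\<integral>\<omega>. (A \<omega>)\<^sup>2 \<partial>Pw)" for A
    by (simp add: V_def power_mult_distrib flip: mult_2)
  show "(\<integral>\<omega>. (dn n w \<omega>)\<^sup>2 \<partial>Pw) \<le> 4 * U\<^sup>2 * exp (80 * t * sqrt t)" for n
  proof -
    have "exp (V (?A n) (?A n) / 2) \<le> exp (80 * t * sqrt t)" "exp (V ?Y ?Y / 2) \<le> exp (80 * t * sqrt t)"
      using In_variance[OF \<xi> t, of n x] good_variance[OF g] unfolding V2 by auto
    then have "exp (V (?A n) (?A n) / 2) - 2 * exp (V (?A n) ?Y / 2) + exp (V ?Y ?Y / 2) \<le> 4 * exp (80 * t * sqrt t)"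
      using exp_gt_zero[of "V (?A n) ?Y / 2"] exp_gt_zero[of "80 * t * sqrt t"] by linarith
    moreover have "?u\<^sup>2 \<le> U\<^sup>2" using power_mono[OF u0_bound[of "X t w + x"], of 2] by simp
    ultimately have "(\<integral>\<omega>. (dn n w \<omega>)\<^sup>2 \<partial>Pw) \<le> ?u\<^sup>2 * (4 * exp (80 * t * sqrt t))"
      unfolding eq by (intro mult_left_mono) auto
    also have "\<dots> \<le> U\<^sup>2 * (4 * exp (80 * t * sqrt t))"
      using \<open>?u\<^sup>2 \<le> U\<^sup>2\<close> by (intro mult_right_mono) auto
    finally show ?thesis by simp
  qed
  have lim: "(\<lambda>n. V (P n) (R n)) \<longlonglongrightarrow> V ?Y ?Y" if "l2lim Pw P ?Y" "l2lim Pw R ?Y" for P R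
    using l2lim_inner[OF l2lim_add[OF that] l2lim_add[OF that]] by (simp add: V_def power2_eq_square)
  note c = l2lim_const[OF gspace_sqi[OF gY]]
  have "(\<lambda>n. ?u\<^sup>2 * (exp (V (?A n) (?A n) / 2) - 2 * exp (V (?A n) ?Y / 2) + exp (V ?Y ?Y / 2)))
    \<longlonglongrightarrow> ?u\<^sup>2 * (exp (V ?Y ?Y / 2) - 2 * exp (V ?Y ?Y / 2) + exp (V ?Y ?Y / 2))"
    by (intro tendsto_intros lim l c) auto
  then show "(\<lambda>n. \<integral>\<omega>. (dn n w \<omega>)\<^sup>2 \<partial>Pw) \<longlonglongrightarrow> 0" unfolding eq by simp
qed

lemma dn_bound: "AE w in Px. (\<integral>\<^sup>+\<omega>. ennreal ((dn n w \<omega>)\<^sup>2) \<partial>Pw) \<le> ennreal (4 * U\<^sup>2 * exp (80 * t * sqrt t))"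
  using AE_good[OF t, of x]
  by eventually_elim (subst nn_integral_eq_integral, auto intro!: dn_sq ennreal_leI)

lemma dn_sqi: "sqi Pw (\<lambda>\<omega>. \<integral>w. dn n w \<omega> \<partial>Px)"
  by (rule sfubini_sqi_integral[OF S.finite_measure_axioms prob_space_axioms dn_measurable dn_bound])

lemma nicen_integrable: "AE \<omega> in Pw. integrable Px (\<lambda>w. nicen n w \<omega>) \<and> integrable Px (\<lambda>w. nice t x w \<omega>)"
  using nice_integrable[OF t, of x] sfubini_integrable[OF S.finite_measure_axioms prob_space_axioms dn_measurable dn_bound, of n]
proof eventually_elim
  case (elim \<omega>)
  from Bochner_Integration.integrable_add[OF elim] show ?case using elim by (simp add: dn_def)
qed

text \<open>Cauchy-Schwarz moves the square under the expectation over paths; there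
  \<open>dn_sq\<close> gives pointwise convergence and a constant bound.\<close>

lemma dn_tendsto: "(\<lambda>n. \<integral>\<omega>. (\<integral>w. dn n w \<omega> \<partial>Px)\<^sup>2 \<partial>Pw) \<longlonglongrightarrow> 0"
proof (rule tendsto_sandwich[OF _ _ tendsto_const])
  interpret PP: pair_sigma_finite Px Pw ..
  have [measurable]: "(\<lambda>(w, \<omega>). dn n w \<omega>) \<in> borel_measurable (Px \<Otimes>\<^sub>M Pw)" for n by (rule dn_measurable)
  have em: "(\<lambda>w. \<integral>\<omega>. (dn n w \<omega>)\<^sup>2 \<partial>Pw) \<in> borel_measurable Px" for n
    by (rule borel_measurable_lebesgue_integral) measurable
  have eb: "AE w in Px. norm (\<integral>\<omega>. (dn n w \<omega>)\<^sup>2 \<partial>Pw) \<le> 4 * U\<^sup>2 * exp (80 * t * sqrt t)" for n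
    using AE_good[OF t, of x] by eventually_elim (use dn_sq(2) in simp)
  have ei: "integrable Px (\<lambda>w. \<integral>\<omega>. (dn n w \<omega>)\<^sup>2 \<partial>Pw)" for n
    by (rule S.integrable_const_bound[OF eb em])
  have "(\<lambda>n. \<integral>w. (\<integral>\<omega>. (dn n w \<omega>)\<^sup>2 \<partial>Pw) \<partial>Px) \<longlonglongrightarrow> (\<integral>w. 0 \<partial>Px)"
  proof (rule integral_dominated_convergence[where w = "\<lambda>_. 4 * U\<^sup>2 * exp (80 * t * sqrt t)"])
    show "AE w in Px. (\<lambda>n. \<integral>\<omega>. (dn n w \<omega>)\<^sup>2 \<partial>Pw) \<longlonglongrightarrow> 0"
      using AE_good[OF t, of x] by eventually_elim (rule dn_sq(3))
  qed (use em eb in auto)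
  then show "(\<lambda>n. \<integral>w. (\<integral>\<omega>. (dn n w \<omega>)\<^sup>2 \<partial>Pw) \<partial>Px) \<longlonglongrightarrow> 0" by simp
  have le: "(\<integral>\<omega>. (\<integral>w. dn n w \<omega> \<partial>Px)\<^sup>2 \<partial>Pw) \<le> (\<integral>w. (\<integral>\<omega>. (dn n w \<omega>)\<^sup>2 \<partial>Pw) \<partial>Px)" for n
  proof -
    have "ennreal (\<integral>\<omega>. (\<integral>w. dn n w \<omega> \<partial>Px)\<^sup>2 \<partial>Pw) = (\<integral>\<^sup>+\<omega>. ennreal ((\<integral>w. dn n w \<omega> \<partial>Px)\<^sup>2) \<partial>Pw)"
      by (rule nn_integral_sqi[OF dn_sqi, symmetric])
    also have "\<dots> \<le> (\<integral>\<^sup>+\<omega>. \<integral>\<^sup>+w. ennreal ((dn n w \<omega>)\<^sup>2) \<partial>Px \<partial>Pw)"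
    proof (rule nn_integral_mono_AE)
      show "AE \<omega> in Pw. ennreal ((\<integral>w. dn n w \<omega> \<partial>Px)\<^sup>2) \<le> (\<integral>\<^sup>+w. ennreal ((dn n w \<omega>)\<^sup>2) \<partial>Px)"
        using sfubini_sqi[OF S.finite_measure_axioms prob_space_axioms dn_measurable dn_bound, of n]
      proof eventually_elim
        case (elim \<omega>)
        have one: "sqi Px (\<lambda>_. 1 :: real)" by (simp add: sqi_def)
        have "\<bar>\<integral>w. dn n w \<omega> \<partial>Px\<bar> \<le> sqrt (\<integral>w. (dn n w \<omega>)\<^sup>2 \<partial>Px)"
          using sqi_Cauchy_Schwarz[OF elim one] by (simp add: S.prob_space)
        then have "(\<integral>w. dn n w \<omega> \<partial>Px)\<^sup>2 \<le> (\<integral>w. (dn n w \<omega>)\<^sup>2 \<partial>Px)"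
          by (metis real_le_rsqrt real_sqrt_abs real_sqrt_le_iff)
        then show ?case unfolding nn_integral_sqi[OF elim] by (rule ennreal_leI)
      qed
    qed
    also have "\<dots> = (\<integral>\<^sup>+w. \<integral>\<^sup>+\<omega>. ennreal ((dn n w \<omega>)\<^sup>2) \<partial>Pw \<partial>Px)"
      by (rule PP.Fubini') measurable
    also have "\<dots> = (\<integral>\<^sup>+w. ennreal (\<integral>\<omega>. (dn n w \<omega>)\<^sup>2 \<partial>Pw) \<partial>Px)"
      by (rule nn_integral_cong_AE, use AE_good[OF t, of x] in eventually_elim)
        (rule nn_integral_eq_integral[OF dn_sq(1)], auto)
    also have "\<dots> = ennreal (\<integral>w. (\<integral>\<omega>. (dn n w \<omega>)\<^sup>2 \<partial>Pw) \<partial>Px)"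
      by (rule nn_integral_eq_integral[OF ei]) auto
    finally show ?thesis by (simp add: ennreal_le_iff)
  qed
  show "\<forall>\<^sub>F n in sequentially. (\<integral>\<omega>. (\<integral>w. dn n w \<omega> \<partial>Px)\<^sup>2 \<partial>Pw) \<le> (\<integral>w. (\<integral>\<omega>. (dn n w \<omega>)\<^sup>2 \<partial>Pw) \<partial>Px)"
    using le by simp
qed simp

end

end

lemma integral_seg_reflect:
  fixes f :: "real \<Rightarrow> real"
  assumes [measurable]: "f \<in> borel_measurable borel"
  shows "(\<integral>s. f (t - s) \<partial>seg t) = (\<integral>s. f s \<partial>seg t)"
proof -
  have "(\<integral>s. f s \<partial>seg t) = (\<integral>s. indicator {0..t} s * f s \<partial>lborel)"
    by (subst integral_seg) (auto simp: set_lebesgue_integral_def)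
  also have "\<dots> = (\<integral>s. indicator {0..t} (t - s) * f (t - s) \<partial>lborel)"
    using lborel_integral_real_affine[of "-1" "\<lambda>s. indicator {0..t} s * f s" t] by simp
  also have "\<dots> = (\<integral>s. f (t - s) \<partial>seg t)"
    by (subst integral_seg) (auto simp: set_lebesgue_integral_def indicator_def intro!: Bochner_Integration.integral_cong)
  finally show ?thesis ..
qed

lemma (in stable) Markov_nn_integral:
  assumes a: "0 \<le> a" and [measurable]: "G \<in> borel_measurable paths"
  shows "(\<integral>\<^sup>+\<omega>. G (after a \<omega>) \<partial>Px) = (\<integral>\<^sup>+p. G (restart a p) \<partial>(Px \<Otimes>\<^sub>M Px))"
proof -
  have "(\<integral>\<^sup>+\<omega>. G (after a \<omega>) \<partial>Px) = (\<integral>\<^sup>+w. G w \<partial>distr Px paths (after a))" by (rule nn_integral_distr[symmetric]) measurable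
  also have "\<dots> = (\<integral>\<^sup>+p. G (restart a p) \<partial>(Px \<Otimes>\<^sub>M Px))" unfolding Markov[OF a] by (rule nn_integral_distr) measurable
  finally show ?thesis .
qed

context fk_seq
begin

context
  fixes t x :: real
  assumes t: "0 \<le> t"
begin

interpretation base: finite_measure "base t" by (rule finite_measure_base[OF t])

lemmas [measurable_cong] = sets_base[OF t]

text \<open>The Markov property turns the expectation over a restarted path into one over a single path, along which the
  time integral is that of an exact derivative.\<close>

lemma qn_integral_path:
  assumes \<omega>: "\<omega> \<in> space Pw" and q: "integrable (base t) (\<lambda>m. qn t x n m \<omega>)"
    and f: "AE w in Px. integrable (seg t) (\<lambda>s. Wn n (t - s) (S.Xp w s + x) \<omega>)"
    and nn: "integrable Px (\<lambda>w. nicen t x n w \<omega>)"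
  shows "(\<integral>m. qn t x n m \<omega> \<partial>base t) = (\<integral>w. nicen t x n w \<omega> \<partial>Px) - (\<integral>w. u0 (X t w + x) \<partial>Px)"
proof -
  interpret A: finite_measure "seg t" by (rule finite_measure_seg)
  interpret PP: pair_prob_space Px Px ..
  interpret AP: pair_sigma_finite "seg t" "Px \<Otimes>\<^sub>M Px" ..
  interpret AX: pair_sigma_finite "seg t" Px ..
  define V where "V v y = Wn n v y \<omega>" for v y
  have Vm[measurable]: "(\<lambda>p. V (f p) (g p)) \<in> borel_measurable M"
    if [measurable]: "f \<in> borel_measurable M" "g \<in> borel_measurable M" for f g and M :: "'z measure"
    unfolding V_def using \<omega> by (intro Wd_measurable pos) auto
  have Xm[measurable]: "(\<lambda>p. S.Xp (g p) (f p)) \<in> borel_measurable M"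
    if "f \<in> borel_measurable M" "g \<in> measurable M Px" for f g and M :: "'z measure"
    by (rule S.Xp_measurable[OF that])
  define f where "f w r = V (t - r) (S.Xp w r + x)" for w r
  have fm[measurable]: "(\<lambda>p. f (g p) (h p)) \<in> borel_measurable M"
    if [measurable]: "h \<in> borel_measurable M" "g \<in> measurable M Px" for g h and M :: "'z measure"
    unfolding f_def by measurable
  \<comment> \<open>The integral over \<open>[t - s, t]\<close>, the part of the path that remains
    after a restart at time \<open>t - s\<close>.\<close>
  define J where "J w s = (\<integral>r. of_bool (t - s \<le> r) * f w r \<partial>seg t)" for w s
  have Jm[measurable]: "(\<lambda>p. J (g p) (h p)) \<in> borel_measurable M"
    if [measurable]: "h \<in> borel_measurable M" "g \<in> measurable M Px" for g h and M :: "'z measure"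
    unfolding J_def by measurable
  define L where "L s w = u0 (X t w + x) * (f w (t - s) * exp (J w s))" for s w
  have Lm[measurable]: "(\<lambda>(s, w). L s w) \<in> borel_measurable (seg t \<Otimes>\<^sub>M Px)"
    unfolding L_def split_beta' by measurable
  \<comment> \<open>One functional with two readings: at \<open>restart\<close> it is the integrand
    \<open>qn\<close> of two independent paths, at \<open>after\<close> it is \<open>L\<close>, a
    function of a single path.\<close>
  define G where "G s v = u0 (ev s v + v (-1) + x) *
    exp (\<integral>r\<in>{0..s}. V (s - r) (ev r v + (v (-1) + x)) \<partial>lborel) * V s (v (-1) + x)" for s and v :: "real \<Rightarrow> real"
  have Gm[measurable]: "G s \<in> borel_measurable paths" for s
  proof -
    have [measurable]: "(\<lambda>v. v (-1)) \<in> borel_measurable paths"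
      by (rule measurable_component_singleton) simp
    show ?thesis unfolding G_def[abs_def] set_lebesgue_integral_def by measurable
  qed
  have Gr: "G s (S.restart (t - s) p) = qn t x n (s, p) \<omega>" if s: "0 \<le> s" "s \<le> t" and p: "p \<in> space (Px \<Otimes>\<^sub>M Px)" for s p
  proof -
    have "S.Xp (fst p) (t - s) = X (t - s) (fst p)" using s by (simp add: S.Xp_def)
    then show ?thesis
      unfolding G_def qn_def[OF t] S.restart_start S.ev_restart[OF p] Ipath_def V_def by (simp add: add.assoc)
  qed
  have Ga: "G s (S.after (t - s) w) = L s w" if s: "0 \<le> s" "s \<le> t" and w: "w \<in> space Px" for s w
  proof -
    have a: "0 \<le> t - s" using s by simp
    have [measurable]: "S.Xp w \<in> borel_measurable borel" by (rule S.Xp_path_measurable[OF w])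
    have [measurable]: "f w \<in> borel_measurable borel" unfolding f_def[abs_def] by measurable
    \<comment> \<open>Time \<open>r\<close> of the restarted path is time \<open>t - s + r\<close>
      of the original one, and the time of the noise is \<open>s - r\<close> in both
      descriptions.\<close>
    have "J w s = (\<integral>r. indicator {0..t} r * (of_bool (t - s \<le> r) * f w r) \<partial>lborel)"
      unfolding J_def by (subst integral_seg) (auto simp: set_lebesgue_integral_def)
    also have "\<dots> = (\<integral>r. indicator {0..t} (t - s + r) * (of_bool (t - s \<le> t - s + r) * f w (t - s + r)) \<partial>lborel)"
      using lborel_integral_real_affine[of 1 "\<lambda>r. indicator {0..t} r * (of_bool (t - s \<le> r) * f w r)" "t - s"] by simp
    also have "\<dots> = (\<integral>r\<in>{0..s}. V (s - r) (ev r (S.after (t - s) w) + (S.after (t - s) w (-1) + x)) \<partial>lborel)"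
      unfolding set_lebesgue_integral_def S.after_start S.ev_after[OF w a] using s
      by (intro Bochner_Integration.integral_cong) (auto simp: f_def S.Xp_def indicator_def max_def)
    finally show ?thesis
      unfolding G_def L_def S.after_start S.ev_after[OF w a] using s by (simp add: f_def S.Xp_def)
  qed
  note q' = q[unfolded base_def[OF t]]
  have [measurable]: "(\<lambda>m. qn t x n m \<omega>) \<in> borel_measurable (seg t \<Otimes>\<^sub>M (Px \<Otimes>\<^sub>M Px))" using q' by simp
  have Li: "integrable (seg t \<Otimes>\<^sub>M Px) (\<lambda>(s, w). L s w)"
  proof (rule integrableI_bounded[OF Lm])
    have "(\<integral>\<^sup>+z. ennreal (norm (case z of (s, w) \<Rightarrow> L s w)) \<partial>(seg t \<Otimes>\<^sub>M Px)) = (\<integral>\<^sup>+s. \<integral>\<^sup>+w. ennreal \<bar>L s w\<bar> \<partial>Px \<partial>seg t)"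
      using Lm by (subst S.nn_integral_fst[symmetric]) auto
    also have "\<dots> = (\<integral>\<^sup>+s. \<integral>\<^sup>+p. ennreal \<bar>qn t x n (s, p) \<omega>\<bar> \<partial>(Px \<Otimes>\<^sub>M Px) \<partial>seg t)"
    proof (rule nn_integral_cong_AE, use AE_seg[of t] in eventually_elim)
      case (elim s)
      have "(\<integral>\<^sup>+w. ennreal \<bar>L s w\<bar> \<partial>Px) = (\<integral>\<^sup>+w. ennreal \<bar>G s (S.after (t - s) w)\<bar> \<partial>Px)"
        using elim by (intro nn_integral_cong) (simp add: Ga)
      also have "\<dots> = (\<integral>\<^sup>+p. ennreal \<bar>G s (S.restart (t - s) p)\<bar> \<partial>(Px \<Otimes>\<^sub>M Px))"
        by (rule S.Markov_nn_integral) (use elim in auto)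
      also have "\<dots> = (\<integral>\<^sup>+p. ennreal \<bar>qn t x n (s, p) \<omega>\<bar> \<partial>(Px \<Otimes>\<^sub>M Px))"
        using elim by (intro nn_integral_cong) (simp add: Gr)
      finally show ?case .
    qed
    also have "\<dots> = (\<integral>\<^sup>+m. ennreal (norm (qn t x n m \<omega>)) \<partial>base t)"
      unfolding base_def[OF t] by (subst PP.nn_integral_fst[symmetric]) auto
    also have "\<dots> < \<infinity>" using q by (simp add: integrable_iff_bounded)
    finally show "(\<integral>\<^sup>+z. ennreal (norm (case z of (s, w) \<Rightarrow> L s w)) \<partial>(seg t \<Otimes>\<^sub>M Px)) < \<infinity>" .
  qed
  have "(\<integral>m. qn t x n m \<omega> \<partial>base t) = (\<integral>s. (\<integral>p. qn t x n (s, p) \<omega> \<partial>(Px \<Otimes>\<^sub>M Px)) \<partial>seg t)"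
    unfolding base_def[OF t] by (rule AP.integral_fst'[OF q', symmetric])
  also have "\<dots> = (\<integral>s. (\<integral>w. L s w \<partial>Px) \<partial>seg t)"
  proof (rule integral_cong_AE)
    show "AE s in seg t. (\<integral>p. qn t x n (s, p) \<omega> \<partial>(Px \<Otimes>\<^sub>M Px)) = (\<integral>w. L s w \<partial>Px)"
      using AE_seg[of t]
    proof eventually_elim
      case (elim s)
      have "(\<integral>w. L s w \<partial>Px) = (\<integral>w. G s (S.after (t - s) w) \<partial>Px)"
        using elim by (intro Bochner_Integration.integral_cong) (simp_all add: Ga)
      also have "\<dots> = (\<integral>p. G s (S.restart (t - s) p) \<partial>(Px \<Otimes>\<^sub>M Px))"
        by (rule S.Markov_integral) (use elim in auto)
      also have "\<dots> = (\<integral>p. qn t x n (s, p) \<omega> \<partial>(Px \<Otimes>\<^sub>M Px))"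
        using elim by (intro Bochner_Integration.integral_cong) (simp_all add: Gr)
      finally show ?case ..
    qed
    show "(\<lambda>s. \<integral>w. L s w \<partial>Px) \<in> borel_measurable (seg t)"
      by (rule S.borel_measurable_lebesgue_integral[OF Lm])
  qed measurable
  also have "\<dots> = (\<integral>w. (\<integral>s. L s w \<partial>seg t) \<partial>Px)"
    by (rule AX.Fubini_integral[OF Li, symmetric])
  also have "\<dots> = (\<integral>w. nicen t x n w \<omega> - u0 (X t w + x) \<partial>Px)"
  proof (rule integral_cong_AE)
    show "AE w in Px. (\<integral>s. L s w \<partial>seg t) = nicen t x n w \<omega> - u0 (X t w + x)"
      using f AE_space
    proof eventually_elim
      case (elim w)
      have [measurable]: "S.Xp w \<in> borel_measurable borel" by (rule S.Xp_path_measurable[OF elim(2)])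
      have fw[measurable]: "f w \<in> borel_measurable borel" unfolding f_def[abs_def] by measurable
      have fi: "integrable (seg t) (f w)" using elim(1) by (simp add: f_def[abs_def] V_def)
      have [measurable]: "(\<lambda>s. \<integral>r. of_bool (s \<le> r) * f w r \<partial>seg t) \<in> borel_measurable borel" by measurable
      \<comment> \<open>Reversing time turns the exponent into the integral of \<open>f w\<close>
        over \<open>[s, t]\<close>, the form of \<open>exp_integral_identity\<close>.\<close>
      have "(\<integral>s. f w (t - s) * exp (J w s) \<partial>seg t) = (\<integral>s. f w s * exp (\<integral>r. of_bool (s \<le> r) * f w r \<partial>seg t) \<partial>seg t)"
        unfolding J_def by (rule integral_seg_reflect[of "\<lambda>s. f w s * exp (\<integral>r. of_bool (s \<le> r) * f w r \<partial>seg t)"]) measurable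
      also have "\<dots> = exp (\<integral>s. f w s \<partial>seg t) - 1" by (rule exp_integral_identity[OF fw fi])
      also have "(\<integral>s. f w s \<partial>seg t) = In n (S.Xp w) t x \<omega>"
        using Ipath_seg[OF pos t _ \<omega>, of "S.Xp w" n n x] by (simp add: f_def V_def)
      finally show ?case by (simp add: L_def nicen_def[OF t] right_diff_distrib)
    qed
    show "(\<lambda>w. \<integral>s. L s w \<partial>seg t) \<in> borel_measurable Px"
      using AX.integrable_snd[OF Li] by (rule borel_measurable_integrable)
  qed (use nn in auto)
  also have "\<dots> = (\<integral>w. nicen t x n w \<omega> \<partial>Px) - (\<integral>w. u0 (X t w + x) \<partial>Px)"
  proof -
    have "integrable Px (\<lambda>w. u0 (X t w + x))"
      by (rule S.integrable_const_bound[of _ U]) (auto simp: u0_bound)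
    with nn show ?thesis by simp
  qed
  finally show ?thesis .
qed

text \<open>The null set in \<open>Ipath_integrable\<close> depends on the path. Exchanging the two
  quantifiers calls for a jointly measurable condition, so integrability is phrased as a finite
  \<open>ennreal\<close> integral.\<close>

lemma AE_path_integrable:
  "AE \<omega> in Pw. AE w in Px. integrable (seg t) (\<lambda>s. Wn n (t - s) (S.Xp w s + x) \<omega>)"
proof -
  interpret PP: pair_sigma_finite Px Pw ..
  interpret A: finite_measure "seg t" by (rule finite_measure_seg)
  have fm[measurable]: "(\<lambda>p. Wn n (t - h p) (S.Xp (g p) (h p) + x) (k p)) \<in> borel_measurable M"
    if [measurable]: "h \<in> borel_measurable M" "g \<in> measurable M Px" "k \<in> measurable M Pw" for g h k and M :: "'z measure"
  proof -
    have [measurable]: "(\<lambda>p. S.Xp (g p) (h p)) \<in> borel_measurable M" by (rule S.Xp_measurable) measurable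
    show ?thesis by (intro Wd_measurable pos) measurable
  qed
  let ?P = "\<lambda>w \<omega>. (\<integral>\<^sup>+s. ennreal \<bar>Wn n (t - s) (S.Xp w s + x) \<omega>\<bar> \<partial>seg t) < \<infinity>"
  have "AE w in Px. AE \<omega> in Pw. ?P w \<omega>"
  proof (rule AE_I2)
    fix w assume w: "w \<in> space Px"
    have \<xi>[measurable]: "S.Xp w \<in> borel_measurable borel" by (rule S.Xp_path_measurable[OF w])
    show "AE \<omega> in Pw. ?P w \<omega>"
      using Ipath_integrable[OF pos t \<xi>, of n n x] AE_space
    proof eventually_elim
      case (elim \<omega>)
      have m: "(\<lambda>s. Wn n (t - s) (S.Xp w s + x) \<omega>) \<in> borel_measurable borel"
        by (rule fm) (use w elim in auto)
      have "(\<integral>\<^sup>+s. ennreal \<bar>Wn n (t - s) (S.Xp w s + x) \<omega>\<bar> \<partial>seg t)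
        = (\<integral>\<^sup>+s. ennreal (norm (indicator {0..t} s *\<^sub>R Wn n (t - s) (S.Xp w s + x) \<omega>)) \<partial>lborel)"
        using m by (subst nn_integral_seg) (auto intro!: nn_integral_cong simp: indicator_def)
      then show ?case using elim(1) by (simp add: set_integrable_def integrable_iff_bounded)
    qed
  qed
  then have "AE \<omega> in Pw. AE w in Px. ?P w \<omega>"
    by (subst (asm) PP.AE_commute) measurable
  then show ?thesis using AE_space
  proof eventually_elim
    case (elim \<omega>)
    show ?case using elim(1) AE_space
    proof eventually_elim
      case e: (elim w)
      have "(\<lambda>s. Wn n (t - s) (S.Xp w s + x) \<omega>) \<in> borel_measurable (seg t)"
        by (rule fm) (use e elim in auto)
      then show ?case using e(1) by (simp add: integrable_iff_bounded)
    qed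
  qed
qed

lemma qn_integral:
  "AE \<omega> in Pw. (\<integral>m. qn t x n m \<omega> \<partial>base t) = (\<integral>w. nicen t x n w \<omega> \<partial>Px) - (\<integral>w. u0 (X t w + x) \<partial>Px)"
  using AE_space sfubini_integrable[OF finite_measure_base[OF t] prob_space_axioms qn_measurable[OF t] qn_bound[OF t], of x n]
    AE_path_integrable[of n] nicen_integrable[OF t, of x n]
  by eventually_elim (rule qn_integral_path; simp)

subsection \<open>Convergence in probability\<close>

definition strat_sum :: "nat \<Rightarrow> 'b \<Rightarrow> real" where
  "strat_sum n \<omega> = (\<integral>z\<in>{0..t} \<times> UNIV. (case z of (s, y) \<Rightarrow>
     g_alpha c \<alpha> (t - s) (x - y) * fk_sol Px X I u0 s y \<omega> * Wn n s y \<omega>) \<partial>lborel)"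

lemma strat_sum_measurable: "strat_sum n \<in> borel_measurable Pw"
proof -
  have [measurable]: "(\<lambda>q. S.Xp (snd q) (fst (snd (fst q)))) \<in> borel_measurable ((Pw \<Otimes>\<^sub>M (lborel \<Otimes>\<^sub>M lborel)) \<Otimes>\<^sub>M Px)"
    by (rule S.Xp_measurable) measurable
  have [measurable]: "(\<lambda>q. I (fst (snd (fst q))) (snd (snd (fst q))) (snd q) (fst (fst q))) \<in> borel_measurable ((Pw \<Otimes>\<^sub>M (lborel \<Otimes>\<^sub>M lborel)) \<Otimes>\<^sub>M Px)"
    by (rule I_measurable) measurable
  have [measurable]: "(\<lambda>p. \<integral>w. u0 (S.Xp w (fst (snd p)) + snd (snd p)) * exp (I (fst (snd p)) (snd (snd p)) w (fst p)) \<partial>Px)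
    \<in> borel_measurable (Pw \<Otimes>\<^sub>M (lborel \<Otimes>\<^sub>M lborel))"
    by measurable
  have [measurable]: "(\<lambda>p. Wn n (fst (snd p)) (snd (snd p)) (fst p)) \<in> borel_measurable (Pw \<Otimes>\<^sub>M (lborel \<Otimes>\<^sub>M lborel))"
    by (intro Wd_measurable pos) measurable
  have [measurable]: "(\<lambda>p. g_alpha c \<alpha> (t - fst (snd p)) (x - snd (snd p))) \<in> borel_measurable (Pw \<Otimes>\<^sub>M (lborel \<Otimes>\<^sub>M lborel))"
    by (rule g_alpha_measurable) measurable
  have eq: "strat_sum n \<omega> = (\<integral>z. of_bool (0 \<le> fst z \<and> fst z \<le> t) * (g_alpha c \<alpha> (t - fst z) (x - snd z) *
      (\<integral>w. u0 (S.Xp w (fst z) + snd z) * exp (I (fst z) (snd z) w \<omega>) \<partial>Px) * Wn n (fst z) (snd z) \<omega>) \<partial>(lborel \<Otimes>\<^sub>M lborel))" for \<omega>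
    unfolding strat_sum_def set_lebesgue_integral_def lborel_prod
    by (intro Bochner_Integration.integral_cong) (auto simp: fk_sol_Xp[OF t] indicator_def)
  show ?thesis unfolding eq[abs_def]
  proof (rule sigma_finite_measure.borel_measurable_lebesgue_integral)
    show "sigma_finite_measure (lborel \<Otimes>\<^sub>M lborel :: (real \<times> real) measure)" unfolding lborel_prod ..
    show "(\<lambda>(\<omega>, z). of_bool (0 \<le> fst z \<and> fst z \<le> t) * (g_alpha c \<alpha> (t - fst z) (x - snd z) *
      (\<integral>w. u0 (S.Xp w (fst z) + snd z) * exp (I (fst z) (snd z) w \<omega>) \<partial>Px) * Wn n (fst z) (snd z) \<omega>))
      \<in> borel_measurable (Pw \<Otimes>\<^sub>M (lborel \<Otimes>\<^sub>M lborel))"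
      unfolding split_beta' by measurable
  qed
qed

text \<open>The error splits into the replacement error \<open>hn\<close> and the error
  \<open>dn\<close> of the approximate solution, because \<open>qn\<close> integrates exactly to
  that solution minus the expected initial value.\<close>

lemma strat_sum_eq:
  "AE \<omega> in Pw. strat_sum n \<omega> - (fk_sol Px X I u0 t x \<omega> - (\<integral>w. u0 (X t w + x) \<partial>Px))
    = (\<integral>m. hn t x n m \<omega> \<partial>base t) + (\<integral>w. dn t x n w \<omega> \<partial>Px)"
  using strat_integral_pn[OF t, of x n] qn_integral[of n] nicen_integrable[OF t, of x n]
    sfubini_integrable[OF finite_measure_base[OF t] prob_space_axioms pn_measurable[OF t] pn_bound[OF t], of x n]
    sfubini_integrable[OF finite_measure_base[OF t] prob_space_axioms qn_measurable[OF t] qn_bound[OF t], of x n]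
  by eventually_elim (simp add: strat_sum_def hn_def[OF t] dn_def[OF t] fk_sol_nice)

text \<open>Both errors vanish in mean square; Chebyshev's inequality gives convergence in
  probability.\<close>

lemma strat_sum_tendsto:
  assumes \<eta>: "0 < \<eta>"
  shows "(\<lambda>n. measure Pw {\<omega>\<in>space Pw. \<bar>strat_sum n \<omega> - (fk_sol Px X I u0 t x \<omega> - (\<integral>w. u0 (X t w + x) \<partial>Px))\<bar> > \<eta>})
    \<longlonglongrightarrow> 0"
proof (rule tendsto_sandwich[OF _ _ tendsto_const])
  let ?H = "\<lambda>n \<omega>. \<integral>m. hn t x n m \<omega> \<partial>base t" and ?D = "\<lambda>n \<omega>. \<integral>w. dn t x n w \<omega> \<partial>Px"
  let ?Y = "\<lambda>n \<omega>. strat_sum n \<omega> - (fk_sol Px X I u0 t x \<omega> - (\<integral>w. u0 (X t w + x) \<partial>Px))"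
  have [measurable]: "fk_sol Px X I u0 t x \<in> borel_measurable Pw"
    unfolding fk_sol_nice[abs_def] by measurable
  note [measurable] = strat_sum_measurable
  have "l2lim Pw ?H (\<lambda>\<omega>. 0)" "l2lim Pw ?D (\<lambda>\<omega>. 0)"
    unfolding l2lim_def using hn_sqi[OF t, of x] hn_tendsto[OF t, of x] dn_sqi[OF t, of x] dn_tendsto[OF t, of x] by auto
  from l2lim_add[OF this] have l: "l2lim Pw (\<lambda>n \<omega>. ?H n \<omega> + ?D n \<omega>) (\<lambda>\<omega>. 0)" by simp
  then have "(\<lambda>n. \<integral>\<omega>. (?H n \<omega> + ?D n \<omega>)\<^sup>2 \<partial>Pw) \<longlonglongrightarrow> 0" by (simp add: l2lim_def)
  then have "(\<lambda>n. (\<integral>\<omega>. (?H n \<omega> + ?D n \<omega>)\<^sup>2 \<partial>Pw) / \<eta>\<^sup>2) \<longlonglongrightarrow> 0 / \<eta>\<^sup>2"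
    by (rule tendsto_divide[OF _ tendsto_const]) (use \<eta> in auto)
  then show "(\<lambda>n. (\<integral>\<omega>. (?H n \<omega> + ?D n \<omega>)\<^sup>2 \<partial>Pw) / \<eta>\<^sup>2) \<longlonglongrightarrow> 0" by simp
  have "measure Pw {\<omega>\<in>space Pw. \<bar>?Y n \<omega>\<bar> > \<eta>} \<le> (\<integral>\<omega>. (?H n \<omega> + ?D n \<omega>)\<^sup>2 \<partial>Pw) / \<eta>\<^sup>2" for n
  proof -
    have Ym: "?Y n \<in> borel_measurable Pw" by measurable
    have HD: "sqi Pw (\<lambda>\<omega>. ?H n \<omega> + ?D n \<omega>)" using l by (simp add: l2lim_def)
    have eq: "AE \<omega> in Pw. ?H n \<omega> + ?D n \<omega> = ?Y n \<omega>" using strat_sum_eq[of n] by eventually_elim (rule sym)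
    have Ys: "sqi Pw (?Y n)" by (rule sqi_cong_AE[OF HD Ym eq])
    have "measure Pw {\<omega>\<in>space Pw. \<bar>?Y n \<omega>\<bar> > \<eta>} \<le> measure Pw {\<omega>\<in>space Pw. (?Y n \<omega>)\<^sup>2 \<ge> \<eta>\<^sup>2}"
      using \<eta> by (intro finite_measure_mono) (auto simp: abs_le_square_iff[symmetric])
    also have "\<dots> \<le> (\<integral>\<omega>. (?Y n \<omega>)\<^sup>2 \<partial>Pw) / \<eta>\<^sup>2"
      using integral_Markov_inequality_measure[of Pw "\<lambda>\<omega>. (?Y n \<omega>)\<^sup>2" "{}" "\<eta>\<^sup>2"] Ys \<eta> by (simp add: sqi_def)
    also have "(\<integral>\<omega>. (?Y n \<omega>)\<^sup>2 \<partial>Pw) = (\<integral>\<omega>. (?H n \<omega> + ?D n \<omega>)\<^sup>2 \<partial>Pw)"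
    proof (rule integral_cong_AE)
      show "AE \<omega> in Pw. (?Y n \<omega>)\<^sup>2 = (?H n \<omega> + ?D n \<omega>)\<^sup>2" using eq by eventually_elim (simp only:)
    qed (use Ym sqi_measurable[OF HD] in \<open>auto intro: borel_measurable_power\<close>)
    finally show ?thesis .
  qed
  then show "\<forall>\<^sub>F n in sequentially. measure Pw {\<omega>\<in>space Pw. \<bar>?Y n \<omega>\<bar> > \<eta>} \<le> (\<integral>\<omega>. (?H n \<omega> + ?D n \<omega>)\<^sup>2 \<partial>Pw) / \<eta>\<^sup>2"
    by simp
qed simp

end

end

text \<open>If the limit failed, every square of side \<open>1 / (n + 1)\<close> at the origin would
  contain a bad pair of parameters, and such pairs form a vanishing sequence.\<close>

lemma tendsto_ed0I:
  assumes seq: "\<And>\<epsilon> \<delta>. vanishing \<epsilon> \<delta> \<Longrightarrow> (\<lambda>n. f (\<epsilon> n, \<delta> n)) \<longlonglongrightarrow> l"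
  shows "(f \<longlongrightarrow> l) ed0"
proof (rule topological_tendstoI, rule ccontr)
  fix S assume S: "open S" "l \<in> S" "\<not> (\<forall>\<^sub>F e in ed0. f e \<in> S)"
  have ex: "\<exists>e. 0 < fst e \<and> fst e < r \<and> 0 < snd e \<and> snd e < r \<and> f e \<notin> S" if r: "0 < r" for r :: real
  proof (rule ccontr)
    assume no: "\<nexists>e. 0 < fst e \<and> fst e < r \<and> 0 < snd e \<and> snd e < r \<and> f e \<notin> S"
    have a: "\<forall>\<^sub>F a in at_right 0. a \<in> {0<..<r}" by (rule eventually_at_right_real[OF r])
    have "\<forall>\<^sub>F e in ed0. fst e \<in> {0<..<r} \<and> snd e \<in> {0<..<r}" by (rule eventually_prodI[OF a a])
    then have "\<forall>\<^sub>F e in ed0. f e \<in> S" by eventually_elim (use no in auto)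
    then show False using S by simp
  qed
  define e where "e n = (SOME e. 0 < fst e \<and> fst e < 1 / real (Suc n) \<and> 0 < snd e \<and> snd e < 1 / real (Suc n) \<and> f e \<notin> S)" for n
  have e: "0 < fst (e n) \<and> fst (e n) < 1 / real (Suc n) \<and> 0 < snd (e n) \<and> snd (e n) < 1 / real (Suc n) \<and> f (e n) \<notin> S" for n
    unfolding e_def by (rule someI_ex, rule ex) simp
  have l0: "(\<lambda>n. 1 / real (Suc n)) \<longlonglongrightarrow> 0" by real_asymp
  have "vanishing (\<lambda>n. fst (e n)) (\<lambda>n. snd (e n))"
  proof
    show "(\<lambda>n. fst (e n)) \<longlonglongrightarrow> 0" "(\<lambda>n. snd (e n)) \<longlonglongrightarrow> 0"
      by (rule tendsto_sandwich[OF _ _ tendsto_const l0]; use e in \<open>auto intro!: always_eventually less_imp_le\<close>)+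
  qed (use e in auto)
  from topological_tendstoD[OF seq[OF this] S(1,2)] have "\<forall>\<^sub>F n in sequentially. f (e n) \<in> S" by simp
  then show False using e by (auto simp: eventually_sequentially)
qed

text \<open>Places a prescribed pair at index 0 of a vanishing sequence, so that facts about single
  parameters can be drawn from facts about sequences.\<close>

lemma vanishing_scaled: "0 < a \<Longrightarrow> 0 < b \<Longrightarrow> vanishing (\<lambda>n. a / real (Suc n)) (\<lambda>n. b / real (Suc n))"
  by unfold_locales (simp_all del: of_nat_Suc, real_asymp+)

theorem theorem3p3:
  fixes Px :: "'a measure" and Pw :: "'b measure"
    and X :: "real \<Rightarrow> 'a \<Rightarrow> real"
    and W :: "(real \<times> real \<Rightarrow> real) \<Rightarrow> 'b \<Rightarrow> real"
    and Wd :: "real \<Rightarrow> real \<Rightarrow> real \<Rightarrow> real \<Rightarrow> 'b \<Rightarrow> real"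
    and I :: "real \<Rightarrow> real \<Rightarrow> 'a \<Rightarrow> 'b \<Rightarrow> real"
    and u0 :: "real \<Rightarrow> real" and c \<alpha> :: real
  assumes PX: "prob_space Px" and PW: "prob_space Pw"
    and alpha: "0 < \<alpha>" "\<alpha> \<le> 2" and cpos: "0 < c"
    and Xstable: "stable_process Px X c \<alpha>"
    and Wiso: "isonormal Pw W"
    and Wd_version: "\<forall>\<epsilon>>0. \<forall>\<delta>>0.
        (\<lambda>(z, \<omega>). Wd \<epsilon> \<delta> (fst z) (snd z) \<omega>) \<in> borel_measurable ((lborel :: (real \<times> real) measure) \<Otimes>\<^sub>M Pw) \<and>
        (\<forall>t\<ge>0. \<forall>x. AE \<omega> in Pw. Wd \<epsilon> \<delta> t x \<omega> = W (phi_ed \<epsilon> \<delta> t x) \<omega>)"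
    and I_meas: "(\<lambda>(z, w). I (fst z) (snd z) (fst w) (snd w))
        \<in> borel_measurable ((lborel :: (real \<times> real) measure) \<Otimes>\<^sub>M (Px \<Otimes>\<^sub>M Pw))"
    and I_limit: "\<forall>t\<ge>0. \<forall>x. AE \<omega>x in Px.
        L2_conv Pw ed0 (\<lambda>(\<epsilon>,\<delta>). W (Aed X \<epsilon> \<delta> t x \<omega>x)) (I t x \<omega>x)"
    and u0_cont: "continuous_on UNIV u0" and u0_bdd: "bounded (range u0)"
  shows "(\<forall>t\<ge>0. \<forall>x. AE \<omega> in Pw. integrable Px (\<lambda>\<omega>x. u0 (X t \<omega>x + x) * exp (I t x \<omega>x \<omega>)))
    \<and> mild_strat_sol Pw W Wd c \<alpha> u0 (fk_sol Px X I u0)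
    \<and> (\<forall>p::nat. p > 0 \<longrightarrow> (\<forall>t\<ge>0. \<forall>x.
          integrable Pw (\<lambda>\<omega>. (fk_sol Px X I u0 t x \<omega>) ^ p) \<and>
          integrable (\<Pi>\<^sub>M j\<in>{1..p}. Px) (moment_rhs X u0 p t x) \<and>
          (\<integral>\<omega>. (fk_sol Px X I u0 t x \<omega>) ^ p \<partial>Pw) = (\<integral>\<omega>. moment_rhs X u0 p t x \<omega> \<partial>(\<Pi>\<^sub>M j\<in>{1..p}. Px))))"
proof -
  obtain U where U: "\<bar>u0 y\<bar> \<le> U" for y
    using u0_bdd by (auto simp: bounded_iff)
  have fk: "fk Px X c \<alpha> Pw W Wd I u0 U"
  proof -
    interpret A: prob_space Px by (rule PX)
    interpret B: prob_space Pw by (rule PW)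
    have m: "u0 \<in> borel_measurable borel" by (rule borel_measurable_continuous_onI[OF u0_cont])
    show ?thesis
      by unfold_locales (use Xstable cpos alpha Wiso Wd_version I_meas I_limit m U in auto)
  qed
  then interpret F: fk Px X c \<alpha> Pw W Wd I u0 U .
  have fks: "fk_seq Px X c \<alpha> Pw W Wd I u0 U \<epsilon> \<delta>" if "vanishing \<epsilon> \<delta>" for \<epsilon> \<delta>
    using fk that by (simp add: fk_seq_def reg_noise_seq_def F.reg_noise_axioms)
  \<comment> \<open>Conclusions that do not mention the sequence, such as adaptedness and the moment
    formula, are taken from this one.\<close>
  interpret T: fk_seq Px X c \<alpha> Pw W Wd I u0 U "\<lambda>n. 1 / real (Suc n)" "\<lambda>n. 1 / real (Suc n)"
    by (rule fks[OF vanishing_scaled]) auto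
  let ?u = "fk_sol Px X I u0"
  have strat: "strat_int Pw Wd (\<lambda>s y \<omega>. g_alpha c \<alpha> (t - s) (x - y) * ?u s y \<omega>) t
      (\<lambda>\<omega>. ?u t x \<omega> - (\<integral>w. u0 (X t w + x) \<partial>Px))" if t: "0 \<le> t" for t x
    unfolding strat_int_def
  proof (intro conjI allI impI)
    show "AE \<omega> in Pw. set_integrable lborel ({0..t} \<times> UNIV) (\<lambda>(s, y). g_alpha c \<alpha> (t - s) (x - y) * ?u s y \<omega>)"
      by (rule T.strat_set_integrable[OF t])
    have [measurable]: "?u t x \<in> borel_measurable Pw" by (rule F.Wfilt_measurable[OF t T.fk_sol_Wfilt[OF t]])
    show "(\<lambda>\<omega>. ?u t x \<omega> - (\<integral>w. u0 (X t w + x) \<partial>Px)) \<in> borel_measurable Pw" by measurable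
    have m: "(\<lambda>\<omega>. \<integral>z\<in>{0..t} \<times> UNIV. (case z of (s, y) \<Rightarrow> g_alpha c \<alpha> (t - s) (x - y) * ?u s y \<omega> * Wd \<epsilon> \<delta> s y \<omega>) \<partial>lborel)
      \<in> borel_measurable Pw" if e: "0 < \<epsilon>" "0 < \<delta>" for \<epsilon> \<delta>
    proof -
      \<comment> \<open>Index 0 of this sequence is the given pair
        \<open>(\<epsilon>, \<delta>)\<close>.\<close>
      interpret E: fk_seq Px X c \<alpha> Pw W Wd I u0 U "\<lambda>n. \<epsilon> / real (Suc n)" "\<lambda>n. \<delta> / real (Suc n)"
        by (rule fks[OF vanishing_scaled[OF e]])
      show ?thesis using E.strat_sum_measurable[OF t, of x 0] unfolding E.strat_sum_def[OF t, abs_def] by simp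
    qed
    have "\<forall>\<^sub>F e in ed0. 0 < fst e \<and> 0 < snd e"
      by (intro eventually_prodI eventually_at_right_less)
    then show "\<forall>\<^sub>F (\<epsilon>, \<delta>) in ed0. (\<lambda>\<omega>. \<integral>z\<in>{0..t} \<times> UNIV. (case z of (s, y) \<Rightarrow>
        g_alpha c \<alpha> (t - s) (x - y) * ?u s y \<omega> * Wd \<epsilon> \<delta> s y \<omega>) \<partial>lborel) \<in> borel_measurable Pw"
      by eventually_elim (auto intro: m)
    fix \<eta> :: real assume \<eta>: "0 < \<eta>"
    show "((\<lambda>(\<epsilon>, \<delta>). measure Pw {\<omega>\<in>space Pw. \<bar>(\<integral>z\<in>{0..t} \<times> UNIV. (case z of (s, y) \<Rightarrow>
        g_alpha c \<alpha> (t - s) (x - y) * ?u s y \<omega> * Wd \<epsilon> \<delta> s y \<omega>) \<partial>lborel) - (?u t x \<omega> - (\<integral>w. u0 (X t w + x) \<partial>Px))\<bar> > \<eta>})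
        \<longlongrightarrow> 0) ed0"
    proof (rule tendsto_ed0I)
      fix \<epsilon> \<delta> assume "vanishing \<epsilon> \<delta>"
      then interpret E: fk_seq Px X c \<alpha> Pw W Wd I u0 U \<epsilon> \<delta> by (rule fks)
      show "(\<lambda>n. case (\<epsilon> n, \<delta> n) of (\<epsilon>, \<delta>) \<Rightarrow> measure Pw {\<omega>\<in>space Pw. \<bar>(\<integral>z\<in>{0..t} \<times> UNIV. (case z of (s, y) \<Rightarrow>
        g_alpha c \<alpha> (t - s) (x - y) * ?u s y \<omega> * Wd \<epsilon> \<delta> s y \<omega>) \<partial>lborel) - (?u t x \<omega> - (\<integral>w. u0 (X t w + x) \<partial>Px))\<bar> > \<eta>}) \<longlonglongrightarrow> 0"
        using E.strat_sum_tendsto[OF t \<eta>, of x] by (simp add: E.strat_sum_def[OF t])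
    qed
  qed
  have mild: "mild_strat_sol Pw W Wd c \<alpha> u0 ?u"
    unfolding mild_strat_sol_def
  proof (intro conjI allI impI)
    fix t x :: real
    show "?u t x \<in> borel_measurable (Wfilt Pw W t)" if "0 \<le> t" using that by (rule T.fk_sol_Wfilt)
    assume t: "0 < t"
    \<comment> \<open>For \<open>t > 0\<close> the deterministic term of the mild equation is
      exactly the constant subtracted in \<open>strat\<close>.\<close>
    have "(\<integral>y. g_alpha c \<alpha> t (x - y) * u0 y \<partial>lborel) = (\<integral>w. u0 (X t w + x) \<partial>Px)"
      by (rule F.S.integral_g_alpha[OF t]) measurable
    then show "\<exists>Z. strat_int Pw Wd (\<lambda>s y \<omega>. g_alpha c \<alpha> (t - s) (x - y) * ?u s y \<omega>) t Z \<and>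
        (AE \<omega> in Pw. ?u t x \<omega> = (\<integral>y. g_alpha c \<alpha> t (x - y) * u0 y \<partial>lborel) + Z \<omega>)"
      using t by (intro exI[of _ "\<lambda>\<omega>. ?u t x \<omega> - (\<integral>w. u0 (X t w + x) \<partial>Px)"] conjI strat) auto
  qed
  have int: "AE \<omega> in Pw. integrable Px (\<lambda>\<omega>x. u0 (X t \<omega>x + x) * exp (I t x \<omega>x \<omega>))" if "0 \<le> t" for t x
    using T.nice_integrable[OF that, of x] by (simp add: F.nice_def)
  show ?thesis
    by (intro conjI allI impI mild int T.moment_formula; assumption)
qed

end
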